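(* Let $A,B$ be real constants, $\mathcal H=L^2(\mathbb R^2)$ and $\mathcal D=\mathcal S(\mathbb R^2)$ (Schwartz space). Consider the manifestly non-hermitian hamiltonian $$H=\tfrac12(p_1^2+x_1^2)+\tfrac12(p_2^2+x_2^2)+i\left[A(x_1+x_2)+B(p_1+p_2)\right].$$ Put $X_j=x_j+iA$, $P_j=p_j+iB$ and, for $j=1,2$, $$a_j=\frac1{\sqrt2}(X_j+iP_j)=\frac1{\sqrt2}(x_j+ip_j+C),\qquad b_j=\frac1{\sqrt2}(X_j-iP_j)=\frac1{\sqrt2}(x_j-ip_j+D),$$ with $C=iA-B$ and $D=iA+B$. Then: (i) $[X_j,P_k]=i\delta_{j,k}1$, $[a_j,b_k]=\delta_{j,k}1$ and, since $X_j^\dagger\ne X_j$ and $P_j^\dagger\ne P_j$, $b_j\ne a_j^\dagger$. With $N_j=b_ja_j$, $H=N_1+N_2+(A^2+B^2+1)1$. (ii) The functions $$\varphi_{0,0}(x_1,x_2)=N e^{-\frac12(x_1^2+x_2^2)-C(x_1+x_2)},\qquad \Psi_{0,0}(x_1,x_2)=N' e^{-\frac12(x_1^2+x_2^2)-\overline{D}(x_1+x_2)}$$ satisfy $a_j\varphi_{0,0}=0$ and $b_j^\dagger\Psi_{0,0}=0$ for $j=1,2$; the constants $N,N'$ are chosen so that $\langle\varphi_{0,0},\Psi_{0,0}\rangle=1$. Both functions belong to $\mathcal D$, which is stable under $a_j,b_j,a_j^\dagger,b_j^\dagger$. (iii) For $n_1,n_2\ge0$ put $$\varphi_{n_1,n_2}=\frac{1}{\sqrt{n_1!\,n_2!}}\,b_1^{n_1}b_2^{n_2}\varphi_{0,0},\qquad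 \Psi_{n_1,n_2}=\frac{1}{\sqrt{n_1!\,n_2!}}\,(a_1^\dagger)^{n_1}(a_2^\dagger)^{n_2}\Psi_{0,0}.$$ These are eigenstates of $H$ and $H^\dagger$ respectively, they all belong to $\mathcal D$, and $\varphi_{n_1,n_2}$ factorizes: $$\varphi_{n_1,n_2}(x_1,x_2)=\frac{N}{\sqrt{n_1!\,n_2!\,2^{n_1+n_2}}}\Big[\Big(x_1-\frac{\partial}{\partial x_1}+D\Big)^{n_1}e^{-\frac12x_1^2-Cx_1}\Big]\Big[\Big(x_2-\frac{\partial}{\partial x_2}+D\Big)^{n_2}e^{-\frac12x_2^2-Cx_2}\Big],$$ while $\Psi_{n_1,n_2}$ is deduced from $\varphi_{n_1,n_2}$ by replacing $C$ with $\overline D$ and vice versa everywhere (and $N$ by $N'$). (iv) Let $T=\exp\big(-A(p_1+p_2)+B(x_1+x_2)\big)$, an unbounded, self-adjoint, invertible operator. Then $H=T\tilde hT^{-1}$, where $$\tilde h=\tfrac12(p_1^2+x_1^2)+\tfrac12(p_2^2+x_2^2)+(A^2+B^2)1=c_1^\dagger c_1+c_2^\dagger c_2+(A^2+B^2+1)1,\qquad c_j=\tfrac1{\sqrt2}(x_j+ip_j).$$ The eigenvalues of $\tilde h$ are $E_{n_1,n_2}=n_1+n_2+A^2+B^2+1$, with eigenvectors $\Phi_{n_1,n_2}=\frac1{\sqrt{n_1!\,n_2!}}(c_1^\dagger)^{n_1}(c_2^\dagger)^{n_2}\Phi_{0,0}$, $n_1,n_2\ge0$, where $c_1\Phi_{0,0}=c_2\Phi_{0,0}=0$;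 these form an orthonormal basis of $\mathcal H$. Moreover $\Phi_{n_1,n_2}\in D(T)\cap D(T^{-1})$ and $$\varphi_{n_1,n_2}=T\Phi_{n_1,n_2},\qquad \Psi_{n_1,n_2}=T^{-1}\Phi_{n_1,n_2}.$$ Consequently $\mathcal F_\varphi=\{\varphi_{n_1,n_2}\}_{n_1,n_2\ge0}$ and $\mathcal F_\Psi=\{\Psi_{n_1,n_2}\}_{n_1,n_2\ge0}$ are $D(T)\cap D(T^{-1})$-quasi bases for $\mathcal H$. (v) Let $\Theta=T^{-2}=e^{2A(p_1+p_2)-2B(x_1+x_2)}$. Then $\Theta$ maps $\mathcal D$ into itself, and so does $\Theta^{-1}$; $\Psi_{n_1,n_2}=\Theta\varphi_{n_1,n_2}$ for all $n_1,n_2$; the pairs $(a_j,b_j^\dagger)$ are $\Theta$-conjugate; and $N_jf=\Theta^{-1}N_j^\dagger\Theta f$ for all $f\in\mathcal D$, $j=1,2$. Formally, $\Theta=\sum_{k_1,k_2}|\Psi_{k_1,k_2}\rangle\langle\Psi_{k_1,k_2}|$ and $\Theta^{-1}=\sum_{k_1,k_2}|\varphi_{k_1,k_2}\rangle\langle\varphi_{k_1,k_2}|$; these series cannot be uniformly convergent, since $\Theta$ and $\Theta^{-1}$ are both unbounded.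
   Context: On $\mathcal H=L^2(\mathbb R^2)$, $x_j$ is multiplication by the $j$-th coordinate and $p_j=-i\,\partial/\partial x_j$ ($j=1,2$), self-adjoint with $[x_j,p_k]=i\delta_{j,k}1$; $1$ denotes the identity operator, and scalars in operator expressions are multiples of it. Polynomial expressions in $x_j,p_j$ act on $\mathcal S(\mathbb R^2)$; $X^\dagger$ denotes the adjoint of $X$, and $D(X)$ the domain of $X$ (not to be confused with the scalar $D$). The exponential of a real linear combination of the $x_j,p_j$ is defined by the functional calculus of the corresponding self-adjoint operator. Quasi bases: given a dense subspace $\mathcal G\subset\mathcal H$, two families $\{\varphi_n\}$, $\{\Psi_n\}$ indexed by the same countable set are called $\mathcal G$-quasi bases for $\mathcal H$ if all $\varphi_n,\Psi_n\in\mathcal G$ and, for all $f,g\in\mathcal G$, $$\langle f,g\rangle=\sum_{n}\langle f,\varphi_n\rangle\langle\Psi_n,g\rangle=\sum_{n}\langle f,\Psi_n\rangle\langle\varphi_n,g\rangle .$$ $\Theta$-conjugacy: for a self-adjoint, invertible operator $\Theta$ such that $\Theta$ and $\Theta^{-1}$ leave $\mathcal D$ invariant, $(a_j,b_j^\dagger)$ are called $\Theta$-conjugate if $a_jf=\Theta^{-1}b_j^\dagger\Theta f$ for all $f\in\mathcal D$.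
   Formalization: In (v) D is replaced by its largest part invariant under Θ, Θ⁻¹ (dense); conjugacy also for f∈D with Θf∈D. H=Th̃T⁻¹ holds for f∈D with T⁻¹f∈D. ≠ and unboundedness claims need A≠0, B≠0 or (A,B)≠(0,0). φ=TΦ, Ψ=T⁻¹Φ, Ψ=Θφ and the Θ-series need |N|=|N'|. *)

theory Defs
  imports "HOL-Analysis.Analysis"
begin

section \<open>The Hilbert space \<open>L\<^sup>2(\<real>\<^sup>2)\<close>\<close>

definition square_integrable :: "(real^2 \<Rightarrow> complex) \<Rightarrow> bool" where
  "square_integrable f \<longleftrightarrow>
     f \<in> borel_measurable lborel \<and> integrable lborel (\<lambda>x. (cmod (f x))\<^sup>2)"

definition l2_rel :: "(real^2 \<Rightarrow> complex) \<Rightarrow> (real^2 \<Rightarrow> complex) \<Rightarrow> bool" where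
  "l2_rel f g \<longleftrightarrow> square_integrable f \<and> square_integrable g \<and> (AE x in lborel. f x = g x)"

lemma square_integrable_zero: "square_integrable (\<lambda>x. 0)"
  by (simp add: square_integrable_def)

lemma square_integrable_cmult:
  assumes "square_integrable f"
  shows "square_integrable (\<lambda>x. c * f x)"
  using assms by (auto simp: square_integrable_def norm_mult power_mult_distrib)

lemma square_integrable_add:
  assumes "square_integrable f" "square_integrable g"
  shows "square_integrable (\<lambda>x. f x + g x)"
proof -
  have m[measurable]: "f \<in> borel_measurable lborel" "g \<in> borel_measurable lborel"
    using assms by (auto simp: square_integrable_def)
  have i: "integrable lborel (\<lambda>x. 2 * (cmod (f x))\<^sup>2 + 2 * (cmod (g x))\<^sup>2)"
    using assms by (auto simp: square_integrable_def)
  have le: "(cmod (f x + g x))\<^sup>2 \<le> 2 * (cmod (f x))\<^sup>2 + 2 * (cmod (g x))\<^sup>2" for x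
  proof -
    have "(cmod (f x + g x))\<^sup>2 \<le> (cmod (f x) + cmod (g x))\<^sup>2"
      by (intro power_mono norm_triangle_ineq) auto
    also have "\<dots> \<le> 2 * (cmod (f x))\<^sup>2 + 2 * (cmod (g x))\<^sup>2"
      using sum_squares_bound[of "cmod (f x)" "cmod (g x)"] by (simp add: power2_sum)
    finally show ?thesis .
  qed
  have "integrable lborel (\<lambda>x. (cmod (f x + g x))\<^sup>2)"
    by (rule Bochner_Integration.integrable_bound[OF i]) (use le in \<open>auto intro!: AE_I2\<close>)
  then show ?thesis by (simp add: square_integrable_def)
qed

lemma integrable_cnj_mult:
  assumes "square_integrable f" "square_integrable g"
  shows "integrable lborel (\<lambda>x. cnj (f x) * g x)"
proof -
  have m[measurable]: "f \<in> borel_measurable lborel" "g \<in> borel_measurable lborel"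
    using assms by (auto simp: square_integrable_def)
  have i: "integrable lborel (\<lambda>x. (cmod (f x))\<^sup>2 + (cmod (g x))\<^sup>2)"
    using assms by (auto simp: square_integrable_def)
  have le: "cmod (f x) * cmod (g x) \<le> (cmod (f x))\<^sup>2 + (cmod (g x))\<^sup>2" for x
    using sum_squares_bound[of "cmod (f x)" "cmod (g x)"]
      mult_nonneg_nonneg[OF norm_ge_zero norm_ge_zero, of "f x" "g x"] by linarith
  have "(\<lambda>x. cnj (f x) * g x) \<in> borel_measurable lborel"
    by (intro borel_measurable_times m borel_measurable_continuous_on[OF _ m(1)] continuous_intros)
  then show ?thesis
    by (rule Bochner_Integration.integrable_bound[OF i]) (use le in \<open>auto simp: norm_mult\<close>)
qed

quotient_type l2 = "real^2 \<Rightarrow> complex" / partial: l2_rel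
  morphisms rep_l2 l2_of
proof (rule part_equivpI)
  show "\<exists>f. l2_rel f f"
    using square_integrable_zero by (auto simp: l2_rel_def)
  show "symp l2_rel"
    by (auto simp: symp_def l2_rel_def elim: AE_mp)
  show "transp l2_rel"
    by (rule transpI) (auto simp: l2_rel_def elim: AE_mp)
qed

instantiation l2 :: ab_group_add
begin

lift_definition zero_l2 :: l2 is "\<lambda>x. 0"
  by (simp add: l2_rel_def square_integrable_zero)

lift_definition plus_l2 :: "l2 \<Rightarrow> l2 \<Rightarrow> l2" is "\<lambda>f g x. f x + g x"
  by (auto simp: l2_rel_def square_integrable_add elim: AE_mp)

lift_definition uminus_l2 :: "l2 \<Rightarrow> l2" is "\<lambda>f x. - f x"
  using square_integrable_cmult[of _ "-1"] by (auto simp: l2_rel_def elim: AE_mp)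

definition minus_l2 :: "l2 \<Rightarrow> l2 \<Rightarrow> l2" where
  "minus_l2 f g = f + (- g)"

instance
proof
  fix f g h :: l2
  show "f + g + h = f + (g + h)"
    by transfer (auto simp: l2_rel_def square_integrable_add add.assoc)
  show "f + g = g + f"
    by transfer (auto simp: l2_rel_def square_integrable_add add.commute)
  show "0 + f = f"
    by transfer (auto simp: l2_rel_def)
  show "- f + f = 0"
    by transfer (auto simp: l2_rel_def square_integrable_zero)
  show "f - g = f + - g"
    by (simp add: minus_l2_def)
qed

end

lift_definition scale_l2 :: "complex \<Rightarrow> l2 \<Rightarrow> l2" (infixr "*\<^sub>C" 75) is "\<lambda>c f x. c * f x"
  by (auto simp: l2_rel_def square_integrable_cmult elim: AE_mp)

lift_definition cinner :: "l2 \<Rightarrow> l2 \<Rightarrow> complex" is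
  "\<lambda>f g. \<integral>x. cnj (f x) * g x \<partial>lborel"
proof -
  fix f f' g g' :: "real^2 \<Rightarrow> complex"
  assume f: "l2_rel f f'" and g: "l2_rel g g'"
  have "integrable lborel (\<lambda>x. cnj (f x) * g x)" "integrable lborel (\<lambda>x. cnj (f' x) * g' x)"
    using f g by (auto simp: l2_rel_def integrable_cnj_mult)
  moreover have "AE x in lborel. cnj (f x) * g x = cnj (f' x) * g' x"
    using f g by (auto simp: l2_rel_def elim: AE_mp)
  ultimately show "(\<integral>x. cnj (f x) * g x \<partial>lborel) = (\<integral>x. cnj (f' x) * g' x \<partial>lborel)"
    by (intro integral_cong_AE) auto
qed

lemma cinner_commute: "cinner f g = cnj (cinner g f)"
proof transfer
  fix f g :: "real^2 \<Rightarrow> complex"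
  have "cnj (\<integral>x. cnj (g x) * f x \<partial>lborel) = (\<integral>x. cnj (cnj (g x) * f x) \<partial>lborel)"
    by (simp only: Bochner_Integration.integral_cnj)
  then show "(\<integral>x. cnj (f x) * g x \<partial>lborel) = cnj (\<integral>x. cnj (g x) * f x \<partial>lborel)"
    by (simp add: mult.commute)
qed

lemma cinner_add_right: "cinner f (g + h) = cinner f g + cinner f h"
  by transfer (auto simp: l2_rel_def distrib_left integrable_cnj_mult
      intro!: Bochner_Integration.integral_add)

lemma cinner_scale_right: "cinner f (c *\<^sub>C g) = c * cinner f g"
  by transfer (simp add: mult.left_commute)

lemma cinner_self: "cinner f f = complex_of_real (Re (cinner f f))" "0 \<le> Re (cinner f f)"
  "cinner f f = 0 \<longleftrightarrow> f = 0"
proof -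
  have *: "(\<integral>x. cnj (u x) * u x \<partial>lborel) = complex_of_real (\<integral>x. (cmod (u x))\<^sup>2 \<partial>lborel)"
    for u :: "real^2 \<Rightarrow> complex"
    unfolding integral_complex_of_real[symmetric]
    by (intro Bochner_Integration.integral_cong) (simp_all only: complex_norm_square mult.commute)
  show "cinner f f = complex_of_real (Re (cinner f f))"
    by transfer (simp add: *)
  show "0 \<le> Re (cinner f f)"
    by transfer (simp add: *)
  show "cinner f f = 0 \<longleftrightarrow> f = 0"
  proof transfer
    fix u :: "real^2 \<Rightarrow> complex"
    assume "l2_rel u u"
    then have "square_integrable u" by (simp add: l2_rel_def)
    then show "((\<integral>x. cnj (u x) * u x \<partial>lborel) = 0) = l2_rel u (\<lambda>x. 0)"
      by (simp add: * integral_nonneg_eq_0_iff_AE square_integrable_def l2_rel_def)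
  qed
qed

instantiation l2 :: real_inner
begin

definition scaleR_l2 :: "real \<Rightarrow> l2 \<Rightarrow> l2" where
  "scaleR_l2 r f = complex_of_real r *\<^sub>C f"

definition inner_l2 :: "l2 \<Rightarrow> l2 \<Rightarrow> real" where
  "inner_l2 f g = Re (cinner f g)"

definition norm_l2 :: "l2 \<Rightarrow> real" where
  "norm_l2 f = sqrt (inner f f)"

definition dist_l2 :: "l2 \<Rightarrow> l2 \<Rightarrow> real" where
  "dist_l2 f g = norm (f - g)"

definition sgn_l2 :: "l2 \<Rightarrow> l2" where
  "sgn_l2 f = inverse (norm f) *\<^sub>R f"

definition uniformity_l2 :: "(l2 \<times> l2) filter" where
  "uniformity_l2 = (INF e\<in>{0<..}. principal {(f, g). dist f g < e})"

definition open_l2 :: "l2 set \<Rightarrow> bool" where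
  "open_l2 U \<longleftrightarrow> (\<forall>f\<in>U. eventually (\<lambda>(f', g). f' = f \<longrightarrow> g \<in> U) uniformity)"

instance
proof
  fix f g h :: l2 and r s :: real
  show "r *\<^sub>R (f + g) = r *\<^sub>R f + r *\<^sub>R g"
    unfolding scaleR_l2_def
    by transfer (auto simp: l2_rel_def distrib_left square_integrable_add square_integrable_cmult)
  show "(r + s) *\<^sub>R f = r *\<^sub>R f + s *\<^sub>R f"
    unfolding scaleR_l2_def
    by transfer (auto simp: l2_rel_def distrib_right square_integrable_add square_integrable_cmult)
  show "r *\<^sub>R s *\<^sub>R f = (r * s) *\<^sub>R f"
    unfolding scaleR_l2_def
    by transfer (auto simp: l2_rel_def mult.assoc square_integrable_cmult)
  show "1 *\<^sub>R f = f"
    unfolding scaleR_l2_def by transfer (auto simp: l2_rel_def)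
  show "dist f g = norm (f - g)" by (simp add: dist_l2_def)
  show "sgn f = inverse (norm f) *\<^sub>R f" by (simp add: sgn_l2_def)
  show "uniformity = (INF e\<in>{0<..}. principal {(f::l2, g). dist f g < e})"
    by (simp add: uniformity_l2_def)
  show "open U \<longleftrightarrow> (\<forall>f\<in>U. \<forall>\<^sub>F (f', g) in uniformity. f' = f \<longrightarrow> g \<in> U)" for U :: "l2 set"
    by (simp add: open_l2_def)
  show "inner f g = inner g f"
    unfolding inner_l2_def by (subst cinner_commute) simp
  show "inner (f + g) h = inner f h + inner g h"
    unfolding inner_l2_def by (subst (1 2 3) cinner_commute) (simp add: cinner_add_right)
  show "inner (r *\<^sub>R f) g = r * inner f g"
    unfolding inner_l2_def scaleR_l2_def
    by (subst (1 2) cinner_commute) (simp add: cinner_scale_right)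
  show "0 \<le> inner f f"
    unfolding inner_l2_def by (rule cinner_self)
  show "inner f f = 0 \<longleftrightarrow> f = 0"
    unfolding inner_l2_def by (metis cinner_self(1,3) of_real_0 zero_complex.simps(1))
  show "norm f = sqrt (inner f f)" by (simp add: norm_l2_def)
qed

end


section \<open>Unbounded operators\<close>

text \<open>An operator is represented by its graph, so that \<open>Domain R\<close> is its domain,
  \<open>R\<inverse>\<close> its inverse and \<open>R ^^ n\<close> its powers.\<close>

type_synonym op = "(l2 \<times> l2) set"

definition app :: "op \<Rightarrow> l2 \<Rightarrow> l2" where
  "app R f = (THE g. (f, g) \<in> R)"

definition op_add :: "op \<Rightarrow> op \<Rightarrow> op" (infixl "+\<^sub>o" 65) where
  "R +\<^sub>o S = {(f, g + h) | f g h. (f, g) \<in> R \<and> (f, h) \<in> S}"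

definition op_scale :: "complex \<Rightarrow> op \<Rightarrow> op" (infixr "\<cdot>\<^sub>o" 75) where
  "c \<cdot>\<^sub>o R = {(f, c *\<^sub>C g) | f g. (f, g) \<in> R}"

text \<open>The product applies its right factor first.\<close>

definition op_mult :: "op \<Rightarrow> op \<Rightarrow> op" (infixr "*\<^sub>o" 70) where
  "R *\<^sub>o S = S O R"

definition commutator :: "op \<Rightarrow> op \<Rightarrow> op" where
  "commutator R S = R *\<^sub>o S +\<^sub>o (-1) \<cdot>\<^sub>o (S *\<^sub>o R)"

definition op_restrict :: "op \<Rightarrow> l2 set \<Rightarrow> op" where
  "op_restrict R M = {(f, g) \<in> R. f \<in> M}"

definition csubspace :: "l2 set \<Rightarrow> bool" where
  "csubspace M \<longleftrightarrow>
     0 \<in> M \<and> (\<forall>f\<in>M. \<forall>g\<in>M. f + g \<in> M) \<and> (\<forall>c. \<forall>f\<in>M. c *\<^sub>C f \<in> M)"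

definition dense_subspace :: "l2 set \<Rightarrow> bool" where
  "dense_subspace M \<longleftrightarrow> csubspace M \<and> closure M = UNIV"

definition linear_op :: "op \<Rightarrow> bool" where
  "linear_op R \<longleftrightarrow> single_valued R \<and> (0, 0) \<in> R \<and>
     (\<forall>(f, g)\<in>R. \<forall>(f', g')\<in>R. (f + f', g + g') \<in> R) \<and>
     (\<forall>c. \<forall>(f, g)\<in>R. (c *\<^sub>C f, c *\<^sub>C g) \<in> R)"

definition adj :: "op \<Rightarrow> op" where
  "adj R = {(g, h). \<forall>(f, f')\<in>R. cinner g f' = cinner h f}"

definition self_adjoint :: "op \<Rightarrow> bool" where
  "self_adjoint R \<longleftrightarrow> linear_op R \<and> closure (Domain R) = UNIV \<and> adj R = R"

definition invertible_op :: "op \<Rightarrow> bool" where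
  "invertible_op R \<longleftrightarrow> single_valued (R\<inverse>) \<and> closure (Range R) = UNIV"

definition unbounded_op :: "op \<Rightarrow> bool" where
  "unbounded_op R \<longleftrightarrow> \<not> (\<exists>K. \<forall>(f, g)\<in>R. norm g \<le> K * norm f)"

definition eigenvector :: "op \<Rightarrow> complex \<Rightarrow> l2 \<Rightarrow> bool" where
  "eigenvector R c f \<longleftrightarrow> f \<noteq> 0 \<and> (f, c *\<^sub>C f) \<in> R"

definition stable_under :: "l2 set \<Rightarrow> op \<Rightarrow> bool" where
  "stable_under M R \<longleftrightarrow> M \<subseteq> Domain R \<and> R `` M \<subseteq> M"

text \<open>The \<open>f\<close> in \<open>M\<close> for which \<open>R f\<close> is defined and again in \<open>M\<close>, and the largest
  part of \<open>M\<close> left invariant by \<open>R\<close> and \<open>R\<inverse>\<close>.\<close>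

definition maps_within :: "l2 set \<Rightarrow> op \<Rightarrow> l2 set" where
  "maps_within M R = {f \<in> M. \<exists>g\<in>M. (f, g) \<in> R}"

definition invariant_part :: "l2 set \<Rightarrow> op \<Rightarrow> l2 set" where
  "invariant_part M R = \<Union>{U. U \<subseteq> M \<and> stable_under U R \<and> stable_under U (R\<inverse>)}"

definition orthonormal_basis :: "('i \<Rightarrow> l2) \<Rightarrow> bool" where
  "orthonormal_basis e \<longleftrightarrow>
     (\<forall>m n. cinner (e m) (e n) = (if m = n then 1 else 0)) \<and>
     (\<forall>f. ((\<lambda>n. cinner (e n) f *\<^sub>C e n) has_sum f) UNIV)"

definition quasi_bases :: "l2 set \<Rightarrow> ('i \<Rightarrow> l2) \<Rightarrow> ('i \<Rightarrow> l2) \<Rightarrow> bool" where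
  "quasi_bases G \<phi> \<Psi> \<longleftrightarrow>
     dense_subspace G \<and> range \<phi> \<subseteq> G \<and> range \<Psi> \<subseteq> G \<and>
     (\<forall>f\<in>G. \<forall>g\<in>G.
        ((\<lambda>n. cinner f (\<phi> n) * cinner (\<Psi> n) g) has_sum cinner f g) UNIV \<and>
        ((\<lambda>n. cinner f (\<Psi> n) * cinner (\<phi> n) g) has_sum cinner f g) UNIV)"

definition Theta_conjugate :: "l2 set \<Rightarrow> op \<Rightarrow> op \<Rightarrow> op \<Rightarrow> bool" where
  "Theta_conjugate M \<Theta> R S \<longleftrightarrow>
     self_adjoint \<Theta> \<and> invertible_op \<Theta> \<and> stable_under M \<Theta> \<and> stable_under M (\<Theta>\<inverse>) \<and>
     M \<subseteq> Domain R \<and> op_restrict R M = op_restrict (\<Theta>\<inverse> *\<^sub>o S *\<^sub>o \<Theta>) M"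


section \<open>Functional calculus of self-adjoint operators\<close>

text \<open>A symmetric idempotent map defined on the whole space is linear, hence an orthogonal
  projection. The values of \<open>E\<close> outside the Borel sets are irrelevant.\<close>

definition projection_valued_measure :: "(real set \<Rightarrow> l2 \<Rightarrow> l2) \<Rightarrow> bool" where
  "projection_valued_measure E \<longleftrightarrow>
     (\<forall>S\<in>sets borel. (\<forall>f. E S (E S f) = E S f) \<and> (\<forall>f g. cinner (E S f) g = cinner f (E S g))) \<and>
     (\<forall>f. E UNIV f = f) \<and>
     (\<forall>S :: nat \<Rightarrow> real set. range S \<subseteq> sets borel \<longrightarrow> disjoint_family S \<longrightarrow>
        (\<forall>f. (\<lambda>i. E (S i) f) sums E (\<Union>i. S i) f))"

text \<open>The measure \<open>S \<mapsto> \<langle>f, E(S) f\<rangle>\<close>.\<close>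

definition spectral_measure :: "(real set \<Rightarrow> l2 \<Rightarrow> l2) \<Rightarrow> l2 \<Rightarrow> real measure" where
  "spectral_measure E f = measure_of UNIV (sets borel) (\<lambda>S. ennreal (Re (cinner f (E S f))))"

text \<open>\<open>\<integral> u dE\<close>: the map \<open>u \<mapsto> (\<integral> u dE) f\<close> is the isometric extension to
  \<open>L\<^sup>2(\<langle>f, E f\<rangle>)\<close> of its values on simple functions.\<close>

definition spectral_integral :: "(real set \<Rightarrow> l2 \<Rightarrow> l2) \<Rightarrow> (real \<Rightarrow> real) \<Rightarrow> op" where
  "spectral_integral E u =
     {(f, g). \<exists>s :: nat \<Rightarrow> real \<Rightarrow> real. (\<forall>n. simple_function borel (s n)) \<and>
        (\<lambda>n. \<integral>\<^sup>+ t. ennreal ((u t - s n t)\<^sup>2) \<partial>spectral_measure E f) \<longlonglongrightarrow> 0 \<and>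
        (\<lambda>n. \<Sum>c\<in>range (s n). c *\<^sub>R E (s n -` {c}) f) \<longlonglongrightarrow> g}"

definition functional_calculus :: "op \<Rightarrow> (real \<Rightarrow> real) \<Rightarrow> op" where
  "functional_calculus R u =
     spectral_integral
       (SOME E. projection_valued_measure E \<and> spectral_integral E (\<lambda>t. t) = R) u"


section \<open>Position and momentum on the Schwartz space\<close>

definition partial :: "2 \<Rightarrow> (real^2 \<Rightarrow> complex) \<Rightarrow> (real^2 \<Rightarrow> complex)" where
  "partial j f x = frechet_derivative f (at x) (axis j 1)"

definition schwartz :: "(real^2 \<Rightarrow> complex) \<Rightarrow> bool" where
  "schwartz f \<longleftrightarrow> (\<forall>js. (\<forall>x. foldr partial js f differentiable (at x)) \<and>
     (\<forall>m n. bounded (range (\<lambda>x. complex_of_real (x$1 ^ m * x$2 ^ n) * foldr partial js f x))))"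

definition \<S> :: "l2 set" where
  "\<S> = l2_of ` {f. schwartz f}"

definition pos :: "2 \<Rightarrow> op" where
  "pos j = {(l2_of f, l2_of (\<lambda>x. complex_of_real (x$j) * f x)) | f. schwartz f}"

definition mom :: "2 \<Rightarrow> op" where
  "mom j = {(l2_of f, l2_of (\<lambda>x. - \<i> * partial j f x)) | f. schwartz f}"

text \<open>Adjoints of polynomials in position and momentum act, like the polynomials themselves,
  on the Schwartz space.\<close>

definition dagger :: "op \<Rightarrow> op" where
  "dagger R = op_restrict (adj R) \<S>"

text \<open>\<open>exp (\<alpha> (p\<^sub>1 + p\<^sub>2) + \<beta> (x\<^sub>1 + x\<^sub>2))\<close>. The exponent is essentially self-adjoint on the
  Schwartz space, and its self-adjoint extension is the closure of its graph.\<close>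

definition exp_pos_mom :: "real \<Rightarrow> real \<Rightarrow> op" where
  "exp_pos_mom \<alpha> \<beta> =
     functional_calculus
       (closure (complex_of_real \<alpha> \<cdot>\<^sub>o (mom 1 +\<^sub>o mom 2) +\<^sub>o complex_of_real \<beta> \<cdot>\<^sub>o (pos 1 +\<^sub>o pos 2)))
       exp"


section \<open>The model\<close>

definition Ham :: "real \<Rightarrow> real \<Rightarrow> op" where
  "Ham A B =
     (1/2) \<cdot>\<^sub>o (mom 1 *\<^sub>o mom 1 +\<^sub>o pos 1 *\<^sub>o pos 1) +\<^sub>o
     (1/2) \<cdot>\<^sub>o (mom 2 *\<^sub>o mom 2 +\<^sub>o pos 2 *\<^sub>o pos 2) +\<^sub>o
     \<i> \<cdot>\<^sub>o (complex_of_real A \<cdot>\<^sub>o (pos 1 +\<^sub>o pos 2) +\<^sub>o complex_of_real B \<cdot>\<^sub>o (mom 1 +\<^sub>o mom 2))"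

definition XX :: "real \<Rightarrow> 2 \<Rightarrow> op" where
  "XX A j = pos j +\<^sub>o (\<i> * A) \<cdot>\<^sub>o Id"

definition PP :: "real \<Rightarrow> 2 \<Rightarrow> op" where
  "PP B j = mom j +\<^sub>o (\<i> * B) \<cdot>\<^sub>o Id"

definition aa :: "real \<Rightarrow> real \<Rightarrow> 2 \<Rightarrow> op" where
  "aa A B j = complex_of_real (1 / sqrt 2) \<cdot>\<^sub>o (XX A j +\<^sub>o \<i> \<cdot>\<^sub>o PP B j)"

definition bb :: "real \<Rightarrow> real \<Rightarrow> 2 \<Rightarrow> op" where
  "bb A B j = complex_of_real (1 / sqrt 2) \<cdot>\<^sub>o (XX A j +\<^sub>o (- \<i>) \<cdot>\<^sub>o PP B j)"

definition CC :: "real \<Rightarrow> real \<Rightarrow> complex" where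
  "CC A B = \<i> * A - B"

definition DD :: "real \<Rightarrow> real \<Rightarrow> complex" where
  "DD A B = \<i> * A + B"

definition NN :: "real \<Rightarrow> real \<Rightarrow> 2 \<Rightarrow> op" where
  "NN A B j = bb A B j *\<^sub>o aa A B j"

definition phi00 :: "real \<Rightarrow> real \<Rightarrow> complex \<Rightarrow> l2" where
  "phi00 A B N =
     l2_of (\<lambda>x. N * exp (- (1/2) * (x$1 ^ 2 + x$2 ^ 2) - CC A B * (x$1 + x$2)))"

definition Psi00 :: "real \<Rightarrow> real \<Rightarrow> complex \<Rightarrow> l2" where
  "Psi00 A B N' =
     l2_of (\<lambda>x. N' * exp (- (1/2) * (x$1 ^ 2 + x$2 ^ 2) - cnj (DD A B) * (x$1 + x$2)))"

definition phi :: "real \<Rightarrow> real \<Rightarrow> complex \<Rightarrow> nat \<Rightarrow> nat \<Rightarrow> l2" where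
  "phi A B N n1 n2 =
     complex_of_real (1 / sqrt (fact n1 * fact n2)) *\<^sub>C
       app (bb A B 1 ^^ n1 *\<^sub>o bb A B 2 ^^ n2) (phi00 A B N)"

definition Psi :: "real \<Rightarrow> real \<Rightarrow> complex \<Rightarrow> nat \<Rightarrow> nat \<Rightarrow> l2" where
  "Psi A B N' n1 n2 =
     complex_of_real (1 / sqrt (fact n1 * fact n2)) *\<^sub>C
       app (dagger (aa A B 1) ^^ n1 *\<^sub>o dagger (aa A B 2) ^^ n2) (Psi00 A B N')"

text \<open>The function \<open>(t - d/dt + d)\<^sup>n e\<^bsup>-t\<^sup>2/2 - c t\<^esup>\<close>.\<close>

definition ladder_fun :: "complex \<Rightarrow> complex \<Rightarrow> nat \<Rightarrow> real \<Rightarrow> complex" where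
  "ladder_fun c d n =
     ((\<lambda>f t. complex_of_real t * f t - vector_derivative f (at t) + d * f t) ^^ n)
       (\<lambda>t. exp (- (1/2) * t ^ 2 - c * t))"

definition TT :: "real \<Rightarrow> real \<Rightarrow> op" where
  "TT A B = exp_pos_mom (- A) B"

definition cc :: "2 \<Rightarrow> op" where
  "cc j = complex_of_real (1 / sqrt 2) \<cdot>\<^sub>o (pos j +\<^sub>o \<i> \<cdot>\<^sub>o mom j)"

definition htilde :: "real \<Rightarrow> real \<Rightarrow> op" where
  "htilde A B =
     (1/2) \<cdot>\<^sub>o (mom 1 *\<^sub>o mom 1 +\<^sub>o pos 1 *\<^sub>o pos 1) +\<^sub>o
     (1/2) \<cdot>\<^sub>o (mom 2 *\<^sub>o mom 2 +\<^sub>o pos 2 *\<^sub>o pos 2) +\<^sub>o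
     complex_of_real (A\<^sup>2 + B\<^sup>2) \<cdot>\<^sub>o Id"

definition energy :: "real \<Rightarrow> real \<Rightarrow> nat \<Rightarrow> nat \<Rightarrow> complex" where
  "energy A B n1 n2 = complex_of_real (real n1 + real n2 + A\<^sup>2 + B\<^sup>2 + 1)"

definition vacuum :: "l2 \<Rightarrow> bool" where
  "vacuum f \<longleftrightarrow> norm f = 1 \<and> (f, 0) \<in> cc 1 \<and> (f, 0) \<in> cc 2"

definition Phi :: "l2 \<Rightarrow> nat \<Rightarrow> nat \<Rightarrow> l2" where
  "Phi \<Phi>00 n1 n2 =
     complex_of_real (1 / sqrt (fact n1 * fact n2)) *\<^sub>C
       app (dagger (cc 1) ^^ n1 *\<^sub>o dagger (cc 2) ^^ n2) \<Phi>00"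

text \<open>Unless \<open>A = B = 0\<close>, \<open>Theta A B\<close> does not leave \<open>\<S>\<close> invariant: for \<open>A \<noteq> 0\<close> no nonzero
  function with compact support is in its domain, and for \<open>A = 0\<close> it multiplies by the
  exponential of a nonzero real linear form. Conjugacy relations are therefore stated on
  \<open>invariant_part \<S> (Theta A B)\<close> and \<open>maps_within \<S> (Theta A B)\<close>.\<close>

definition Theta :: "real \<Rightarrow> real \<Rightarrow> op" where
  "Theta A B = (TT A B)\<inverse> *\<^sub>o (TT A B)\<inverse>"

end

theory Submission
  imports Defs "HOL-Probability.Levy"
begin

text \<open>The exponent \<open>- A (p\<^sub>1 + p\<^sub>2) + B (x\<^sub>1 + x\<^sub>2)\<close> is \<open>r (x\<^sub>1 + x\<^sub>2)\<close> rotated in phase space by the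
  argument of \<open>B - i A = r e\<^bsup>i\<theta>\<^esup>\<close>. The rotation is implemented by the unitary operator that multiplies
  the Hermite function with indices \<open>n\<^sub>1, n\<^sub>2\<close> by \<open>e\<^bsup>i\<theta>(n\<^sub>1 + n\<^sub>2)\<^esup>\<close>, so \<open>T\<close> is unitarily equivalent to
  multiplication by \<open>e\<^bsup>r (x\<^sub>1 + x\<^sub>2)\<^esup>\<close>; uniqueness of the spectral measure identifies this operator with
  the one given by the functional calculus. Conjugation by \<open>T\<close> shifts every operator
  \<open>a x\<^sub>j + b p\<^sub>j + c\<close> by a constant. Hence \<open>T\<close> carries the ladder operators of the oscillator to
  \<open>a\<^sub>j, b\<^sub>j\<close> and \<open>T\<^sup>-\<^sup>1\<close> carries them to the adjoints of \<open>b\<^sub>j, a\<^sub>j\<close>, the two families are the images of one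
  Hermite basis under \<open>T\<close> and \<open>T\<^sup>-\<^sup>1\<close>, and all expansions reduce to Parseval's identity.\<close>

section \<open>Geometry of the Hilbert space\<close>

text \<open>\<open>functional_calculus\<close> picks its spectral measure by choice, so only the
  defining property of that measure is available and uniqueness must be proved for an arbitrary
  projection-valued measure. The rotation is a fractional Fourier transform. It is specified by its
  eigenvalues instead of an integral kernel, which makes unitarity immediate but leaves its effect
  on a general Schwartz function unknown. The class \<open>GP\<close> of polynomials times a
  Gaussian with complex linear exponent gets around this: over all exponents it is preserved by
  position, momentum, rotations and multiplication by \<open>exp (mm r x)\<close>, its members with
  exponent zero are total, and statements about other vectors follow by testing against it. A
  rotation takes such a Gaussian only to a multiple of another one; \<open>tfactor\<close> records
  the multiple that results for T on the vacuum. It is the same for T and its inverse, so one unit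
  vacuum serves both families as soon as |N| = |N'|.\<close>

lemma l2_of_eq_iff:
  assumes "square_integrable f" "square_integrable g"
  shows "l2_of f = l2_of g \<longleftrightarrow> (AE x in lborel. f x = g x)"
proof -
  have r: "l2_rel f f" "l2_rel g g" using assms by (auto simp: l2_rel_def)
  have "l2_rel f g \<longleftrightarrow> l2_of f = l2_of g"
    using Quotient_rel[OF Quotient_l2, of f g] r by blast
  then show ?thesis using assms by (auto simp: l2_rel_def)
qed

lemma l2_cases:
  obtains f where "square_integrable f" "F = l2_of f"
proof -
  have "l2_rel (rep_l2 F) (rep_l2 F)" "l2_of (rep_l2 F) = F"
    using Quotient_rep_reflp[OF Quotient_l2] Quotient_abs_rep[OF Quotient_l2] by blast+
  then show thesis using that by (auto simp: l2_rel_def)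
qed

lemma l2_of_add:
  "square_integrable f \<Longrightarrow> square_integrable g \<Longrightarrow> l2_of f + l2_of g = l2_of (\<lambda>x. f x + g x)"
  by (rule plus_l2.abs_eq) (auto simp: l2_rel_def eq_onp_def)

lemma l2_of_scale:
  "square_integrable f \<Longrightarrow> c *\<^sub>C l2_of f = l2_of (\<lambda>x. c * f x)"
  by (rule scale_l2.abs_eq) (auto simp: l2_rel_def eq_onp_def)

lemma l2_of_zero: "0 = l2_of (\<lambda>x. 0)"
  by (rule zero_l2.abs_eq) 

lemma l2_of_uminus:
  "square_integrable f \<Longrightarrow> - l2_of f = l2_of (\<lambda>x. - f x)"
  by (rule uminus_l2.abs_eq) (auto simp: l2_rel_def eq_onp_def)

lemma square_integrable_uminus: "square_integrable f \<Longrightarrow> square_integrable (\<lambda>x. - f x)"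
  using square_integrable_cmult[of f "-1"] by simp

lemma square_integrable_diff:
  "square_integrable f \<Longrightarrow> square_integrable g \<Longrightarrow> square_integrable (\<lambda>x. f x - g x)"
  using square_integrable_add[OF _ square_integrable_uminus, of f g] by simp

lemma l2_of_diff:
  "square_integrable f \<Longrightarrow> square_integrable g \<Longrightarrow> l2_of f - l2_of g = l2_of (\<lambda>x. f x - g x)"
  using l2_of_add[OF _ square_integrable_uminus, of f g] by (simp add: minus_l2_def l2_of_uminus)

lemma cinner_l2_of:
  "square_integrable f \<Longrightarrow> square_integrable g \<Longrightarrow>
    cinner (l2_of f) (l2_of g) = (\<integral>x. cnj (f x) * g x \<partial>lborel)"
  by (rule cinner.abs_eq) (auto simp: l2_rel_def eq_onp_def)

lemma scaleC_add_right: "c *\<^sub>C (f + g) = c *\<^sub>C f + c *\<^sub>C g"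
  by transfer (auto simp: l2_rel_def distrib_left square_integrable_add square_integrable_cmult)

lemma scaleC_add_left: "(c + d) *\<^sub>C f = c *\<^sub>C f + d *\<^sub>C f"
  by transfer (auto simp: l2_rel_def distrib_right square_integrable_add square_integrable_cmult)

lemma scaleC_scaleC [simp]: "c *\<^sub>C d *\<^sub>C f = (c * d) *\<^sub>C f"
  by transfer (auto simp: l2_rel_def mult.assoc square_integrable_cmult)

lemma scaleC_one [simp]: "1 *\<^sub>C f = f"
  by transfer (auto simp: l2_rel_def)

lemma scaleC_zero_left [simp]: "0 *\<^sub>C f = 0"
  by transfer (auto simp: l2_rel_def square_integrable_zero)

lemma scaleC_zero_right [simp]: "c *\<^sub>C (0::l2) = 0"
  by transfer (auto simp: l2_rel_def square_integrable_zero)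

lemma scaleC_minus_one: "(-1) *\<^sub>C f = - f"
  by (metis add.right_inverse add_eq_0_iff scaleC_add_left scaleC_one scaleC_zero_left)

lemma scaleC_minus_left [simp]: "(- c) *\<^sub>C f = - (c *\<^sub>C f)"
  by (metis mult_minus1 scaleC_minus_one scaleC_scaleC)

lemma scaleC_minus_right [simp]: "c *\<^sub>C (- f) = - (c *\<^sub>C f)"
  by (metis mult.commute mult_minus1 scaleC_minus_left scaleC_minus_one scaleC_scaleC)

lemma scaleC_diff_right: "c *\<^sub>C (f - g) = c *\<^sub>C f - c *\<^sub>C g"
  using scaleC_add_right[of c f "- g"] by simp

lemma scaleC_eq_0_iff [simp]: "c *\<^sub>C f = 0 \<longleftrightarrow> c = 0 \<or> f = 0"
  by (metis divide_self_if scaleC_one scaleC_scaleC scaleC_zero_left scaleC_zero_right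
      times_divide_eq_left mult_1 mult.commute divide_inverse)

lemma cinner_add_left: "cinner (f + g) h = cinner f h + cinner g h"
  by (subst (1 2 3) cinner_commute) (simp add: cinner_add_right)

lemma cinner_scale_left: "cinner (c *\<^sub>C f) g = cnj c * cinner f g"
  by (subst (1 2) cinner_commute) (simp add: cinner_scale_right)

lemma cinner_zero_right [simp]: "cinner f 0 = 0"
  using cinner_scale_right[of f 0 0] by simp

lemma cinner_zero_left [simp]: "cinner 0 f = 0"
  using cinner_scale_left[of 0 0 f] by simp

lemma cinner_minus_right [simp]: "cinner f (- g) = - cinner f g"
  using cinner_scale_right[of f "-1" g] by (simp add: scaleC_minus_one)

lemma cinner_minus_left [simp]: "cinner (- f) g = - cinner f g"
  using cinner_scale_left[of "-1" f g] by (simp add: scaleC_minus_one)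

lemma cinner_diff_right: "cinner f (g - h) = cinner f g - cinner f h"
  using cinner_add_right[of f g "- h"] by simp

lemma cinner_diff_left: "cinner (f - g) h = cinner f h - cinner g h"
  using cinner_add_left[of f "- g" h] by simp

lemma cinner_sum_right: "cinner f (\<Sum>i\<in>I. g i) = (\<Sum>i\<in>I. cinner f (g i))"
  by (induction I rule: infinite_finite_induct) (auto simp: cinner_add_right)

lemma cinner_sum_left: "cinner (\<Sum>i\<in>I. g i) f = (\<Sum>i\<in>I. cinner (g i) f)"
  by (induction I rule: infinite_finite_induct) (auto simp: cinner_add_left)

lemma norm_l2_square: "(norm f)\<^sup>2 = Re (cinner f f)" for f :: l2
  by (simp add: power2_norm_eq_inner inner_l2_def)

lemma cinner_self_norm: "cinner f f = complex_of_real ((norm f)\<^sup>2)"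
  using cinner_self(1)[of f] by (simp add: norm_l2_square)

lemma norm_scaleC [simp]: "norm (c *\<^sub>C f) = cmod c * norm f" for f :: l2
proof -
  have "complex_of_real ((norm (c *\<^sub>C f))\<^sup>2) = complex_of_real ((cmod c * norm f)\<^sup>2)"
    by (simp add: cinner_self_norm[symmetric] cinner_scale_left cinner_scale_right
        power_mult_distrib complex_norm_square mult_ac del: of_real_power)
  then show ?thesis by (simp only: of_real_eq_iff) (simp add: power2_eq_iff_nonneg)
qed

lemma cinner_scaleR_right: "cinner f (r *\<^sub>R g) = r * cinner f g"
  by (simp add: scaleR_l2_def cinner_scale_right)

lemma cinner_scaleR_left: "cinner (r *\<^sub>R f) g = r * cinner f g"
  by (simp add: scaleR_l2_def cinner_scale_left)

lemma cinner_Cauchy_Schwarz: "cmod (cinner f g) \<le> norm f * norm g"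
proof -
  define z where "z = cnj (sgn (cinner f g))"
  have z1: "cmod z \<le> 1" by (simp add: z_def norm_sgn)
  have "complex_of_real (cmod (cinner f g)) = z * cinner f g"
    unfolding z_def sgn_eq by (cases "cinner f g = 0")
      (auto simp: divide_simps complex_norm_square[symmetric] power2_eq_square mult_ac)
  then have "cmod (cinner f g) = Re (cinner f (z *\<^sub>C g))"
    by (metis Re_complex_of_real cinner_scale_right)
  also have "\<dots> = inner f (z *\<^sub>C g)" by (simp add: inner_l2_def)
  also have "\<dots> \<le> norm f * norm (z *\<^sub>C g)" by (rule norm_cauchy_schwarz)
  also have "\<dots> \<le> norm f * (1 * norm g)"
    using z1 by (intro mult_left_mono) (simp_all add: mult_left_le_one_le)
  finally show ?thesis by simp
qed

lemma bounded_bilinear_cinner: "bounded_bilinear cinner"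
  by standard (auto simp: cinner_add_left cinner_add_right cinner_scaleR_left cinner_scaleR_right
    scaleR_conv_of_real intro!: exI[of _ 1] cinner_Cauchy_Schwarz)

lemma bounded_linear_cinner_right: "bounded_linear (cinner f)"
  by (rule bounded_bilinear.bounded_linear_right[OF bounded_bilinear_cinner])

lemmas tendsto_cinner [tendsto_intros] = bounded_bilinear.tendsto[OF bounded_bilinear_cinner]
lemmas continuous_on_cinner [continuous_intros] = bounded_bilinear.continuous_on[OF bounded_bilinear_cinner]

section \<open>Completeness of the space\<close>

lemma norm_l2_of:
  assumes "square_integrable f"
  shows "(norm (l2_of f))\<^sup>2 = (\<integral>x. (cmod (f x))\<^sup>2 \<partial>lborel)"
proof -
  have "complex_of_real ((norm (l2_of f))\<^sup>2) = (\<integral>x. complex_of_real ((cmod (f x))\<^sup>2) \<partial>lborel)"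
    unfolding cinner_self_norm[symmetric] cinner_l2_of[OF assms assms]
    by (intro Bochner_Integration.integral_cong) (auto simp: complex_norm_square mult.commute
         simp del: of_real_power)
  then show ?thesis by (simp only: integral_complex_of_real of_real_eq_iff)
qed

lemma norm_l2_of_nn:
  assumes "square_integrable f"
  shows "ennreal ((norm (l2_of f))\<^sup>2) = (\<integral>\<^sup>+x. ennreal ((cmod (f x))\<^sup>2) \<partial>lborel)"
  using assms by (subst norm_l2_of) (auto simp: square_integrable_def nn_integral_eq_integral)

lemma square_integrable_norm: "square_integrable f \<Longrightarrow> square_integrable (\<lambda>x. complex_of_real (cmod (f x)))"
  by (auto simp: square_integrable_def)

lemma square_integrable_sum:
  "(\<And>i. i \<in> I \<Longrightarrow> square_integrable (f i)) \<Longrightarrow> square_integrable (\<lambda>x. \<Sum>i\<in>I. f i x)"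
  by (induction I rule: infinite_finite_induct)
     (auto simp: square_integrable_zero square_integrable_add)

lemma l2_of_sum:
  "(\<And>i. i \<in> I \<Longrightarrow> square_integrable (f i)) \<Longrightarrow>
     (\<Sum>i\<in>I. l2_of (f i)) = l2_of (\<lambda>x. \<Sum>i\<in>I. f i x)"
  by (induction I rule: infinite_finite_induct)
     (auto simp: l2_of_zero square_integrable_sum l2_of_add)

text \<open>The Riesz-Fischer argument. The partial sums of \<open>cmod (f k x)\<close> have norm at
  most 2, so monotone convergence makes the series absolutely convergent almost everywhere; Fatou's
  lemma carries the geometric tail bounds over to the pointwise limit.\<close>

lemma l2_sequence_converges:
  fixes d :: "nat \<Rightarrow> l2"
  assumes bd: "\<And>k. norm (d k) \<le> (1/2)^k"
  shows "\<exists>F. (\<lambda>n. \<Sum>k<n. d k) \<longlonglongrightarrow> F"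
proof -
  have "\<forall>k. \<exists>f. square_integrable f \<and> d k = l2_of f" by (metis l2_cases)
  then obtain f where f: "\<And>k. square_integrable (f k)" "\<And>k. d k = l2_of (f k)" by metis
  have m[measurable]: "f k \<in> borel_measurable borel" for k
    using f(1)[of k] by (simp add: square_integrable_def)
  define G where "G n x = (\<Sum>k<n. cmod (f k x))" for n x
  have Gm[measurable]: "G n \<in> borel_measurable borel" for n unfolding G_def by measurable
  have Gsq: "square_integrable (\<lambda>x. complex_of_real (G n x))" for n
    unfolding G_def of_real_sum by (intro square_integrable_sum square_integrable_norm f)
  have Gn: "norm (l2_of (\<lambda>x. complex_of_real (G n x))) \<le> 2" for n
  proof -
    have "l2_of (\<lambda>x. complex_of_real (G n x)) = (\<Sum>k<n. l2_of (\<lambda>x. complex_of_real (cmod (f k x))))"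
      unfolding G_def of_real_sum by (intro l2_of_sum[symmetric] square_integrable_norm f)
    also have "norm \<dots> \<le> (\<Sum>k<n. norm (l2_of (\<lambda>x. complex_of_real (cmod (f k x)))))"
      by (rule norm_sum)
    also have "norm (l2_of (\<lambda>x. complex_of_real (cmod (f k x)))) = norm (d k)" for k
      using norm_l2_of[OF square_integrable_norm[OF f(1)], of k] norm_l2_of[OF f(1), of k]
      by (simp add: f(2)) (metis norm_ge_zero power2_eq_iff_nonneg)
    then have "(\<Sum>k<n. norm (l2_of (\<lambda>x. complex_of_real (cmod (f k x))))) \<le> (\<Sum>k<n. (1/2)^k)"
      using bd by (simp add: sum_mono)
    also have "\<dots> \<le> 2"
      using geometric_sum_less[of "1/2::real" "{..<n}"] by (simp add: power_divide)
    finally show ?thesis .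
  qed
  have "(\<integral>\<^sup>+x. (SUP n. ennreal ((G n x)\<^sup>2)) \<partial>lborel) = (SUP n. \<integral>\<^sup>+x. ennreal ((G n x)\<^sup>2) \<partial>lborel)"
    by (intro nn_integral_monotone_convergence_SUP)
       (auto simp: incseq_def le_fun_def G_def intro!: ennreal_leI power_mono sum_mono2 sum_nonneg)
  also have "\<dots> \<le> 4"
  proof (rule SUP_least)
    fix n
    have "(\<integral>\<^sup>+x. ennreal ((G n x)\<^sup>2) \<partial>lborel) = ennreal ((norm (l2_of (\<lambda>x. complex_of_real (G n x))))\<^sup>2)"
      by (subst norm_l2_of_nn[OF Gsq]) simp
    also have "\<dots> \<le> ennreal (2\<^sup>2)"
      by (intro ennreal_leI power_mono Gn) auto
    finally show "(\<integral>\<^sup>+x. ennreal ((G n x)\<^sup>2) \<partial>lborel) \<le> 4" by simp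
  qed
  finally have "(\<integral>\<^sup>+x. (SUP n. ennreal ((G n x)\<^sup>2)) \<partial>lborel) \<noteq> \<infinity>"
    by (metis ennreal_numeral ennreal_less_top infinity_ennreal_def leD)
  then have "AE x in lborel. (SUP n. ennreal ((G n x)\<^sup>2)) \<noteq> \<infinity>"
    by (intro nn_integral_PInf_AE) auto
  then have ae: "AE x in lborel. summable (\<lambda>k. f k x)"
  proof eventually_elim
    case (elim x)
    then obtain c where c: "(SUP n. ennreal ((G n x)\<^sup>2)) = ennreal c" "0 \<le> c"
      by (cases "SUP n. ennreal ((G n x)\<^sup>2)") auto
    have "(G n x)\<^sup>2 \<le> c" for n
      using SUP_upper[of n UNIV "\<lambda>n. ennreal ((G n x)\<^sup>2)"] c by simp
    then have "(\<Sum>k<n. norm (f k x)) \<le> sqrt c" for n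
      unfolding G_def by (metis real_le_rsqrt)
    then have "summable (\<lambda>k. norm (f k x))"
      by (intro summableI_nonneg_bounded[where x="sqrt c"]) auto
    then show ?case by (rule summable_norm_cancel)
  qed
  define F where "F x = lim (\<lambda>n. \<Sum>k<n. f k x)" for x
  have Fm[measurable]: "F \<in> borel_measurable borel"
    unfolding F_def by measurable
  have lim: "AE x in lborel. (\<lambda>n. \<Sum>k<n. f k x) \<longlonglongrightarrow> F x"
    using ae by eventually_elim (auto simp: F_def summable_iff_convergent convergent_LIMSEQ_iff)
  define S where "S n x = (\<Sum>k<n. f k x)" for n x
  have Ss: "square_integrable (S n)" for n unfolding S_def by (intro square_integrable_sum f)
  have Sm[measurable]: "S n \<in> borel_measurable borel" for n unfolding S_def by measurable
  have Sd: "(\<Sum>k<n. d k) = l2_of (S n)" for n unfolding S_def f(2) by (intro l2_of_sum f)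
  have tail: "(\<integral>\<^sup>+x. ennreal ((cmod (S p x - S n x))\<^sup>2) \<partial>lborel) \<le> ennreal ((2 * (1/2)^n)\<^sup>2)" if "n \<le> p" for n p
  proof -
    have "norm (l2_of (S p) - l2_of (S n)) = norm (\<Sum>k\<in>{n..<p}. d k)"
      unfolding Sd[symmetric] using that
      by (subst sum_diff[symmetric]) (auto intro!: arg_cong[where f=norm] sum.cong)
    also have "\<dots> \<le> (\<Sum>k\<in>{n..<p}. (1/2)^k)"
      by (rule sum_norm_le) (use bd in auto)
    also have "\<dots> \<le> 2 * (1/2)^n"
    proof -
      have "(\<Sum>k\<in>{n..<p}. (1/2)^k) = 2 * (1/2)^n - 2 * (1/2::real)^p"
        using that by (induction rule: dec_induct) (auto simp: sum.atLeastLessThan_Suc)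
      then show ?thesis by simp
    qed
    finally have b: "norm (l2_of (S p) - l2_of (S n)) \<le> 2 * (1/2)^n" .
    have "(\<integral>\<^sup>+x. ennreal ((cmod (S p x - S n x))\<^sup>2) \<partial>lborel) = ennreal ((norm (l2_of (S p) - l2_of (S n)))\<^sup>2)"
      by (simp add: l2_of_diff Ss norm_l2_of_nn square_integrable_diff)
    also have "\<dots> \<le> ennreal ((2 * (1/2)^n)\<^sup>2)"
      by (intro ennreal_leI power_mono b) auto
    finally show ?thesis .
  qed
  have tail': "(\<integral>\<^sup>+x. ennreal ((cmod (F x - S n x))\<^sup>2) \<partial>lborel) \<le> ennreal ((2 * (1/2)^n)\<^sup>2)" for n
  proof -
    have "(\<integral>\<^sup>+x. ennreal ((cmod (F x - S n x))\<^sup>2) \<partial>lborel)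
        = (\<integral>\<^sup>+x. liminf (\<lambda>p. ennreal ((cmod (S p x - S n x))\<^sup>2)) \<partial>lborel)"
    proof (rule nn_integral_cong_AE)
      show "AE x in lborel. ennreal ((cmod (F x - S n x))\<^sup>2) = liminf (\<lambda>p. ennreal ((cmod (S p x - S n x))\<^sup>2))"
        using lim
      proof eventually_elim
        case (elim x)
        have "(\<lambda>p. ennreal ((cmod (S p x - S n x))\<^sup>2)) \<longlonglongrightarrow> ennreal ((cmod (F x - S n x))\<^sup>2)"
          using elim unfolding S_def[symmetric] by (intro tendsto_intros)
        then show ?case by (intro lim_imp_Liminf[symmetric] sequentially_bot)
      qed
    qed
    also have "\<dots> \<le> liminf (\<lambda>p. \<integral>\<^sup>+x. ennreal ((cmod (S p x - S n x))\<^sup>2) \<partial>lborel)"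
      by (rule nn_integral_liminf) auto
    also have "\<dots> \<le> ennreal ((2 * (1/2)^n)\<^sup>2)"
      by (intro Liminf_le) (use tail in \<open>auto simp: eventually_sequentially\<close>)
    finally show ?thesis .
  qed
  have "square_integrable (\<lambda>x. F x - S n x)" for n
    unfolding square_integrable_def using tail'[of n]
    by (auto simp: integrable_iff_bounded less_top[symmetric] top_unique)
  note sd = this
  have Fs: "square_integrable F" using sd[of 0] by (simp add: S_def)
  have "norm (l2_of F - (\<Sum>k<n. d k)) \<le> 2 * (1/2)^n" for n
  proof -
    have "ennreal ((norm (l2_of F - (\<Sum>k<n. d k)))\<^sup>2) \<le> ennreal ((2 * (1/2)^n)\<^sup>2)"
      using tail'[of n] unfolding Sd l2_of_diff[OF Fs Ss] norm_l2_of_nn[OF sd] .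
    then have "(norm (l2_of F - (\<Sum>k<n. d k)))\<^sup>2 \<le> (2 * (1/2)^n)\<^sup>2"
      by (subst (asm) ennreal_le_iff) auto
    then show ?thesis by (rule power2_le_imp_le) simp
  qed
  then have "\<forall>\<^sub>F n in sequentially. norm (l2_of F - (\<Sum>k<n. d k)) \<le> 2 * (1/2)^n" by simp
  moreover have "(\<lambda>n. 2 * (1/2)^n) \<longlonglongrightarrow> (0::real)"
    by (intro tendsto_mult_right_zero LIMSEQ_realpow_zero) auto
  ultimately have "(\<lambda>n. l2_of F - (\<Sum>k<n. d k)) \<longlonglongrightarrow> 0"
    by (rule Lim_null_comparison)
  from tendsto_diff[OF tendsto_const[of "l2_of F"] this]
  have "(\<lambda>n. \<Sum>k<n. d k) \<longlonglongrightarrow> l2_of F" by simp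
  then show ?thesis by blast
qed

instance l2 :: complete_space
proof
  fix X :: "nat \<Rightarrow> l2"
  assume X: "Cauchy X"
  have "\<exists>M. \<forall>m\<ge>M. \<forall>n\<ge>M. norm (X m - X n) < (1/2)^k" for k
    using CauchyD[OF X, of "(1/2)^k"] by simp
  then obtain M where M: "\<And>k m n. m \<ge> M k \<Longrightarrow> n \<ge> M k \<Longrightarrow> norm (X m - X n) < (1/2)^k" by metis
  \<comment> \<open>Summing \<open>Suc\<close> of all thresholds up to \<open>k\<close> makes
    \<open>r\<close> strictly increasing while keeping \<open>r k\<close> above
    \<open>M k\<close>.\<close>
  define r where "r k = (\<Sum>j\<le>k. Suc (M j))" for k
  have r: "strict_mono r" unfolding strict_mono_Suc_iff r_def by simp
  have rM: "r k \<ge> M k" for k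
    unfolding r_def using member_le_sum[of k "{..k}" "\<lambda>j. Suc (M j)"] by simp
  have "norm (X (r (Suc k)) - X (r k)) \<le> (1/2)^k" for k
    using M[of k "r (Suc k)" "r k"] rM strict_mono_less_eq[OF r, of k "Suc k"]
    by (meson Suc_n_not_le_n le_trans less_imp_le nat_le_linear)
  then obtain F where F: "(\<lambda>n. \<Sum>k<n. X (r (Suc k)) - X (r k)) \<longlonglongrightarrow> F"
    using l2_sequence_converges[of "\<lambda>k. X (r (Suc k)) - X (r k)"] by blast
  have "(\<lambda>n. (\<Sum>k<n. X (r (Suc k)) - X (r k)) + X (r 0)) \<longlonglongrightarrow> F + X (r 0)"
    by (intro tendsto_intros F)
  then have "(X \<circ> r) \<longlonglongrightarrow> F + X (r 0)"
    by (subst (asm) sum_lessThan_telescope) (simp add: o_def)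
  then show "convergent X"
    using Cauchy_converges_subseq[OF X r] by (auto simp: convergent_def)
qed

instance l2 :: banach ..

section \<open>Nearest points and orthonormal systems\<close>

lemma parallelogram_l2: "(norm (f + g))\<^sup>2 + (norm (f - g))\<^sup>2 = 2 * (norm f)\<^sup>2 + 2 * (norm g)\<^sup>2" for f g :: l2
  by (simp add: norm_l2_square cinner_add_left cinner_add_right cinner_diff_left cinner_diff_right)

text \<open>Completeness turns a minimising sequence for the distance from \<open>f\<close> to
  \<open>K\<close> into a nearest point of the closure; the residual is orthogonal to
  \<open>K\<close>, hence zero by \<open>triv\<close>.\<close>

lemma csubspace_dense_if_orthogonal_trivial:
  assumes K: "csubspace K" and triv: "\<And>f. (\<And>k. k \<in> K \<Longrightarrow> cinner k f = 0) \<Longrightarrow> f = 0"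
  shows "closure K = UNIV"
proof -
  have "f \<in> closure K" for f
  proof -
    define \<delta> where "\<delta> = infdist f K"
    have ne: "K \<noteq> {}" using K by (auto simp: csubspace_def)
    have "\<exists>k\<in>K. dist f k < \<delta> + 1 / Suc n" for n
    proof (rule ccontr)
      assume "\<not> ?thesis"
      then have "\<delta> + 1 / Suc n \<le> infdist f K"
        by (subst infdist_notempty[OF ne]) (force intro!: cINF_greatest ne)
      then show False by (simp add: \<delta>_def)
    qed
    then obtain k where k: "\<And>n. k n \<in> K" "\<And>n. dist f (k n) < \<delta> + 1 / Suc n" by metis
    have \<delta>: "\<delta> \<le> norm (f - h)" if "h \<in> K" for h
      using infdist_le[OF that, of f] by (simp add: \<delta>_def dist_norm)
    have \<delta>0: "0 \<le> \<delta>" by (simp add: \<delta>_def infdist_nonneg)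
    \<comment> \<open>Parallelogram identity for \<open>f - k m\<close> and \<open>f - k n\<close>:
      half their sum is \<open>f\<close> minus an element of \<open>K\<close> and has norm at least
      \<delta>, which leaves little room for their difference.\<close>
    have mid: "(norm (k m - k n))\<^sup>2 \<le> (4 * \<delta> + 2) * (1 / Suc m + 1 / Suc n)" for m n
    proof -
      have "(1/2) *\<^sub>C (k m + k n) \<in> K" using K k by (auto simp: csubspace_def)
      from \<delta>[OF this] have "\<delta>\<^sup>2 \<le> (norm (f - (1/2) *\<^sub>C (k m + k n)))\<^sup>2"
        using \<delta>0 by (intro power_mono) auto
      also have "f - (1/2) *\<^sub>C (k m + k n) = (1/2) *\<^sub>C ((f - k m) + (f - k n))"
        using scaleC_add_left[of "1/2" "1/2" f]
        by (simp add: scaleC_add_right scaleC_diff_right)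
      finally have a: "4 * \<delta>\<^sup>2 \<le> (norm ((f - k m) + (f - k n)))\<^sup>2"
        by (simp add: power_mult_distrib power_divide)
      have b: "(norm (f - k n))\<^sup>2 \<le> \<delta>\<^sup>2 + (2 * \<delta> + 1) * (1 / Suc n)" for n
      proof -
        have "(norm (f - k n))\<^sup>2 \<le> (\<delta> + 1 / Suc n)\<^sup>2"
          using k(2)[of n] by (intro power_mono) (auto simp: dist_norm)
        also have "\<dots> = \<delta>\<^sup>2 + (2 * \<delta> + 1 / Suc n) * (1 / Suc n)"
          by (simp add: power2_eq_square algebra_simps add_divide_distrib)
        also have "\<dots> \<le> \<delta>\<^sup>2 + (2 * \<delta> + 1) * (1 / Suc n)"
          by (intro add_left_mono mult_right_mono) auto
        finally show ?thesis .
      qed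
      have "(norm (k m - k n))\<^sup>2 = (norm ((f - k m) - (f - k n)))\<^sup>2"
        by (simp add: norm_minus_commute)
      also have "\<dots> \<le> 2 * (\<delta>\<^sup>2 + (2 * \<delta> + 1) * (1 / Suc m)) + 2 * (\<delta>\<^sup>2 + (2 * \<delta> + 1) * (1 / Suc n)) - 4 * \<delta>\<^sup>2"
      proof -
        define s t where "s = (2 * \<delta> + 1) * (1 / Suc m)" and "t = (2 * \<delta> + 1) * (1 / Suc n)"
        show ?thesis
          using parallelogram_l2[of "f - k m" "f - k n"] a b[of m] b[of n]
          unfolding s_def[symmetric] t_def[symmetric]
          by (simp add: algebra_simps del: diff_add_eq diff_diff_eq2 diff_diff_eq add_diff_eq)
      qed
      also have "\<dots> = (4 * \<delta> + 2) * (1 / Suc m + 1 / Suc n)" by (simp add: algebra_simps)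
      finally show ?thesis .
    qed
    have "Cauchy k"
    proof (rule CauchyI)
      fix e :: real assume "0 < e"
      define D where "D = 2 * (4 * \<delta> + 2)"
      obtain M where M: "D / e\<^sup>2 < real (Suc M)" by (meson Suc_leD less_le_trans of_nat_mono reals_Archimedean2 lessI less_trans of_nat_less_iff)
      have D: "D > 0" using \<delta>0 by (simp add: D_def)
      show "\<exists>M. \<forall>m\<ge>M. \<forall>n\<ge>M. norm (k m - k n) < e"
      proof (intro exI allI impI)
        fix m n assume mn: "M \<le> m" "M \<le> n"
        have "(norm (k m - k n))\<^sup>2 \<le> (4 * \<delta> + 2) * (1 / Suc m + 1 / Suc n)" by (rule mid)
        also have "\<dots> \<le> (4 * \<delta> + 2) * (1 / Suc M + 1 / Suc M)"
          using mn \<delta>0 by (intro mult_left_mono add_mono divide_left_mono) auto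
        also have "\<dots> = D / Suc M" by (simp add: D_def)
        also have "\<dots> < e\<^sup>2" using M \<open>0 < e\<close> D by (simp add: field_simps)
        finally show "norm (k m - k n) < e" using \<open>0 < e\<close>
          by (auto intro: power2_less_imp_less)
      qed
    qed
    then obtain l where l: "k \<longlonglongrightarrow> l" by (auto simp: Cauchy_convergent_iff convergent_def)
    have lc: "l \<in> closure K" using l k(1) by (auto simp: closure_sequential)
    have "(\<lambda>n. dist f (k n)) \<longlonglongrightarrow> dist f l" by (intro tendsto_intros l)
    moreover have "(\<lambda>n. \<delta> + 1 / Suc n) \<longlonglongrightarrow> \<delta> + 0"
      by (intro tendsto_intros LIMSEQ_inverse_real_of_nat[unfolded inverse_eq_divide])
    ultimately have ld: "norm (f - l) \<le> \<delta>"
      using k(2) unfolding dist_norm add_0_right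
      by (intro LIMSEQ_le[where X="\<lambda>n. norm (f - k n)"]) (auto intro: less_imp_le)
    have "f - l = 0"
    proof (rule triv)
      fix h assume h: "h \<in> K"
      show "cinner h (f - l) = 0"
      proof (rule ccontr)
        assume nz: "cinner h (f - l) \<noteq> 0"
        then have h0: "h \<noteq> 0" by auto
        \<comment> \<open>\<open>c *\<^sub>C h\<close> is the projection of \<open>f - l\<close> on
          \<open>h\<close>; adding it to \<open>l\<close> would lower the squared distance below its
          minimum.\<close>
        define c where "c = cinner h (f - l) / (norm h)\<^sup>2"
        have "(\<lambda>n. norm (f - (k n + c *\<^sub>C h))) \<longlonglongrightarrow> norm (f - (l + c *\<^sub>C h))"
          by (intro tendsto_intros l)
        moreover have "k n + c *\<^sub>C h \<in> K" for n using K k h by (auto simp: csubspace_def)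
        ultimately have "\<delta> \<le> norm (f - (l + c *\<^sub>C h))"
          using \<delta> by (intro LIMSEQ_le_const) auto
        then have "(norm (f - l))\<^sup>2 \<le> (norm ((f - l) - c *\<^sub>C h))\<^sup>2"
          using ld by (intro power_mono) (auto simp: algebra_simps)
        also have "\<dots> = (norm (f - l))\<^sup>2 - (cmod (cinner h (f - l)))\<^sup>2 / (norm h)\<^sup>2"
        proof -
          have "complex_of_real ((norm ((f - l) - c *\<^sub>C h))\<^sup>2) =
             complex_of_real ((norm (f - l))\<^sup>2) - cnj c * cinner h (f - l) - c * cinner (f - l) h
               + c * cnj c * complex_of_real ((norm h)\<^sup>2)"
            unfolding cinner_self_norm[symmetric]
            by (simp only: cinner_diff_right[of _ "f - l"] cinner_diff_left[of "f - l"]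
                cinner_scale_left cinner_scale_right) (simp add: right_diff_distrib)
          also have "\<dots> = complex_of_real ((norm (f - l))\<^sup>2 - (cmod (cinner h (f - l)))\<^sup>2 / (norm h)\<^sup>2)"
          proof -
            define z X where "z = cinner h (f - l)" and "X = complex_of_real ((cmod z)\<^sup>2 / (norm h)\<^sup>2)"
            have zz: "z * cnj z = complex_of_real ((cmod z)\<^sup>2)" by (rule complex_norm_square[symmetric])
            have nh: "complex_of_real ((norm h)\<^sup>2) \<noteq> 0" using h0 by simp
            have 1: "cnj c * z = X" and 2: "c * cnj z = X"
              and 3: "c * cnj c * complex_of_real ((norm h)\<^sup>2) = X"
              using zz nh by (simp_all add: c_def z_def X_def mult.commute del: of_real_power)
            show ?thesis
              unfolding cinner_commute[of "f - l" h] z_def[symmetric] 1 2 3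
              by (simp add: X_def)
          qed
          finally show ?thesis by (simp only: of_real_eq_iff)
        qed
        also have "\<dots> < (norm (f - l))\<^sup>2" using nz h0 by simp
        finally show False by simp
      qed
    qed
    then show ?thesis using lc by simp
  qed
  then show ?thesis by auto
qed

text \<open>By Pythagoras the squared distance between partial sums over nested finite sets is a
  difference of partial sums of the real series, so the net of partial sums is Cauchy.\<close>

lemma orthonormal_summable:
  fixes e :: "'i \<Rightarrow> l2"
  assumes on: "\<And>m n. cinner (e m) (e n) = (if m = n then 1 else 0)"
    and c: "(\<lambda>n. (cmod (c n))\<^sup>2) summable_on UNIV"
  shows "(\<lambda>n. c n *\<^sub>C e n) summable_on UNIV"
proof -
  have nrm: "(norm (\<Sum>n\<in>F. c n *\<^sub>C e n))\<^sup>2 = (\<Sum>n\<in>F. (cmod (c n))\<^sup>2)" if "finite F" for F :: "'i set"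
  proof -
    have "complex_of_real ((norm (\<Sum>n\<in>F. c n *\<^sub>C e n))\<^sup>2) = (\<Sum>n\<in>F. c n * cnj (c n))"
      unfolding cinner_self_norm[symmetric] using that
      by (simp add: cinner_sum_left cinner_sum_right cinner_scale_left cinner_scale_right on
          if_distrib[of "\<lambda>x. _ * x"] if_distrib[of "\<lambda>x. cnj _ * x"] sum.delta cong: if_cong)
    also have "\<dots> = complex_of_real (\<Sum>n\<in>F. (cmod (c n))\<^sup>2)"
      by (simp add: complex_norm_square mult.commute del: of_real_power)
    finally show ?thesis by (simp only: of_real_eq_iff)
  qed
  obtain L where lim: "(sum (\<lambda>n. (cmod (c n))\<^sup>2) \<longlongrightarrow> L) (finite_subsets_at_top UNIV)"
    using c unfolding has_sum_def summable_on_def by blast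
  have "\<exists>P. eventually P (finite_subsets_at_top UNIV) \<and>
      (\<forall>F F'. P F \<and> P F' \<longrightarrow> dist (\<Sum>n\<in>F. c n *\<^sub>C e n) (\<Sum>n\<in>F'. c n *\<^sub>C e n) < \<epsilon>)" if "\<epsilon> > 0" for \<epsilon>
  proof -
    \<comment> \<open>Two finite sums this close to \<open>L\<close> differ by less than
      \<open>\<epsilon>\<^sup>2 / 16\<close>, which is below
      \<open>(\<epsilon> / 2)\<^sup>2\<close>; two halves of \<epsilon> are spent on joining
      \<open>F1\<close> and \<open>F2\<close> through a common superset.\<close>
    define P where "P F \<longleftrightarrow> finite F \<and> dist (\<Sum>n\<in>F. (cmod (c n))\<^sup>2) L < \<epsilon>\<^sup>2 / 32" for F
    have ev: "eventually P (finite_subsets_at_top UNIV)"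
      using tendstoD[OF lim, of "\<epsilon>\<^sup>2 / 32"] that
      by (auto simp: P_def[abs_def] eventually_conj_iff eventually_finite_subsets_at_top_weakI
          simp del: less_divide_eq_numeral1)
    then obtain F0 where F0: "finite F0" "\<And>F. finite F \<Longrightarrow> F0 \<subseteq> F \<Longrightarrow> P F"
      by (auto simp: eventually_finite_subsets_at_top)
    have "dist (\<Sum>n\<in>F1. c n *\<^sub>C e n) (\<Sum>n\<in>F2. c n *\<^sub>C e n) < \<epsilon>" if P12: "P F1" "P F2" for F1 F2
    proof -
      define F where "F = F0 \<union> F1 \<union> F2"
      have F: "finite F" "P F" "F1 \<subseteq> F" "F2 \<subseteq> F"
        using F0(1) F0(2)[of F] P12 by (auto simp: F_def P_def)
      have d: "dist (\<Sum>n\<in>F. c n *\<^sub>C e n) (\<Sum>n\<in>F'. c n *\<^sub>C e n) < \<epsilon> / 2" if F': "F' \<subseteq> F" "P F'" for F'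
      proof -
        have "(dist (\<Sum>n\<in>F. c n *\<^sub>C e n) (\<Sum>n\<in>F'. c n *\<^sub>C e n))\<^sup>2 = (norm (\<Sum>n\<in>F - F'. c n *\<^sub>C e n))\<^sup>2"
          unfolding dist_norm using F F' by (subst sum_diff) auto
        also have "\<dots> = (\<Sum>n\<in>F. (cmod (c n))\<^sup>2) - (\<Sum>n\<in>F'. (cmod (c n))\<^sup>2)"
          using F F' by (subst nrm) (auto simp: sum_diff)
        also have "\<dots> < \<epsilon>\<^sup>2 / 16"
          using F(2) F'(2) unfolding P_def dist_real_def by linarith
        also have "\<dots> < (\<epsilon> / 2)\<^sup>2" using \<open>\<epsilon> > 0\<close> by (simp add: power_divide)
        finally show ?thesis using \<open>\<epsilon> > 0\<close> by (intro power2_less_imp_less[of _ "\<epsilon> / 2"]) auto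
      qed
      show ?thesis
        using dist_triangle3[of "\<Sum>n\<in>F1. c n *\<^sub>C e n" "\<Sum>n\<in>F2. c n *\<^sub>C e n" "\<Sum>n\<in>F. c n *\<^sub>C e n"]
          d[OF F(3) P12(1)] d[OF F(4) P12(2)] by linarith
    qed
    with ev show ?thesis by blast
  qed
  then have "cauchy_filter (filtermap (sum (\<lambda>n. c n *\<^sub>C e n)) (finite_subsets_at_top UNIV))"
    by (simp add: cauchy_filter_metric_filtermap)
  moreover have "complete (UNIV :: l2 set)" by (rule complete_UNIV)
  ultimately obtain f where "(sum (\<lambda>n. c n *\<^sub>C e n) \<longlongrightarrow> f) (finite_subsets_at_top UNIV)"
    using complete_uniform[where S="UNIV :: l2 set"] by (force simp add: filterlim_def)
  then show ?thesis using summable_on_def has_sum_def by blast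
qed

text \<open>With \<open>p\<close> the projection of \<open>f\<close> on a finite part of the system,
  the bound on the partial sum is the nonnegativity of
  \<open>(norm (f - p))\<^sup>2\<close>.\<close>

lemma Bessel_summable:
  fixes e :: "'i \<Rightarrow> l2"
  assumes on: "\<And>m n. cinner (e m) (e n) = (if m = n then 1 else 0)"
  shows "(\<lambda>n. (cmod (cinner (e n) f))\<^sup>2) summable_on UNIV"
proof (rule nonneg_bdd_above_summable_on)
  show "bdd_above (sum (\<lambda>n. (cmod (cinner (e n) f))\<^sup>2) ` {F. F \<subseteq> UNIV \<and> finite F})"
  proof (rule bdd_aboveI2)
    fix F :: "'i set" assume "F \<in> {F. F \<subseteq> UNIV \<and> finite F}"
    then have F: "finite F" by simp
    define p where "p = (\<Sum>n\<in>F. cinner (e n) f *\<^sub>C e n)"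
    have pp: "cinner p p = complex_of_real (\<Sum>n\<in>F. (cmod (cinner (e n) f))\<^sup>2)"
      unfolding p_def using F
      by (simp add: cinner_sum_left cinner_sum_right cinner_scale_left cinner_scale_right on
          if_distrib[of "\<lambda>x. _ * x"] sum.delta complex_norm_square mult.commute del: of_real_power cong: if_cong)
    have pf: "cinner p f = complex_of_real (\<Sum>n\<in>F. (cmod (cinner (e n) f))\<^sup>2)"
      unfolding p_def by (simp add: cinner_sum_left cinner_scale_left complex_norm_square mult.commute del: of_real_power)
    have fp: "cinner f p = complex_of_real (\<Sum>n\<in>F. (cmod (cinner (e n) f))\<^sup>2)"
      by (subst cinner_commute, subst pf) (rule complex_cnj_complex_of_real)
    have "complex_of_real ((norm (f - p))\<^sup>2) = complex_of_real ((norm f)\<^sup>2 - (\<Sum>n\<in>F. (cmod (cinner (e n) f))\<^sup>2))"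
      unfolding of_real_diff cinner_self_norm[symmetric]
      by (simp only: cinner_diff_left cinner_diff_right pp pf fp) simp
    then have "(\<Sum>n\<in>F. (cmod (cinner (e n) f))\<^sup>2) = (norm f)\<^sup>2 - (norm (f - p))\<^sup>2"
      by (simp only: of_real_eq_iff)
    then show "(\<Sum>n\<in>F. (cmod (cinner (e n) f))\<^sup>2) \<le> (norm f)\<^sup>2"
      by simp
  qed
qed auto

text \<open>Bessel's inequality makes the Fourier series of \<open>f\<close> converge to some
  \<open>g\<close>; \<open>f - g\<close> is orthogonal to every \<open>e m\<close>, so totality
  identifies the sum.\<close>

lemma orthonormal_basis_if_total:
  assumes on: "\<And>m n. cinner (e m) (e n) = (if m = n then 1 else 0)"
    and triv: "\<And>f. (\<And>n. cinner (e n) f = 0) \<Longrightarrow> f = 0"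
  shows "orthonormal_basis e"
proof -
  have "((\<lambda>n. cinner (e n) f *\<^sub>C e n) has_sum f) UNIV" for f
  proof -
    have "(\<lambda>n. cinner (e n) f *\<^sub>C e n) summable_on UNIV"
      by (intro orthonormal_summable Bessel_summable on)
    then obtain g where g: "((\<lambda>n. cinner (e n) f *\<^sub>C e n) has_sum g) UNIV"
      by (auto simp: summable_on_def)
    have "f - g = 0"
    proof (rule triv)
      fix m
      have "((\<lambda>n. cinner (e m) (cinner (e n) f *\<^sub>C e n)) has_sum cinner (e m) g) UNIV"
        using has_sum_bounded_linear[OF bounded_linear_cinner_right g] by (simp add: o_def)
      moreover have "((\<lambda>n. cinner (e m) (cinner (e n) f *\<^sub>C e n)) has_sum cinner (e m) f) UNIV"
        using has_sum_finite[of "{m}" "\<lambda>n. cinner (e m) (cinner (e n) f *\<^sub>C e n)"]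
        by (subst has_sum_cong_neutral[where T="{m}" and g="\<lambda>n. cinner (e m) (cinner (e n) f *\<^sub>C e n)"])
           (auto simp: cinner_scale_right on)
      ultimately show "cinner (e m) (f - g) = 0"
        by (metis has_sum_unique cinner_diff_right right_minus_eq)
    qed
    then show ?thesis using g by simp
  qed
  then show ?thesis using on by (simp add: orthonormal_basis_def)
qed

lemma Parseval_has_sum:
  assumes "orthonormal_basis e"
  shows "((\<lambda>n. cinner f (e n) * cinner (e n) g) has_sum cinner f g) UNIV"
proof -
  have "((\<lambda>n. cinner (e n) g *\<^sub>C e n) has_sum g) UNIV"
    using assms by (simp add: orthonormal_basis_def)
  from has_sum_bounded_linear[OF bounded_linear_cinner_right this, of f] show ?thesis
    by (simp add: o_def cinner_scale_right mult.commute)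
qed

section \<open>Schwartz functions and operators on them\<close>

text \<open>Every Schwartz function is dominated by a multiple of this weight. It is integrable and
  at most 1, so one comparison settles integrability and square integrability alike.\<close>

definition decay :: "real^2 \<Rightarrow> real" where
  "decay x = 1 / ((1 + (x$1)\<^sup>2) * (1 + (x$2)\<^sup>2))"

lemma one_plus_square_pos: "0 < 1 + (t::real)\<^sup>2"
  by (simp add: add_pos_nonneg)

lemma decay_pos: "0 < decay x"
  by (simp add: decay_def one_plus_square_pos)

lemma decay_le_one: "decay x \<le> 1"
proof -
  have "1 * 1 \<le> (1 + (x$1)\<^sup>2) * (1 + (x$2)\<^sup>2)" by (intro mult_mono) auto
  then show ?thesis by (simp add: decay_def)
qed

lemma measurable_vec_nth [measurable]: "(\<lambda>x::real^2. x $ i) \<in> borel_measurable borel"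
  by (intro borel_measurable_continuous_onI continuous_intros)

lemma measurable_cnj [measurable]: "cnj \<in> borel_measurable borel"
  by (intro borel_measurable_continuous_onI continuous_intros)

lemma measurable_decay [measurable]: "decay \<in> borel_measurable borel"
  unfolding decay_def[abs_def] by measurable

lemma integrable_decay: "integrable lborel decay"
proof -
  have "set_integrable lborel UNIV (\<lambda>x. inverse (1 + x^2) :: real)"
    using integrable_inverse_1_plus_square by simp
  then have 1: "integrable lborel (\<lambda>x::real. inverse (1 + x^2))"
    by (simp add: set_integrable_def)
  have fin: "(\<integral>\<^sup>+x. ennreal (inverse (1 + x^2)) \<partial>lborel) < \<infinity>"
    using 1 by (simp add: integrable_iff_bounded)
  have B: "(Basis :: (real^2) set) = {axis 1 1, axis 2 1}"
    by (auto simp: Basis_vec_def UNIV_2)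
  have ne: "axis 1 1 \<noteq> (axis 2 1 :: real^2)" by (simp add: axis_eq_axis)
  have eq: "ennreal (decay x) = (\<Prod>b\<in>Basis. ennreal (inverse (1 + (x \<bullet> b)\<^sup>2)))" for x
    unfolding B using ne by (simp add: inner_axis decay_def ennreal_mult[symmetric] field_simps)
  have "(\<integral>\<^sup>+x. ennreal (decay x) \<partial>lborel) < \<infinity>"
    unfolding eq using fin
    by (subst nn_integral_lborel_prod) (auto simp: ennreal_mult_less_top B ne)
  then show ?thesis using decay_pos by (simp add: integrable_iff_bounded less_imp_le)
qed

lemma square_integrable_if_decay:
  assumes m[measurable]: "f \<in> borel_measurable borel" and b: "\<And>x. cmod (f x) \<le> C * decay x"
  shows "square_integrable f"
proof -
  have "integrable lborel (\<lambda>x. C\<^sup>2 * decay x)" by (simp add: integrable_decay)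
  moreover have "(cmod (f x))\<^sup>2 \<le> C\<^sup>2 * decay x" for x
  proof -
    have "(cmod (f x))\<^sup>2 \<le> (C * decay x)\<^sup>2" by (intro power_mono b) auto
    also have "\<dots> \<le> C\<^sup>2 * decay x"
      using decay_le_one[of x] decay_pos[of x]
      unfolding power_mult_distrib
      by (intro mult_left_mono) (simp_all add: power2_eq_square mult_left_le_one_le)
    finally show ?thesis .
  qed
  ultimately have "integrable lborel (\<lambda>x. (cmod (f x))\<^sup>2)"
    by (elim Bochner_Integration.integrable_bound) (auto intro: order_trans[OF _ abs_ge_self])
  then show ?thesis by (simp add: square_integrable_def)
qed

lemma integrable_if_decay:
  fixes f :: "real^2 \<Rightarrow> complex"
  assumes m[measurable]: "f \<in> borel_measurable borel" and b: "\<And>x. cmod (f x) \<le> C * decay x"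
  shows "integrable lborel f"
proof -
  have "integrable lborel (\<lambda>x. C * decay x)" by (simp add: integrable_decay)
  then show ?thesis by (rule Bochner_Integration.integrable_bound) (use b in \<open>auto intro: order_trans[OF b abs_ge_self]\<close>)
qed

section \<open>Partial derivatives and the Schwartz class\<close>

lemma partial_eqI: "(f has_derivative D) (at x) \<Longrightarrow> partial j f x = D (axis j 1)"
  unfolding partial_def using frechet_derivative_at by metis

lemma has_derivative_coord:
  "((\<lambda>x. complex_of_real (x$i)) has_derivative (\<lambda>h. complex_of_real (h$i))) F"
  by (intro bounded_linear_imp_has_derivative bounded_linear_compose[OF bounded_linear_of_real bounded_linear_vec_nth, unfolded o_def])

lemma frechet_works: "f differentiable (at x) \<Longrightarrow> (f has_derivative frechet_derivative f (at x)) (at x)"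
  using frechet_derivative_works by blast

lemma partial_add:
  "f differentiable (at x) \<Longrightarrow> g differentiable (at x) \<Longrightarrow>
    partial j (\<lambda>x. f x + g x) x = partial j f x + partial j g x"
  by (subst partial_eqI[OF has_derivative_add[OF frechet_works frechet_works]]) (auto simp: partial_def)

lemma partial_cmult:
  "f differentiable (at x) \<Longrightarrow> partial j (\<lambda>x. c * f x) x = c * partial j f x"
  by (subst partial_eqI[OF has_derivative_mult_right[OF frechet_works]]) (auto simp: partial_def)

lemma partial_mult:
  "f differentiable (at x) \<Longrightarrow> g differentiable (at x) \<Longrightarrow>
    partial j (\<lambda>x. f x * g x) x = partial j f x * g x + f x * partial j g x"
  by (subst partial_eqI[OF has_derivative_mult[OF frechet_works frechet_works]]) (auto simp: partial_def)

lemma partial_coord: "partial j (\<lambda>x. complex_of_real (x$i)) x = (if i = j then 1 else 0)"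
  by (subst partial_eqI[OF has_derivative_coord]) (simp add: axis_def)

lemma differentiable_coord: "(\<lambda>x. complex_of_real (x$i)) differentiable (at x)"
  using has_derivative_coord differentiable_def by blast

lemma partial_xmult:
  "f differentiable (at x) \<Longrightarrow>
    partial j (\<lambda>x. complex_of_real (x$i) * f x) x = (if i = j then f x else 0) + complex_of_real (x$i) * partial j f x"
  by (subst partial_mult[OF differentiable_coord]) (auto simp: partial_coord)

lemma partial_cnj:
  "f differentiable (at x) \<Longrightarrow> partial j (\<lambda>x. cnj (f x)) x = cnj (partial j f x)"
  by (subst partial_eqI[OF has_derivative_cnj[OF frechet_works]]) (auto simp: partial_def)

lemma differentiable_cnj:
  assumes "f differentiable (at x)" shows "(\<lambda>x. cnj (f x)) differentiable (at x)"
  using has_derivative_cnj[OF frechet_works[OF assms]] by (auto simp: differentiable_def)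

text \<open>Replaces Leibniz formulas for iterated derivatives: it suffices to exhibit a class
  closed under both partial derivatives whose members are differentiable and satisfy the decay
  bounds without derivatives.\<close>

lemma schwartz_coinduct:
  assumes "K f"
    and d: "\<And>f x. K f \<Longrightarrow> f differentiable (at x)"
    and b: "\<And>f m n. K f \<Longrightarrow> bounded (range (\<lambda>x. complex_of_real (x$1 ^ m * x$2 ^ n) * f x))"
    and p: "\<And>f j. K f \<Longrightarrow> K (partial j f)"
  shows "schwartz f"
proof -
  have "K (foldr partial js f)" for js
    by (induction js) (simp_all add: assms(1) p)
  then show ?thesis using d b unfolding schwartz_def by blast
qed

lemma schwartz_differentiable: "schwartz f \<Longrightarrow> f differentiable (at x)"
  unfolding schwartz_def by (drule spec[of _ "[]"]) simp

lemma schwartz_bounded: "schwartz f \<Longrightarrow> bounded (range (\<lambda>x. complex_of_real (x$1 ^ m * x$2 ^ n) * f x))"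
  unfolding schwartz_def by (drule spec[of _ "[]"]) simp

lemma schwartz_partial:
  assumes "schwartz f" shows "schwartz (partial j f)"
proof -
  have "foldr partial js (partial j f) = foldr partial (js @ [j]) f" for js by simp
  then show ?thesis using assms unfolding schwartz_def by (simp only: simp_thms)
qed

lemma bounded_range_add:
  fixes f g :: "'a \<Rightarrow> complex"
  assumes "bounded (range f)" "bounded (range g)"
  shows "bounded (range (\<lambda>x. f x + g x))"
  by (rule bounded_plus_comp) (use assms in auto)

lemma bounded_range_cmult:
  fixes f :: "'a \<Rightarrow> complex"
  assumes "bounded (range f)"
  shows "bounded (range (\<lambda>x. c * f x))"
proof -
  obtain B where "\<And>x. cmod (f x) \<le> B" using assms by (auto simp: bounded_iff)
  then have "cmod (c * f x) \<le> cmod c * B" for x by (simp add: norm_mult mult_left_mono)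
  then show ?thesis unfolding bounded_iff by blast
qed

lemma schwartz_add:
  assumes "schwartz f" "schwartz g" shows "schwartz (\<lambda>x. f x + g x)"
proof (rule schwartz_coinduct[where K="\<lambda>h. \<exists>f g. schwartz f \<and> schwartz g \<and> h = (\<lambda>x. f x + g x)"])
  fix h x assume "\<exists>f g. schwartz f \<and> schwartz g \<and> h = (\<lambda>x. f x + g x)"
  then show "h differentiable at x" by (elim exE conjE) (simp add: schwartz_differentiable)
next
  fix h m n assume "\<exists>f g. schwartz f \<and> schwartz g \<and> h = (\<lambda>x. f x + g x)"
  then show "bounded (range (\<lambda>x. complex_of_real (x$1 ^ m * x$2 ^ n) * h x))"
    by (elim exE conjE) (simp only: distrib_left bounded_range_add schwartz_bounded)
next
  fix h j assume "\<exists>f g. schwartz f \<and> schwartz g \<and> h = (\<lambda>x. f x + g x)"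
  then obtain f g where h: "schwartz f" "schwartz g" "h = (\<lambda>x. f x + g x)" by blast
  then have "partial j h = (\<lambda>x. partial j f x + partial j g x)"
    by (auto simp: partial_add schwartz_differentiable)
  then show "\<exists>f g. schwartz f \<and> schwartz g \<and> partial j h = (\<lambda>x. f x + g x)"
    using h schwartz_partial by blast
qed (use assms in blast)

lemma schwartz_cmult:
  assumes "schwartz f" shows "schwartz (\<lambda>x. c * f x)"
proof (rule schwartz_coinduct[where K="\<lambda>h. \<exists>f. schwartz f \<and> h = (\<lambda>x. c * f x)"])
  fix h x assume "\<exists>f. schwartz f \<and> h = (\<lambda>x. c * f x)"
  then show "h differentiable at x" by (elim exE conjE) (simp add: schwartz_differentiable)
next
  fix h m n assume "\<exists>f. schwartz f \<and> h = (\<lambda>x. c * f x)"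
  then obtain f where f: "schwartz f" "h = (\<lambda>x. c * f x)" by blast
  have "(\<lambda>x. complex_of_real (x$1 ^ m * x$2 ^ n) * h x) = (\<lambda>x. c * (complex_of_real (x$1 ^ m * x$2 ^ n) * f x))"
    by (simp add: f mult_ac)
  then show "bounded (range (\<lambda>x. complex_of_real (x$1 ^ m * x$2 ^ n) * h x))"
    by (simp only: bounded_range_cmult schwartz_bounded[OF f(1)])
next
  fix h j assume "\<exists>f. schwartz f \<and> h = (\<lambda>x. c * f x)"
  then obtain f where h: "schwartz f" "h = (\<lambda>x. c * f x)" by blast
  then have "partial j h = (\<lambda>x. c * partial j f x)"
    by (auto simp: partial_cmult schwartz_differentiable)
  then show "\<exists>f. schwartz f \<and> partial j h = (\<lambda>x. c * f x)"
    using h schwartz_partial by blast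
qed (use assms in blast)

lemma schwartz_xmult:
  assumes "schwartz f" shows "schwartz (\<lambda>x. complex_of_real (x$i) * f x)"
proof -
  have zero: "schwartz (\<lambda>x. 0)" using schwartz_cmult[OF assms, of 0] by simp
  show ?thesis
  \<comment> \<open>The product rule leaves a term without the factor \<open>x$i\<close>, so the
    class that is closed under derivatives needs the additional Schwartz summand
    \<open>g\<close>.\<close>
  proof (rule schwartz_coinduct[where K="\<lambda>h. \<exists>f g. schwartz f \<and> schwartz g \<and> h = (\<lambda>x. complex_of_real (x$i) * f x + g x)"])
    show "\<exists>g h. schwartz g \<and> schwartz h \<and> (\<lambda>x. complex_of_real (x$i) * f x) = (\<lambda>x. complex_of_real (x$i) * g x + h x)"
      by (intro exI[of _ f] exI[of _ "\<lambda>x. 0"]) (simp add: assms zero)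
  next
    fix h x assume "\<exists>f g. schwartz f \<and> schwartz g \<and> h = (\<lambda>x. complex_of_real (x$i) * f x + g x)"
    then show "h differentiable at x"
      by (elim exE conjE) (simp add: schwartz_differentiable differentiable_coord)
  next
    fix h m n assume "\<exists>f g. schwartz f \<and> schwartz g \<and> h = (\<lambda>x. complex_of_real (x$i) * f x + g x)"
    then obtain f g where h: "schwartz f" "schwartz g" "h = (\<lambda>x. complex_of_real (x$i) * f x + g x)" by blast
    obtain m' n' where mn: "\<And>x::real^2. x$1 ^ m' * x$2 ^ n' = x$1 ^ m * x$2 ^ n * x$i"
    proof (cases "i = 1")
      case True then show ?thesis using that[of "Suc m" n] by (simp add: mult_ac)
    next
      case False
      then have "i = 2" using exhaust_2 by blast
      then show ?thesis using that[of m "Suc n"] by (simp add: mult_ac)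
    qed
    have "complex_of_real (x$1 ^ m * x$2 ^ n) * h x =
      complex_of_real (x$1 ^ m' * x$2 ^ n') * f x + complex_of_real (x$1 ^ m * x$2 ^ n) * g x" for x
      unfolding mn h by (simp add: algebra_simps)
    then show "bounded (range (\<lambda>x. complex_of_real (x$1 ^ m * x$2 ^ n) * h x))"
      using bounded_range_add[OF schwartz_bounded[OF h(1), of m' n'] schwartz_bounded[OF h(2), of m n]]
      by presburger
  next
    fix h j assume "\<exists>f g. schwartz f \<and> schwartz g \<and> h = (\<lambda>x. complex_of_real (x$i) * f x + g x)"
    then obtain f g where h: "schwartz f" "schwartz g" "h = (\<lambda>x. complex_of_real (x$i) * f x + g x)" by blast
    then have "partial j h = (\<lambda>x. complex_of_real (x$i) * partial j f x + ((if i = j then 1 else 0) * f x + partial j g x))"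
      by (auto simp: partial_add partial_xmult differentiable_mult differentiable_coord schwartz_differentiable)
    moreover have "schwartz (\<lambda>x. (if i = j then 1 else 0) * f x + partial j g x)"
      by (intro schwartz_add schwartz_cmult schwartz_partial h)
    ultimately show "\<exists>f g. schwartz f \<and> schwartz g \<and> partial j h = (\<lambda>x. complex_of_real (x$i) * f x + g x)"
      using schwartz_partial[OF h(1)] by blast
  qed
qed

text \<open>The bounds for the monomials with exponents 0 or 2 add up to a bound for
  \<open>(1 + (x$1)\<^sup>2) * (1 + (x$2)\<^sup>2)\<close> times the function.\<close>

lemma schwartz_decay:
  assumes "schwartz f" obtains C where "\<And>x. cmod (f x) \<le> C * decay x"
proof -
  have "\<exists>B. \<forall>x. cmod (complex_of_real (x$1 ^ m * x$2 ^ n) * f x) \<le> B" for m n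
    using schwartz_bounded[OF assms, of m n] by (auto simp: bounded_iff)
  then obtain B where B: "\<And>m n x. cmod (complex_of_real (x$1 ^ m * x$2 ^ n) * f x) \<le> B m n" by metis
  have "cmod (f x) \<le> (B 0 0 + B 2 0 + B 0 2 + B 2 2) * decay x" for x
  proof -
    have e: "cmod (complex_of_real (x$1 ^ m * x$2 ^ n) * f x) = x$1 ^ m * x$2 ^ n * cmod (f x)" if "even m" "even n" for m n
      using that by (simp add: norm_mult norm_power zero_le_even_power abs_mult flip: power_abs)
    have "(1 + (x$1)\<^sup>2) * (1 + (x$2)\<^sup>2) * cmod (f x) \<le> B 0 0 + B 2 0 + B 0 2 + B 2 2"
      using B[of x 0 0] B[of x 2 0] B[of x 0 2] B[of x 2 2] e[of 0 0] e[of 2 0] e[of 0 2] e[of 2 2]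
      by (simp add: algebra_simps)
    moreover have "0 < (1 + (x$1)\<^sup>2) * (1 + (x$2)\<^sup>2)" by (intro mult_pos_pos one_plus_square_pos)
    ultimately show ?thesis by (simp add: decay_def field_simps)
  qed
  then show ?thesis using that by blast
qed

lemma schwartz_continuous: "schwartz f \<Longrightarrow> continuous_on UNIV f"
  by (simp add: continuous_at_imp_continuous_on differentiable_imp_continuous_within schwartz_differentiable)

lemma schwartz_measurable: "schwartz f \<Longrightarrow> f \<in> borel_measurable borel"
  by (intro borel_measurable_continuous_onI schwartz_continuous)

lemma schwartz_square_integrable: "schwartz f \<Longrightarrow> square_integrable f"
  by (metis schwartz_decay schwartz_measurable square_integrable_if_decay)

text \<open>The set of agreement is closed, and a closed set of full measure is everything. A class
  in \<open>l2\<close> therefore has at most one continuous representative.\<close>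

lemma continuous_AE_eq:
  fixes f g :: "real^2 \<Rightarrow> complex"
  assumes "continuous_on UNIV f" "continuous_on UNIV g" "AE x in lborel. f x = g x"
  shows "f = g"
proof
  fix x
  have "closed {x. f x = g x}" by (intro closed_Collect_eq assms)
  moreover have "AE x in lebesgue. x \<in> {x. f x = g x}" using assms(3) by (auto intro: AE_completion)
  ultimately have "x \<in> {x. f x = g x}" by (rule mem_closed_if_AE_lebesgue)
  then show "f x = g x" by simp
qed

lemma l2_of_schwartz_inj: "schwartz f \<Longrightarrow> schwartz g \<Longrightarrow> l2_of f = l2_of g \<longleftrightarrow> f = g"
  by (metis continuous_AE_eq l2_of_eq_iff schwartz_continuous schwartz_square_integrable)

text \<open>The factor does not depend on the shift, so all difference quotients with step at most 1
  share one integrable majorant.\<close>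

lemma decay_shift:
  assumes "\<bar>s\<bar> \<le> 1" shows "decay (x + s *\<^sub>R axis j 1) \<le> 3 * decay x"
proof -
  have key: "1 + t\<^sup>2 \<le> 3 * (1 + (t + s)\<^sup>2)" for t :: real
  proof -
    have "s\<^sup>2 \<le> 1" using assms by (simp add: abs_square_le_1)
    moreover have "0 \<le> (t + 2 * s)\<^sup>2 + t\<^sup>2 + t\<^sup>2" by simp
    moreover have "0 \<le> (2 * t + 3 * s)\<^sup>2" by simp
    ultimately show ?thesis by (simp add: power2_eq_square algebra_simps)
  qed
  have pos: "0 < (1 + t\<^sup>2) * (1 + u\<^sup>2)" for t u :: real by (intro mult_pos_pos one_plus_square_pos)
  have "j = 1 \<or> j = 2" by (rule exhaust_2)
  then have "(1 + (x$1)\<^sup>2) * (1 + (x$2)\<^sup>2) \<le>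
     3 * ((1 + ((x + s *\<^sub>R axis j 1)$1)\<^sup>2) * (1 + ((x + s *\<^sub>R axis j 1)$2)\<^sup>2))"
    using mult_right_mono[OF key[of "x$1"], of "1 + (x$2)\<^sup>2"] mult_left_mono[OF key[of "x$2"], of "1 + (x$1)\<^sup>2"]
    by (auto simp: axis_def algebra_simps)
  then show ?thesis
    using pos[of "x$1" "x$2"] pos[of "(x + s *\<^sub>R axis j 1)$1" "(x + s *\<^sub>R axis j 1)$2"]
    unfolding decay_def by (simp add: divide_simps mult_ac)
qed

text \<open>Translation invariance of the Lebesgue measure makes the integral of every difference
  quotient vanish; dominated convergence passes to the derivative.\<close>

lemma integral_partial_eq_0:
  assumes d: "\<And>x. h differentiable (at x)"
    and b: "\<And>x. cmod (h x) \<le> C * decay x" "\<And>x. cmod (partial j h x) \<le> C * decay x"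
    and m[measurable]: "partial j h \<in> borel_measurable borel"
  shows "(\<integral>x. partial j h x \<partial>lborel) = 0"
proof -
  have hc: "continuous_on UNIV h"
    by (simp add: continuous_at_imp_continuous_on differentiable_imp_continuous_within d)
  have hm[measurable]: "h \<in> borel_measurable borel" by (intro borel_measurable_continuous_onI hc)
  have hi: "integrable lborel h" by (rule integrable_if_decay[OF hm b(1)])
  have C0: "0 \<le> C"
  proof -
    have "0 \<le> C * decay 0" using b(1)[of 0] norm_ge_zero order_trans by blast
    then show ?thesis using decay_pos[of 0] by (simp add: zero_le_mult_iff)
  qed
  define q where "q n x = of_nat (Suc n) * (h (x + (1 / Suc n) *\<^sub>R axis j 1) - h x)" for n x
  have shift: "integrable lborel (\<lambda>x. h (x + v)) \<and> (\<integral>x. h (x + v) \<partial>lborel) = (\<integral>x. h x \<partial>lborel)" for v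
  proof -
    have "integrable (distr lborel borel ((+) v)) h" by (subst lborel_distr_plus) (rule hi)
    then have i: "integrable lborel (\<lambda>x. h (v + x))" by (subst (asm) integrable_distr_eq) auto
    have "(\<integral>x. h x \<partial>lborel) = (\<integral>x. h x \<partial>distr lborel borel ((+) v))" by (subst lborel_distr_plus) simp
    also have "\<dots> = (\<integral>x. h (v + x) \<partial>lborel)" by (subst integral_distr) auto
    finally show ?thesis using i by (simp add: add.commute)
  qed
  have q0: "(\<integral>x. q n x \<partial>lborel) = 0" for n
    unfolding q_def using shift[of "(1 / Suc n) *\<^sub>R axis j 1"] hi by simp
  have der: "((\<lambda>s. h (x + s *\<^sub>R axis j 1)) has_derivative (\<lambda>t. t *\<^sub>R partial j h (x + s *\<^sub>R axis j 1))) (at s within S)" for x s S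
  proof -
    have "((\<lambda>s. x + s *\<^sub>R axis j 1) has_derivative (\<lambda>t. t *\<^sub>R axis j 1)) (at s within S)"
      by (auto intro!: derivative_eq_intros)
    from has_derivative_compose[OF this frechet_works[OF d]]
    have 1: "((\<lambda>s. h (x + s *\<^sub>R axis j 1)) has_derivative
       (\<lambda>t. frechet_derivative h (at (x + s *\<^sub>R axis j 1)) (t *\<^sub>R axis j 1))) (at s within S)" .
    have "linear (frechet_derivative h (at y))" for y using d by (rule linear_frechet_derivative)
    then show ?thesis using 1 by (simp add: linear_scale partial_def)
  qed
  \<comment> \<open>Mean value inequality along a segment in direction \<open>j\<close>. Its points
    are shifts of \<open>x\<close> by at most 1, so \<open>decay_shift\<close> bounds the derivative
    there by the weight at \<open>x\<close>.\<close>
  have dom: "norm (q n x) \<le> 3 * C * decay x" for n x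
  proof -
    have "norm (h (x + (1 / Suc n) *\<^sub>R axis j 1) - h (x + 0 *\<^sub>R axis j 1)) \<le> (3 * C * decay x) * norm (1 / Suc n - 0::real)"
    proof (rule differentiable_bound[where S="{0..1}" and f="\<lambda>s. h (x + s *\<^sub>R axis j 1)"])
      show "((\<lambda>s. h (x + s *\<^sub>R axis j 1)) has_derivative (\<lambda>t. t *\<^sub>R partial j h (x + s *\<^sub>R axis j 1))) (at s within {0..1})" for s
        by (rule der)
      fix s :: real assume s: "s \<in> {0..1}"
      have "cmod (partial j h (x + s *\<^sub>R axis j 1)) \<le> C * decay (x + s *\<^sub>R axis j 1)" by (rule b)
      also have "\<dots> \<le> C * (3 * decay x)" using s C0 by (intro mult_left_mono decay_shift) auto
      finally have "cmod (partial j h (x + s *\<^sub>R axis j 1)) \<le> 3 * C * decay x" by simp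
      then show "onorm (\<lambda>t. t *\<^sub>R partial j h (x + s *\<^sub>R axis j 1)) \<le> 3 * C * decay x"
        by (intro onorm_le) (metis mult.commute mult_right_mono norm_ge_zero norm_scaleR real_norm_def)
    qed auto
    then have "real (Suc n) * norm (h (x + (1 / Suc n) *\<^sub>R axis j 1) - h x) \<le> 3 * C * decay x"
      by (simp add: pos_le_divide_eq mult.commute del: of_nat_Suc)
    then show ?thesis by (simp only: q_def norm_mult norm_of_nat)
  qed
  have lim: "(\<lambda>n. q n x) \<longlonglongrightarrow> partial j h x" for x
  proof -
    have "((\<lambda>t. norm (h (x + (0 + t) *\<^sub>R axis j 1) - h (x + 0 *\<^sub>R axis j 1) - t *\<^sub>R partial j h (x + 0 *\<^sub>R axis j 1)) / norm t) \<longlongrightarrow> 0) (at 0)"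
      using der[of x 0 UNIV] unfolding has_derivative_at by blast
    moreover have "filterlim (\<lambda>n. 1 / real (Suc n)) (at 0) sequentially"
      using LIMSEQ_inverse_real_of_nat by (simp add: filterlim_at inverse_eq_divide)
    ultimately have "(\<lambda>n. norm (h (x + (0 + 1 / real (Suc n)) *\<^sub>R axis j 1) - h (x + 0 *\<^sub>R axis j 1) -
        (1 / real (Suc n)) *\<^sub>R partial j h (x + 0 *\<^sub>R axis j 1)) / norm (1 / real (Suc n))) \<longlonglongrightarrow> 0"
      by (rule filterlim_compose)
    also have "(\<lambda>n. norm (h (x + (0 + 1 / real (Suc n)) *\<^sub>R axis j 1) - h (x + 0 *\<^sub>R axis j 1) -
        (1 / real (Suc n)) *\<^sub>R partial j h (x + 0 *\<^sub>R axis j 1)) / norm (1 / real (Suc n))) = (\<lambda>n. norm (q n x - partial j h x))"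
    proof
      fix n
      have "q n x - partial j h x = real (Suc n) *\<^sub>R (h (x + (1 / real (Suc n)) *\<^sub>R axis j 1) - h x -
        (1 / real (Suc n)) *\<^sub>R partial j h x)"
        unfolding q_def scaleR_right_diff_distrib
        by (simp add: scaleR_conv_of_real right_diff_distrib del: of_nat_Suc)
      then show "norm (h (x + (0 + 1 / real (Suc n)) *\<^sub>R axis j 1) - h (x + 0 *\<^sub>R axis j 1) -
        (1 / real (Suc n)) *\<^sub>R partial j h (x + 0 *\<^sub>R axis j 1)) / norm (1 / real (Suc n)) = norm (q n x - partial j h x)"
        by (simp del: of_nat_Suc)
    qed
    finally show ?thesis by (simp add: LIM_zero_iff tendsto_norm_zero_iff)
  qed
  have "(\<lambda>n. \<integral>x. q n x \<partial>lborel) \<longlonglongrightarrow> (\<integral>x. partial j h x \<partial>lborel)"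
    by (rule integral_dominated_convergence[where w="\<lambda>x. 3 * C * decay x"])
       (use lim dom in \<open>auto simp: integrable_decay q_def\<close>)
  then show ?thesis using q0 by (simp add: LIMSEQ_const_iff)
qed

text \<open>The product \<open>cnj (f x) * g x\<close> and its derivative decay, so the integral of
  the derivative vanishes and no boundary term is left.\<close>

lemma integral_by_parts:
  assumes f: "schwartz f" and g: "schwartz g"
  shows "(\<integral>x. cnj (f x) * partial j g x \<partial>lborel) = - (\<integral>x. cnj (partial j f x) * g x \<partial>lborel)"
proof -
  obtain F F' G G' where b: "\<And>x. cmod (f x) \<le> F * decay x" "\<And>x. cmod (partial j f x) \<le> F' * decay x"
      "\<And>x. cmod (g x) \<le> G * decay x" "\<And>x. cmod (partial j g x) \<le> G' * decay x"
    using schwartz_decay[OF f] schwartz_decay[OF g] schwartz_decay[OF schwartz_partial[OF f], of j]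
      schwartz_decay[OF schwartz_partial[OF g], of j] by metis
  have m[measurable]: "f \<in> borel_measurable borel" "g \<in> borel_measurable borel"
    "partial j f \<in> borel_measurable borel" "partial j g \<in> borel_measurable borel"
    using f g by (auto intro!: schwartz_measurable schwartz_partial)
  define h where "h x = cnj (f x) * g x" for x
  have ph: "partial j h x = cnj (partial j f x) * g x + cnj (f x) * partial j g x" for x
    unfolding h_def[abs_def] by (subst partial_mult) (auto simp: partial_cnj differentiable_cnj schwartz_differentiable f g)
  have pr: "cmod (u * v) \<le> (K * L) * decay x" if "cmod u \<le> K * decay x" "cmod v \<le> L * decay x" for u v K L x
  proof -
    have K: "0 \<le> K" "0 \<le> L" using that decay_pos[of x] norm_ge_zero order_trans zero_le_mult_iff
      by (metis not_le order_less_imp_le)+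
    have "cmod (u * v) \<le> (K * decay x) * (L * decay x)" unfolding norm_mult by (intro mult_mono that) (use K decay_pos[of x] in auto)
    also have "\<dots> = (K * L) * (decay x * decay x)" by simp
    also have "\<dots> \<le> (K * L) * (1 * decay x)"
      using K decay_le_one[of x] decay_pos[of x] by (intro mult_left_mono mult_right_mono) auto
    finally show ?thesis by simp
  qed
  have 1: "cmod (cnj (partial j f x) * g x) \<le> (F' * G) * decay x" for x using b by (intro pr) auto
  have 2: "cmod (cnj (f x) * partial j g x) \<le> (F * G') * decay x" for x using b by (intro pr) auto
  have 0: "cmod (h x) \<le> (F * G) * decay x" for x unfolding h_def using b by (intro pr) auto
  define C where "C = max (F * G) (F' * G + F * G')"
  have "(\<integral>x. partial j h x \<partial>lborel) = 0"
  proof (rule integral_partial_eq_0)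
    show "h differentiable (at x)" for x
      unfolding h_def[abs_def] by (rule differentiable_mult[OF differentiable_cnj[OF schwartz_differentiable[OF f]] schwartz_differentiable[OF g]])
    show "cmod (h x) \<le> C * decay x" for x
      using decay_pos[of x] by (intro order_trans[OF 0[of x]] mult_right_mono) (auto simp: C_def)
    have 3: "cmod (partial j h x) \<le> (F' * G + F * G') * decay x" for x
      unfolding ph using norm_triangle_le[OF add_mono[OF 1 2]] by (simp add: distrib_right)
    show "cmod (partial j h x) \<le> C * decay x" for x
      using decay_pos[of x] by (intro order_trans[OF 3[of x]] mult_right_mono) (auto simp: C_def)
    show "partial j h \<in> borel_measurable borel" unfolding ph[abs_def] by measurable
  qed
  moreover have "integrable lborel (\<lambda>x. cnj (partial j f x) * g x)" "integrable lborel (\<lambda>x. cnj (f x) * partial j g x)"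
    by (intro integrable_if_decay[OF _ 1] integrable_if_decay[OF _ 2]; measurable)+
  ultimately show ?thesis unfolding ph by (simp add: eq_neg_iff_add_eq_0 add.commute)
qed

section \<open>Operators induced by maps of Schwartz functions\<close>

definition sop :: "((real^2 \<Rightarrow> complex) \<Rightarrow> (real^2 \<Rightarrow> complex)) \<Rightarrow> op" where
  "sop L = {(l2_of f, l2_of (L f)) | f. schwartz f}"

definition schwartz_map :: "((real^2 \<Rightarrow> complex) \<Rightarrow> (real^2 \<Rightarrow> complex)) \<Rightarrow> bool" where
  "schwartz_map L \<longleftrightarrow> (\<forall>f. schwartz f \<longrightarrow> schwartz (L f))"

definition xf :: "2 \<Rightarrow> (real^2 \<Rightarrow> complex) \<Rightarrow> real^2 \<Rightarrow> complex" where
  "xf j f x = complex_of_real (x$j) * f x"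

definition pf :: "2 \<Rightarrow> (real^2 \<Rightarrow> complex) \<Rightarrow> real^2 \<Rightarrow> complex" where
  "pf j f x = - \<i> * partial j f x"

lemma pos_eq_sop: "pos j = sop (xf j)" and mom_eq_sop: "mom j = sop (pf j)"
  by (auto simp: pos_def mom_def sop_def xf_def[abs_def] pf_def[abs_def])

lemma schwartz_map_xf: "schwartz_map (xf j)"
  by (auto simp: schwartz_map_def xf_def[abs_def] schwartz_xmult)

lemma schwartz_map_pf: "schwartz_map (pf j)"
  using schwartz_cmult[OF schwartz_partial, of _ "- \<i>"] by (auto simp: schwartz_map_def pf_def[abs_def])

lemma schwartz_mapD: "schwartz_map L \<Longrightarrow> schwartz f \<Longrightarrow> schwartz (L f)"
  by (simp add: schwartz_map_def)

lemma schwartz_map_add: "schwartz_map L \<Longrightarrow> schwartz_map M \<Longrightarrow> schwartz_map (\<lambda>f x. L f x + M f x)"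
  by (simp add: schwartz_map_def schwartz_add)

lemma schwartz_map_scale: "schwartz_map L \<Longrightarrow> schwartz_map (\<lambda>f x. c * L f x)"
  by (simp add: schwartz_map_def schwartz_cmult)

lemma schwartz_map_ident: "schwartz_map (\<lambda>f. f)"
  by (simp add: schwartz_map_def)

lemma schwartz_map_add_scalar: "schwartz_map L \<Longrightarrow> schwartz_map (\<lambda>f x. L f x + c * f x)"
  by (simp add: schwartz_map_def schwartz_add schwartz_cmult)

lemma schwartz_map_comp: "schwartz_map L \<Longrightarrow> schwartz_map M \<Longrightarrow> schwartz_map (\<lambda>f. L (M f))"
  by (simp add: schwartz_map_def)

lemmas schwartz_map_intros = schwartz_map_xf schwartz_map_pf schwartz_map_add schwartz_map_scale
  schwartz_map_ident schwartz_map_add_scalar schwartz_map_comp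

text \<open>Rests on uniqueness of the Schwartz representative. Through it, identities between
  graphs reduce to pointwise identities between functions.\<close>

lemma sop_iff: "schwartz f \<Longrightarrow> (l2_of f, G) \<in> sop L \<longleftrightarrow> G = l2_of (L f)"
  by (auto simp: sop_def l2_of_schwartz_inj)

lemma sopE:
  assumes "(F, G) \<in> sop L" obtains f where "schwartz f" "F = l2_of f" "G = l2_of (L f)"
  using assms by (auto simp: sop_def)

lemma sop_cong: "(\<And>f. schwartz f \<Longrightarrow> L f = M f) \<Longrightarrow> sop L = sop M"
  by (force simp: sop_def)

lemma sop_add:
  assumes "schwartz_map L" "schwartz_map M"
  shows "sop L +\<^sub>o sop M = sop (\<lambda>f x. L f x + M f x)"
proof (intro set_eqI iffI; clarify)
  fix F G assume "(F, G) \<in> sop L +\<^sub>o sop M"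
  then obtain G1 G2 where g: "G = G1 + G2" "(F, G1) \<in> sop L" "(F, G2) \<in> sop M"
    by (auto simp: op_add_def)
  from g(2) obtain f where f: "schwartz f" "F = l2_of f" "G1 = l2_of (L f)" by (rule sopE)
  with g(3) have "G2 = l2_of (M f)" by (simp add: sop_iff)
  with f g(1) show "(F, G) \<in> sop (\<lambda>f x. L f x + M f x)"
    using assms by (simp add: sop_iff l2_of_add schwartz_square_integrable schwartz_mapD)
next
  fix F G assume "(F, G) \<in> sop (\<lambda>f x. L f x + M f x)"
  then obtain f where f: "schwartz f" "F = l2_of f" "G = l2_of (\<lambda>x. L f x + M f x)" by (rule sopE)
  then have "G = l2_of (L f) + l2_of (M f)"
    using assms by (simp add: l2_of_add schwartz_square_integrable schwartz_mapD)
  then show "(F, G) \<in> sop L +\<^sub>o sop M" using f by (auto simp: op_add_def sop_iff)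
qed

lemma sop_scale:
  assumes "schwartz_map L"
  shows "c \<cdot>\<^sub>o sop L = sop (\<lambda>f x. c * L f x)"
proof -
  have "c *\<^sub>C l2_of (L f) = l2_of (\<lambda>x. c * L f x)" if "schwartz f" for f
    using assms that by (simp add: l2_of_scale schwartz_square_integrable schwartz_mapD)
  then show ?thesis by (force simp: op_scale_def sop_def)
qed

lemma sop_add_scalar:
  assumes "schwartz_map L"
  shows "sop L +\<^sub>o c \<cdot>\<^sub>o Id = sop (\<lambda>f x. L f x + c * f x)"
proof -
  have "l2_of (L f) + c *\<^sub>C l2_of f = l2_of (\<lambda>x. L f x + c * f x)" if "schwartz f" for f
    using assms that
    by (simp add: l2_of_scale l2_of_add square_integrable_cmult schwartz_square_integrable schwartz_mapD)
  then show ?thesis by (force simp: op_scale_def op_add_def sop_def)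
qed

lemma sop_mult:
  assumes "schwartz_map M"
  shows "sop L *\<^sub>o sop M = sop (\<lambda>f. L (M f))"
proof (intro set_eqI iffI; clarify)
  fix F G assume "(F, G) \<in> sop L *\<^sub>o sop M"
  then obtain H where "(F, H) \<in> sop M" "(H, G) \<in> sop L" by (auto simp: op_mult_def)
  then show "(F, G) \<in> sop (\<lambda>f. L (M f))"
    using assms by (metis sopE sop_iff schwartz_mapD)
next
  fix F G assume "(F, G) \<in> sop (\<lambda>f. L (M f))"
  then obtain f where "schwartz f" "F = l2_of f" "G = l2_of (L (M f))" by (rule sopE)
  then show "(F, G) \<in> sop L *\<^sub>o sop M"
    using assms unfolding op_mult_def by (metis relcomp.relcompI sop_iff schwartz_mapD)
qed

lemma Id_on_schwartz: "Id_on \<S> = sop (\<lambda>f. f)"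
  by (auto simp: Id_on_def \<S>_def sop_def)

lemma sop_Domain: "Domain (sop L) = \<S>"
  by (auto simp: sop_def \<S>_def)

lemmas sop_simps = pos_eq_sop mom_eq_sop sop_add sop_scale sop_add_scalar sop_mult schwartz_map_intros

lemma stable_under_sop: "schwartz_map L \<Longrightarrow> stable_under \<S> (sop L)"
  by (auto simp: stable_under_def sop_Domain \<S>_def schwartz_mapD elim!: sopE)

lemma cinner_schwartz:
  "schwartz f \<Longrightarrow> schwartz g \<Longrightarrow> cinner (l2_of f) (l2_of g) = (\<integral>x. cnj (f x) * g x \<partial>lborel)"
  by (simp add: cinner_l2_of schwartz_square_integrable)

lemma cinner_xf:
  "schwartz f \<Longrightarrow> schwartz g \<Longrightarrow> cinner (l2_of f) (l2_of (xf j g)) = cinner (l2_of (xf j f)) (l2_of g)"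
  by (simp add: cinner_schwartz schwartz_mapD[OF schwartz_map_xf]) (simp add: xf_def mult_ac)

lemma cinner_pf:
  assumes "schwartz f" "schwartz g"
  shows "cinner (l2_of f) (l2_of (pf j g)) = cinner (l2_of (pf j f)) (l2_of g)"
  using assms integral_by_parts[OF assms, of j]
  by (simp add: cinner_schwartz schwartz_mapD[OF schwartz_map_pf])
     (simp add: pf_def mult.left_commute[of _ "\<i>"] mult.assoc)

text \<open>Formal adjoints on Schwartz functions. They pass to sums, scalar multiples and reversed
  products, so the full \<open>adj\<close> of a composite operator never has to be computed.\<close>

definition adjoint_pair :: "((real^2 \<Rightarrow> complex) \<Rightarrow> (real^2 \<Rightarrow> complex)) \<Rightarrow> ((real^2 \<Rightarrow> complex) \<Rightarrow> (real^2 \<Rightarrow> complex)) \<Rightarrow> bool" where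
  "adjoint_pair L M \<longleftrightarrow> schwartz_map L \<and> schwartz_map M \<and>
     (\<forall>f g. schwartz f \<longrightarrow> schwartz g \<longrightarrow> cinner (l2_of f) (l2_of (L g)) = cinner (l2_of (M f)) (l2_of g))"

lemma adjoint_pair_xf: "adjoint_pair (xf j) (xf j)"
  by (simp add: adjoint_pair_def cinner_xf schwartz_map_xf)

lemma adjoint_pair_pf: "adjoint_pair (pf j) (pf j)"
  by (simp add: adjoint_pair_def cinner_pf schwartz_map_pf)

lemma adjoint_pair_add:
  assumes "adjoint_pair L L'" "adjoint_pair M M'"
  shows "adjoint_pair (\<lambda>f x. L f x + M f x) (\<lambda>f x. L' f x + M' f x)"
  using assms unfolding adjoint_pair_def
  by (auto simp: schwartz_map_intros schwartz_mapD schwartz_square_integrable cinner_add_left cinner_add_right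
      simp flip: l2_of_add)

lemma adjoint_pair_scale:
  assumes "adjoint_pair L L'"
  shows "adjoint_pair (\<lambda>f x. c * L f x) (\<lambda>f x. cnj c * L' f x)"
  using assms unfolding adjoint_pair_def
  by (auto simp: schwartz_map_intros schwartz_mapD schwartz_square_integrable cinner_scale_left cinner_scale_right
      simp flip: l2_of_scale)

lemma adjoint_pair_ident: "adjoint_pair (\<lambda>f. f) (\<lambda>f. f)"
  by (simp add: adjoint_pair_def schwartz_map_ident)

lemma adjoint_pair_add_scalar:
  assumes "adjoint_pair L L'"
  shows "adjoint_pair (\<lambda>f x. L f x + c * f x) (\<lambda>f x. L' f x + cnj c * f x)"
  by (intro adjoint_pair_add assms adjoint_pair_scale adjoint_pair_ident)

lemma adjoint_pair_comp:
  assumes "adjoint_pair L L'" "adjoint_pair M M'"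
  shows "adjoint_pair (\<lambda>f. L (M f)) (\<lambda>f. M' (L' f))"
  using assms unfolding adjoint_pair_def by (auto simp: schwartz_map_intros schwartz_mapD)

section \<open>Gaussians times polynomials\<close>

definition gauss :: "complex \<Rightarrow> complex \<Rightarrow> real^2 \<Rightarrow> complex" where
  "gauss w1 w2 x = exp (- (1/2) * ((complex_of_real (x$1))\<^sup>2 + (complex_of_real (x$2))\<^sup>2)
     + w1 * complex_of_real (x$1) + w2 * complex_of_real (x$2))"

text \<open>Polynomials times one Gaussian. The exponents \<open>w1\<close>, \<open>w2\<close> are
  parameters because derivatives and coordinates leave them alone; only rotations and exponential
  multipliers change them.\<close>

inductive GP :: "complex \<Rightarrow> complex \<Rightarrow> (real^2 \<Rightarrow> complex) \<Rightarrow> bool" for w1 w2 where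
  gauss: "GP w1 w2 (gauss w1 w2)"
| add: "GP w1 w2 f \<Longrightarrow> GP w1 w2 g \<Longrightarrow> GP w1 w2 (\<lambda>x. f x + g x)"
| scale: "GP w1 w2 f \<Longrightarrow> GP w1 w2 (\<lambda>x. c * f x)"
| coord: "GP w1 w2 f \<Longrightarrow> GP w1 w2 (xf j f)"

lemma gauss_derivative:
  "(gauss w1 w2 has_derivative (\<lambda>h. gauss w1 w2 x * ((w1 - complex_of_real (x$1)) * complex_of_real (h$1)
     + (w2 - complex_of_real (x$2)) * complex_of_real (h$2)))) (at x)"
proof -
  have D: "((\<lambda>x. - (1/2) * ((complex_of_real (x$1))\<^sup>2 + (complex_of_real (x$2))\<^sup>2)
     + w1 * complex_of_real (x$1) + w2 * complex_of_real (x$2)) has_derivative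
     (\<lambda>h. (w1 - complex_of_real (x$1)) * complex_of_real (h$1)
     + (w2 - complex_of_real (x$2)) * complex_of_real (h$2))) (at x)"
    by (rule derivative_eq_intros has_derivative_coord refl | simp add: algebra_simps)+
  show ?thesis
    unfolding gauss_def[abs_def]
    by (rule has_derivative_compose[OF D DERIV_exp[unfolded has_field_derivative_def]])
qed

lemma gauss_differentiable: "gauss w1 w2 differentiable (at x)"
  using gauss_derivative differentiable_def by blast

lemma partial_gauss:
  "partial j (gauss w1 w2) = (\<lambda>x. (if j = 1 then w1 else w2) * gauss w1 w2 x + (-1) * xf j (gauss w1 w2) x)"
proof
  fix x
  have "j = 1 \<or> j = 2" by (rule exhaust_2)
  then show "partial j (gauss w1 w2) x = (if j = 1 then w1 else w2) * gauss w1 w2 x + (-1) * xf j (gauss w1 w2) x"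
    by (subst partial_eqI[OF gauss_derivative]) (auto simp: axis_def xf_def algebra_simps)
qed

lemma GP_differentiable: "GP w1 w2 f \<Longrightarrow> f differentiable (at x)"
  by (induction rule: GP.induct) (auto simp: gauss_differentiable xf_def[abs_def] differentiable_coord)

lemma GP_partial: "GP w1 w2 f \<Longrightarrow> GP w1 w2 (partial j f)"
proof (induction rule: GP.induct)
  case gauss
  show ?case unfolding partial_gauss by (intro GP.intros)
next
  case (add f g)
  have "partial j (\<lambda>x. f x + g x) = (\<lambda>x. partial j f x + partial j g x)"
    using add by (auto simp: partial_add GP_differentiable)
  then show ?case using GP.add add by simp
next
  case (scale f c)
  have "partial j (\<lambda>x. c * f x) = (\<lambda>x. c * partial j f x)"
    using scale by (auto simp: partial_cmult GP_differentiable)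
  then show ?case using GP.scale scale by simp
next
  case (coord f i)
  have "partial j (xf i f) = (\<lambda>x. (if i = j then 1 else 0) * f x + xf i (partial j f) x)"
    using coord by (auto simp: xf_def[abs_def] partial_xmult GP_differentiable)
  then show ?case using coord by (simp only:) (intro GP.intros)
qed

lemma power_le_fact_exp: "0 \<le> t \<Longrightarrow> t ^ n \<le> fact n * exp (t::real)"
proof -
  assume t: "0 \<le> t"
  have "(\<Sum>k\<in>{n}. t ^ k /\<^sub>R fact k) \<le> exp t"
    unfolding exp_def by (rule sum_le_suminf[OF summable_exp_generic]) (use t in auto)
  then show ?thesis by (simp add: field_simps)
qed

lemma power_gauss_bounded:
  fixes a :: real
  shows "\<exists>B. \<forall>t. \<bar>t\<bar> ^ n * exp (a * t - t\<^sup>2 / 2) \<le> B"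
proof (intro exI allI)
  fix t :: real
  \<comment> \<open>The unit added to \<open>\<bar>a\<bar>\<close> absorbs the
    \<open>exp \<bar>t\<bar>\<close> that dominates the power; completing the square then bounds the
    exponent by \<open>b\<^sup>2 / 2\<close>.\<close>
  define b where "b = \<bar>a\<bar> + 1"
  have "\<bar>t\<bar> ^ n * exp (a * t - t\<^sup>2 / 2) \<le> (fact n * exp \<bar>t\<bar>) * exp (\<bar>a\<bar> * \<bar>t\<bar> - t\<^sup>2 / 2)"
    by (intro mult_mono power_le_fact_exp) (auto simp: abs_mult[symmetric])
  also have "\<dots> = fact n * exp (b * \<bar>t\<bar> - t\<^sup>2 / 2)"
    by (simp add: b_def algebra_simps flip: exp_add)
  also have "\<dots> \<le> fact n * exp (b\<^sup>2 / 2)"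
  proof -
    have "0 \<le> (b - \<bar>t\<bar>)\<^sup>2" by simp
    then have "b * \<bar>t\<bar> - t\<^sup>2 / 2 \<le> b\<^sup>2 / 2" by (simp add: power2_diff)
    then show ?thesis by (intro mult_left_mono) auto
  qed
  finally show "\<bar>t\<bar> ^ n * exp (a * t - t\<^sup>2 / 2) \<le> fact n * exp (b\<^sup>2 / 2)" .
qed

lemma cmod_gauss:
  "cmod (gauss w1 w2 x) = exp (Re w1 * x$1 - (x$1)\<^sup>2 / 2) * exp (Re w2 * x$2 - (x$2)\<^sup>2 / 2)"
  unfolding gauss_def norm_exp_eq_Re by (simp flip: exp_add of_real_power add: field_simps)

lemma gauss_bounded: "bounded (range (\<lambda>x. complex_of_real (x$1 ^ m * x$2 ^ n) * gauss w1 w2 x))"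
proof -
  obtain B1 B2 where B: "\<And>t. \<bar>t\<bar> ^ m * exp (Re w1 * t - t\<^sup>2 / 2) \<le> B1" "\<And>t. \<bar>t\<bar> ^ n * exp (Re w2 * t - t\<^sup>2 / 2) \<le> B2"
    using power_gauss_bounded by metis
  have "cmod (complex_of_real (x$1 ^ m * x$2 ^ n) * gauss w1 w2 x) \<le> B1 * B2" for x
  proof -
    have "cmod (complex_of_real (x$1 ^ m * x$2 ^ n) * gauss w1 w2 x)
      = (\<bar>x$1\<bar> ^ m * exp (Re w1 * x$1 - (x$1)\<^sup>2 / 2)) * (\<bar>x$2\<bar> ^ n * exp (Re w2 * x$2 - (x$2)\<^sup>2 / 2))"
      by (simp add: norm_mult norm_power cmod_gauss)
    also have "\<dots> \<le> B1 * B2"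
      using order_trans[OF _ B(1)[of "x$1"]] by (intro mult_mono B) auto
    finally show ?thesis .
  qed
  then show ?thesis unfolding bounded_iff by blast
qed

lemma GP_bounded: "GP w1 w2 f \<Longrightarrow> bounded (range (\<lambda>x. complex_of_real (x$1 ^ m * x$2 ^ n) * f x))"
proof (induction arbitrary: m n rule: GP.induct)
  case gauss then show ?case by (rule gauss_bounded)
next
  case (add f g) then show ?case by (simp only: distrib_left bounded_range_add)
next
  case (scale f c)
  have "(\<lambda>x. complex_of_real (x$1 ^ m * x$2 ^ n) * (c * f x)) = (\<lambda>x. c * (complex_of_real (x$1 ^ m * x$2 ^ n) * f x))"
    by (simp add: mult_ac)
  then show ?case using scale by (simp only: bounded_range_cmult)
next
  case (coord f j)
  obtain m' n' where mn: "\<And>x::real^2. x$1 ^ m' * x$2 ^ n' = x$1 ^ m * x$2 ^ n * x$j"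
  proof (cases "j = 1")
    case True then show ?thesis using that[of "Suc m" n] by (simp add: mult_ac)
  next
    case False
    then have "j = 2" using exhaust_2 by blast
    then show ?thesis using that[of m "Suc n"] by (simp add: mult_ac)
  qed
  have "(\<lambda>x. complex_of_real (x$1 ^ m * x$2 ^ n) * xf j f x) = (\<lambda>x. complex_of_real (x$1 ^ m' * x$2 ^ n') * f x)"
    unfolding mn by (simp add: xf_def mult_ac)
  then show ?case using coord by (simp only:)
qed

lemma GP_schwartz: "GP w1 w2 f \<Longrightarrow> schwartz f"
  by (rule schwartz_coinduct[where K="GP w1 w2"])
     (assumption | rule GP_differentiable GP_bounded GP_partial)+

lemma measurable_gauss [measurable]: "gauss w1 w2 \<in> borel_measurable borel"
  by (rule schwartz_measurable[OF GP_schwartz[OF GP.gauss]])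

lemma GP_pf: "GP w1 w2 f \<Longrightarrow> GP w1 w2 (pf j f)"
  unfolding pf_def[abs_def] by (intro GP.scale GP_partial)

text \<open>Explicit derivatives of the Gaussian start an induction over the generators;
  \<open>partial_commute\<close> later extends the result to all Schwartz functions by
  duality.\<close>

lemma partial_commute_GP: "GP w1 w2 f \<Longrightarrow> partial i (partial j f) = partial j (partial i f)"
proof (induction rule: GP.induct)
  case gauss
  have d: "(\<lambda>x. c * gauss w1 w2 x) differentiable (at x)" "(\<lambda>x. (-1) * xf j (gauss w1 w2) x) differentiable (at x)" for c j x
    using GP_differentiable[OF GP.scale[OF GP.gauss]] GP_differentiable[OF GP.scale[OF GP.coord[OF GP.gauss]]] by blast+
  have dx: "xf j (gauss w1 w2) differentiable (at x)" for j x
    using GP_differentiable[OF GP.coord[OF GP.gauss]] by blast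
  have px: "partial i (xf j (gauss w1 w2)) x = (if j = i then gauss w1 w2 x else 0) + complex_of_real (x$j) * partial i (gauss w1 w2) x" for i j x
    unfolding xf_def[abs_def] by (rule partial_xmult[OF gauss_differentiable])
  have "partial i (partial j (gauss w1 w2)) x = (if j = 1 then w1 else w2) * partial i (gauss w1 w2) x
      - ((if j = i then gauss w1 w2 x else 0) + complex_of_real (x$j) * partial i (gauss w1 w2) x)" for i j x
    by (subst partial_gauss) (simp only: partial_add[OF d] partial_cmult[OF gauss_differentiable] partial_cmult[OF dx] px, simp)
  then show ?case
    by (intro ext) (simp only: partial_gauss xf_def, auto simp: algebra_simps)
next
  case (add f g)
  have "partial i (\<lambda>x. f x + g x) = (\<lambda>x. partial i f x + partial i g x)" for i
    using add by (auto simp: partial_add GP_differentiable)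
  moreover have "partial i (\<lambda>x. partial j f x + partial j g x) = (\<lambda>x. partial i (partial j f) x + partial i (partial j g) x)" for i j
    using add by (intro ext partial_add GP_differentiable GP_partial)
  ultimately show ?case using add by simp
next
  case (scale f c)
  have "partial i (\<lambda>x. c * f x) = (\<lambda>x. c * partial i f x)" for i
    using scale by (auto simp: partial_cmult GP_differentiable)
  moreover have "partial i (\<lambda>x. c * partial j f x) = (\<lambda>x. c * partial i (partial j f) x)" for i j
    using scale by (intro ext partial_cmult GP_differentiable GP_partial)
  ultimately show ?case using scale by simp
next
  case (coord f k)
  have f: "GP w1 w2 f" by fact
  have 1: "partial j (xf k f) = (\<lambda>x. (if k = j then 1 else 0) * f x + xf k (partial j f) x)" for j
    using f by (auto simp: xf_def[abs_def] partial_xmult GP_differentiable)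
  have dd: "(\<lambda>x. c * f x) differentiable (at x)" "xf k (partial j f) differentiable (at x)" for c j x
    using GP_differentiable[OF GP.scale[OF f]] GP_differentiable[OF GP.coord[OF GP_partial[OF f]]] by blast+
  have "partial i (partial j (xf k f)) x = (if k = j then 1 else 0) * partial i f x
     + ((if k = i then 1 else 0) * partial j f x + complex_of_real (x$k) * partial i (partial j f) x)" for i j x
  proof -
    have "partial i (xf k (partial j f)) x = (if k = i then 1 else 0) * partial j f x + complex_of_real (x$k) * partial i (partial j f) x"
      unfolding xf_def[abs_def] by (subst partial_xmult[OF GP_differentiable[OF GP_partial[OF f]]]) simp
    then show ?thesis
      unfolding 1 by (simp only: partial_add[OF dd] partial_cmult[OF GP_differentiable[OF f]])
  qed
  then show ?case using coord by (intro ext) (simp add: add.left_commute)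
qed

section \<open>Completeness\<close>

text \<open>Positive and negative part of \<open>K\<close>, divided by their common mass, are
  probability densities whose images under \<phi> have the same characteristic function; Levy
  uniqueness makes the images equal.\<close>

lemma charfun_zero_real:
  fixes K :: "real^2 \<Rightarrow> real"
  assumes K: "integrable lborel K" and \<phi>[measurable]: "\<phi> \<in> borel_measurable borel"
    and z: "\<And>t. (\<integral>x. complex_of_real (K x) * iexp (t * \<phi> x) \<partial>lborel) = 0"
    and S: "S \<in> sets borel"
  shows "(\<integral>x. indicator S (\<phi> x) * K x \<partial>lborel) = 0"
proof -
  have Km[measurable]: "K \<in> borel_measurable borel" using K by auto
  \<comment> \<open>The value at \<open>t = 0\<close> gives both parts of \<open>K\<close> the same
    mass, so one constant \<open>c\<close> normalises both.\<close>
  have "(\<integral>x. complex_of_real (K x) \<partial>lborel) = 0" using z[of 0] by simp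
  then have K0: "(\<integral>x. K x \<partial>lborel) = 0" by simp
  define P where "P s x = max 0 (s * K x)" for s x
  have Pm[measurable]: "P s \<in> borel_measurable borel" for s unfolding P_def by measurable
  have Pi: "integrable lborel (P s)" for s unfolding P_def using K by (intro integrable_max) auto
  have Ppos: "0 \<le> P s x" for s x by (simp add: P_def)
  have KP: "K x = P 1 x - P (-1) x" for x by (simp add: P_def)
  define c where "c = (\<integral>x. P 1 x \<partial>lborel)"
  have c: "(\<integral>x. P s x \<partial>lborel) = c" if "s = 1 \<or> s = -1" for s
    using that K0 Bochner_Integration.integral_diff[OF Pi[of 1] Pi[of "-1"]] by (auto simp: KP c_def)
  have c0: "0 \<le> c" unfolding c_def by (intro Bochner_Integration.integral_nonneg) (simp add: Ppos)
  have PS: "integrable lborel (\<lambda>x. indicator S (\<phi> x) * P s x)" for s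
    by (rule Bochner_Integration.integrable_bound[OF Pi[of s]]) (use S in \<open>auto simp: indicator_def\<close>)
  have KS: "(\<integral>x. indicator S (\<phi> x) * K x \<partial>lborel) =
     (\<integral>x. indicator S (\<phi> x) * P 1 x \<partial>lborel) - (\<integral>x. indicator S (\<phi> x) * P (-1) x \<partial>lborel)"
    unfolding KP right_diff_distrib by (intro Bochner_Integration.integral_diff PS)
  show ?thesis
  proof (cases "c = 0")
    case True
    have "AE x in lborel. P s x = 0" if "s = 1 \<or> s = -1" for s
      using integral_nonneg_eq_0_iff_AE[OF Pi[of s]] c[OF that] True Ppos by simp
    from this[of 1] this[of "-1"] have "AE x in lborel. P 1 x = 0" "AE x in lborel. P (-1) x = 0" by auto
    then have "AE x in lborel. indicator S (\<phi> x) * K x = 0"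
      by eventually_elim (simp add: KP)
    then show ?thesis by (intro integral_eq_zero_AE)
  next
    case False
    define M where "M s = distr (density lborel (\<lambda>x. ennreal (P s x / c))) borel \<phi>" for s
    have rd: "real_distribution (M s)" if "s = 1 \<or> s = -1" for s
    proof -
      have "emeasure (density lborel (\<lambda>x. ennreal (P s x / c))) (space lborel) = (\<integral>\<^sup>+x. ennreal (P s x / c) \<partial>lborel)"
        by (simp add: emeasure_density)
      also have "\<dots> = ennreal (\<integral>x. P s x / c \<partial>lborel)"
        using Pi c0 Ppos by (intro nn_integral_eq_integral) auto
      also have "\<dots> = 1" using c[OF that] False by simp
      finally have "prob_space (density lborel (\<lambda>x. ennreal (P s x / c)))" by (intro prob_spaceI) simp
      then have "prob_space (M s)" unfolding M_def by (intro prob_space.prob_space_distr) auto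
      then show ?thesis by (simp add: real_distribution_def real_distribution_axioms_def M_def)
    qed
    have ch: "char (M s) t = (\<integral>x. complex_of_real (P s x) * iexp (t * \<phi> x) \<partial>lborel) / c" if "s = 1 \<or> s = -1" for s t
    proof -
      have "char (M s) t = (\<integral>x. iexp (t * \<phi> x) \<partial>density lborel (\<lambda>x. ennreal (P s x / c)))"
        unfolding char_def M_def by (subst integral_distr) auto
      also have "\<dots> = (\<integral>x. (P s x / c) *\<^sub>R iexp (t * \<phi> x) \<partial>lborel)"
        using Ppos c0 by (subst integral_density) auto
      also have "\<dots> = (\<integral>x. (complex_of_real (P s x) * iexp (t * \<phi> x)) / c \<partial>lborel)"
        by (simp add: scaleR_conv_of_real)
      finally show ?thesis by simp
    qed
    have Pe: "integrable lborel (\<lambda>x. complex_of_real (P s x) * iexp (t * \<phi> x))" for s t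
      by (rule Bochner_Integration.integrable_bound[OF Pi[of s]]) (auto simp: norm_mult)
    have "char (M 1) t = char (M (-1)) t" for t
    proof -
      have "(\<integral>x. complex_of_real (P 1 x) * iexp (t * \<phi> x) \<partial>lborel) - (\<integral>x. complex_of_real (P (-1) x) * iexp (t * \<phi> x) \<partial>lborel) = 0"
        using z[of t] unfolding KP of_real_diff left_diff_distrib
        by (subst (asm) Bochner_Integration.integral_diff[OF Pe Pe])
      then show ?thesis by (simp add: ch)
    qed
    then have M: "M 1 = M (-1)" by (intro Levy_uniqueness rd) auto
    have em: "emeasure (M s) S = ennreal (\<integral>x. indicator S (\<phi> x) * P s x / c \<partial>lborel)" for s
    proof -
      have "emeasure (M s) S = (\<integral>\<^sup>+x. ennreal (P s x / c) * indicator (\<phi> -` S) x \<partial>lborel)"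
        unfolding M_def using S measurable_sets_borel[OF \<phi> S] by (simp add: emeasure_distr emeasure_density)
      also have "\<dots> = (\<integral>\<^sup>+x. ennreal (indicator S (\<phi> x) * P s x / c) \<partial>lborel)"
        by (intro nn_integral_cong) (auto simp: indicator_def)
      also have "\<dots> = ennreal (\<integral>x. indicator S (\<phi> x) * P s x / c \<partial>lborel)"
        using PS c0 Ppos by (intro nn_integral_eq_integral) auto
      finally show ?thesis .
    qed
    have "0 \<le> (\<integral>x. indicator S (\<phi> x) * P s x / c \<partial>lborel)" for s
      using c0 Ppos by (intro Bochner_Integration.integral_nonneg) auto
    then have "(\<integral>x. indicator S (\<phi> x) * P 1 x / c \<partial>lborel) = (\<integral>x. indicator S (\<phi> x) * P (-1) x / c \<partial>lborel)"
      using em[of 1] em[of "-1"] unfolding M by auto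
    then show ?thesis using KS False by simp
  qed
qed

text \<open>Conjugation together with \<open>t\<close> replaced by \<open>- t\<close> shows that
  \<open>cnj (K x)\<close> satisfies the same hypothesis; hence so do the real and the imaginary
  part.\<close>

lemma charfun_zero:
  fixes K :: "real^2 \<Rightarrow> complex"
  assumes K: "integrable lborel K" and \<phi>[measurable]: "\<phi> \<in> borel_measurable borel"
    and z: "\<And>t. (\<integral>x. K x * iexp (t * \<phi> x) \<partial>lborel) = 0"
    and S: "S \<in> sets borel"
  shows "(\<integral>x. indicator S (\<phi> x) * K x \<partial>lborel) = 0"
proof -
  have Km[measurable]: "K \<in> borel_measurable borel" using K by auto
  have Kc: "integrable lborel (\<lambda>x. cnj (K x))" using K by simp
  have i: "integrable lborel (\<lambda>x. L x * iexp (t * \<phi> x))" if "integrable lborel L" for L :: "real^2 \<Rightarrow> complex" and t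
    by (rule Bochner_Integration.integrable_bound[OF that]) (use that in \<open>auto simp: norm_mult\<close>)
  have zc: "(\<integral>x. cnj (K x) * iexp (t * \<phi> x) \<partial>lborel) = 0" for t
  proof -
    have "cnj (\<integral>x. K x * iexp ((- t) * \<phi> x) \<partial>lborel) = (\<integral>x. cnj (K x * iexp ((- t) * \<phi> x)) \<partial>lborel)"
      by (simp only: Bochner_Integration.integral_cnj)
    also have "\<dots> = (\<integral>x. cnj (K x) * iexp (t * \<phi> x) \<partial>lborel)" by (simp add: exp_cnj)
    finally show ?thesis using z[of "- t"] by simp
  qed
  have "(\<integral>x. complex_of_real (Re (K x)) * iexp (t * \<phi> x) \<partial>lborel) = 0" for t
  proof -
    have "(\<integral>x. complex_of_real (Re (K x)) * iexp (t * \<phi> x) \<partial>lborel) =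
      (\<integral>x. (1/2) * (K x * iexp (t * \<phi> x) + cnj (K x) * iexp (t * \<phi> x)) \<partial>lborel)"
      by (intro Bochner_Integration.integral_cong refl) (simp add: distrib_right[symmetric] complex_add_cnj)
    also have "\<dots> = 0" using i[OF K, of t] i[OF Kc, of t] z[of t] zc[of t] by simp
    finally show ?thesis .
  qed
  then have re: "(\<integral>x. indicator S (\<phi> x) * Re (K x) \<partial>lborel) = 0"
    using K by (intro charfun_zero_real S \<phi>) auto
  have "(\<integral>x. complex_of_real (Im (K x)) * iexp (t * \<phi> x) \<partial>lborel) = 0" for t
  proof -
    have "(\<integral>x. complex_of_real (Im (K x)) * iexp (t * \<phi> x) \<partial>lborel) =
      (\<integral>x. (1/(2*\<i>)) * (K x * iexp (t * \<phi> x) - cnj (K x) * iexp (t * \<phi> x)) \<partial>lborel)"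
      by (intro Bochner_Integration.integral_cong refl) (simp add: left_diff_distrib[symmetric] complex_diff_cnj, simp add: mult_ac)
    also have "\<dots> = 0" using i[OF K, of t] i[OF Kc, of t] z[of t] zc[of t] by simp
    finally show ?thesis .
  qed
  then have im: "(\<integral>x. indicator S (\<phi> x) * Im (K x) \<partial>lborel) = 0"
    using K by (intro charfun_zero_real S \<phi>) auto
  have int: "integrable lborel (\<lambda>x. indicator S (\<phi> x) * K x)"
    by (rule Bochner_Integration.integrable_bound[OF K]) (use S in \<open>auto simp: indicator_def\<close>)
  show ?thesis
  proof (rule complex_eqI)
    show "Re (\<integral>x. indicator S (\<phi> x) * K x \<partial>lborel) = Re 0"
    proof -
      have "(\<integral>x. Re (indicator S (\<phi> x) * K x) \<partial>lborel) = (\<integral>x. indicator S (\<phi> x) * Re (K x) \<partial>lborel)"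
        by (intro Bochner_Integration.integral_cong) (auto simp: indicator_def)
      then show ?thesis using re integral_Re[OF int] by simp
    qed
    show "Im (\<integral>x. indicator S (\<phi> x) * K x \<partial>lborel) = Im 0"
    proof -
      have "(\<integral>x. Im (indicator S (\<phi> x) * K x) \<partial>lborel) = (\<integral>x. indicator S (\<phi> x) * Im (K x) \<partial>lborel)"
        by (intro Bochner_Integration.integral_cong) (auto simp: indicator_def)
      then show ?thesis using im integral_Im[OF int] by simp
    qed
  qed
qed

text \<open>\<open>charfun_zero\<close> is applied one coordinate at a time: with
  \<open>iexp (t * x$2)\<close> kept in the integrand it localises \<open>x$1\<close>, then it
  localises \<open>x$2\<close>. So \<open>K\<close> integrates to zero over every box, hence over
  every Borel set.\<close>

lemma Fourier_injective:
  fixes K :: "real^2 \<Rightarrow> complex"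
  assumes K: "integrable lborel K"
    and z: "\<And>s t. (\<integral>x. K x * iexp (s * x$1 + t * x$2) \<partial>lborel) = 0"
  shows "AE x in lborel. K x = 0"
proof -
  have Km[measurable]: "K \<in> borel_measurable borel" using K by auto
  have 1: "(\<integral>x. indicator S (x$1) * (K x * iexp (t * x$2)) \<partial>lborel) = 0" if "S \<in> sets borel" for S t
  proof (rule charfun_zero[OF _ _ _ that])
    show "integrable lborel (\<lambda>x. K x * iexp (t * x$2))"
      by (rule Bochner_Integration.integrable_bound[OF K]) (auto simp: norm_mult)
    show "(\<integral>x. K x * iexp (t * x$2) * iexp (s * x$1) \<partial>lborel) = 0" for s
      using z[of s t] by (simp add: exp_add distrib_left mult_ac)
  qed auto
  have 2: "(\<integral>x. indicator S' (x$2) * (indicator S (x$1) * K x) \<partial>lborel) = 0"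
    if [measurable]: "S \<in> sets borel" "S' \<in> sets borel" for S S'
  proof (rule charfun_zero[OF _ _ _ that(2)])
    show "integrable lborel (\<lambda>x. indicator S (x$1) * K x)"
      by (rule Bochner_Integration.integrable_bound[OF K]) (auto simp: indicator_def)
    show "(\<integral>x. indicator S (x$1) * K x * iexp (t * x$2) \<partial>lborel) = 0" for t
      using 1[OF that(1), of t] by (simp add: mult_ac)
  qed auto
  have K0: "(\<integral>x. K x \<partial>lborel) = 0" using z[of 0 0] by simp
  have Ki: "set_integrable lborel A K" if "A \<in> sets borel" for A
    unfolding set_integrable_def using that K by (intro integrable_mult_indicator) auto
  have B: "(Basis :: (real^2) set) = {axis 1 1, axis 2 1}"
    by (auto simp: Basis_vec_def UNIV_2)
  have "(LINT x:A|lborel. K x) = 0" if A: "A \<in> sets lborel" for A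
  proof -
    have "Int_stable (range (\<lambda>(a, b). box a b :: (real^2) set))"
      unfolding Int_stable_def by (auto simp: box_Int_box)
    moreover have "range (\<lambda>(a, b). box a b :: (real^2) set) \<subseteq> Pow UNIV" by simp
    moreover have "A \<in> sigma_sets UNIV (range (\<lambda>(a, b). box a b :: (real^2) set))"
      using A by (simp add: borel_eq_box)
    ultimately show ?thesis
    proof (induction rule: sigma_sets_induct_disjoint)
      case (basic A)
      then obtain a b where ab: "A = box a b" by auto
      have "indicator A x *\<^sub>R K x = indicator {a$2<..<b$2} (x$2) * (indicator {a$1<..<b$1} (x$1) * K x)" for x
        by (auto simp: ab indicator_def mem_box B inner_axis)
      then show ?case unfolding set_lebesgue_integral_def by (simp add: 2)
    next
      case (compl A)
      have A: "A \<in> sets lborel" using compl(1) by (simp add: borel_eq_box)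
      have "(LINT x:(UNIV - A) \<union> A|lborel. K x) = (LINT x:(UNIV - A)|lborel. K x) + (LINT x:A|lborel. K x)"
        using A by (intro set_integral_Un Ki) auto
      moreover have "(LINT x:(UNIV - A) \<union> A|lborel. K x) = 0" using K0 by (simp add: set_lebesgue_integral_def)
      ultimately show ?case using compl by simp
    next
      case (union A)
      have A: "A i \<in> sets lborel" for i using union(2) by (auto simp: borel_eq_box)
      have "(LINT x:(\<Union>i. A i)|lborel. K x) = (\<Sum>i. (LINT x:(A i)|lborel. K x))"
        using A union(1) by (intro lebesgue_integral_countable_add Ki) (auto simp: disjoint_family_on_def)
      then show ?case using union(3) by simp
    qed (auto simp: set_lebesgue_integral_def)
  qed
  then show ?thesis using sigma_finite_measure.density_zero[OF sigma_finite_lborel K] by blast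
qed

lemma GP_polynomial:
  "GP w1 w2 f \<Longrightarrow> GP w1 w2 (\<lambda>x. (complex_of_real (s * x$1 + t * x$2)) ^ n * f x)"
proof (induction n)
  case (Suc n)
  then have g: "GP w1 w2 (\<lambda>x. (complex_of_real (s * x$1 + t * x$2)) ^ n * f x)" (is "GP w1 w2 ?g") by simp
  have "(\<lambda>x. (complex_of_real (s * x$1 + t * x$2)) ^ Suc n * f x) =
    (\<lambda>x. complex_of_real s * xf 1 ?g x + complex_of_real t * xf 2 ?g x)"
    by (auto simp: xf_def algebra_simps)
  then show ?case using g by (simp only:) (intro GP.intros)
qed simp

lemma GP_sum: "finite I \<Longrightarrow> (\<And>i. i \<in> I \<Longrightarrow> GP w1 w2 (f i)) \<Longrightarrow> GP w1 w2 (\<lambda>x. \<Sum>i\<in>I. f i x)"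
proof (induction I rule: finite_induct)
  case empty
  show ?case using GP.scale[OF GP.gauss, of w1 w2 0] by simp
qed (auto intro: GP.add)

text \<open>Partial sums of the exponential series of \<open>iexp (s * x$1 + t * x$2)\<close> times
  the Gaussian lie in \<open>GP\<close>, and \<open>int\<close> with
  \<open>c = \<bar>s\<bar> + \<bar>t\<bar>\<close> dominates them. In the limit the Fourier
  transform of \<open>G x * gauss 0 0 x\<close> vanishes.\<close>

lemma GP_total:
  fixes G :: "real^2 \<Rightarrow> complex"
  assumes G[measurable]: "G \<in> borel_measurable borel"
    and int: "\<And>c. integrable lborel (\<lambda>x. G x * gauss 0 0 x * exp (c * (\<bar>x$1\<bar> + \<bar>x$2\<bar>)))"
    and orth: "\<And>h. GP 0 0 h \<Longrightarrow> (\<integral>x. G x * h x \<partial>lborel) = 0"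
  shows "AE x in lborel. G x = 0"
proof -
  have i0: "integrable lborel (\<lambda>x. G x * gauss 0 0 x)" using int[of 0] by simp
  have "(\<integral>x. G x * gauss 0 0 x * iexp (s * x$1 + t * x$2) \<partial>lborel) = 0" for s t
  proof -
    define u where "u x = complex_of_real (s * x$1 + t * x$2)" for x :: "real^2"
    have um[measurable]: "u \<in> borel_measurable borel" unfolding u_def by measurable
    define S where "S N x = (\<Sum>n<N. (\<i> * u x) ^ n /\<^sub>R fact n)" for N x
    have Sm[measurable]: "S N \<in> borel_measurable borel" for N unfolding S_def by measurable
    have GPS: "GP 0 0 (\<lambda>x. S N x * gauss 0 0 x)" for N
    proof -
      have "(\<lambda>x. S N x * gauss 0 0 x) = (\<lambda>x. \<Sum>n<N. (\<i> ^ n / fact n) * ((u x) ^ n * gauss 0 0 x))"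
        unfolding S_def sum_distrib_right
        by (intro ext sum.cong) (auto simp: power_mult_distrib scaleR_conv_of_real divide_inverse)
      then show ?thesis
        unfolding u_def by (simp only:) (intro GP_sum GP.scale GP_polynomial GP.gauss finite_lessThan)
    qed
    have zero: "(\<integral>x. G x * gauss 0 0 x * S N x \<partial>lborel) = 0" for N
      using orth[OF GPS[of N]] by (simp add: mult_ac)
    have "(\<lambda>N. \<integral>x. G x * gauss 0 0 x * S N x \<partial>lborel) \<longlonglongrightarrow> (\<integral>x. G x * gauss 0 0 x * exp (\<i> * u x) \<partial>lborel)"
    proof (rule integral_dominated_convergence[where
          w="\<lambda>x. cmod (G x * gauss 0 0 x * exp ((\<bar>s\<bar> + \<bar>t\<bar>) * (\<bar>x$1\<bar> + \<bar>x$2\<bar>)))"])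
      show "integrable lborel (\<lambda>x. cmod (G x * gauss 0 0 x * exp ((\<bar>s\<bar> + \<bar>t\<bar>) * (\<bar>x$1\<bar> + \<bar>x$2\<bar>))))"
        using int[of "\<bar>s\<bar> + \<bar>t\<bar>"] by (intro integrable_norm) simp
      have "(\<lambda>N. S N x) \<longlonglongrightarrow> exp (\<i> * u x)" for x
        using exp_converges[of "\<i> * u x"] by (simp add: sums_def S_def)
      then show "AE x in lborel. (\<lambda>N. G x * gauss 0 0 x * S N x) \<longlonglongrightarrow> G x * gauss 0 0 x * exp (\<i> * u x)"
        by (intro always_eventually allI tendsto_intros)
      show "AE x in lborel. norm (G x * gauss 0 0 x * S N x) \<le>
        cmod (G x * gauss 0 0 x * exp ((\<bar>s\<bar> + \<bar>t\<bar>) * (\<bar>x$1\<bar> + \<bar>x$2\<bar>)))" for N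
      proof (intro always_eventually allI)
        fix x
        have "norm (S N x) \<le> (\<Sum>n<N. cmod (u x) ^ n /\<^sub>R fact n)"
          unfolding S_def by (intro sum_norm_le) (simp add: norm_mult norm_power)
        also have "\<dots> \<le> exp (cmod (u x))"
          unfolding exp_def by (rule sum_le_suminf[OF summable_exp_generic]) auto
        also have "cmod (u x) \<le> (\<bar>s\<bar> + \<bar>t\<bar>) * (\<bar>x$1\<bar> + \<bar>x$2\<bar>)"
        proof -
          have "cmod (u x) \<le> \<bar>s\<bar> * \<bar>x$1\<bar> + \<bar>t\<bar> * \<bar>x$2\<bar>"
            unfolding u_def norm_of_real using abs_triangle_ineq[of "s * x$1" "t * x$2"] by (simp add: abs_mult)
          also have "\<dots> \<le> (\<bar>s\<bar> + \<bar>t\<bar>) * (\<bar>x$1\<bar> + \<bar>x$2\<bar>)" by (simp add: algebra_simps)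
          finally show ?thesis .
        qed
        finally show "norm (G x * gauss 0 0 x * S N x) \<le>
            cmod (G x * gauss 0 0 x * exp ((\<bar>s\<bar> + \<bar>t\<bar>) * (\<bar>x$1\<bar> + \<bar>x$2\<bar>)))"
          by (simp add: norm_mult mult_left_mono)
      qed
    qed measurable
    then show ?thesis unfolding zero by (simp add: LIMSEQ_const_iff u_def)
  qed
  then have "AE x in lborel. G x * gauss 0 0 x = 0" by (intro Fourier_injective i0)
  then show ?thesis by (auto simp: gauss_def)
qed

text \<open>Exponential growth is what the multipliers \<open>exp (r (x1 + x2))\<close> and the coordinates have in
  common; it is harmless against a Gaussian.\<close>

definition exp_growth :: "(real^2 \<Rightarrow> real) \<Rightarrow> bool" where
  "exp_growth u \<longleftrightarrow> u \<in> borel_measurable borel \<and> (\<exists>K. \<forall>x. \<bar>u x\<bar> \<le> K * exp (K * (\<bar>x$1\<bar> + \<bar>x$2\<bar>)))"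

lemma exp_gauss_square_integrable:
  "square_integrable (\<lambda>x. gauss 0 0 x * complex_of_real (exp (c * (\<bar>x$1\<bar> + \<bar>x$2\<bar>))))"
proof -
  obtain B where B: "\<And>t. \<bar>t\<bar> ^ 0 * exp (\<bar>c\<bar> * t - t\<^sup>2 / 2) \<le> B" using power_gauss_bounded[of 0 "\<bar>c\<bar>"] by blast
  obtain B2 where B2: "\<And>t. \<bar>t\<bar> ^ 2 * exp (\<bar>c\<bar> * t - t\<^sup>2 / 2) \<le> B2" using power_gauss_bounded[of 2 "\<bar>c\<bar>"] by blast
  have one: "exp (c * \<bar>t\<bar> - t\<^sup>2 / 2) \<le> (B + B2) / (1 + t\<^sup>2)" for t :: real
  proof -
    have "exp (c * \<bar>t\<bar> - t\<^sup>2 / 2) \<le> exp (\<bar>c\<bar> * \<bar>t\<bar> - \<bar>t\<bar>\<^sup>2 / 2)"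
      by (simp add: mult_right_mono)
    moreover have "(1 + t\<^sup>2) * exp (\<bar>c\<bar> * \<bar>t\<bar> - \<bar>t\<bar>\<^sup>2 / 2) \<le> B + B2"
      using B[of "\<bar>t\<bar>"] B2[of "\<bar>t\<bar>"] by (simp add: distrib_right)
    ultimately have "(1 + t\<^sup>2) * exp (c * \<bar>t\<bar> - t\<^sup>2 / 2) \<le> B + B2"
      by (meson mult_left_mono order_trans less_imp_le one_plus_square_pos)
    then show ?thesis by (simp add: pos_le_divide_eq one_plus_square_pos mult.commute)
  qed
  show ?thesis
  proof (rule square_integrable_if_decay[where C="(B + B2)\<^sup>2"])
    fix x :: "real^2"
    have "cmod (gauss 0 0 x * complex_of_real (exp (c * (\<bar>x$1\<bar> + \<bar>x$2\<bar>)))) =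
      exp (c * \<bar>x$1\<bar> - (x$1)\<^sup>2 / 2) * exp (c * \<bar>x$2\<bar> - (x$2)\<^sup>2 / 2)"
      by (simp add: norm_mult cmod_gauss distrib_left flip: exp_add del: of_real_exp)
    also have "\<dots> \<le> ((B + B2) / (1 + (x$1)\<^sup>2)) * ((B + B2) / (1 + (x$2)\<^sup>2))"
      by (intro mult_mono one) (auto intro: order_trans[OF _ one[of "x$1"]])
    also have "\<dots> = (B + B2)\<^sup>2 * decay x" by (simp add: decay_def power2_eq_square)
    finally show "cmod (gauss 0 0 x * complex_of_real (exp (c * (\<bar>x$1\<bar> + \<bar>x$2\<bar>)))) \<le> (B + B2)\<^sup>2 * decay x" .
  qed measurable
qed

text \<open>Provides the integrability hypothesis of \<open>GP_total\<close>: the growth rate of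
  \<open>u\<close> is merely added to \<open>c\<close>, and the Gaussian tolerates every
  rate.\<close>

lemma exp_growth_integrable:
  assumes f: "square_integrable f" and u: "exp_growth u"
  shows "integrable lborel (\<lambda>x. (cnj (f x) * complex_of_real (u x)) * gauss 0 0 x * exp (c * (\<bar>x$1\<bar> + \<bar>x$2\<bar>)))"
proof -
  obtain K where K: "\<And>x. \<bar>u x\<bar> \<le> K * exp (K * (\<bar>x$1\<bar> + \<bar>x$2\<bar>))" using u by (auto simp: exp_growth_def)
  have [measurable]: "u \<in> borel_measurable borel" "f \<in> borel_measurable borel"
    using f u by (auto simp: exp_growth_def square_integrable_def)
  have "integrable lborel (\<lambda>x. cnj (f x) * (K * (gauss 0 0 x * complex_of_real (exp ((K + c) * (\<bar>x$1\<bar> + \<bar>x$2\<bar>))))))"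
    by (intro integrable_cnj_mult f square_integrable_cmult exp_gauss_square_integrable)
  then show ?thesis
  proof (rule Bochner_Integration.integrable_bound)
    show "AE x in lborel. norm ((cnj (f x) * complex_of_real (u x)) * gauss 0 0 x * exp (c * (\<bar>x$1\<bar> + \<bar>x$2\<bar>)))
      \<le> norm (cnj (f x) * (K * (gauss 0 0 x * complex_of_real (exp ((K + c) * (\<bar>x$1\<bar> + \<bar>x$2\<bar>))))))"
    proof (intro always_eventually allI)
      fix x :: "real^2"
      define a where "a = \<bar>x$1\<bar> + \<bar>x$2\<bar>"
      have "\<bar>u x\<bar> * exp (c * a) \<le> (\<bar>K\<bar> * exp (K * a)) * exp (c * a)"
        using K[of x] unfolding a_def[symmetric]
        by (intro mult_right_mono) (auto intro: order_trans mult_right_mono)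
      also have "\<dots> = \<bar>K\<bar> * exp ((K + c) * a)" by (simp add: distrib_right exp_add)
      finally have "(cmod (f x) * cmod (gauss 0 0 x)) * (\<bar>u x\<bar> * exp (c * a)) \<le>
        (cmod (f x) * cmod (gauss 0 0 x)) * (\<bar>K\<bar> * exp ((K + c) * a))"
        by (intro mult_left_mono) auto
      then show "norm ((cnj (f x) * complex_of_real (u x)) * gauss 0 0 x * exp (c * (\<bar>x$1\<bar> + \<bar>x$2\<bar>)))
      \<le> norm (cnj (f x) * (K * (gauss 0 0 x * complex_of_real (exp ((K + c) * (\<bar>x$1\<bar> + \<bar>x$2\<bar>))))))"
        unfolding a_def[symmetric] norm_mult complex_mod_cnj norm_of_real abs_exp_cancel
        by (simp only: mult_ac)
    qed
  qed measurable
qed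

section \<open>First-order operators on the Schwartz space\<close>

lemma exp_growth_one: "exp_growth (\<lambda>x. 1)"
  unfolding exp_growth_def by (auto intro!: exI[of _ 1])

lemma l2_eq_0_if_orthogonal_GP:
  assumes "\<And>h. GP 0 0 h \<Longrightarrow> cinner (l2_of h) F = 0"
  shows "F = 0"
proof -
  obtain f where f: "square_integrable f" "F = l2_of f" by (rule l2_cases)
  have fm[measurable]: "f \<in> borel_measurable borel" using f by (simp add: square_integrable_def)
  have "AE x in lborel. cnj (f x) = 0"
  proof (rule GP_total)
    show "integrable lborel (\<lambda>x. cnj (f x) * gauss 0 0 x * exp (c * (\<bar>x$1\<bar> + \<bar>x$2\<bar>)))" for c
      using exp_growth_integrable[OF f(1) exp_growth_one] by simp
    show "(\<integral>x. cnj (f x) * h x \<partial>lborel) = 0" if "GP 0 0 h" for h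
    proof -
      have "cinner F (l2_of h) = 0" using assms[OF that] by (subst cinner_commute) simp
      then show ?thesis using f by (simp add: cinner_l2_of schwartz_square_integrable GP_schwartz[OF that])
    qed
  qed measurable
  then have "AE x in lborel. f x = 0" by eventually_elim simp
  then show ?thesis unfolding f(2) l2_of_zero by (subst l2_of_eq_iff) (auto simp: f square_integrable_zero)
qed

lemma l2_eqI_GP:
  assumes "\<And>h. GP 0 0 h \<Longrightarrow> cinner (l2_of h) F = cinner (l2_of h) G"
  shows "F = G"
  using l2_eq_0_if_orthogonal_GP[of "F - G"] assms by (simp add: cinner_diff_right)

lemma csubspace_GP: "csubspace {l2_of h | h. GP 0 0 h}"
  unfolding csubspace_def
proof (intro conjI ballI allI)
  have "0 = l2_of (\<lambda>x. 0 * gauss 0 0 x)" by (simp add: l2_of_zero)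
  then show "0 \<in> {l2_of h | h. GP 0 0 h}" using GP.scale[OF GP.gauss] by blast
next
  fix F G assume "F \<in> {l2_of h | h. GP 0 0 h}" "G \<in> {l2_of h | h. GP 0 0 h}"
  then obtain f g where "GP 0 0 f" "F = l2_of f" "GP 0 0 g" "G = l2_of g" by blast
  moreover from this have "F + G = l2_of (\<lambda>x. f x + g x)"
    by (simp add: l2_of_add schwartz_square_integrable[OF GP_schwartz])
  ultimately show "F + G \<in> {l2_of h | h. GP 0 0 h}" using GP.add by blast
next
  fix F c assume "F \<in> {l2_of h | h. GP 0 0 h}"
  then obtain f where "GP 0 0 f" "F = l2_of f" by blast
  moreover from this have "c *\<^sub>C F = l2_of (\<lambda>x. c * f x)"
    by (simp add: l2_of_scale schwartz_square_integrable[OF GP_schwartz])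
  ultimately show "c *\<^sub>C F \<in> {l2_of h | h. GP 0 0 h}" using GP.scale by blast
qed

lemma dense_GP: "closure {l2_of h | h. GP 0 0 h} = UNIV"
  by (rule csubspace_dense_if_orthogonal_trivial[OF csubspace_GP]) (blast intro: l2_eq_0_if_orthogonal_GP)

lemma l2_of_GP_in_S: "GP w1 w2 h \<Longrightarrow> l2_of h \<in> \<S>"
  by (auto simp: \<S>_def GP_schwartz)

text \<open>The adjoint relation tested on \<open>GP 0 0\<close> alone already determines the image,
  because that class is total; so on \<open>\<S>\<close> the adjoint is no larger than the formal
  one.\<close>

lemma dagger_sop:
  assumes "adjoint_pair L M"
  shows "dagger (sop L) = sop M"
proof (intro set_eqI iffI; clarify)
  fix F G assume "(F, G) \<in> dagger (sop L)"
  then have FS: "F \<in> \<S>" and adj: "\<And>u v. (u, v) \<in> sop L \<Longrightarrow> cinner F v = cinner G u"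
    by (auto simp: dagger_def op_restrict_def adj_def)
  obtain f where f: "schwartz f" "F = l2_of f" using FS by (auto simp: \<S>_def)
  have "G = l2_of (M f)"
  proof (rule l2_eqI_GP)
    fix h assume h: "GP 0 0 h"
    then have hs: "schwartz h" by (rule GP_schwartz)
    have "cinner F (l2_of (L h)) = cinner G (l2_of h)" using hs by (intro adj) (simp add: sop_iff)
    moreover have "cinner F (l2_of (L h)) = cinner (l2_of (M f)) (l2_of h)"
      using assms f hs by (simp add: adjoint_pair_def)
    ultimately show "cinner (l2_of h) G = cinner (l2_of h) (l2_of (M f))" by (metis cinner_commute)
  qed
  then show "(F, G) \<in> sop M" using f by (simp add: sop_iff)
next
  fix F G assume "(F, G) \<in> sop M"
  then obtain f where f: "schwartz f" "F = l2_of f" "G = l2_of (M f)" by (rule sopE)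
  then show "(F, G) \<in> dagger (sop L)"
    using assms by (auto simp: dagger_def op_restrict_def adj_def \<S>_def adjoint_pair_def elim!: sopE)
qed

text \<open>Two integrations by parts move both derivatives onto a test function in
  \<open>GP\<close>, where their order is known not to matter.\<close>

lemma partial_commute:
  assumes f: "schwartz f" shows "partial i (partial j f) = partial j (partial i f)"
proof -
  have sp: "schwartz (partial i (partial j f))" for i j by (intro schwartz_partial f)
  have by2: "(\<integral>x. cnj (h x) * partial i (partial j f) x \<partial>lborel) = (\<integral>x. cnj (partial j (partial i h) x) * f x \<partial>lborel)"
    if "schwartz h" for h i j
    using integral_by_parts[OF that schwartz_partial[OF f], of i j]
      integral_by_parts[OF schwartz_partial[OF that] f, of i j] by simp
  have "l2_of (partial i (partial j f)) = l2_of (partial j (partial i f))"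
  proof (rule l2_eqI_GP)
    fix h assume h: "GP 0 0 h"
    show "cinner (l2_of h) (l2_of (partial i (partial j f))) = cinner (l2_of h) (l2_of (partial j (partial i f)))"
      by (simp add: cinner_schwartz GP_schwartz[OF h] sp by2 partial_commute_GP[OF h, of i j])
  qed
  then show ?thesis by (simp add: l2_of_schwartz_inj sp)
qed

lemma pf_add: "schwartz f \<Longrightarrow> schwartz g \<Longrightarrow> pf j (\<lambda>x. f x + g x) = (\<lambda>x. pf j f x + pf j g x)"
  by (auto simp: pf_def partial_add schwartz_differentiable algebra_simps)

lemma pf_scale: "schwartz f \<Longrightarrow> pf j (\<lambda>x. c * f x) = (\<lambda>x. c * pf j f x)"
  by (auto simp: pf_def partial_cmult schwartz_differentiable)

lemma pf_xf: "schwartz f \<Longrightarrow> pf i (xf j f) = (\<lambda>x. xf j (pf i f) x + (if i = j then - \<i> else 0) * f x)"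
  unfolding pf_def xf_def[abs_def]
  by (rule ext) (subst partial_xmult, auto simp: schwartz_differentiable algebra_simps)

lemma pf_pf: "schwartz f \<Longrightarrow> pf i (pf j f) = pf j (pf i f)"
proof -
  assume f: "schwartz f"
  have "pf i (pf j f) x = - \<i> * (- \<i> * partial i (partial j f) x)" for i j x
    unfolding pf_def[abs_def]
    by (subst partial_cmult) (simp_all only: schwartz_differentiable[OF schwartz_partial[OF f]])
  then show ?thesis using partial_commute[OF f, of i j] by (intro ext) simp
qed

text \<open>Positions, momenta, ladder operators, their adjoints and their conjugates under T all
  have this form, and two such operators commute up to a scalar.\<close>

definition lin :: "complex \<Rightarrow> complex \<Rightarrow> complex \<Rightarrow> 2 \<Rightarrow> (real^2 \<Rightarrow> complex) \<Rightarrow> real^2 \<Rightarrow> complex" where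
  "lin a b c j f x = a * xf j f x + b * pf j f x + c * f x"

lemma schwartz_map_lin: "schwartz_map (lin a b c j)"
  unfolding lin_def[abs_def] by (intro schwartz_map_intros)

lemmas schwartz_lin = schwartz_mapD[OF schwartz_map_lin]
lemmas schwartz_xf = schwartz_mapD[OF schwartz_map_xf]
lemmas schwartz_pf = schwartz_mapD[OF schwartz_map_pf]

lemma adjoint_pair_lin: "adjoint_pair (lin a b c j) (lin (cnj a) (cnj b) (cnj c) j)"
  unfolding lin_def[abs_def]
  by (intro adjoint_pair_add_scalar adjoint_pair_add adjoint_pair_scale adjoint_pair_xf adjoint_pair_pf)

lemma pf_lin:
  assumes "schwartz f"
  shows "pf k (lin a b c j f) = (\<lambda>x. a * pf k (xf j f) x + b * pf k (pf j f) x + c * pf k f x)"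
  unfolding lin_def[abs_def]
  using assms by (simp add: pf_add pf_scale schwartz_add schwartz_cmult schwartz_xf schwartz_pf)

text \<open>Only position and momentum of the same mode fail to commute, so a determinant of their
  coefficients is all that remains.\<close>

lemma lin_commute:
  assumes "schwartz f"
  shows "lin a b c j (lin a' b' c' k f) x =
     lin a' b' c' k (lin a b c j f) x + (if j = k then \<i> * (a * b' - b * a') else 0) * f x"
proof -
  have "pf j (pf k f) = pf k (pf j f)" by (rule pf_pf[OF assms])
  then show ?thesis
    unfolding lin_def[of a b c j "lin a' b' c' k f"] lin_def[of a' b' c' k "lin a b c j f"]
      pf_lin[OF assms] pf_xf[OF assms]
    by (simp add: lin_def xf_def algebra_simps)
qed

lemma lin_add: "schwartz f \<Longrightarrow> schwartz g \<Longrightarrow> lin a b c j (\<lambda>x. f x + g x) = (\<lambda>x. lin a b c j f x + lin a b c j g x)"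
  by (auto simp: lin_def pf_add xf_def algebra_simps)

lemma lin_scale: "schwartz f \<Longrightarrow> lin a b c j (\<lambda>x. d * f x) = (\<lambda>x. d * lin a b c j f x)"
  by (auto simp: lin_def pf_scale xf_def algebra_simps)

lemma lin_zero: "lin a b c j (\<lambda>x. 0) = (\<lambda>x. 0)"
  by (auto simp: lin_def xf_def pf_def partial_def)

lemma GP_lin: "GP w1 w2 f \<Longrightarrow> GP w1 w2 (lin a b c j f)"
  unfolding lin_def[abs_def] by (intro GP.add GP.scale GP.coord GP_pf)

lemma cinner_lin:
  "schwartz f \<Longrightarrow> schwartz g \<Longrightarrow>
    cinner (l2_of f) (l2_of (lin a b c j g)) = cinner (l2_of (lin (cnj a) (cnj b) (cnj c) j f)) (l2_of g)"
  using adjoint_pair_lin[of a b c j] by (simp add: adjoint_pair_def)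

section \<open>Ladders\<close>

definition rungs :: "(2 \<Rightarrow> (real^2 \<Rightarrow> complex) \<Rightarrow> real^2 \<Rightarrow> complex) \<Rightarrow> (real^2 \<Rightarrow> complex) \<Rightarrow> nat \<Rightarrow> nat \<Rightarrow> real^2 \<Rightarrow> complex" where
  "rungs R v n1 n2 = (R 1 ^^ n1) ((R 2 ^^ n2) v)"

text \<open>\<open>lower\<close> and \<open>raise\<close> are not assumed adjoint to each other, so
  the same algebra serves the Hermite functions and both biorthogonal families. By
  \<open>lin_commute\<close>, \<open>ccr\<close> says that their commutator within one mode is
  1.\<close>

locale ladder =
  fixes a b c a' b' c' :: complex and v :: "real^2 \<Rightarrow> complex"
  assumes schwartz_v: "schwartz v"
    and lower_v: "\<And>j. lin a b c j v = (\<lambda>x. 0)"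
    and ccr: "\<i> * (a * b' - b * a') = 1"
begin

abbreviation "lower j \<equiv> lin a b c j"
abbreviation "raise j \<equiv> lin a' b' c' j"
abbreviation "rung n1 n2 \<equiv> rungs raise v n1 n2"

lemma schwartz_raise_pow: "schwartz f \<Longrightarrow> schwartz ((raise j ^^ n) f)"
  by (induction n) (auto intro: schwartz_lin)

lemma schwartz_rung: "schwartz (rung n1 n2)"
  unfolding rungs_def by (intro schwartz_raise_pow schwartz_v)

lemma raise_commute: "schwartz f \<Longrightarrow> raise j (raise k f) = raise k (raise j f)"
  by (rule ext) (subst lin_commute, auto)

lemma raise_pow_commute: "schwartz f \<Longrightarrow> raise j ((raise k ^^ n) f) = (raise k ^^ n) (raise j f)"
proof (induction n)
  case (Suc n)
  have "raise j (raise k ((raise k ^^ n) f)) = raise k (raise j ((raise k ^^ n) f))"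
    by (rule raise_commute[OF schwartz_raise_pow[OF Suc.prems]])
  then show ?case using Suc by simp
qed simp

lemma raise_rung_1: "raise 1 (rung n1 n2) = rung (Suc n1) n2"
  by (simp add: rungs_def)

lemma raise_rung_2: "raise 2 (rung n1 n2) = rung n1 (Suc n2)"
  by (simp add: rungs_def raise_pow_commute schwartz_raise_pow schwartz_v)

text \<open>Each of the \<open>n\<close> commutations of \<open>lower\<close> past a
  \<open>raise\<close> contributes one lower power. At \<open>n = 0\<close> the truncated
  \<open>n - 1\<close> is harmless because its coefficient is zero.\<close>

lemma lower_raise_pow_same:
  "schwartz f \<Longrightarrow> lower j ((raise j ^^ n) f) = (\<lambda>x. (raise j ^^ n) (lower j f) x + of_nat n * (raise j ^^ (n - 1)) f x)"
proof (induction n)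
  case (Suc n)
  have s: "schwartz ((raise j ^^ n) f)" "schwartz ((raise j ^^ n) (lower j f))" "schwartz (\<lambda>x. of_nat n * (raise j ^^ (n - 1)) f x)"
    using Suc.prems by (auto intro!: schwartz_raise_pow schwartz_lin schwartz_cmult)
  have e: "raise j (\<lambda>x. of_nat n * (raise j ^^ (n - 1)) f x) = (\<lambda>x. of_nat n * (raise j ^^ n) f x)"
  proof (cases n)
    case 0 then show ?thesis by (simp add: lin_zero)
  next
    case (Suc m) then show ?thesis using \<open>schwartz f\<close> by (simp add: lin_scale schwartz_raise_pow)
  qed
  show ?case
  proof
    fix x
    have "lower j ((raise j ^^ Suc n) f) x = lower j (raise j ((raise j ^^ n) f)) x" by simp
    also have "\<dots> = raise j (lower j ((raise j ^^ n) f)) x + (raise j ^^ n) f x"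
      by (subst lin_commute[OF s(1)]) (simp add: ccr)
    also have "raise j (lower j ((raise j ^^ n) f)) x = raise j ((raise j ^^ n) (lower j f)) x + of_nat n * (raise j ^^ n) f x"
      unfolding Suc.IH[OF Suc.prems] lin_add[OF s(2,3)] e ..
    finally show "lower j ((raise j ^^ Suc n) f) x = (raise j ^^ Suc n) (lower j f) x + of_nat (Suc n) * (raise j ^^ (Suc n - 1)) f x"
      by (simp add: algebra_simps)
  qed
qed simp

lemma lower_raise_pow_other:
  "j \<noteq> k \<Longrightarrow> schwartz f \<Longrightarrow> lower j ((raise k ^^ n) f) = (raise k ^^ n) (lower j f)"
proof (induction n)
  case (Suc n)
  have "lower j ((raise k ^^ Suc n) f) = raise k (lower j ((raise k ^^ n) f))"
    using Suc.prems(1) by (intro ext) (simp add: lin_commute[OF schwartz_raise_pow[OF Suc.prems(2)], of a b c j])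
  then show ?case using Suc by simp
qed simp

lemma raise_pow_zero: "(raise j ^^ n) (\<lambda>x. 0) = (\<lambda>x. 0)"
  by (induction n) (simp_all add: lin_zero)

lemma lower_rung_1: "lower 1 (rung n1 n2) = (\<lambda>x. of_nat n1 * rung (n1 - 1) n2 x)"
proof -
  have "lower 1 ((raise 2 ^^ n2) v) = (\<lambda>x. 0)"
    by (subst lower_raise_pow_other) (auto simp: schwartz_v lower_v raise_pow_zero)
  then show ?thesis
    unfolding rungs_def by (subst lower_raise_pow_same) (auto simp: schwartz_raise_pow schwartz_v raise_pow_zero)
qed

lemma lower_rung_2: "lower 2 (rung n1 n2) = (\<lambda>x. of_nat n2 * rung n1 (n2 - 1) x)"
proof -
  have z: "(raise 1 ^^ n1) (\<lambda>x. d * f x) = (\<lambda>x. d * (raise 1 ^^ n1) f x)" if "schwartz f" for d f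
    by (induction n1) (auto simp: lin_scale schwartz_raise_pow that)
  have "lower 2 ((raise 2 ^^ n2) v) = (\<lambda>x. of_nat n2 * (raise 2 ^^ (n2 - 1)) v x)"
    by (subst lower_raise_pow_same) (auto simp: schwartz_v lower_v raise_pow_zero)
  then show ?thesis
    unfolding rungs_def
    by (subst lower_raise_pow_other) (auto simp: schwartz_raise_pow schwartz_v z)
qed

lemma raise_lower_rung_1: "raise 1 (lower 1 (rung n1 n2)) = (\<lambda>x. of_nat n1 * rung n1 n2 x)"
  unfolding lower_rung_1 lin_scale[OF schwartz_rung] raise_rung_1 by (cases n1) auto

lemma raise_lower_rung_2: "raise 2 (lower 2 (rung n1 n2)) = (\<lambda>x. of_nat n2 * rung n1 n2 x)"
  unfolding lower_rung_2 lin_scale[OF schwartz_rung] raise_rung_2 by (cases n2) auto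

text \<open>Lowering a rung returns a nonzero multiple of the previous one, so a vanishing rung
  would force \<open>v\<close> to vanish.\<close>

lemma rung_nonzero:
  assumes "v \<noteq> (\<lambda>x. 0)" shows "rung n1 n2 \<noteq> (\<lambda>x. 0)"
proof -
  have 2: "rung 0 n2 \<noteq> (\<lambda>x. 0)"
  proof (induction n2)
    case 0 show ?case using assms by (simp add: rungs_def)
  next
    case (Suc n)
    show ?case
    proof
      assume "rung 0 (Suc n) = (\<lambda>x. 0)"
      then have "(\<lambda>x. of_nat (Suc n) * rung 0 n x) = (\<lambda>x. 0)" using lower_rung_2[of 0 "Suc n"] by (simp add: lin_zero)
      then show False using Suc by (auto simp: fun_eq_iff simp del: of_nat_Suc)
    qed
  qed
  show ?thesis
  proof (induction n1)
    case (Suc n)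
    show ?case
    proof
      assume "rung (Suc n) n2 = (\<lambda>x. 0)"
      then have "(\<lambda>x. of_nat (Suc n) * rung n n2 x) = (\<lambda>x. 0)" using lower_rung_1[of "Suc n" n2] by (simp add: lin_zero)
      then show False using Suc by (auto simp: fun_eq_iff simp del: of_nat_Suc)
    qed
  qed (rule 2)
qed

end

section \<open>The Hermite basis\<close>

definition s2 :: complex where "s2 = complex_of_real (1 / sqrt 2)"

lemma s2_square: "s2 * s2 = 1/2"
  by (simp add: s2_def flip: of_real_mult)

lemma s2_nonzero: "s2 \<noteq> 0"
  by (simp add: s2_def)

lemma cnj_s2 [simp]: "cnj s2 = s2"
  by (simp add: s2_def)

abbreviation cf :: "2 \<Rightarrow> (real^2 \<Rightarrow> complex) \<Rightarrow> real^2 \<Rightarrow> complex" where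
  "cf \<equiv> lin s2 (\<i> * s2) 0"

abbreviation df :: "2 \<Rightarrow> (real^2 \<Rightarrow> complex) \<Rightarrow> real^2 \<Rightarrow> complex" where
  "df \<equiv> lin s2 (- (\<i> * s2)) 0"

lemma cinner_df: "schwartz f \<Longrightarrow> schwartz g \<Longrightarrow> cinner (l2_of (df j f)) (l2_of g) = cinner (l2_of f) (l2_of (cf j g))"
  using cinner_lin[of f g s2 "\<i> * s2" 0 j] by simp

lemma cinner_cf: "schwartz f \<Longrightarrow> schwartz g \<Longrightarrow> cinner (l2_of (cf j f)) (l2_of g) = cinner (l2_of f) (l2_of (df j g))"
  using cinner_lin[of f g s2 "- (\<i> * s2)" 0 j] by simp

lemma xf_eq_ladder: "xf j f x = s2 * (cf j f x + df j f x)"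
  and pf_eq_ladder: "pf j f x = - \<i> * s2 * (cf j f x - df j f x)"
proof -
  have "s2 * (s2 * y) = y / 2" for y by (simp flip: mult.assoc add: s2_square)
  then show "xf j f x = s2 * (cf j f x + df j f x)" "pf j f x = - \<i> * s2 * (cf j f x - df j f x)"
    by (simp_all add: lin_def algebra_simps)
qed

lemma lin_gauss:
  "lin a b c j (gauss w1 w2) x = ((a + \<i> * b) * complex_of_real (x$j) - \<i> * b * (if j = 1 then w1 else w2) + c) * gauss w1 w2 x"
  by (simp add: lin_def pf_def partial_gauss xf_def algebra_simps)

lemma cf_gauss: "cf j (gauss w1 w2) = (\<lambda>x. s2 * (if j = 1 then w1 else w2) * gauss w1 w2 x)"
  by (rule ext) (simp add: lin_gauss algebra_simps flip: mult.assoc)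

lemma gauss_nonzero: "gauss w1 w2 x \<noteq> 0"
  by (simp add: gauss_def)

lemma schwartz_gauss: "schwartz (gauss w1 w2)"
  by (rule GP_schwartz[OF GP.gauss])

lemma l2_of_eq_0_iff: "schwartz f \<Longrightarrow> l2_of f = 0 \<longleftrightarrow> f = (\<lambda>x. 0)"
  using l2_of_schwartz_inj[OF _ schwartz_cmult, of f f 0] by (simp add: l2_of_zero)

text \<open>Kept abstract: the Gaussian integral is never evaluated, and its positivity is enough to
  normalise.\<close>

definition gnorm :: real where "gnorm = norm (l2_of (gauss 0 0))"

lemma gnorm_pos: "0 < gnorm"
proof -
  have "gauss 0 0 \<noteq> (\<lambda>x. 0)" using gauss_nonzero by metis
  then show ?thesis by (simp add: gnorm_def l2_of_eq_0_iff schwartz_gauss)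
qed

definition g0 :: "real^2 \<Rightarrow> complex" where "g0 x = complex_of_real (1 / gnorm) * gauss 0 0 x"

lemma GP_g0: "GP 0 0 g0"
  unfolding g0_def[abs_def] by (intro GP.scale GP.gauss)

lemma schwartz_g0: "schwartz g0"
  by (rule GP_schwartz[OF GP_g0])

lemma norm_g0: "norm (l2_of g0) = 1"
proof -
  have "l2_of g0 = complex_of_real (1 / gnorm) *\<^sub>C l2_of (gauss 0 0)"
    unfolding g0_def[abs_def] by (simp add: l2_of_scale schwartz_square_integrable schwartz_gauss)
  then have "norm (l2_of g0) = cmod (complex_of_real (1 / gnorm)) * gnorm"
    by (simp only: norm_scaleC gnorm_def)
  then show ?thesis using gnorm_pos by (simp add: norm_divide)
qed

lemma cf_g0: "cf j g0 = (\<lambda>x. 0)"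
  unfolding g0_def[abs_def] lin_scale[OF schwartz_gauss] cf_gauss by simp

lemma ccr_s2: "\<i> * (s2 * (- (\<i> * s2)) - \<i> * s2 * s2) = 1"
proof -
  have "\<i> * (s2 * (- (\<i> * s2)) - \<i> * s2 * s2) = 2 * (s2 * s2)" by (simp add: algebra_simps)
  then show ?thesis by (simp add: s2_square)
qed

interpretation H: ladder s2 "\<i> * s2" 0 s2 "- (\<i> * s2)" 0 g0
  by unfold_locales (rule schwartz_g0 cf_g0 ccr_s2)+

abbreviation hf :: "nat \<Rightarrow> nat \<Rightarrow> real^2 \<Rightarrow> complex" where
  "hf \<equiv> rungs df g0"

text \<open>A raising operator moved across the inner product becomes a lowering operator; this
  drops the index on both sides by one and contributes one factor of the factorial, until the vacuum
  is annihilated.\<close>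

lemma cinner_hf: "cinner (l2_of (hf m1 m2)) (l2_of (hf n1 n2)) = (if m1 = n1 \<and> m2 = n2 then fact m1 * fact m2 else 0)"
proof -
  have s: "schwartz (hf m n)" for m n by (rule H.schwartz_rung)
  have sc: "l2_of (\<lambda>x. d * hf m n x) = d *\<^sub>C l2_of (hf m n)" for d m n
    by (simp add: l2_of_scale schwartz_square_integrable s)
  have vac: "cinner (l2_of (hf 0 0)) (l2_of (hf n1 n2)) = (if n1 = 0 \<and> n2 = 0 then 1 else 0)" for n1 n2
  proof (cases n1)
    case (Suc k)
    have "cinner (l2_of (hf 0 0)) (l2_of (df 1 (hf k n2))) = cinner (l2_of (cf 1 (hf 0 0))) (l2_of (hf k n2))"
      by (rule cinner_cf[symmetric]) (rule s)+
    then show ?thesis using Suc by (simp add: H.raise_rung_1 H.lower_rung_1 flip: l2_of_zero)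
  next
    case n1: 0
    show ?thesis
    proof (cases n2)
      case (Suc k)
      have "cinner (l2_of (hf 0 0)) (l2_of (df 2 (hf n1 k))) = cinner (l2_of (cf 2 (hf 0 0))) (l2_of (hf n1 k))"
        by (rule cinner_cf[symmetric]) (rule s)+
      then show ?thesis using Suc by (simp add: H.raise_rung_2 H.lower_rung_2 flip: l2_of_zero)
    next
      case 0 then show ?thesis using n1 cinner_self_norm[of "l2_of g0"] by (simp add: rungs_def norm_g0)
    qed
  qed
  have 1: "cinner (l2_of (hf 0 m2)) (l2_of (hf n1 n2)) = (if 0 = n1 \<and> m2 = n2 then fact m2 else 0)" for m2 n1 n2
  proof (induction m2 arbitrary: n2)
    case 0 then show ?case using vac by auto
  next
    case (Suc m)
    have "cinner (l2_of (df 2 (hf 0 m))) (l2_of (hf n1 n2)) = cinner (l2_of (hf 0 m)) (l2_of (cf 2 (hf n1 n2)))"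
      by (rule cinner_df) (rule s)+
    then show ?case using Suc by (cases n2) (auto simp: H.raise_rung_2 H.lower_rung_2 sc cinner_scale_right simp flip: l2_of_zero)
  qed
  show ?thesis
  proof (induction m1 arbitrary: n1)
    case 0 then show ?case using 1 by auto
  next
    case (Suc m)
    have "cinner (l2_of (df 1 (hf m m2))) (l2_of (hf n1 n2)) = cinner (l2_of (hf m m2)) (l2_of (cf 1 (hf n1 n2)))"
      by (rule cinner_df) (rule s)+
    then show ?case using Suc by (cases n1) (auto simp: H.raise_rung_1 H.lower_rung_1 sc cinner_scale_right mult_ac simp del: of_nat_Suc simp flip: l2_of_zero)
  qed
qed

inductive hspan :: "(real^2 \<Rightarrow> complex) \<Rightarrow> bool" where
  hf: "hspan (hf n1 n2)"
| add: "hspan f \<Longrightarrow> hspan g \<Longrightarrow> hspan (\<lambda>x. f x + g x)"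
| scale: "hspan f \<Longrightarrow> hspan (\<lambda>x. c * f x)"

lemma hspan_schwartz: "hspan f \<Longrightarrow> schwartz f"
  by (induction rule: hspan.induct) (auto intro: schwartz_add schwartz_cmult H.schwartz_rung)

lemma hspan_xf: "hspan f \<Longrightarrow> hspan (xf j f)"
proof (induction rule: hspan.induct)
  case (hf n1 n2)
  have "j = 1 \<or> j = 2" by (rule exhaust_2)
  then have "hspan (cf j (hf n1 n2))" "hspan (df j (hf n1 n2))"
    by (auto simp: H.raise_rung_1 H.raise_rung_2 H.lower_rung_1 H.lower_rung_2 intro!: hspan.scale hspan.hf)
  then have "hspan (\<lambda>x. s2 * (cf j (hf n1 n2) x + df j (hf n1 n2) x))" by (intro hspan.intros)
  moreover have "xf j (hf n1 n2) = (\<lambda>x. s2 * (cf j (hf n1 n2) x + df j (hf n1 n2) x))"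
    by (rule ext) (rule xf_eq_ladder)
  ultimately show ?case by (simp only:)
next
  case (add f g)
  have "xf j (\<lambda>x. f x + g x) = (\<lambda>x. xf j f x + xf j g x)" by (auto simp: xf_def algebra_simps)
  then show ?case using add hspan.add by simp
next
  case (scale f c)
  have "xf j (\<lambda>x. c * f x) = (\<lambda>x. c * xf j f x)" by (auto simp: xf_def algebra_simps)
  then show ?case using scale hspan.scale by simp
qed

text \<open>A coordinate is a multiple of the sum of a raising and a lowering operator and so
  preserves the span of the Hermite functions. This transfers the totality of \<open>GP 0 0\<close>
  to them.\<close>

lemma GP_hspan: "GP 0 0 f \<Longrightarrow> hspan f"
proof (induction rule: GP.induct)
  case gauss
  have "hspan (\<lambda>x. complex_of_real gnorm * hf 0 0 x)" by (intro hspan.intros)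
  also have "(\<lambda>x. complex_of_real gnorm * hf 0 0 x) = gauss 0 0"
    using gnorm_pos by (auto simp: rungs_def g0_def)
  finally show ?case .
qed (auto intro: hspan.intros hspan_xf)

lemma l2_eqI_hf:
  assumes "\<And>n1 n2. cinner (l2_of (hf n1 n2)) F = cinner (l2_of (hf n1 n2)) G"
  shows "F = G"
proof (rule l2_eqI_GP)
  fix h assume "GP 0 0 h"
  then have "hspan h" by (rule GP_hspan)
  then show "cinner (l2_of h) F = cinner (l2_of h) G"
    by (induction rule: hspan.induct)
       (auto simp: assms cinner_add_left cinner_scale_left hspan_schwartz schwartz_square_integrable
         simp flip: l2_of_add l2_of_scale)
qed

definition hbasis :: "nat \<times> nat \<Rightarrow> l2" where
  "hbasis = (\<lambda>(n1, n2). complex_of_real (1 / sqrt (fact n1 * fact n2)) *\<^sub>C l2_of (hf n1 n2))"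

lemma l2_of_hf: "l2_of (hf n1 n2) = complex_of_real (sqrt (fact n1 * fact n2)) *\<^sub>C hbasis (n1, n2)"
  by (simp add: hbasis_def flip: of_real_mult)

lemma cinner_hbasis: "cinner (hbasis m) (hbasis n) = (if m = n then 1 else 0)"
proof -
  have "complex_of_real (1 / sqrt (fact k * fact l)) * (complex_of_real (1 / sqrt (fact k * fact l)) * (fact k * fact l)) = 1" for k l
  proof -
    have "(1 / sqrt (fact k * fact l)) * ((1 / sqrt (fact k * fact l)) * (fact k * fact l)) = (1::real)"
      by (simp add: field_simps)
    then have "complex_of_real ((1 / sqrt (fact k * fact l)) * ((1 / sqrt (fact k * fact l)) * (fact k * fact l))) = 1"
      by (simp only: of_real_1)
    then show ?thesis by (simp only: of_real_mult of_real_fact)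
  qed
  then show ?thesis
    by (cases m; cases n) (auto simp: hbasis_def cinner_scale_left cinner_scale_right cinner_hf)
qed

lemma orthonormal_basis_hbasis: "orthonormal_basis hbasis"
proof (rule orthonormal_basis_if_total[OF cinner_hbasis])
  fix f assume "\<And>n. cinner (hbasis n) f = 0"
  then show "f = 0" by (intro l2_eqI_hf) (simp add: l2_of_hf cinner_scale_left)
qed

section \<open>Rotation in phase space\<close>

text \<open>For \<open>\<omega> = - \<i>\<close> this is the unitary Fourier transform. If
  \<open>cmod \<omega> = 1\<close>, the coefficients stay square summable and the series converges;
  for other values the infinite sum may take its default value.\<close>

definition rot :: "complex \<Rightarrow> l2 \<Rightarrow> l2" where
  "rot \<omega> f = (\<Sum>\<^sub>\<infinity>n. (\<omega> ^ (fst n + snd n) * cinner (hbasis n) f) *\<^sub>C hbasis n)"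

lemma cinner_hbasis_rot:
  assumes \<omega>: "cmod \<omega> = 1"
  shows "cinner (hbasis m) (rot \<omega> f) = \<omega> ^ (fst m + snd m) * cinner (hbasis m) f"
proof -
  have "(\<lambda>n. (cmod (\<omega> ^ (fst n + snd n) * cinner (hbasis n) f))\<^sup>2) summable_on UNIV"
    using Bessel_summable[of hbasis, OF cinner_hbasis] by (simp add: norm_mult norm_power \<omega>)
  then have "(\<lambda>n. (\<omega> ^ (fst n + snd n) * cinner (hbasis n) f) *\<^sub>C hbasis n) summable_on UNIV"
    by (intro orthonormal_summable cinner_hbasis)
  then have "((\<lambda>n. (\<omega> ^ (fst n + snd n) * cinner (hbasis n) f) *\<^sub>C hbasis n) has_sum rot \<omega> f) UNIV"
    unfolding rot_def by (rule has_sum_infsum)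
  from has_sum_bounded_linear[OF bounded_linear_cinner_right this, of "hbasis m"]
  have "((\<lambda>n. cinner (hbasis m) ((\<omega> ^ (fst n + snd n) * cinner (hbasis n) f) *\<^sub>C hbasis n)) has_sum cinner (hbasis m) (rot \<omega> f)) UNIV"
    by (simp add: o_def)
  moreover have "((\<lambda>n. cinner (hbasis m) ((\<omega> ^ (fst n + snd n) * cinner (hbasis n) f) *\<^sub>C hbasis n)) has_sum
      \<omega> ^ (fst m + snd m) * cinner (hbasis m) f) UNIV"
    using has_sum_finite[of "{m}" "\<lambda>n. cinner (hbasis m) ((\<omega> ^ (fst n + snd n) * cinner (hbasis n) f) *\<^sub>C hbasis n)"]
    by (subst has_sum_cong_neutral[where T="{m}" and g="\<lambda>n. cinner (hbasis m) ((\<omega> ^ (fst n + snd n) * cinner (hbasis n) f) *\<^sub>C hbasis n)"])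
       (auto simp: cinner_scale_right cinner_hbasis)
  ultimately show ?thesis by (rule has_sum_unique)
qed

lemma cinner_hf_rot:
  "cmod \<omega> = 1 \<Longrightarrow> cinner (l2_of (hf n1 n2)) (rot \<omega> f) = \<omega> ^ (n1 + n2) * cinner (l2_of (hf n1 n2)) f"
  by (simp add: l2_of_hf cinner_scale_left cinner_hbasis_rot mult_ac)

lemma l2_eqI_hbasis: "(\<And>n. cinner (hbasis n) f = cinner (hbasis n) g) \<Longrightarrow> f = g"
  by (rule l2_eqI_hf) (simp add: l2_of_hf cinner_scale_left)

lemma rot_add: "cmod \<omega> = 1 \<Longrightarrow> rot \<omega> (f + g) = rot \<omega> f + rot \<omega> g"
  by (rule l2_eqI_hbasis) (simp add: cinner_hbasis_rot cinner_add_right distrib_left)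

lemma rot_scale: "cmod \<omega> = 1 \<Longrightarrow> rot \<omega> (c *\<^sub>C f) = c *\<^sub>C rot \<omega> f"
  by (rule l2_eqI_hbasis) (simp add: cinner_hbasis_rot cinner_scale_right mult_ac)

lemma rot_diff: "cmod \<omega> = 1 \<Longrightarrow> rot \<omega> (f - g) = rot \<omega> f - rot \<omega> g"
  by (rule l2_eqI_hbasis) (simp add: cinner_hbasis_rot cinner_diff_right right_diff_distrib)

lemma cmod_1_cnj: "cmod \<omega> = 1 \<Longrightarrow> cnj \<omega> * \<omega> = 1"
  by (metis complex_norm_square mult.commute of_real_1 power_one)

lemma rot_rot: "cmod \<omega> = 1 \<Longrightarrow> rot (cnj \<omega>) (rot \<omega> f) = f"
  by (rule l2_eqI_hbasis) (simp add: cinner_hbasis_rot cmod_1_cnj flip: mult.assoc power_mult_distrib)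

lemma rot_rot': "cmod \<omega> = 1 \<Longrightarrow> rot \<omega> (rot (cnj \<omega>) f) = f"
  using rot_rot[of "cnj \<omega>"] by simp

lemma cinner_rot:
  assumes "cmod \<omega> = 1" shows "cinner (rot \<omega> f) g = cinner f (rot (cnj \<omega>) g)"
proof -
  have "cinner (rot \<omega> f) (hbasis n) * cinner (hbasis n) g = cinner f (hbasis n) * cinner (hbasis n) (rot (cnj \<omega>) g)" for n
    by (subst (1 2) cinner_commute[of _ "hbasis n"]) (simp add: cinner_hbasis_rot assms)
  then show ?thesis
    using Parseval_has_sum[OF orthonormal_basis_hbasis, of "rot \<omega> f" g]
      Parseval_has_sum[OF orthonormal_basis_hbasis, of f "rot (cnj \<omega>) g"]
    by (simp add: has_sum_unique)
qed

lemma cinner_rot_rot: "cmod \<omega> = 1 \<Longrightarrow> cinner (rot \<omega> f) (rot \<omega> g) = cinner f g"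
  by (simp add: cinner_rot rot_rot)

lemma norm_rot: "cmod \<omega> = 1 \<Longrightarrow> norm (rot \<omega> f) = norm f"
  by (metis cinner_rot_rot norm_l2_square norm_ge_zero power2_eq_iff_nonneg)

lemma bounded_linear_rot: "cmod \<omega> = 1 \<Longrightarrow> bounded_linear (rot \<omega>)"
  by standard (auto simp: rot_add scaleR_l2_def rot_scale norm_rot intro!: exI[of _ 1])

text \<open>Lowering reduces the total degree by one, so passing it through the rotation costs one
  factor. The image of \<open>u\<close> is required to have a Schwartz representative because
  \<open>cf\<close> acts on functions, not on classes.\<close>

lemma rot_cf:
  assumes \<omega>: "cmod \<omega> = 1" and u: "schwartz u" and w: "schwartz w" "rot \<omega> (l2_of u) = l2_of w"
  shows "rot \<omega> (l2_of (cf j u)) = cnj \<omega> *\<^sub>C l2_of (cf j w)"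
proof (rule l2_eqI_hf)
  fix n1 n2
  \<comment> \<open>Inserting \<open>cnj \<omega> * \<omega> = 1\<close> raises the exponent to the
    degree of the raised Hermite function.\<close>
  have e: "\<omega> ^ k = cnj \<omega> * \<omega> ^ Suc k" for k using cmod_1_cnj[OF \<omega>] by (simp flip: mult.assoc)
  have j: "j = 1 \<or> j = 2" by (rule exhaust_2)
  have "cinner (l2_of (hf n1 n2)) (rot \<omega> (l2_of (cf j u))) = \<omega> ^ (n1 + n2) * cinner (l2_of (df j (hf n1 n2))) (l2_of u)"
    by (simp add: cinner_hf_rot[OF \<omega>] cinner_df H.schwartz_rung u)
  also have "\<dots> = cnj \<omega> * cinner (l2_of (df j (hf n1 n2))) (rot \<omega> (l2_of u))"
    using j by (subst e) (auto simp: H.raise_rung_1 H.raise_rung_2 cinner_hf_rot[OF \<omega>])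
  also have "\<dots> = cinner (l2_of (hf n1 n2)) (cnj \<omega> *\<^sub>C l2_of (cf j w))"
    by (simp add: w cinner_df H.schwartz_rung cinner_scale_right)
  finally show "cinner (l2_of (hf n1 n2)) (rot \<omega> (l2_of (cf j u))) = cinner (l2_of (hf n1 n2)) (cnj \<omega> *\<^sub>C l2_of (cf j w))" .
qed

lemma rot_df:
  assumes \<omega>: "cmod \<omega> = 1" and u: "schwartz u" and w: "schwartz w" "rot \<omega> (l2_of u) = l2_of w"
  shows "rot \<omega> (l2_of (df j u)) = \<omega> *\<^sub>C l2_of (df j w)"
proof (rule l2_eqI_hf)
  fix n1 n2
  have j: "j = 1 \<or> j = 2" by (rule exhaust_2)
  have sc: "l2_of (\<lambda>x. d * hf m n x) = d *\<^sub>C l2_of (hf m n)" for d m n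
    by (simp add: l2_of_scale schwartz_square_integrable H.schwartz_rung)
  have "cinner (l2_of (hf n1 n2)) (rot \<omega> (l2_of (df j u))) = \<omega> ^ (n1 + n2) * cinner (l2_of (cf j (hf n1 n2))) (l2_of u)"
    by (simp add: cinner_hf_rot[OF \<omega>] cinner_cf H.schwartz_rung u)
  also have "\<dots> = \<omega> * cinner (l2_of (cf j (hf n1 n2))) (rot \<omega> (l2_of u))"
    using j
  proof
    assume "j = 1" then show ?thesis
      by (cases n1) (simp_all add: H.lower_rung_1 sc cinner_scale_left cinner_hf_rot[OF \<omega>] mult_ac
        del: of_nat_Suc flip: l2_of_zero)
  next
    assume "j = 2" then show ?thesis
      by (cases n2) (simp_all add: H.lower_rung_2 sc cinner_scale_left cinner_hf_rot[OF \<omega>] mult_ac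
        del: of_nat_Suc flip: l2_of_zero)
  qed
  also have "\<dots> = cinner (l2_of (hf n1 n2)) (\<omega> *\<^sub>C l2_of (df j w))"
    by (simp add: w cinner_cf H.schwartz_rung cinner_scale_right)
  finally show "cinner (l2_of (hf n1 n2)) (rot \<omega> (l2_of (df j u))) = cinner (l2_of (hf n1 n2)) (\<omega> *\<^sub>C l2_of (df j w))" .
qed

text \<open>These Gaussians are coherent states: by \<open>cf_gauss\<close> they are eigenfunctions
  of the lowering operators, and each raising operator moved across the inner product yields one
  eigenvalue.\<close>

lemma cinner_hf_gauss:
  "cinner (l2_of (hf n1 n2)) (l2_of (gauss w1 w2)) = (s2 * w1) ^ n1 * (s2 * w2) ^ n2 * cinner (l2_of g0) (l2_of (gauss w1 w2))"
proof -
  have sc: "l2_of (\<lambda>x. d * gauss w1 w2 x) = d *\<^sub>C l2_of (gauss w1 w2)" for d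
    by (simp add: l2_of_scale schwartz_square_integrable schwartz_gauss)
  have 2: "cinner (l2_of (hf 0 n2)) (l2_of (gauss w1 w2)) = (s2 * w2) ^ n2 * cinner (l2_of g0) (l2_of (gauss w1 w2))"
  proof (induction n2)
    case (Suc n)
    have "cinner (l2_of (df 2 (hf 0 n))) (l2_of (gauss w1 w2)) = cinner (l2_of (hf 0 n)) (l2_of (cf 2 (gauss w1 w2)))"
      by (rule cinner_df[OF H.schwartz_rung schwartz_gauss])
    then show ?case using Suc by (simp add: H.raise_rung_2 cf_gauss sc cinner_scale_right)
  qed (simp add: rungs_def)
  show ?thesis
  proof (induction n1)
    case (Suc n)
    have "cinner (l2_of (df 1 (hf n n2))) (l2_of (gauss w1 w2)) = cinner (l2_of (hf n n2)) (l2_of (cf 1 (gauss w1 w2)))"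
      by (rule cinner_df[OF H.schwartz_rung schwartz_gauss])
    then show ?case using Suc by (simp add: H.raise_rung_1 cf_gauss sc cinner_scale_right)
  qed (simp add: 2)
qed

definition goverlap :: "complex \<Rightarrow> complex \<Rightarrow> complex" where
  "goverlap w1 w2 = cinner (l2_of g0) (l2_of (gauss w1 w2))"

text \<open>All Hermite coefficients of the Gaussian are multiples of this overlap, so its vanishing
  would make the Gaussian zero.\<close>

lemma goverlap_nonzero: "goverlap w1 w2 \<noteq> 0"
proof
  assume 0: "goverlap w1 w2 = 0"
  have "l2_of (gauss w1 w2) = 0"
    by (rule l2_eqI_hf) (simp add: cinner_hf_gauss 0[unfolded goverlap_def])
  then show False using gauss_nonzero by (metis l2_of_eq_0_iff schwartz_gauss)
qed

text \<open>The Hermite coefficients of a coherent state are monomials in its parameters, so the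
  factor \<open>\<omega> ^ (n1 + n2)\<close> is absorbed by multiplying the parameters by \<omega>;
  only the overlap with the vacuum has to be corrected.\<close>

lemma rot_gauss:
  assumes \<omega>: "cmod \<omega> = 1"
  shows "rot \<omega> (l2_of (gauss w1 w2)) = (goverlap w1 w2 / goverlap (\<omega> * w1) (\<omega> * w2)) *\<^sub>C l2_of (gauss (\<omega> * w1) (\<omega> * w2))"
proof (rule l2_eqI_hf)
  fix n1 n2
  show "cinner (l2_of (hf n1 n2)) (rot \<omega> (l2_of (gauss w1 w2))) =
    cinner (l2_of (hf n1 n2)) ((goverlap w1 w2 / goverlap (\<omega> * w1) (\<omega> * w2)) *\<^sub>C l2_of (gauss (\<omega> * w1) (\<omega> * w2)))"
    using goverlap_nonzero[of "\<omega> * w1" "\<omega> * w2"]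
    by (simp add: cinner_hf_rot[OF \<omega>] cinner_scale_right cinner_hf_gauss goverlap_def[symmetric]
        power_mult_distrib power_add mult_ac)
qed

lemma rot_xf:
  assumes u: "schwartz u" and w: "schwartz w" "rot (cis \<theta>) (l2_of u) = l2_of w"
  shows "rot (cis \<theta>) (l2_of (xf j u)) = l2_of (lin (cos \<theta>) (sin \<theta>) 0 j w)"
    and "rot (cis \<theta>) (l2_of (pf j u)) = l2_of (lin (- sin \<theta>) (cos \<theta>) 0 j w)"
proof -
  have sq: "square_integrable (lin a b c j f)" if "schwartz f" for a b c f
    using that by (intro schwartz_square_integrable schwartz_lin)
  have \<omega>: "cmod (cis \<theta>) = 1" by simp
  have ss: "s2 * (s2 * y) = y / 2" for y by (simp flip: mult.assoc add: s2_square)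
  have c: "cis \<theta> = complex_of_real (cos \<theta>) + \<i> * complex_of_real (sin \<theta>)"
    by (simp add: complex_eq_iff)
  have "l2_of (xf j u) = s2 *\<^sub>C (l2_of (cf j u) + l2_of (df j u))"
    unfolding xf_eq_ladder[abs_def] by (simp add: l2_of_add l2_of_scale square_integrable_add sq u)
  then have "rot (cis \<theta>) (l2_of (xf j u)) = s2 *\<^sub>C (cnj (cis \<theta>) *\<^sub>C l2_of (cf j w) + cis \<theta> *\<^sub>C l2_of (df j w))"
    by (simp only: rot_scale[OF \<omega>] rot_add[OF \<omega>] rot_cf[OF \<omega> u w] rot_df[OF \<omega> u w])
  also have "\<dots> = l2_of (\<lambda>x. s2 * (cnj (cis \<theta>) * cf j w x + cis \<theta> * df j w x))"
    by (simp add: l2_of_add l2_of_scale square_integrable_add square_integrable_cmult sq w)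
  also have "(\<lambda>x. s2 * (cnj (cis \<theta>) * cf j w x + cis \<theta> * df j w x)) = lin (cos \<theta>) (sin \<theta>) 0 j w"
    unfolding c by (rule ext) (simp add: lin_def algebra_simps ss)
  finally show "rot (cis \<theta>) (l2_of (xf j u)) = l2_of (lin (cos \<theta>) (sin \<theta>) 0 j w)" .
  have "l2_of (pf j u) = (- \<i> * s2) *\<^sub>C (l2_of (cf j u) - l2_of (df j u))"
    unfolding pf_eq_ladder[abs_def] by (simp only: l2_of_diff l2_of_scale square_integrable_diff sq u)
  then have "rot (cis \<theta>) (l2_of (pf j u)) = (- \<i> * s2) *\<^sub>C (cnj (cis \<theta>) *\<^sub>C l2_of (cf j w) - cis \<theta> *\<^sub>C l2_of (df j w))"
    by (simp only: rot_scale[OF \<omega>] rot_diff[OF \<omega>] rot_cf[OF \<omega> u w] rot_df[OF \<omega> u w])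
  also have "\<dots> = l2_of (\<lambda>x. (- \<i> * s2) * (cnj (cis \<theta>) * cf j w x - cis \<theta> * df j w x))"
    by (simp only: l2_of_diff l2_of_scale square_integrable_diff square_integrable_cmult sq w)
  also have "(\<lambda>x. (- \<i> * s2) * (cnj (cis \<theta>) * cf j w x - cis \<theta> * df j w x)) = lin (- sin \<theta>) (cos \<theta>) 0 j w"
    unfolding c by (rule ext) (simp add: lin_def algebra_simps ss)
  finally show "rot (cis \<theta>) (l2_of (pf j u)) = l2_of (lin (- sin \<theta>) (cos \<theta>) 0 j w)" .
qed

text \<open>A coordinate turns into a first-order operator under rotation, and such operators act
  within \<open>GP\<close>. This makes the class a core compatible with every rotation.\<close>

lemma rot_GP:
  assumes "GP w1 w2 u"
  shows "\<exists>w. GP (cis \<theta> * w1) (cis \<theta> * w2) w \<and> rot (cis \<theta>) (l2_of u) = l2_of w"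
  using assms
proof (induction rule: GP.induct)
  case gauss
  have "rot (cis \<theta>) (l2_of (gauss w1 w2)) =
      l2_of (\<lambda>x. (goverlap w1 w2 / goverlap (cis \<theta> * w1) (cis \<theta> * w2)) * gauss (cis \<theta> * w1) (cis \<theta> * w2) x)"
    by (subst rot_gauss) (simp_all add: l2_of_scale schwartz_square_integrable schwartz_gauss)
  then show ?case using GP.scale[OF GP.gauss] by blast
next
  case (add f g)
  then obtain u v where "GP (cis \<theta> * w1) (cis \<theta> * w2) u" "rot (cis \<theta>) (l2_of f) = l2_of u"
      "GP (cis \<theta> * w1) (cis \<theta> * w2) v" "rot (cis \<theta>) (l2_of g) = l2_of v" by blast
  moreover from this have "rot (cis \<theta>) (l2_of (\<lambda>x. f x + g x)) = l2_of (\<lambda>x. u x + v x)"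
    using add.hyps by (simp add: rot_add schwartz_square_integrable GP_schwartz flip: l2_of_add)
  ultimately show ?case using GP.add by blast
next
  case (scale f c)
  then obtain u where "GP (cis \<theta> * w1) (cis \<theta> * w2) u" "rot (cis \<theta>) (l2_of f) = l2_of u" by blast
  moreover from this have "rot (cis \<theta>) (l2_of (\<lambda>x. c * f x)) = l2_of (\<lambda>x. c * u x)"
    using scale.hyps by (simp add: rot_scale schwartz_square_integrable GP_schwartz flip: l2_of_scale)
  ultimately show ?case using GP.scale by blast
next
  case (coord f j)
  then obtain u where "GP (cis \<theta> * w1) (cis \<theta> * w2) u" "rot (cis \<theta>) (l2_of f) = l2_of u" by blast
  then show ?case using rot_xf(1)[OF GP_schwartz[OF coord.hyps(1)] GP_schwartz] GP_lin by metis
qed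

section \<open>Multiplication operators and their rotations\<close>

definition mult_op :: "(real^2 \<Rightarrow> real) \<Rightarrow> op" where
  "mult_op u = {(l2_of f, l2_of (\<lambda>x. complex_of_real (u x) * f x)) | f.
     square_integrable f \<and> square_integrable (\<lambda>x. complex_of_real (u x) * f x)}"

lemma square_integrable_measurable: "square_integrable f \<Longrightarrow> f \<in> borel_measurable borel"
  by (simp add: square_integrable_def)

lemma square_integrable_cong_AE:
  assumes "square_integrable f" and [measurable]: "g \<in> borel_measurable borel" and "AE x in lborel. f x = g x"
  shows "square_integrable g"
proof -
  have [measurable]: "f \<in> borel_measurable borel" using assms(1) by (rule square_integrable_measurable)
  have "integrable lborel (\<lambda>x. (cmod (f x))\<^sup>2) \<longleftrightarrow> integrable lborel (\<lambda>x. (cmod (g x))\<^sup>2)"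
    using assms(3) by (intro integrable_cong_AE) (auto elim: AE_mp)
  then show ?thesis using assms(1) by (simp add: square_integrable_def)
qed

lemma mult_op_iff:
  assumes u[measurable]: "u \<in> borel_measurable borel" and f: "square_integrable f"
  shows "(l2_of f, G) \<in> mult_op u \<longleftrightarrow>
    square_integrable (\<lambda>x. complex_of_real (u x) * f x) \<and> G = l2_of (\<lambda>x. complex_of_real (u x) * f x)"
proof
  assume "(l2_of f, G) \<in> mult_op u"
  then obtain f' where f': "square_integrable f'" "square_integrable (\<lambda>x. complex_of_real (u x) * f' x)"
      "l2_of f = l2_of f'" "G = l2_of (\<lambda>x. complex_of_real (u x) * f' x)"
    by (auto simp: mult_op_def)
  have [measurable]: "f \<in> borel_measurable borel" using f by (rule square_integrable_measurable)
  have "AE x in lborel. f x = f' x" using f f' by (simp add: l2_of_eq_iff)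
  then have ae: "AE x in lborel. complex_of_real (u x) * f' x = complex_of_real (u x) * f x"
    by eventually_elim simp
  have s: "square_integrable (\<lambda>x. complex_of_real (u x) * f x)"
    by (rule square_integrable_cong_AE[OF f'(2) _ ae]) measurable
  with f' ae show "square_integrable (\<lambda>x. complex_of_real (u x) * f x) \<and> G = l2_of (\<lambda>x. complex_of_real (u x) * f x)"
    by (simp add: l2_of_eq_iff)
qed (use f in \<open>auto simp: mult_op_def\<close>)

lemma mult_opE:
  assumes "(F, G) \<in> mult_op u"
  obtains f where "square_integrable f" "square_integrable (\<lambda>x. complex_of_real (u x) * f x)"
    "F = l2_of f" "G = l2_of (\<lambda>x. complex_of_real (u x) * f x)"
  using assms by (auto simp: mult_op_def)

lemma mult_op_add:
  assumes "(F, G) \<in> mult_op u" "(F', G') \<in> mult_op u"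
  shows "(F + F', G + G') \<in> mult_op u"
proof -
  obtain f where f: "square_integrable f" "square_integrable (\<lambda>x. complex_of_real (u x) * f x)"
    "F = l2_of f" "G = l2_of (\<lambda>x. complex_of_real (u x) * f x)" using assms(1) by (rule mult_opE)
  obtain f' where f': "square_integrable f'" "square_integrable (\<lambda>x. complex_of_real (u x) * f' x)"
    "F' = l2_of f'" "G' = l2_of (\<lambda>x. complex_of_real (u x) * f' x)" using assms(2) by (rule mult_opE)
  have "F + F' = l2_of (\<lambda>x. f x + f' x)" using f f' by (simp add: l2_of_add)
  moreover have "G + G' = l2_of (\<lambda>x. complex_of_real (u x) * (f x + f' x))"
    using f f' by (simp add: l2_of_add distrib_left)
  moreover have "square_integrable (\<lambda>x. complex_of_real (u x) * (f x + f' x))"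
    using square_integrable_add[OF f(2) f'(2)] by (simp add: distrib_left)
  ultimately show ?thesis
    using square_integrable_add[OF f(1) f'(1)] unfolding mult_op_def by blast
qed

lemma mult_op_scale:
  assumes "(F, G) \<in> mult_op u"
  shows "(c *\<^sub>C F, c *\<^sub>C G) \<in> mult_op u"
proof -
  obtain f where f: "square_integrable f" "square_integrable (\<lambda>x. complex_of_real (u x) * f x)"
    "F = l2_of f" "G = l2_of (\<lambda>x. complex_of_real (u x) * f x)" using assms(1) by (rule mult_opE)
  have "c *\<^sub>C F = l2_of (\<lambda>x. c * f x)" using f by (simp add: l2_of_scale)
  moreover have "c *\<^sub>C G = l2_of (\<lambda>x. complex_of_real (u x) * (c * f x))"
    using f by (simp add: l2_of_scale mult.left_commute)
  moreover have "square_integrable (\<lambda>x. complex_of_real (u x) * (c * f x))"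
    using square_integrable_cmult[OF f(2), of c] by (simp add: mult.left_commute)
  ultimately show ?thesis
    using square_integrable_cmult[OF f(1), of c] unfolding mult_op_def by blast
qed

lemma mult_op_symmetric:
  assumes "(F, G) \<in> mult_op u" "(F', G') \<in> mult_op u"
  shows "cinner F G' = cinner G F'"
proof -
  obtain f where f: "square_integrable f" "square_integrable (\<lambda>x. complex_of_real (u x) * f x)"
    "F = l2_of f" "G = l2_of (\<lambda>x. complex_of_real (u x) * f x)" using assms(1) by (rule mult_opE)
  obtain f' where f': "square_integrable f'" "square_integrable (\<lambda>x. complex_of_real (u x) * f' x)"
    "F' = l2_of f'" "G' = l2_of (\<lambda>x. complex_of_real (u x) * f' x)" using assms(2) by (rule mult_opE)
  show ?thesis using f f' by (simp add: cinner_l2_of mult_ac)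
qed

text \<open>The growth bound makes \<open>GP_total\<close> applicable to products with
  \<open>u\<close>; the second condition puts the core into the domain of
  \<open>mult_op u\<close>.\<close>

definition core_multiplier :: "(real^2 \<Rightarrow> real) \<Rightarrow> bool" where
  "core_multiplier u \<longleftrightarrow> exp_growth u \<and>
     (\<forall>h. GP 0 0 h \<longrightarrow> square_integrable (\<lambda>x. complex_of_real (u x) * h x))"

lemma core_multiplier_measurable: "core_multiplier u \<Longrightarrow> u \<in> borel_measurable borel"
  by (simp add: core_multiplier_def exp_growth_def)

text \<open>Gaussians times polynomials form a core: a pair satisfying the symmetry relation against
  them lies in the maximal multiplication operator.\<close>

lemma mult_op_core:
  assumes u: "core_multiplier u"
    and sym: "\<And>h. GP 0 0 h \<Longrightarrow> cinner F (l2_of (\<lambda>x. complex_of_real (u x) * h x)) = cinner G (l2_of h)"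
  shows "(F, G) \<in> mult_op u"
proof -
  obtain f where f: "square_integrable f" "F = l2_of f" by (rule l2_cases)
  obtain k where k: "square_integrable k" "G = l2_of k" by (rule l2_cases)
  have [measurable]: "u \<in> borel_measurable borel" "f \<in> borel_measurable borel" "k \<in> borel_measurable borel"
    using u f k by (auto intro: core_multiplier_measurable square_integrable_measurable)
  have ug: "exp_growth u" using u by (simp add: core_multiplier_def)
  have "AE x in lborel. cnj (f x) * complex_of_real (u x) - cnj (k x) * complex_of_real 1 = 0"
  proof (rule GP_total)
    show "integrable lborel (\<lambda>x. (cnj (f x) * complex_of_real (u x) - cnj (k x) * complex_of_real 1) * gauss 0 0 x
        * exp (c * (\<bar>x$1\<bar> + \<bar>x$2\<bar>)))" for c
      unfolding left_diff_distrib
      by (intro Bochner_Integration.integrable_diff exp_growth_integrable f k ug exp_growth_one)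
    fix h assume h: "GP 0 0 h"
    have uh: "square_integrable (\<lambda>x. complex_of_real (u x) * h x)" using u h by (simp add: core_multiplier_def)
    have hs: "square_integrable h" using h by (simp add: GP_schwartz schwartz_square_integrable)
    have "(\<integral>x. cnj (f x) * (complex_of_real (u x) * h x) \<partial>lborel) - (\<integral>x. cnj (k x) * h x \<partial>lborel) = 0"
      using sym[OF h] by (simp add: f k cinner_l2_of uh hs)
    also have "(\<integral>x. cnj (f x) * (complex_of_real (u x) * h x) \<partial>lborel) - (\<integral>x. cnj (k x) * h x \<partial>lborel) =
      (\<integral>x. cnj (f x) * (complex_of_real (u x) * h x) - cnj (k x) * h x \<partial>lborel)"
      by (intro Bochner_Integration.integral_diff[symmetric] integrable_cnj_mult f k uh hs)
    finally show "(\<integral>x. (cnj (f x) * complex_of_real (u x) - cnj (k x) * complex_of_real 1) * h x \<partial>lborel) = 0"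
      by (simp add: algebra_simps)
  qed measurable
  then have ae: "AE x in lborel. k x = complex_of_real (u x) * f x"
  proof eventually_elim
    case (elim x)
    then have "cnj (k x) = cnj (complex_of_real (u x) * f x)" by (simp add: mult.commute)
    then show ?case by (simp only: complex_cnj_cancel_iff)
  qed
  have "square_integrable (\<lambda>x. complex_of_real (u x) * f x)"
    by (rule square_integrable_cong_AE[OF k(1) _ ae]) measurable
  then show ?thesis using f k ae by (simp add: mult_op_iff l2_of_eq_iff)
qed

lemma mult_op_GP:
  assumes "core_multiplier u" "GP 0 0 h"
  shows "(l2_of h, l2_of (\<lambda>x. complex_of_real (u x) * h x)) \<in> mult_op u"
  using assms by (auto simp: mult_op_def core_multiplier_def GP_schwartz schwartz_square_integrable)

definition rotop :: "real \<Rightarrow> (real^2 \<Rightarrow> real) \<Rightarrow> op" where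
  "rotop \<theta> u = {(F, G). (rot (cis (- \<theta>)) F, rot (cis (- \<theta>)) G) \<in> mult_op u}"

lemma rot_inverse [simp]: "rot (cis (- \<theta>)) (rot (cis \<theta>) F) = F" "rot (cis \<theta>) (rot (cis (- \<theta>)) F) = F"
  using rot_rot[of "cis \<theta>" F] rot_rot'[of "cis \<theta>" F] by (simp_all add: cis_cnj)

lemma cinner_rot_cis: "cinner (rot (cis \<theta>) F) G = cinner F (rot (cis (- \<theta>)) G)"
  using cinner_rot[of "cis \<theta>" F G] by (simp add: cis_cnj)

lemma cinner_rot_cis': "cinner F (rot (cis \<theta>) G) = cinner (rot (cis (- \<theta>)) F) G"
  using cinner_rot_cis[of "- \<theta>" F G] by simp

lemmas rot_cis_linear = rot_add[of "cis t" for t, simplified] rot_scale[of "cis t" for t, simplified]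
  rot_diff[of "cis t" for t, simplified] norm_rot[of "cis t" for t, simplified]

lemma rot_cis_zero [simp]: "rot (cis t) 0 = 0"
  using rot_cis_linear(2)[of t 0 0] by simp

lemma tendsto_rot [tendsto_intros]:
  "(f \<longlongrightarrow> a) F \<Longrightarrow> ((\<lambda>x. rot (cis t) (f x)) \<longlongrightarrow> rot (cis t) a) F"
  using bounded_linear.tendsto[OF bounded_linear_rot[of "cis t"]] by simp

text \<open>Turns membership in the graph into continuous equations in the pair, one for each
  rotated core vector. Closedness and the adjoint are read off from this form.\<close>

lemma rotop_core_iff:
  assumes u: "core_multiplier u"
  shows "(F, G) \<in> rotop \<theta> u \<longleftrightarrow>
    (\<forall>h. GP 0 0 h \<longrightarrow> cinner F (rot (cis \<theta>) (l2_of (\<lambda>x. complex_of_real (u x) * h x))) = cinner G (rot (cis \<theta>) (l2_of h)))"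
  unfolding rotop_def cinner_rot_cis'
  using mult_op_core[OF u, of "rot (cis (- \<theta>)) F" "rot (cis (- \<theta>)) G"] mult_op_symmetric mult_op_GP[OF u] by blast

lemma closed_rotop:
  assumes u: "core_multiplier u" shows "closed (rotop \<theta> u)"
proof -
  have "rotop \<theta> u = (\<Inter>h\<in>{h. GP 0 0 h}. {p. cinner (fst p) (rot (cis \<theta>) (l2_of (\<lambda>x. complex_of_real (u x) * h x)))
      = cinner (snd p) (rot (cis \<theta>) (l2_of h))})"
    using rotop_core_iff[OF u] by auto
  also have "closed \<dots>"
    by (intro closed_INT ballI closed_Collect_eq continuous_intros)
  finally show ?thesis .
qed

lemma rot_GP_onto:
  assumes "GP 0 0 h" shows "\<exists>w. GP 0 0 w \<and> rot (cis \<theta>) (l2_of w) = l2_of h"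
proof -
  obtain w where w: "GP 0 0 w" "rot (cis (- \<theta>)) (l2_of h) = l2_of w"
    using rot_GP[OF assms, of "- \<theta>"] by auto
  then have "rot (cis \<theta>) (l2_of w) = l2_of h" by (metis rot_inverse(2))
  with w show ?thesis by blast
qed

lemma rotop_Domain_GP:
  assumes u: "core_multiplier u" and h: "GP 0 0 h"
  shows "l2_of h \<in> Domain (rotop \<theta> u)"
proof -
  obtain w where w: "GP 0 0 w" "rot (cis \<theta>) (l2_of w) = l2_of h" using rot_GP_onto[OF h] by blast
  then have "rot (cis (- \<theta>)) (l2_of h) = l2_of w" by (metis rot_inverse(1))
  then have "(l2_of h, rot (cis \<theta>) (l2_of (\<lambda>x. complex_of_real (u x) * w x))) \<in> rotop \<theta> u"
    using mult_op_GP[OF u w(1)] by (simp add: rotop_def)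
  then show ?thesis by blast
qed

lemma closure_UNIV_if_GP: "(\<And>h. GP 0 0 h \<Longrightarrow> l2_of h \<in> M) \<Longrightarrow> closure M = UNIV"
  using closure_mono[of "{l2_of h | h. GP 0 0 h}" M] dense_GP by auto

lemma single_valued_mult_op:
  assumes [measurable]: "u \<in> borel_measurable borel" shows "single_valued (mult_op u)"
proof (rule single_valuedI)
  fix F G G' assume "(F, G) \<in> mult_op u" "(F, G') \<in> mult_op u"
  moreover obtain f where "square_integrable f" "F = l2_of f" by (rule l2_cases)
  ultimately show "G = G'" by (simp add: mult_op_iff)
qed

lemma linear_op_rotop:
  assumes "u \<in> borel_measurable borel" shows "linear_op (rotop \<theta> u)"
proof -
  have "single_valued (rotop \<theta> u)"
  proof (rule single_valuedI)
    fix F G G' assume "(F, G) \<in> rotop \<theta> u" "(F, G') \<in> rotop \<theta> u"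
    then have "rot (cis (- \<theta>)) G = rot (cis (- \<theta>)) G'"
      using single_valued_mult_op[OF assms] by (auto simp: rotop_def single_valued_def)
    then show "G = G'" by (metis rot_inverse(2))
  qed
  moreover have "(0, 0) \<in> rotop \<theta> u"
  proof -
    have "(l2_of (\<lambda>x. 0), l2_of (\<lambda>x. complex_of_real (u x) * 0)) \<in> mult_op u"
      unfolding mult_op_def using square_integrable_zero by force
    then show ?thesis by (simp add: rotop_def flip: l2_of_zero)
  qed
  ultimately show ?thesis
    by (auto simp: linear_op_def rotop_def rot_cis_linear mult_op_add mult_op_scale)
qed

lemma rotop_symmetric: "(F, G) \<in> rotop \<theta> u \<Longrightarrow> (F', G') \<in> rotop \<theta> u \<Longrightarrow> cinner F G' = cinner G F'"
proof -
  assume a: "(F, G) \<in> rotop \<theta> u" "(F', G') \<in> rotop \<theta> u"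
  then have "cinner (rot (cis (- \<theta>)) F) (rot (cis (- \<theta>)) G') = cinner (rot (cis (- \<theta>)) G) (rot (cis (- \<theta>)) F')"
    by (intro mult_op_symmetric) (auto simp: rotop_def)
  then show ?thesis by (simp add: cinner_rot_cis)
qed

lemma rotop_rot_GP:
  assumes "core_multiplier u" "GP 0 0 h"
  shows "(rot (cis \<theta>) (l2_of h), rot (cis \<theta>) (l2_of (\<lambda>x. complex_of_real (u x) * h x))) \<in> rotop \<theta> u"
  using mult_op_GP[OF assms] by (simp add: rotop_def)

lemma self_adjoint_rotop:
  assumes u: "core_multiplier u" shows "self_adjoint (rotop \<theta> u)"
proof -
  have "adj (rotop \<theta> u) = rotop \<theta> u"
  proof (intro set_eqI iffI; clarify)
    fix F G assume "(F, G) \<in> adj (rotop \<theta> u)"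
    then show "(F, G) \<in> rotop \<theta> u"
      unfolding rotop_core_iff[OF u] using rotop_rot_GP[OF u] by (auto simp: adj_def)
  next
    fix F G assume "(F, G) \<in> rotop \<theta> u"
    then show "(F, G) \<in> adj (rotop \<theta> u)" using rotop_symmetric by (auto simp: adj_def)
  qed
  then show ?thesis
    using linear_op_rotop[OF core_multiplier_measurable[OF u]] closure_UNIV_if_GP[OF rotop_Domain_GP[OF u]]
    by (simp add: self_adjoint_def)
qed

section \<open>The exponent\<close>

definition mm :: "real \<Rightarrow> real^2 \<Rightarrow> real" where "mm r x = r * (x$1 + x$2)"

lemma measurable_mm [measurable]: "mm r \<in> borel_measurable borel"
  unfolding mm_def[abs_def] by measurable

lemma mm_le: "\<bar>mm r x\<bar> \<le> \<bar>r\<bar> * (\<bar>x$1\<bar> + \<bar>x$2\<bar>)"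
  using abs_triangle_ineq[of "x$1" "x$2"] by (simp add: mm_def abs_mult mult_left_mono)

lemma GP_mm: "GP w1 w2 h \<Longrightarrow> GP w1 w2 (\<lambda>x. complex_of_real (mm r x) * h x)"
proof -
  assume h: "GP w1 w2 h"
  have "(\<lambda>x. complex_of_real (mm r x) * h x) = (\<lambda>x. complex_of_real r * (xf 1 h x + xf 2 h x))"
    by (auto simp: mm_def xf_def algebra_simps)
  then show ?thesis using h by (simp only:) (intro GP.intros)
qed

lemma core_multiplier_mm: "core_multiplier (mm r)"
proof -
  have "\<bar>mm r x\<bar> \<le> (\<bar>r\<bar> + 1) * exp ((\<bar>r\<bar> + 1) * (\<bar>x$1\<bar> + \<bar>x$2\<bar>))" for x
  proof -
    define a where "a = \<bar>x$1\<bar> + \<bar>x$2\<bar>"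
    have "\<bar>mm r x\<bar> \<le> \<bar>r\<bar> * a" using mm_le by (simp add: a_def)
    also have "\<dots> \<le> (\<bar>r\<bar> + 1) * a" by (simp add: a_def mult_right_mono)
    also have "\<dots> \<le> exp ((\<bar>r\<bar> + 1) * a)" using exp_ge_add_one_self[of "(\<bar>r\<bar> + 1) * a"] by linarith
    also have "\<dots> \<le> (\<bar>r\<bar> + 1) * exp ((\<bar>r\<bar> + 1) * a)" by (simp add: distrib_right)
    finally show ?thesis by (simp add: a_def)
  qed
  then have "exp_growth (mm r)" unfolding exp_growth_def by auto
  then show ?thesis
    using schwartz_square_integrable[OF GP_schwartz[OF GP_mm]] unfolding core_multiplier_def by blast
qed

lemma GP_exp_mm: "GP w1 w2 h \<Longrightarrow> GP (complex_of_real r + w1) (complex_of_real r + w2) (\<lambda>x. complex_of_real (exp (mm r x)) * h x)"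
proof (induction rule: GP.induct)
  case gauss
  have "(\<lambda>x. complex_of_real (exp (mm r x)) * gauss w1 w2 x) = gauss (complex_of_real r + w1) (complex_of_real r + w2)"
    by (auto simp: gauss_def mm_def exp_of_real[symmetric] exp_add[symmetric] algebra_simps)
  then show ?case using GP.gauss by simp
next
  case (add f g)
  then show ?case using GP.add[OF add.IH] by (simp add: distrib_left)
next
  case (scale f c)
  then show ?case using GP.scale[OF scale.IH, of c] by (simp add: mult.left_commute)
next
  case (coord f j)
  have "(\<lambda>x. complex_of_real (exp (mm r x)) * xf j f x) = xf j (\<lambda>x. complex_of_real (exp (mm r x)) * f x)"
    by (auto simp: xf_def)
  then show ?case using GP.coord[OF coord.IH] by simp
qed

lemma core_multiplier_exp_mm: "core_multiplier (\<lambda>x. exp (mm r x))"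
proof -
  have "\<bar>exp (mm r x)\<bar> \<le> (\<bar>r\<bar> + 1) * exp ((\<bar>r\<bar> + 1) * (\<bar>x$1\<bar> + \<bar>x$2\<bar>))" for x
  proof -
    have "mm r x \<le> (\<bar>r\<bar> + 1) * (\<bar>x$1\<bar> + \<bar>x$2\<bar>)" using mm_le[of r x] by (simp add: distrib_right)
    then have "exp (mm r x) \<le> exp ((\<bar>r\<bar> + 1) * (\<bar>x$1\<bar> + \<bar>x$2\<bar>))" by simp
    also have "\<dots> \<le> (\<bar>r\<bar> + 1) * exp ((\<bar>r\<bar> + 1) * (\<bar>x$1\<bar> + \<bar>x$2\<bar>))" by (simp add: distrib_right)
    finally show ?thesis by simp
  qed
  then have "exp_growth (\<lambda>x. exp (mm r x))" unfolding exp_growth_def by auto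
  then show ?thesis
    using GP_exp_mm GP_schwartz schwartz_square_integrable by (fastforce simp: core_multiplier_def)
qed

definition generator :: "real \<Rightarrow> real \<Rightarrow> (real^2 \<Rightarrow> complex) \<Rightarrow> real^2 \<Rightarrow> complex" where
  "generator \<theta> r f x = complex_of_real r * (lin (cos \<theta>) (sin \<theta>) 0 1 f x + lin (cos \<theta>) (sin \<theta>) 0 2 f x)"

lemma adjoint_pair_generator: "adjoint_pair (generator \<theta> r) (generator \<theta> r)"
proof -
  have "adjoint_pair (lin (cos \<theta>) (sin \<theta>) 0 j) (lin (cos \<theta>) (sin \<theta>) 0 j)" for j
  proof -
    have "cnj (cos (complex_of_real \<theta>)) = cos (complex_of_real \<theta>)" "cnj (sin (complex_of_real \<theta>)) = sin (complex_of_real \<theta>)"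
      by (simp_all add: cos_of_real sin_of_real)
    then show ?thesis using adjoint_pair_lin[of "cos \<theta>" "sin \<theta>" 0 j] by simp
  qed
  then have "adjoint_pair (\<lambda>f x. complex_of_real r * (lin (cos \<theta>) (sin \<theta>) 0 1 f x + lin (cos \<theta>) (sin \<theta>) 0 2 f x))
     (\<lambda>f x. cnj (complex_of_real r) * (lin (cos \<theta>) (sin \<theta>) 0 1 f x + lin (cos \<theta>) (sin \<theta>) 0 2 f x))"
    by (intro adjoint_pair_scale adjoint_pair_add)
  then show ?thesis by (simp add: generator_def[abs_def])
qed

lemma exponent_eq_sop:
  "complex_of_real (r * sin \<theta>) \<cdot>\<^sub>o (mom 1 +\<^sub>o mom 2) +\<^sub>o complex_of_real (r * cos \<theta>) \<cdot>\<^sub>o (pos 1 +\<^sub>o pos 2) = sop (generator \<theta> r)"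
  by (simp add: sop_simps) (rule sop_cong, rule ext, simp add: generator_def lin_def algebra_simps)

lemma rot_mm:
  assumes h: "GP 0 0 h" and w: "schwartz w" "rot (cis \<theta>) (l2_of h) = l2_of w"
  shows "rot (cis \<theta>) (l2_of (\<lambda>x. complex_of_real (mm r x) * h x)) = l2_of (generator \<theta> r w)"
proof -
  have hs: "schwartz h" by (rule GP_schwartz[OF h])
  have "(\<lambda>x. complex_of_real (mm r x) * h x) = (\<lambda>x. complex_of_real r * (xf 1 h x + xf 2 h x))"
    by (auto simp: mm_def xf_def algebra_simps)
  then have "l2_of (\<lambda>x. complex_of_real (mm r x) * h x) = complex_of_real r *\<^sub>C (l2_of (xf 1 h) + l2_of (xf 2 h))"
    by (simp add: l2_of_add l2_of_scale square_integrable_add schwartz_square_integrable schwartz_xf hs)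
  then have "rot (cis \<theta>) (l2_of (\<lambda>x. complex_of_real (mm r x) * h x)) =
     complex_of_real r *\<^sub>C (l2_of (lin (cos \<theta>) (sin \<theta>) 0 1 w) + l2_of (lin (cos \<theta>) (sin \<theta>) 0 2 w))"
    by (simp only: rot_cis_linear rot_xf(1)[OF hs w])
  also have "\<dots> = l2_of (generator \<theta> r w)"
    by (simp add: generator_def[abs_def] l2_of_add l2_of_scale square_integrable_add schwartz_square_integrable schwartz_lin w)
  finally show ?thesis .
qed

lemma mult_op_diff:
  assumes "(F, G) \<in> mult_op u" "(F', G') \<in> mult_op u"
  shows "(F - F', G - G') \<in> mult_op u"
  using mult_op_add[OF assms(1) mult_op_scale[OF assms(2), of "-1"]] by simp

text \<open>The cross terms cancel by symmetry. Convergence of \<open>G + \<i> *\<^sub>C F\<close>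
  thus forces convergence of both components.\<close>

lemma mult_op_norm_plus_i:
  assumes "(F, G) \<in> mult_op u"
  shows "(norm (G + \<i> *\<^sub>C F))\<^sup>2 = (norm G)\<^sup>2 + (norm F)\<^sup>2"
proof -
  have s: "cinner F G = cinner G F" by (rule mult_op_symmetric[OF assms assms])
  show ?thesis
    by (simp add: norm_l2_square cinner_add_left cinner_add_right cinner_scale_left cinner_scale_right s)
qed

text \<open>By \<open>mult_op_core\<close>, a vector orthogonal to this range is an eigenvector with
  eigenvalue \<open>\<i>\<close> unless it is zero, and a symmetric operator has no such
  eigenvector.\<close>

lemma dense_resolvent_range: "closure {l2_of (\<lambda>x. (complex_of_real (mm r x) + \<i>) * h x) | h. GP 0 0 h} = UNIV"
proof (rule csubspace_dense_if_orthogonal_trivial)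
  have G: "GP 0 0 (\<lambda>x. (complex_of_real (mm r x) + \<i>) * h x)" if "GP 0 0 h" for h
    using GP.add[OF GP_mm[OF that, of r] GP.scale[OF that, of \<i>]] by (simp add: distrib_right)
  have sq: "square_integrable (\<lambda>x. (complex_of_real (mm r x) + \<i>) * h x)" if "GP 0 0 h" for h
    by (rule schwartz_square_integrable[OF GP_schwartz[OF G[OF that]]])
  show "csubspace {l2_of (\<lambda>x. (complex_of_real (mm r x) + \<i>) * h x) | h. GP 0 0 h}"
    unfolding csubspace_def
  proof (intro conjI ballI allI)
    have "0 = l2_of (\<lambda>x. (complex_of_real (mm r x) + \<i>) * (0 * gauss 0 0 x))" by (simp add: l2_of_zero)
    moreover have "GP 0 0 (\<lambda>x. 0 * gauss 0 0 x)" by (intro GP.scale GP.gauss)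
    ultimately show "0 \<in> {l2_of (\<lambda>x. (complex_of_real (mm r x) + \<i>) * h x) | h. GP 0 0 h}"
      by (intro CollectI exI[of _ "\<lambda>x. 0 * gauss 0 0 x"]) simp
  next
    fix F H assume "F \<in> {l2_of (\<lambda>x. (complex_of_real (mm r x) + \<i>) * h x) | h. GP 0 0 h}" "H \<in> {l2_of (\<lambda>x. (complex_of_real (mm r x) + \<i>) * h x) | h. GP 0 0 h}"
    then obtain f g where "GP 0 0 f" "F = l2_of (\<lambda>x. (complex_of_real (mm r x) + \<i>) * f x)" "GP 0 0 g" "H = l2_of (\<lambda>x. (complex_of_real (mm r x) + \<i>) * g x)" by blast
    moreover from this have "F + H = l2_of (\<lambda>x. (complex_of_real (mm r x) + \<i>) * (f x + g x))"
      by (simp add: l2_of_add sq) (simp add: distrib_left)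
    ultimately show "F + H \<in> {l2_of (\<lambda>x. (complex_of_real (mm r x) + \<i>) * h x) | h. GP 0 0 h}" using GP.add by (intro CollectI exI[of _ "\<lambda>x. f x + g x"]) simp
  next
    fix F c assume "F \<in> {l2_of (\<lambda>x. (complex_of_real (mm r x) + \<i>) * h x) | h. GP 0 0 h}"
    then obtain f where "GP 0 0 f" "F = l2_of (\<lambda>x. (complex_of_real (mm r x) + \<i>) * f x)" by blast
    moreover from this have "c *\<^sub>C F = l2_of (\<lambda>x. (complex_of_real (mm r x) + \<i>) * (c * f x))"
      by (simp add: l2_of_scale sq mult.left_commute)
    ultimately show "c *\<^sub>C F \<in> {l2_of (\<lambda>x. (complex_of_real (mm r x) + \<i>) * h x) | h. GP 0 0 h}"
      using GP.scale by (intro CollectI exI[of _ "\<lambda>x. c * f x"]) simp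
  qed
  fix F assume orth: "\<And>k. k \<in> {l2_of (\<lambda>x. (complex_of_real (mm r x) + \<i>) * h x) | h. GP 0 0 h} \<Longrightarrow> cinner k F = 0"
  have "(F, (- \<i>) *\<^sub>C ((-1) *\<^sub>C F)) \<in> mult_op (mm r)" if "True"
  proof (rule mult_op_core[OF core_multiplier_mm])
    fix h assume h: "GP 0 0 h"
    have "l2_of (\<lambda>x. (complex_of_real (mm r x) + \<i>) * h x) = l2_of (\<lambda>x. complex_of_real (mm r x) * h x) + \<i> *\<^sub>C l2_of h"
      by (simp add: l2_of_scale l2_of_add square_integrable_cmult schwartz_square_integrable[OF GP_schwartz[OF h]]
          schwartz_square_integrable[OF GP_schwartz[OF GP_mm[OF h]]] distrib_right)
    moreover have "cinner F (l2_of (\<lambda>x. (complex_of_real (mm r x) + \<i>) * h x)) = 0"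
      using orth h by (subst cinner_commute) auto
    ultimately have "cinner F (l2_of (\<lambda>x. complex_of_real (mm r x) * h x)) = - \<i> * cinner F (l2_of h)"
      by (simp add: cinner_add_right cinner_scale_right eq_neg_iff_add_eq_0)
    then show "cinner F (l2_of (\<lambda>x. complex_of_real (mm r x) * h x)) = cinner ((- \<i>) *\<^sub>C ((-1) *\<^sub>C F)) (l2_of h)"
      by (simp add: cinner_scale_left)
  qed
  then have m: "(F, \<i> *\<^sub>C F) \<in> mult_op (mm r)" by simp
  have "cinner F (\<i> *\<^sub>C F) = cinner (\<i> *\<^sub>C F) F" by (rule mult_op_symmetric[OF m m])
  then have "cinner F F = 0" by (simp add: cinner_scale_left cinner_scale_right)
  then show "F = 0" by (simp add: cinner_self(3))
qed

text \<open>Essential self-adjointness on the Schwartz space. One inclusion is duality against the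
  core; for the other, \<open>dense_resolvent_range\<close> approximates a pair of the closed
  operator in graph norm by pairs over \<open>GP 0 0\<close>, whose rotations are Schwartz
  functions.\<close>

lemma closure_exponent: "closure (sop (generator \<theta> r)) = rotop \<theta> (mm r)"
proof
  have "sop (generator \<theta> r) \<subseteq> rotop \<theta> (mm r)"
  proof clarify
    fix F G assume "(F, G) \<in> sop (generator \<theta> r)"
    then obtain f where f: "schwartz f" "F = l2_of f" "G = l2_of (generator \<theta> r f)" by (rule sopE)
    show "(F, G) \<in> rotop \<theta> (mm r)"
      unfolding rotop_core_iff[OF core_multiplier_mm]
    proof (intro allI impI)
      fix h assume h: "GP 0 0 h"
      obtain w where w: "GP 0 0 w" "rot (cis \<theta>) (l2_of h) = l2_of w" using rot_GP[OF h, of \<theta>] by auto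
      have ws: "schwartz w" by (rule GP_schwartz[OF w(1)])
      show "cinner F (rot (cis \<theta>) (l2_of (\<lambda>x. complex_of_real (mm r x) * h x))) = cinner G (rot (cis \<theta>) (l2_of h))"
        using adjoint_pair_generator[of \<theta> r] f ws
        by (simp add: rot_mm[OF h ws w(2)] w(2) adjoint_pair_def)
    qed
  qed
  then show "closure (sop (generator \<theta> r)) \<subseteq> rotop \<theta> (mm r)"
    by (intro closure_minimal closed_rotop core_multiplier_mm)
next
  show "rotop \<theta> (mm r) \<subseteq> closure (sop (generator \<theta> r))"
  proof clarify
    fix F G assume "(F, G) \<in> rotop \<theta> (mm r)"
    then have m: "(rot (cis (- \<theta>)) F, rot (cis (- \<theta>)) G) \<in> mult_op (mm r)" by (simp add: rotop_def)
    have "rot (cis (- \<theta>)) G + \<i> *\<^sub>C rot (cis (- \<theta>)) F \<in> closure {l2_of (\<lambda>x. (complex_of_real (mm r x) + \<i>) * h x) | h. GP 0 0 h}"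
      by (simp add: dense_resolvent_range)
    then obtain s where s: "\<And>n. s n \<in> {l2_of (\<lambda>x. (complex_of_real (mm r x) + \<i>) * h x) | h. GP 0 0 h}"
      "s \<longlonglongrightarrow> rot (cis (- \<theta>)) G + \<i> *\<^sub>C rot (cis (- \<theta>)) F"
      unfolding closure_sequential by blast
    have "\<forall>n. \<exists>h. GP 0 0 h \<and> s n = l2_of (\<lambda>x. (complex_of_real (mm r x) + \<i>) * h x)" using s(1) by blast
    then obtain h where h: "\<And>n. GP 0 0 (h n)" "\<And>n. s n = l2_of (\<lambda>x. (complex_of_real (mm r x) + \<i>) * h n x)" by metis
    define a where "a n = l2_of (h n)" for n
    define b where "b n = l2_of (\<lambda>x. complex_of_real (mm r x) * h n x)" for n
    have sab: "s n = b n + \<i> *\<^sub>C a n" for n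
      unfolding h(2) a_def b_def
      by (simp add: l2_of_scale l2_of_add square_integrable_cmult schwartz_square_integrable[OF GP_schwartz[OF h(1)]]
          schwartz_square_integrable[OF GP_schwartz[OF GP_mm[OF h(1)]]] distrib_right)
    have d: "(a n - rot (cis (- \<theta>)) F, b n - rot (cis (- \<theta>)) G) \<in> mult_op (mm r)" for n
      unfolding a_def b_def by (intro mult_op_diff m mult_op_GP core_multiplier_mm h)
    have nn: "(norm (s n - (rot (cis (- \<theta>)) G + \<i> *\<^sub>C rot (cis (- \<theta>)) F)))\<^sup>2 =
        (norm (b n - rot (cis (- \<theta>)) G))\<^sup>2 + (norm (a n - rot (cis (- \<theta>)) F))\<^sup>2" for n
      using mult_op_norm_plus_i[OF d[of n]] by (simp add: sab scaleC_diff_right algebra_simps)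
    have s0: "(\<lambda>n. norm (s n - (rot (cis (- \<theta>)) G + \<i> *\<^sub>C rot (cis (- \<theta>)) F))) \<longlonglongrightarrow> 0"
      using s(2) by (simp add: LIM_zero_iff tendsto_norm_zero_iff)
    have "(\<lambda>n. a n - rot (cis (- \<theta>)) F) \<longlonglongrightarrow> 0"
      by (rule Lim_null_comparison[OF always_eventually s0]) (use nn in \<open>auto intro: power2_le_imp_le\<close>)
    then have a: "a \<longlonglongrightarrow> rot (cis (- \<theta>)) F" by (simp add: LIM_zero_iff)
    have "(\<lambda>n. b n - rot (cis (- \<theta>)) G) \<longlonglongrightarrow> 0"
      by (rule Lim_null_comparison[OF always_eventually s0]) (use nn in \<open>auto intro: power2_le_imp_le\<close>)
    then have b: "b \<longlonglongrightarrow> rot (cis (- \<theta>)) G" by (simp add: LIM_zero_iff)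
    have "(\<lambda>n. (rot (cis \<theta>) (a n), rot (cis \<theta>) (b n))) \<longlonglongrightarrow> (rot (cis \<theta>) (rot (cis (- \<theta>)) F), rot (cis \<theta>) (rot (cis (- \<theta>)) G))"
      by (intro tendsto_intros a b)
    moreover have "(rot (cis \<theta>) (a n), rot (cis \<theta>) (b n)) \<in> sop (generator \<theta> r)" for n
    proof -
      obtain w where w: "GP 0 0 w" "rot (cis \<theta>) (l2_of (h n)) = l2_of w" using rot_GP[OF h(1), of \<theta>] by auto
      have ws: "schwartz w" by (rule GP_schwartz[OF w(1)])
      show ?thesis unfolding a_def b_def rot_mm[OF h(1) ws w(2)] w(2) by (simp add: sop_iff ws)
    qed
    ultimately show "(F, G) \<in> closure (sop (generator \<theta> r))"
      unfolding closure_sequential by (intro exI[of _ "\<lambda>n. (rot (cis \<theta>) (a n), rot (cis \<theta>) (b n))"]) simp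
  qed
qed

section \<open>Projection-valued measures\<close>

locale pvm =
  fixes E :: "real set \<Rightarrow> l2 \<Rightarrow> l2"
  assumes pvm: "projection_valued_measure E"
begin

lemma UNIV_id: "E UNIV f = f"
  using pvm unfolding projection_valued_measure_def by blast

lemma sums: "range A \<subseteq> sets borel \<Longrightarrow> disjoint_family A \<Longrightarrow> (\<lambda>i. E (A i) f) sums E (\<Union>i. A i) f"
  for A :: "nat \<Rightarrow> real set"
  using pvm unfolding projection_valued_measure_def by blast

lemma sym': "S \<in> sets borel \<Longrightarrow> cinner (E S f) g = cinner f (E S g)"
  using pvm unfolding projection_valued_measure_def by blast

lemma idem': "S \<in> sets borel \<Longrightarrow> E S (E S f) = E S f"
  using pvm unfolding projection_valued_measure_def by blast

lemma ext: "(\<And>h. cinner h f = cinner h g) \<Longrightarrow> f = g"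
  by (metis cinner_diff_right cinner_self(3) right_minus_eq)

lemma add: "S \<in> sets borel \<Longrightarrow> E S (f + g) = E S f + E S g"
  by (rule ext) (simp add: sym'[symmetric] cinner_add_right)

lemma scale: "S \<in> sets borel \<Longrightarrow> E S (c *\<^sub>C f) = c *\<^sub>C E S f"
  by (rule ext) (simp add: sym'[symmetric] cinner_scale_right)

lemma diff: "S \<in> sets borel \<Longrightarrow> E S (f - g) = E S f - E S g"
  by (rule ext) (simp add: sym'[symmetric] cinner_diff_right)

lemma cinner_self_eq: "S \<in> sets borel \<Longrightarrow> cinner f (E S f) = complex_of_real ((norm (E S f))\<^sup>2)"
  by (metis cinner_self_norm idem' sym')

lemma norm_le: "S \<in> sets borel \<Longrightarrow> norm (E S f) \<le> norm f"
proof -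
  assume S: "S \<in> sets borel"
  have "(norm (E S f))\<^sup>2 \<le> norm f * norm (E S f)"
    using cinner_Cauchy_Schwarz[of f "E S f"] cinner_self_eq[OF S, of f] by (simp flip: of_real_power)
  then show ?thesis by (cases "E S f = 0") (auto simp: power2_eq_square)
qed

lemma empty: "E {} f = 0"
proof -
  have "(\<lambda>i::nat. E {} f) sums E (\<Union>i::nat. {}) f"
    by (rule sums) (auto simp: disjoint_family_on_def)
  then have "(\<lambda>i::nat. E {} f) \<longlonglongrightarrow> 0" by (intro summable_LIMSEQ_zero) (auto simp: sums_iff)
  then show ?thesis by (simp add: LIMSEQ_const_iff)
qed

lemma Un: 
  assumes "S \<in> sets borel" "T \<in> sets borel" "S \<inter> T = {}"
  shows "E (S \<union> T) f = E S f + E T f"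
proof -
  have "(\<lambda>i. E (binaryset S T i) f) sums E (\<Union>i. binaryset S T i) f"
    using assms by (intro sums) (auto simp: range_binaryset_eq disjoint_family_on_def binaryset_def)
  moreover have "(\<lambda>i. E (binaryset S T i) f) sums (\<Sum>i<2. E (binaryset S T i) f)"
    by (rule sums_finite) (auto simp: binaryset_def empty)
  ultimately have "E (\<Union>i. binaryset S T i) f = (\<Sum>i<2. E (binaryset S T i) f)" by (rule sums_unique2)
  then show ?thesis by (simp add: UN_binaryset_eq binaryset_def numeral_2_eq_2)
qed

text \<open>For \<open>g\<close> in the range of \<open>E T\<close>, additivity gives
  \<open>E (S \<union> T) g\<close> the squared norm of \<open>E S g\<close> plus that of
  \<open>g\<close>, but a projection cannot increase the norm.\<close>

lemma disjoint_mult: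
  assumes S: "S \<in> sets borel" and T: "T \<in> sets borel" and "S \<inter> T = {}"
  shows "E S (E T f) = 0"
proof -
  have U: "S \<union> T \<in> sets borel" using S T by simp
  define g where "g = E T f"
  have g: "E T g = g" unfolding g_def by (rule idem'[OF T])
  have "E (S \<union> T) g = E S g + g" using Un[OF assms, of g] g by simp
  have "(norm (E (S \<union> T) g))\<^sup>2 \<le> (norm g)\<^sup>2" using norm_le[OF U] by (intro power_mono) auto
  moreover have "complex_of_real ((norm (E (S \<union> T) g))\<^sup>2) = complex_of_real ((norm (E S g))\<^sup>2 + (norm g)\<^sup>2)"
    using cinner_self_eq[OF U, of g] cinner_self_eq[OF S, of g] \<open>E (S \<union> T) g = E S g + g\<close>
    by (simp add: cinner_add_right cinner_self_norm)
  ultimately have "(norm (E S g))\<^sup>2 \<le> 0" unfolding of_real_eq_iff by linarith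
  then show ?thesis by (simp add: g_def)
qed

lemma Int:
  assumes S: "S \<in> sets borel" and T: "T \<in> sets borel"
  shows "E S (E T f) = E (S \<inter> T) f"
proof -
  have 1: "E T f = E (S \<inter> T) f + E (T - S) f"
    using Un[of "S \<inter> T" "T - S" f] S T by (metis Int_Diff_Un Int_Diff_disjoint Int_commute sets.Diff sets.Int)
  have 2: "E S g = E (S \<inter> T) g + E (S - T) g" for g
    using Un[of "S \<inter> T" "S - T" g] S T by (metis Int_Diff_Un Int_Diff_disjoint sets.Diff sets.Int)
  have "E S (E T f) = E S (E (S \<inter> T) f) + E S (E (T - S) f)"
    unfolding 1 using S T by (simp add: add)
  also have "E S (E (T - S) f) = 0" using S T by (intro disjoint_mult) auto
  also have "E S (E (S \<inter> T) f) = E (S \<inter> T) (E (S \<inter> T) f) + E (S - T) (E (S \<inter> T) f)" by (rule 2)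
  also have "E (S - T) (E (S \<inter> T) f) = 0" using S T by (intro disjoint_mult) auto
  finally show ?thesis using S T by (simp add: idem')
qed

lemma bounded_linear: "S \<in> sets borel \<Longrightarrow> bounded_linear (E S)"
  by standard (auto simp: add scaleR_l2_def scale norm_le intro!: exI[of _ 1])

lemma incseq_LIMSEQ:
  assumes S: "\<And>n::nat. S n \<in> sets borel" and "incseq S"
  shows "(\<lambda>n. E (S n) f) \<longlonglongrightarrow> E (\<Union>n. S n) f"
proof -
  have d': "disjointed S i \<in> sets borel" for i
    unfolding disjointed_def using S by (intro sets.Diff sets.finite_UN) auto
  then have d: "range (disjointed S) \<subseteq> sets borel" by auto
  have "(\<lambda>n. \<Sum>i<Suc n. E (disjointed S i) f) \<longlonglongrightarrow> E (\<Union>n. S n) f"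
    using sums[OF d disjoint_family_disjointed, of f] unfolding UN_disjointed_eq sums_def
    by (rule LIMSEQ_Suc)
  moreover have "(\<Sum>i<Suc n. E (disjointed S i) f) = E (S n) f" for n
  proof (induction n)
    case 0 show ?case by simp
  next
    case (Suc n)
    have "disjointed S (Suc n) = S (Suc n) - S n"
      using \<open>incseq S\<close> by (simp add: disjointed_mono)
    then have "E (S (Suc n)) f = E (S n) f + E (disjointed S (Suc n)) f"
      using Un[of "S n" "disjointed S (Suc n)" f] S incseq_SucD[OF \<open>incseq S\<close>, of n] d'[of "Suc n"]
      by (simp add: Un_absorb1)
    then show ?case using Suc by simp
  qed
  ultimately show ?thesis by simp
qed

lemma spectral_measure_space [simp]: "space (spectral_measure E f) = UNIV" "sets (spectral_measure E f) = sets borel"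
proof -
  show "space (spectral_measure E f) = UNIV" unfolding spectral_measure_def by (rule space_measure_of) auto
  show "sets (spectral_measure E f) = sets borel"
    unfolding spectral_measure_def using sets.sigma_sets_eq[of borel] by (simp add: sets_measure_of)
qed

lemma emeasure_spectral_measure:
  assumes S: "S \<in> sets borel"
  shows "emeasure (spectral_measure E f) S = ennreal ((norm (E S f))\<^sup>2)"
proof -
  have e: "ennreal (Re (cinner f (E S f))) = ennreal ((norm (E S f))\<^sup>2)" if "S \<in> sets borel" for S
    using cinner_self_eq[OF that, of f] by simp
  have "emeasure (spectral_measure E f) S = ennreal (Re (cinner f (E S f)))"
  proof (rule emeasure_measure_of[OF spectral_measure_def])
    show "positive (sets (spectral_measure E f)) (\<lambda>S. ennreal (Re (cinner f (E S f))))"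
      by (simp add: positive_def empty)
    show "countably_additive (sets (spectral_measure E f)) (\<lambda>S. ennreal (Re (cinner f (E S f))))"
      unfolding countably_additive_def
    proof (intro allI impI)
      fix A :: "nat \<Rightarrow> real set" assume A: "range A \<subseteq> sets (spectral_measure E f)" "disjoint_family A"
      have A': "A i \<in> sets borel" for i using A(1) by auto
      have "(\<lambda>i. Re (cinner f (E (A i) f))) sums Re (cinner f (E (\<Union>i. A i) f))"
        using bounded_linear.sums[OF bounded_linear_cinner_right sums, of A f f] A by (intro sums_Re) auto
      then show "(\<Sum>i. ennreal (Re (cinner f (E (A i) f)))) = ennreal (Re (cinner f (E (\<Union>i. A i) f)))"
        using cinner_self_eq[OF A'] by (intro suminf_ennreal_eq) auto
    qed
  qed (use S in auto)
  then show ?thesis using e[OF S] by simp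
qed

lemma sum_norm_square:
  assumes "finite C" "\<And>c. c \<in> C \<Longrightarrow> S c \<in> sets borel" "disjoint_family_on S C"
  shows "(norm (\<Sum>c\<in>C. a c *\<^sub>R E (S c) f))\<^sup>2 = (\<Sum>c\<in>C. (a c)\<^sup>2 * (norm (E (S c) f))\<^sup>2)"
proof -
  have *: "cinner (a c *\<^sub>R E (S c) f) (a d *\<^sub>R E (S d) f) = (if c = d then complex_of_real ((a c)\<^sup>2 * (norm (E (S c) f))\<^sup>2) else 0)"
    if "c \<in> C" "d \<in> C" for c d
  proof (cases "c = d")
    case True
    then show ?thesis by (simp add: cinner_self_norm power_mult_distrib)
  next
    case False
    then have "S c \<inter> S d = {}" using assms(3) that by (auto simp: disjoint_family_on_def)
    then have "cinner (E (S c) f) (E (S d) f) = 0"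
      using disjoint_mult[OF assms(2)[OF that(1)] assms(2)[OF that(2)], of f] by (simp add: sym'[OF assms(2)[OF that(1)]])
    then show ?thesis using False by (simp add: cinner_scaleR_left cinner_scaleR_right)
  qed
  have "complex_of_real ((norm (\<Sum>c\<in>C. a c *\<^sub>R E (S c) f))\<^sup>2) = (\<Sum>c\<in>C. \<Sum>d\<in>C. cinner (a c *\<^sub>R E (S c) f) (a d *\<^sub>R E (S d) f))"
    unfolding cinner_self_norm[symmetric] by (simp only: cinner_sum_left cinner_sum_right) (rule sum.swap)
  also have "\<dots> = (\<Sum>c\<in>C. \<Sum>d\<in>C. if c = d then complex_of_real ((a c)\<^sup>2 * (norm (E (S c) f))\<^sup>2) else 0)"
    by (intro sum.cong refl *)
  also have "\<dots> = complex_of_real (\<Sum>c\<in>C. (a c)\<^sup>2 * (norm (E (S c) f))\<^sup>2)"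
    using assms(1) by (simp add: sum.delta)
  finally show ?thesis by (simp only: of_real_eq_iff)
qed

text \<open>The level sets of \<open>s\<close> split \<open>f\<close> into orthogonal pieces and the
  constant \<open>z\<close> can be spread over them, so both sides are the same finite weighted
  sum.\<close>

lemma simple_integral_norm:
  assumes s: "simple_function borel (s :: real \<Rightarrow> real)"
  shows "ennreal ((norm ((\<Sum>c\<in>range s. c *\<^sub>R E (s -` {c}) f) - z *\<^sub>R f))\<^sup>2) =
    (\<integral>\<^sup>+t. ennreal ((s t - z)\<^sup>2) \<partial>spectral_measure E f)"
proof -
  have fin: "finite (range s)" and m: "\<And>c. s -` {c} \<in> sets borel"
    using simple_functionD[OF s] by (auto simp: simple_function_def)
  note E_empty = empty
  have "(\<Sum>c\<in>range s. E (s -` {c}) f) = E (\<Union>c\<in>range s. s -` {c}) f"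
    using fin
  proof (induction rule: finite_induct)
    case empty show ?case by (simp add: E_empty)
  next
    case (insert c C)
    have "E (s -` {c} \<union> (\<Union>c\<in>C. s -` {c})) f = E (s -` {c}) f + E (\<Union>c\<in>C. s -` {c}) f"
      using insert m by (intro Un sets.finite_UN) auto
    then show ?case using insert by simp
  qed
  also have "(\<Union>c\<in>range s. s -` {c}) = UNIV" by auto
  finally have one: "(\<Sum>c\<in>range s. E (s -` {c}) f) = f" by (simp add: UNIV_id)
  have "(\<Sum>c\<in>range s. c *\<^sub>R E (s -` {c}) f) - z *\<^sub>R f = (\<Sum>c\<in>range s. (c - z) *\<^sub>R E (s -` {c}) f)"
  proof -
    have "z *\<^sub>R f = (\<Sum>c\<in>range s. z *\<^sub>R E (s -` {c}) f)"
      using one by (simp flip: scaleR_right.sum)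
    then show ?thesis by (simp add: sum_subtractf scaleR_left_diff_distrib)
  qed
  then have "(norm ((\<Sum>c\<in>range s. c *\<^sub>R E (s -` {c}) f) - z *\<^sub>R f))\<^sup>2 = (\<Sum>c\<in>range s. (c - z)\<^sup>2 * (norm (E (s -` {c}) f))\<^sup>2)"
  proof -
    have "disjoint_family_on (\<lambda>c. s -` {c}) (range s)" by (auto simp: disjoint_family_on_def)
    then show ?thesis using sum_norm_square[OF fin m, where a="\<lambda>c. c - z" and f=f]
      \<open>(\<Sum>c\<in>range s. c *\<^sub>R E (s -` {c}) f) - z *\<^sub>R f = (\<Sum>c\<in>range s. (c - z) *\<^sub>R E (s -` {c}) f)\<close>
      by simp
  qed
  also have "ennreal \<dots> = (\<Sum>c\<in>range s. ennreal ((c - z)\<^sup>2) * emeasure (spectral_measure E f) (s -` {c}))"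
    using m by (simp add: emeasure_spectral_measure ennreal_mult[symmetric] sum_ennreal)
  also have "\<dots> = (\<integral>\<^sup>+t. (\<Sum>c\<in>range s. ennreal ((c - z)\<^sup>2) * indicator (s -` {c}) t) \<partial>spectral_measure E f)"
  proof -
    note [measurable_cong] = spectral_measure_space(2) and [measurable] = m
    have "s -` {c} \<in> sets (spectral_measure E f)" for c using m by simp
    then show ?thesis by (subst nn_integral_sum) (simp_all add: nn_integral_cmult_indicator)
  qed
  also have "\<dots> = (\<integral>\<^sup>+t. ennreal ((s t - z)\<^sup>2) \<partial>spectral_measure E f)"
  proof (rule nn_integral_cong)
    fix t
    have "(\<Sum>c\<in>range s. ennreal ((c - z)\<^sup>2) * indicator (s -` {c}) t) = (\<Sum>c\<in>range s. if c = s t then ennreal ((c - z)\<^sup>2) else 0)"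
      by (intro sum.cong) (auto simp: indicator_def)
    then show "(\<Sum>c\<in>range s. ennreal ((c - z)\<^sup>2) * indicator (s -` {c}) t) = ennreal ((s t - z)\<^sup>2)"
      using fin by simp
  qed
  finally show ?thesis .
qed

text \<open>A spectral projection onto an interval commutes with the spectral integral of the identity,
  and on its range the latter differs from the midpoint by at most half the length.\<close>

lemma spectral_integral_restrict:
  assumes FG: "(F, G) \<in> spectral_integral E (\<lambda>t. t)"
  shows "(E {a..b} F, E {a..b} G) \<in> spectral_integral E (\<lambda>t. t)"
    and "\<And>z d. (\<And>t. t \<in> {a..b} \<Longrightarrow> \<bar>t - z\<bar> \<le> d) \<Longrightarrow> 0 \<le> d \<Longrightarrow>
       norm (E {a..b} G - z *\<^sub>R E {a..b} F) \<le> d * norm (E {a..b} F)"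
proof -
  note [measurable_cong] = spectral_measure_space(2)
  define F' where "F' = E {a..b} F"
  have I: "{a..b} \<in> sets borel" by simp
  obtain s :: "nat \<Rightarrow> real \<Rightarrow> real" where s: "\<And>n. simple_function borel (s n)"
    "(\<lambda>n. \<integral>\<^sup>+ t. ennreal ((t - s n t)\<^sup>2) \<partial>spectral_measure E F) \<longlonglongrightarrow> 0"
    "(\<lambda>n. \<Sum>c\<in>range (s n). c *\<^sub>R E (s n -` {c}) F) \<longlonglongrightarrow> G"
    using FG unfolding spectral_integral_def by blast
  have sm: "s n -` {c} \<in> sets borel" for n c using simple_functionD[OF s(1)] by auto
  have smm[measurable]: "s n \<in> borel_measurable borel" for n using s(1) by (rule borel_measurable_simple_function)
  \<comment> \<open>Spectral projections commute, so passing from \<open>F\<close> to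
    \<open>F'\<close> can only shrink the spectral measure; simple functions that approximate for
    \<open>F\<close> also approximate for \<open>F'\<close>.\<close>
  have le: "emeasure (spectral_measure E F') S \<le> emeasure (spectral_measure E F) S" if "S \<in> sets borel" for S
  proof -
    have "E S F' = E {a..b} (E S F)" unfolding F'_def using that by (simp add: Int Int_commute)
    then show ?thesis using that norm_le[OF I, of "E S F"]
      by (simp add: emeasure_spectral_measure ennreal_leI power_mono)
  qed
  have leM: "spectral_measure E F' \<le> spectral_measure E F"
    by (subst le_measure) (simp_all add: le)
  have nle: "(\<integral>\<^sup>+ t. h t \<partial>spectral_measure E F') \<le> (\<integral>\<^sup>+ t. h t \<partial>spectral_measure E F)" for h
    by (rule nn_integral_mono_measure) (auto simp: leM)
  have lim1: "(\<lambda>n. \<integral>\<^sup>+ t. ennreal ((t - s n t)\<^sup>2) \<partial>spectral_measure E F') \<longlonglongrightarrow> 0"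
    by (rule tendsto_sandwich[OF _ _ tendsto_const s(2)]) (auto simp: nle)
  have eq: "(\<Sum>c\<in>range (s n). c *\<^sub>R E (s n -` {c}) F') = E {a..b} (\<Sum>c\<in>range (s n). c *\<^sub>R E (s n -` {c}) F)" for n
    using bounded_linear.linear[OF bounded_linear[OF I]] sm
    by (simp add: linear_sum linear_scale F'_def Int Int_commute)
  have lim2: "(\<lambda>n. \<Sum>c\<in>range (s n). c *\<^sub>R E (s n -` {c}) F') \<longlonglongrightarrow> E {a..b} G"
    unfolding eq by (rule bounded_linear.tendsto[OF bounded_linear[OF I] s(3)])
  show "(E {a..b} F, E {a..b} G) \<in> spectral_integral E (\<lambda>t. t)"
    unfolding F'_def[symmetric] spectral_integral_def using s(1) lim1 lim2 by blast
  show "norm (E {a..b} G - z *\<^sub>R E {a..b} F) \<le> d * norm (E {a..b} F)"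
    if z: "\<And>t. t \<in> {a..b} \<Longrightarrow> \<bar>t - z\<bar> \<le> d" and d: "0 \<le> d" for z d
  proof -
    have tot: "emeasure (spectral_measure E F') UNIV = ennreal ((norm F')\<^sup>2)"
      by (simp add: emeasure_spectral_measure UNIV_id)
    have out: "emeasure (spectral_measure E F') (- {a..b}) = 0"
      unfolding F'_def by (simp add: emeasure_spectral_measure disjoint_mult)
    have ae: "AE t in spectral_measure E F'. t \<in> {a..b}"
      by (rule AE_I[OF _ out]) auto
    \<comment> \<open>Young's inequality with a free weight \<open>e\<close>: the coefficient
      \<open>k\<close> of the approximation error may be large because that error tends to zero, and
      \<open>e\<close> is removed afterwards.\<close>
    have bound: "(norm (E {a..b} G - z *\<^sub>R F'))\<^sup>2 \<le> (1 + e) * d\<^sup>2 * (norm F')\<^sup>2" if e: "0 < e" for e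
    proof -
      define k where "k = 1 + 1 / e"
      have k: "0 < k" using e by (simp add: k_def add_pos_pos)
      have ineq: "(x + y)\<^sup>2 \<le> k * x\<^sup>2 + (1 + e) * y\<^sup>2" for x y :: real
      proof -
        have "0 \<le> (x / e - y)\<^sup>2 * e" using e by simp
        also have "\<dots> = x\<^sup>2 / e - 2 * x * y + e * y\<^sup>2" using e by (simp add: power2_eq_square field_simps)
        finally show ?thesis by (simp add: k_def power2_sum algebra_simps)
      qed
      have ineqn: "ennreal ((norm ((\<Sum>c\<in>range (s n). c *\<^sub>R E (s n -` {c}) F') - z *\<^sub>R F'))\<^sup>2) \<le>
        ennreal k * (\<integral>\<^sup>+ t. ennreal ((t - s n t)\<^sup>2) \<partial>spectral_measure E F') + ennreal ((1 + e) * d\<^sup>2 * (norm F')\<^sup>2)" for n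
      proof -
        have "ennreal ((norm ((\<Sum>c\<in>range (s n). c *\<^sub>R E (s n -` {c}) F') - z *\<^sub>R F'))\<^sup>2) =
            (\<integral>\<^sup>+t. ennreal ((s n t - z)\<^sup>2) \<partial>spectral_measure E F')"
          by (rule simple_integral_norm[OF s(1)])
        also have "\<dots> \<le> (\<integral>\<^sup>+t. ennreal k * ennreal ((t - s n t)\<^sup>2) + ennreal ((1 + e) * d\<^sup>2) \<partial>spectral_measure E F')"
        proof (rule nn_integral_mono_AE)
          show "AE t in spectral_measure E F'. ennreal ((s n t - z)\<^sup>2) \<le> ennreal k * ennreal ((t - s n t)\<^sup>2) + ennreal ((1 + e) * d\<^sup>2)"
            using ae
          proof eventually_elim
            case (elim t)
            have "(s n t - z)\<^sup>2 \<le> k * (s n t - t)\<^sup>2 + (1 + e) * (t - z)\<^sup>2" using ineq[of "s n t - t" "t - z"] by simp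
            also have "(t - z)\<^sup>2 \<le> d\<^sup>2" using z[OF elim] by (metis abs_ge_zero power2_abs power_mono)
            then have "k * (s n t - t)\<^sup>2 + (1 + e) * (t - z)\<^sup>2 \<le> k * (t - s n t)\<^sup>2 + (1 + e) * d\<^sup>2"
              using e k by (intro add_mono mult_left_mono) (auto simp: power2_commute)
            finally show ?case using k e by (simp add: ennreal_mult[symmetric] ennreal_plus[symmetric] ennreal_leI del: ennreal_plus)
          qed
        qed
        also have "\<dots> = ennreal k * (\<integral>\<^sup>+ t. ennreal ((t - s n t)\<^sup>2) \<partial>spectral_measure E F') + ennreal ((1 + e) * d\<^sup>2) * ennreal ((norm F')\<^sup>2)"
          by (subst nn_integral_add) (auto simp: nn_integral_cmult tot[symmetric])
        finally show ?thesis using e by (simp add: ennreal_mult[symmetric])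
      qed
      have L1: "(\<lambda>n. ennreal ((norm ((\<Sum>c\<in>range (s n). c *\<^sub>R E (s n -` {c}) F') - z *\<^sub>R F'))\<^sup>2)) \<longlonglongrightarrow>
          ennreal ((norm (E {a..b} G - z *\<^sub>R F'))\<^sup>2)"
        by (intro tendsto_intros lim2)
      have L2: "(\<lambda>n. ennreal k * (\<integral>\<^sup>+ t. ennreal ((t - s n t)\<^sup>2) \<partial>spectral_measure E F') + ennreal ((1 + e) * d\<^sup>2 * (norm F')\<^sup>2))
          \<longlonglongrightarrow> ennreal k * 0 + ennreal ((1 + e) * d\<^sup>2 * (norm F')\<^sup>2)"
        by (intro tendsto_add tendsto_const ennreal_tendsto_cmult lim1) simp
      have "ennreal ((norm (E {a..b} G - z *\<^sub>R F'))\<^sup>2) \<le> ennreal k * 0 + ennreal ((1 + e) * d\<^sup>2 * (norm F')\<^sup>2)"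
        by (rule LIMSEQ_le[OF L1 L2]) (use ineqn in blast)
      then show ?thesis using e by simp
    qed
    have "(norm (E {a..b} G - z *\<^sub>R F'))\<^sup>2 \<le> d\<^sup>2 * (norm F')\<^sup>2"
    proof (rule field_le_epsilon)
      fix e :: real assume e: "0 < e"
      \<comment> \<open>The weight \<open>e / (q + 1)\<close> is used instead of
        \<open>e / q\<close> so that \<open>q = 0\<close> is covered.\<close>
      define q where "q = d\<^sup>2 * (norm F')\<^sup>2"
      have q: "0 \<le> q" by (simp add: q_def)
      have "(norm (E {a..b} G - z *\<^sub>R F'))\<^sup>2 \<le> (1 + e / (q + 1)) * d\<^sup>2 * (norm F')\<^sup>2"
        using e q by (intro bound) (simp add: add_nonneg_pos)
      also have "\<dots> = q + e * (q / (q + 1))" by (simp add: q_def algebra_simps)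
      also have "\<dots> \<le> q + e * 1" using e q by (intro add_left_mono mult_left_mono) auto
      finally show "(norm (E {a..b} G - z *\<^sub>R F'))\<^sup>2 \<le> d\<^sup>2 * (norm F')\<^sup>2 + e" by (simp add: q_def)
    qed
    then have "(norm (E {a..b} G - z *\<^sub>R F'))\<^sup>2 \<le> (d * norm F')\<^sup>2" by (simp add: power_mult_distrib)
    then show ?thesis unfolding F'_def[symmetric] using d by (auto intro: power2_le_imp_le)
  qed
qed

end

text \<open>Two projection-valued measures agree as soon as the ranges of one are contained in those of
  the other for compact intervals: containment for complementary half-lines forces equality there.\<close>

lemma pvm_eqI:
  assumes "pvm E" "pvm P"
    and sub: "\<And>a b f. P {a..b} (E {a..b} f) = E {a..b} f"
    and S: "S \<in> sets borel"
  shows "E S f = P S f"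
proof -
  interpret E: pvm E by fact
  interpret P: pvm P by fact
  have half: "E {..a} f = P {..a} f" for a f
  proof -
    have "(\<lambda>n. E {- real n..a} f) \<longlonglongrightarrow> E (\<Union>n. {- real n..a}) f"
      by (rule E.incseq_LIMSEQ) (auto simp: incseq_def)
    moreover have "(\<Union>n. {- real n..a}) = {..a}"
      by auto (metis minus_le_iff real_arch_simple)
    ultimately have l1: "(\<lambda>n. E {- real n..a} f) \<longlonglongrightarrow> E {..a} f" by simp
    have "P {..a} (E {- real n..a} f) = E {- real n..a} f" for n
      by (subst (1 2) sub[symmetric]) (simp add: P.Int)
    then have "(\<lambda>n. E {- real n..a} f) \<longlonglongrightarrow> P {..a} (E {..a} f)"
      using bounded_linear.tendsto[OF P.bounded_linear l1, of "{..a}"] by simp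
    then have 1: "P {..a} (E {..a} f) = E {..a} f" using l1 LIMSEQ_unique by blast
    \<comment> \<open>Compact intervals strictly above \<open>a\<close> exhaust the complementary
      half-line, and the inclusion of ranges makes \<open>P {..a}\<close> vanish on each of their
      spectral ranges.\<close>
    have "(\<lambda>n. E {a + 1 / real (Suc n)..real n} f) \<longlonglongrightarrow> E (\<Union>n. {a + 1 / real (Suc n)..real n}) f"
      by (rule E.incseq_LIMSEQ) (auto simp: incseq_def field_simps intro: order_trans)
    moreover have "(\<Union>n. {a + 1 / real (Suc n)..real n}) = {a<..}"
    proof (intro set_eqI iffI)
      fix t assume "t \<in> {a<..}"
      then have "0 < t - a" by simp
      then obtain n where n: "inverse (real (Suc n)) < t - a" using reals_Archimedean by blast
      obtain m where m: "t \<le> real m" using real_arch_simple by blast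
      have "1 / real (Suc (max n m)) \<le> inverse (real (Suc n))" by (simp add: field_simps)
      then have "t \<in> {a + 1 / real (Suc (max n m))..real (max n m)}" using n m by auto
      then show "t \<in> (\<Union>n. {a + 1 / real (Suc n)..real n})" by blast
    next
      fix t assume "t \<in> (\<Union>n. {a + 1 / real (Suc n)..real n})"
      then obtain n where "a + 1 / real (Suc n) \<le> t" by auto
      moreover have "0 < 1 / real (Suc n)" by simp
      ultimately have "a < t" by linarith
      then show "t \<in> {a<..}" by simp
    qed
    ultimately have l2: "(\<lambda>n. E {a + 1 / real (Suc n)..real n} f) \<longlonglongrightarrow> E {a<..} f" by simp
    have "P {..a} (E {a + 1 / real (Suc n)..real n} f) = 0" for n
    proof -
      have "0 < 1 / real (Suc n)" by simp
      then have "{..a} \<inter> {a + 1 / real (Suc n)..real n} = {}" by (auto simp del: of_nat_Suc)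
      then show ?thesis by (subst sub[symmetric]) (simp add: P.Int P.empty del: of_nat_Suc)
    qed
    then have "(\<lambda>n. 0) \<longlonglongrightarrow> P {..a} (E {a<..} f)"
      using bounded_linear.tendsto[OF P.bounded_linear l2, of "{..a}"] by simp
    then have 2: "P {..a} (E {a<..} f) = 0" by (simp add: LIMSEQ_const_iff)
    have "{..a} \<union> {a<..} = UNIV" "{..a} \<inter> {a<..} = {}" by auto
    then have "f = E {..a} f + E {a<..} f" using E.Un[of "{..a}" "{a<..}" f] E.UNIV_id[of f] by auto
    then have "P {..a} f = P {..a} (E {..a} f + E {a<..} f)" by simp
    then show ?thesis using 1 2 by (simp add: P.add)
  qed
  have "Int_stable (range (\<lambda>a::real. {..a}))" by (auto simp: Int_stable_def)
  moreover have "range (\<lambda>a::real. {..a}) \<subseteq> Pow UNIV" by simp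
  moreover have "S \<in> sigma_sets UNIV (range (\<lambda>a::real. {..a}))"
    using S by (simp add: borel_eq_atMost)
  ultimately have "\<forall>f. E S f = P S f"
  proof (induction rule: sigma_sets_induct_disjoint)
    case (basic A) then show ?case using half by auto
  next
    case empty show ?case by (simp add: E.empty P.empty)
  next
    case (compl A)
    have A: "A \<in> sets borel" using compl(1) by (simp add: borel_eq_atMost)
    have "A \<union> (UNIV - A) = UNIV" by auto
    then have "f = E A f + E (UNIV - A) f" "f = P A f + P (UNIV - A) f" for f
      using E.Un[of A "UNIV - A" f] P.Un[of A "UNIV - A" f] A by (auto simp: E.UNIV_id P.UNIV_id)
    then show ?case using compl(2) by (metis add_left_cancel)
  next
    case (union A)
    have A: "range A \<subseteq> sets borel" using union(2) by (simp add: borel_eq_atMost)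
    show ?case
    proof
      fix f
      have "(\<lambda>i. E (A i) f) sums E (\<Union>i. A i) f" "(\<lambda>i. P (A i) f) sums P (\<Union>i. A i) f"
        using E.sums[OF A union(1)] P.sums[OF A union(1)] by auto
      then show "E (\<Union>i. A i) f = P (\<Union>i. A i) f" using union(3) by (simp add: sums_unique2)
    qed
  qed
  then show ?thesis by simp
qed

text \<open>Values outside the Borel sets are arbitrary, so equality on Borel sets is the most that
  uniqueness can give. It is enough because level sets of simple functions are Borel.\<close>

lemma spectral_integral_cong:
  assumes eq: "\<And>S f. S \<in> sets borel \<Longrightarrow> E S f = P S f"
  shows "spectral_integral E u = spectral_integral P u"
proof -
  have sm: "spectral_measure E f = spectral_measure P f" for f
    unfolding spectral_measure_def
    by (rule measure_of_eq) (auto simp: eq sets.sigma_sets_eq[of borel, simplified])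
  have "(\<Sum>c\<in>range s. c *\<^sub>R E (s -` {c}) f) = (\<Sum>c\<in>range s. c *\<^sub>R P (s -` {c}) f)"
    if "simple_function borel s" for s :: "real \<Rightarrow> real" and f
    using simple_functionD[OF that] by (intro sum.cong refl) (simp add: eq)
  then show ?thesis unfolding spectral_integral_def sm by (intro Collect_cong) (auto cong: conj_cong)
qed

section \<open>Spectral measures of multiplication operators\<close>

lemma square_integrable_bounded_mult:
  assumes [measurable]: "u \<in> borel_measurable borel" and b: "\<And>x. \<bar>u x\<bar> \<le> B" and f: "square_integrable f"
  shows "square_integrable (\<lambda>x. complex_of_real (u x) * f x)"
proof -
  have [measurable]: "f \<in> borel_measurable borel" using f by (rule square_integrable_measurable)
  have i: "integrable lborel (\<lambda>x. B\<^sup>2 * (cmod (f x))\<^sup>2)" using f by (simp add: square_integrable_def)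
  have "(cmod (complex_of_real (u x) * f x))\<^sup>2 \<le> B\<^sup>2 * (cmod (f x))\<^sup>2" for x
    using b[of x] by (auto simp: norm_mult power_mult_distrib intro!: mult_right_mono) (metis abs_ge_zero power2_abs power_mono)
  then have "integrable lborel (\<lambda>x. (cmod (complex_of_real (u x) * f x))\<^sup>2)"
    by (intro Bochner_Integration.integrable_bound[OF i]) (auto intro: order_trans[OF _ abs_ge_self])
  then show ?thesis by (simp add: square_integrable_def)
qed

lemma l2_of_tendsto:
  assumes f: "\<And>n. square_integrable (f n)" and F: "square_integrable F" and g: "square_integrable g"
    and b: "\<And>n x. cmod (f n x - F x) \<le> cmod (g x)" and lim: "\<And>x. (\<lambda>n. f n x) \<longlonglongrightarrow> F x"
  shows "(\<lambda>n. l2_of (f n)) \<longlonglongrightarrow> l2_of F"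
proof -
  have [measurable]: "f n \<in> borel_measurable borel" "F \<in> borel_measurable borel" for n
    using f F by (auto intro: square_integrable_measurable)
  have "(\<lambda>n. \<integral>x. (cmod (f n x - F x))\<^sup>2 \<partial>lborel) \<longlonglongrightarrow> (\<integral>x. 0 \<partial>(lborel :: (real^2) measure))"
  proof (rule integral_dominated_convergence[where w="\<lambda>x. (cmod (g x))\<^sup>2"])
    show "integrable lborel (\<lambda>x. (cmod (g x))\<^sup>2)" using g by (simp add: square_integrable_def)
    have "(\<lambda>n. (cmod (f n x - F x))\<^sup>2) \<longlonglongrightarrow> (cmod (F x - F x))\<^sup>2" for x by (intro tendsto_intros lim)
    then show "AE x in lborel. (\<lambda>n. (cmod (f n x - F x))\<^sup>2) \<longlonglongrightarrow> 0" by simp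
    show "AE x in lborel. norm ((cmod (f n x - F x))\<^sup>2) \<le> (cmod (g x))\<^sup>2" for n using b by (auto intro!: power_mono)
  qed measurable
  then have "(\<lambda>n. (norm (l2_of (f n) - l2_of F))\<^sup>2) \<longlonglongrightarrow> 0"
    by (simp add: l2_of_diff f F norm_l2_of square_integrable_diff)
  then have "(\<lambda>n. sqrt ((norm (l2_of (f n) - l2_of F))\<^sup>2)) \<longlonglongrightarrow> sqrt 0" by (rule tendsto_real_sqrt)
  then show ?thesis by (simp add: LIM_zero_iff tendsto_norm_zero_iff)
qed

definition bproj :: "(real^2 \<Rightarrow> real) \<Rightarrow> real set \<Rightarrow> l2 \<Rightarrow> l2" where
  "bproj \<phi> S F = l2_of (\<lambda>x. complex_of_real (indicator S (\<phi> x)) * rep_l2 F x)"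

definition rotproj :: "real \<Rightarrow> (real^2 \<Rightarrow> real) \<Rightarrow> real set \<Rightarrow> l2 \<Rightarrow> l2" where
  "rotproj \<theta> \<phi> S F = rot (cis \<theta>) (bproj \<phi> S (rot (cis (- \<theta>)) F))"

context
  fixes \<phi> :: "real^2 \<Rightarrow> real"
  assumes \<phi>[measurable]: "\<phi> \<in> borel_measurable borel"
begin

lemma square_integrable_indicator:
  assumes S[measurable]: "S \<in> sets borel" and f: "square_integrable f"
  shows "square_integrable (\<lambda>x. complex_of_real (indicator S (\<phi> x)) * f x)"
  by (rule square_integrable_bounded_mult[where B=1]) (auto simp: f indicator_def)

lemma bproj_l2_of:
  assumes S[measurable]: "S \<in> sets borel" and f: "square_integrable f"
  shows "bproj \<phi> S (l2_of f) = l2_of (\<lambda>x. complex_of_real (indicator S (\<phi> x)) * f x)"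
proof -
  have r: "l2_rel (rep_l2 (l2_of f)) (rep_l2 (l2_of f))" "l2_of (rep_l2 (l2_of f)) = l2_of f"
    using Quotient_rep_reflp[OF Quotient_l2] Quotient_abs_rep[OF Quotient_l2] by blast+
  then have rs: "square_integrable (rep_l2 (l2_of f))" by (simp add: l2_rel_def)
  then have "AE x in lborel. rep_l2 (l2_of f) x = f x" using r(2) f by (simp add: l2_of_eq_iff)
  then have "AE x in lborel. complex_of_real (indicator S (\<phi> x)) * rep_l2 (l2_of f) x = complex_of_real (indicator S (\<phi> x)) * f x"
    by eventually_elim simp
  then show ?thesis unfolding bproj_def
    by (simp add: l2_of_eq_iff square_integrable_indicator S rs f)
qed

lemma pvm_rotproj: "pvm (rotproj \<theta> \<phi>)"
proof
  show "projection_valued_measure (rotproj \<theta> \<phi>)"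
    unfolding projection_valued_measure_def
  proof (intro conjI ballI allI impI)
    fix S :: "real set" and F G assume S: "S \<in> sets borel"
    obtain f where f: "square_integrable f" "rot (cis (- \<theta>)) F = l2_of f" by (rule l2_cases)
    obtain g where g: "square_integrable g" "rot (cis (- \<theta>)) G = l2_of g" by (rule l2_cases)
    show "rotproj \<theta> \<phi> S (rotproj \<theta> \<phi> S F) = rotproj \<theta> \<phi> S F"
      by (simp add: rotproj_def f bproj_l2_of S square_integrable_indicator)
         (intro arg_cong[where f="\<lambda>z. rot _ (l2_of z)"] ext, simp add: indicator_def)
    show "cinner (rotproj \<theta> \<phi> S F) G = cinner F (rotproj \<theta> \<phi> S G)"
      by (simp add: rotproj_def cinner_rot_cis cinner_rot_cis' f g bproj_l2_of S cinner_l2_of square_integrable_indicator)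
        (simp add: mult_ac)
  next
    fix F
    obtain f where f: "square_integrable f" "rot (cis (- \<theta>)) F = l2_of f" by (rule l2_cases)
    show "rotproj \<theta> \<phi> UNIV F = F"
      by (simp add: rotproj_def f bproj_l2_of) (simp flip: f(2))
  next
    fix A :: "nat \<Rightarrow> real set" and F assume A: "range A \<subseteq> sets borel" "disjoint_family A"
    have A': "A i \<in> sets borel" for i using A(1) by auto
    obtain f where f: "square_integrable f" "rot (cis (- \<theta>)) F = l2_of f" by (rule l2_cases)
    have part: "(\<Sum>i<n. rotproj \<theta> \<phi> (A i) F) = rot (cis \<theta>) (l2_of (\<lambda>x. complex_of_real (indicator (\<Union>i<n. A i) (\<phi> x)) * f x))" for n
    proof (induction n)
      case 0 show ?case by (simp flip: l2_of_zero)
    next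
      case (Suc n)
      have U: "(\<Union>i<n. A i) \<in> sets borel" using A' by auto
      have "indicator (\<Union>i<Suc n. A i) t = (indicator (\<Union>i<n. A i) t + indicator (A n) t :: real)" for t
        using A(2) by (auto simp: indicator_def lessThan_Suc disjoint_family_on_def) (metis Int_iff empty_iff less_irrefl UNIV_I)
      then have "l2_of (\<lambda>x. complex_of_real (indicator (\<Union>i<Suc n. A i) (\<phi> x)) * f x) =
         l2_of (\<lambda>x. complex_of_real (indicator (\<Union>i<n. A i) (\<phi> x)) * f x) + l2_of (\<lambda>x. complex_of_real (indicator (A n) (\<phi> x)) * f x)"
        by (simp add: l2_of_add square_integrable_indicator U A' f distrib_right)
      then show ?case using Suc by (simp add: rotproj_def f bproj_l2_of A' rot_cis_linear)
    qed
    have U: "(\<Union>i. A i) \<in> sets borel" "(\<Union>i<n. A i) \<in> sets borel" for n using A' by auto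
    have "(\<lambda>n. l2_of (\<lambda>x. complex_of_real (indicator (\<Union>i<n. A i) (\<phi> x)) * f x)) \<longlonglongrightarrow> l2_of (\<lambda>x. complex_of_real (indicator (\<Union>i. A i) (\<phi> x)) * f x)"
    proof (rule l2_of_tendsto[where g=f])
      show "cmod (complex_of_real (indicator (\<Union>i<n. A i) (\<phi> x)) * f x - complex_of_real (indicator (\<Union>i. A i) (\<phi> x)) * f x) \<le> cmod (f x)" for n x
        by (auto simp: indicator_def)
      show "(\<lambda>n. complex_of_real (indicator (\<Union>i<n. A i) (\<phi> x)) * f x) \<longlonglongrightarrow> complex_of_real (indicator (\<Union>i. A i) (\<phi> x)) * f x" for x
        by (intro tendsto_intros LIMSEQ_indicator_UN)
    qed (auto simp: square_integrable_indicator U f)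
    then show "(\<lambda>i. rotproj \<theta> \<phi> (A i) F) sums rotproj \<theta> \<phi> (\<Union>i. A i) F"
      unfolding sums_def part by (simp add: rotproj_def f bproj_l2_of U tendsto_rot)
  qed
qed

text \<open>The spectral measure of \<open>F\<close> is the image under \<phi> of the measure with
  density \<open>(cmod (f x))\<^sup>2\<close>, so spectral integrals become Lebesgue integrals over
  the plane.\<close>

lemma nn_integral_spectral_measure_rotproj:
  assumes f: "square_integrable f" "rot (cis (- \<theta>)) F = l2_of f" and [measurable]: "h \<in> borel_measurable borel"
  shows "(\<integral>\<^sup>+t. h t \<partial>spectral_measure (rotproj \<theta> \<phi>) F) = (\<integral>\<^sup>+x. h (\<phi> x) * ennreal ((cmod (f x))\<^sup>2) \<partial>lborel)"
proof -
  interpret pvm "rotproj \<theta> \<phi>" by (rule pvm_rotproj)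
  have [measurable]: "f \<in> borel_measurable borel" using f(1) by (rule square_integrable_measurable)
  have "spectral_measure (rotproj \<theta> \<phi>) F = distr (density lborel (\<lambda>x. ennreal ((cmod (f x))\<^sup>2))) borel \<phi>"
  proof (rule measure_eqI)
    fix S assume "S \<in> sets (spectral_measure (rotproj \<theta> \<phi>) F)"
    then have S[measurable]: "S \<in> sets borel" by simp
    have "emeasure (spectral_measure (rotproj \<theta> \<phi>) F) S = ennreal ((norm (l2_of (\<lambda>x. complex_of_real (indicator S (\<phi> x)) * f x)))\<^sup>2)"
      using f by (simp add: emeasure_spectral_measure[OF S]) (simp add: rotproj_def rot_cis_linear bproj_l2_of)
    also have "\<dots> = (\<integral>\<^sup>+x. ennreal ((cmod (complex_of_real (indicator S (\<phi> x)) * f x))\<^sup>2) \<partial>lborel)"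
      by (rule norm_l2_of_nn) (simp add: square_integrable_indicator f)
    also have "\<dots> = (\<integral>\<^sup>+x. ennreal ((cmod (f x))\<^sup>2) * indicator (\<phi> -` S) x \<partial>lborel)"
      by (intro nn_integral_cong) (auto simp: indicator_def)
    also have "\<dots> = emeasure (distr (density lborel (\<lambda>x. ennreal ((cmod (f x))\<^sup>2))) borel \<phi>) S"
      using measurable_sets_borel[OF \<phi> S] by (simp add: emeasure_distr emeasure_density)
    finally show "emeasure (spectral_measure (rotproj \<theta> \<phi>) F) S = emeasure (distr (density lborel (\<lambda>x. ennreal ((cmod (f x))\<^sup>2))) borel \<phi>) S" .
  qed simp
  then show ?thesis by (simp add: nn_integral_distr nn_integral_density mult.commute)
qed

text \<open>By the image formula, the distance of \<open>u\<close> and a simple function in the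
  spectral measure is the L2 distance of their products with \<open>f\<close>; both operators thus
  arise from the same approximating sequences.\<close>

lemma spectral_integral_rotproj:
  assumes u[measurable]: "u \<in> borel_measurable borel"
  shows "spectral_integral (rotproj \<theta> \<phi>) u = rotop \<theta> (\<lambda>x. u (\<phi> x))"
proof (intro set_eqI iffI; clarify)
  have approx: "(\<Sum>c\<in>range s. c *\<^sub>R rotproj \<theta> \<phi> (s -` {c}) F) = rot (cis \<theta>) (l2_of (\<lambda>x. complex_of_real (s (\<phi> x)) * f x))
      \<and> square_integrable (\<lambda>x. complex_of_real (s (\<phi> x)) * f x)"
    if s: "simple_function borel (s :: real \<Rightarrow> real)" and f: "square_integrable f" "rot (cis (- \<theta>)) F = l2_of f" for s F f
  proof -
    have fin: "finite (range s)" using s by (simp add: simple_function_def)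
    have m: "s -` {c} \<in> sets borel" for c using simple_functionD[OF s] by auto
    have q: "square_integrable (\<lambda>x. complex_of_real c * (complex_of_real (indicator (s -` {c}) (\<phi> x)) * f x))" for c
      by (intro square_integrable_cmult square_integrable_indicator m f)
    have "(\<Sum>c\<in>range s. c *\<^sub>R rotproj \<theta> \<phi> (s -` {c}) F) =
        (\<Sum>c\<in>range s. rot (cis \<theta>) (l2_of (\<lambda>x. complex_of_real c * (complex_of_real (indicator (s -` {c}) (\<phi> x)) * f x))))"
      by (intro sum.cong refl)
         (simp add: rotproj_def f bproj_l2_of m scaleR_l2_def square_integrable_indicator flip: rot_cis_linear l2_of_scale)
    also have "\<dots> = rot (cis \<theta>) (\<Sum>c\<in>range s. l2_of (\<lambda>x. complex_of_real c * (complex_of_real (indicator (s -` {c}) (\<phi> x)) * f x)))"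
      using bounded_linear.linear[OF bounded_linear_rot[of "cis \<theta>"]] by (simp add: linear_sum)
    also have "\<dots> = rot (cis \<theta>) (l2_of (\<lambda>x. \<Sum>c\<in>range s. complex_of_real c * (complex_of_real (indicator (s -` {c}) (\<phi> x)) * f x)))"
      by (subst l2_of_sum) (use q in auto)
    also have e: "(\<lambda>x. \<Sum>c\<in>range s. complex_of_real c * (complex_of_real (indicator (s -` {c}) (\<phi> x)) * f x)) = (\<lambda>x. complex_of_real (s (\<phi> x)) * f x)"
    proof
      fix x
      have "(\<Sum>c\<in>range s. complex_of_real c * (complex_of_real (indicator (s -` {c}) (\<phi> x)) * f x)) =
         (\<Sum>c\<in>range s. if c = s (\<phi> x) then complex_of_real c * f x else 0)"
        by (intro sum.cong) (auto simp: indicator_def)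
      then show "(\<Sum>c\<in>range s. complex_of_real c * (complex_of_real (indicator (s -` {c}) (\<phi> x)) * f x)) = complex_of_real (s (\<phi> x)) * f x"
        using fin by simp
    qed
    finally have "(\<Sum>c\<in>range s. c *\<^sub>R rotproj \<theta> \<phi> (s -` {c}) F) = rot (cis \<theta>) (l2_of (\<lambda>x. complex_of_real (s (\<phi> x)) * f x))" .
    moreover have "square_integrable (\<lambda>x. complex_of_real (s (\<phi> x)) * f x)"
      unfolding e[symmetric] by (intro square_integrable_sum q)
    ultimately show ?thesis by blast
  qed
  {
    fix F G assume "(F, G) \<in> spectral_integral (rotproj \<theta> \<phi>) u"
    then obtain s :: "nat \<Rightarrow> real \<Rightarrow> real" where s: "\<And>n. simple_function borel (s n)"
      "(\<lambda>n. \<integral>\<^sup>+ t. ennreal ((u t - s n t)\<^sup>2) \<partial>spectral_measure (rotproj \<theta> \<phi>) F) \<longlonglongrightarrow> 0"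
      "(\<lambda>n. \<Sum>c\<in>range (s n). c *\<^sub>R rotproj \<theta> \<phi> (s n -` {c}) F) \<longlonglongrightarrow> G"
      unfolding spectral_integral_def by blast
    have sm[measurable]: "s n \<in> borel_measurable borel" for n using s(1) by (rule borel_measurable_simple_function)
    obtain f where f: "square_integrable f" "rot (cis (- \<theta>)) F = l2_of f" by (rule l2_cases)
    have [measurable]: "f \<in> borel_measurable borel" using f(1) by (rule square_integrable_measurable)
    note a = approx[OF s(1) f]
    have I: "(\<integral>\<^sup>+ t. ennreal ((u t - s n t)\<^sup>2) \<partial>spectral_measure (rotproj \<theta> \<phi>) F) =
        (\<integral>\<^sup>+ x. ennreal ((cmod (complex_of_real (u (\<phi> x)) * f x - complex_of_real (s n (\<phi> x)) * f x))\<^sup>2) \<partial>lborel)" for n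
      by (subst nn_integral_spectral_measure_rotproj[OF f])
         (auto simp: norm_mult power_mult_distrib ennreal_mult[symmetric] simp flip: left_diff_distrib of_real_diff)
    \<comment> \<open>A single index with finite distance puts the product of
      \<open>u (\<phi> x)\<close> and \<open>f x\<close> into L2, since the product with a simple
      function is there.\<close>
    have "\<forall>\<^sub>F n in sequentially. (\<integral>\<^sup>+ x. ennreal ((cmod (complex_of_real (u (\<phi> x)) * f x - complex_of_real (s n (\<phi> x)) * f x))\<^sup>2) \<partial>lborel) < 1"
      using order_tendstoD(2)[OF s(2), of 1] by (simp add: I)
    then obtain n where n: "(\<integral>\<^sup>+ x. ennreal ((cmod (complex_of_real (u (\<phi> x)) * f x - complex_of_real (s n (\<phi> x)) * f x))\<^sup>2) \<partial>lborel) < 1"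
      by (meson eventually_happens sequentially_bot)
    have "square_integrable (\<lambda>x. complex_of_real (u (\<phi> x)) * f x - complex_of_real (s n (\<phi> x)) * f x)"
      using order.strict_trans[OF n, of top] by (simp add: square_integrable_def integrable_iff_bounded)
    from square_integrable_add[OF this conjunct2[OF a[of n]]]
    have uf: "square_integrable (\<lambda>x. complex_of_real (u (\<phi> x)) * f x)" by simp
    have "(\<lambda>n. ennreal ((norm (l2_of (\<lambda>x. complex_of_real (u (\<phi> x)) * f x) - l2_of (\<lambda>x. complex_of_real (s n (\<phi> x)) * f x)))\<^sup>2)) \<longlonglongrightarrow> ennreal 0"
      using s(2) a uf by (simp add: I l2_of_diff norm_l2_of_nn square_integrable_diff)
    then have "(\<lambda>n. (norm (l2_of (\<lambda>x. complex_of_real (u (\<phi> x)) * f x) - l2_of (\<lambda>x. complex_of_real (s n (\<phi> x)) * f x)))\<^sup>2) \<longlonglongrightarrow> 0"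
      by (rule tendsto_ennrealD) auto
    then have "(\<lambda>n. sqrt ((norm (l2_of (\<lambda>x. complex_of_real (u (\<phi> x)) * f x) - l2_of (\<lambda>x. complex_of_real (s n (\<phi> x)) * f x)))\<^sup>2)) \<longlonglongrightarrow> sqrt 0"
      by (rule tendsto_real_sqrt)
    then have "(\<lambda>n. l2_of (\<lambda>x. complex_of_real (u (\<phi> x)) * f x) - l2_of (\<lambda>x. complex_of_real (s n (\<phi> x)) * f x)) \<longlonglongrightarrow> 0"
      by (simp add: tendsto_norm_zero_iff)
    from tendsto_diff[OF tendsto_const[of "l2_of (\<lambda>x. complex_of_real (u (\<phi> x)) * f x)"] this]
    have l: "(\<lambda>n. l2_of (\<lambda>x. complex_of_real (s n (\<phi> x)) * f x)) \<longlonglongrightarrow> l2_of (\<lambda>x. complex_of_real (u (\<phi> x)) * f x)" by simp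
    have "(\<lambda>n. l2_of (\<lambda>x. complex_of_real (s n (\<phi> x)) * f x)) \<longlonglongrightarrow> rot (cis (- \<theta>)) G"
      using tendsto_rot[OF s(3), of "- \<theta>"] a by simp
    then have "rot (cis (- \<theta>)) G = l2_of (\<lambda>x. complex_of_real (u (\<phi> x)) * f x)" using l LIMSEQ_unique by blast
    then show "(F, G) \<in> rotop \<theta> (\<lambda>x. u (\<phi> x))" using uf f by (simp add: rotop_def mult_op_iff)
  }
  {
    fix F G assume "(F, G) \<in> rotop \<theta> (\<lambda>x. u (\<phi> x))"
    then have FG: "(rot (cis (- \<theta>)) F, rot (cis (- \<theta>)) G) \<in> mult_op (\<lambda>x. u (\<phi> x))" by (simp add: rotop_def)
    obtain f where f: "square_integrable f" "square_integrable (\<lambda>x. complex_of_real (u (\<phi> x)) * f x)"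
      "rot (cis (- \<theta>)) F = l2_of f" "rot (cis (- \<theta>)) G = l2_of (\<lambda>x. complex_of_real (u (\<phi> x)) * f x)"
      using FG by (rule mult_opE)
    have [measurable]: "f \<in> borel_measurable borel" using f(1) by (rule square_integrable_measurable)
    \<comment> \<open>The bound of the approximants by twice \<open>u\<close> is what makes three
      times the product of \<open>u (\<phi> x)\<close> and \<open>f x\<close> a dominating
      function.\<close>
    obtain s where s: "\<And>n. simple_function borel (s n)" "\<And>t. (\<lambda>n. s n t) \<longlonglongrightarrow> u t" "\<And>n t. dist (s n t) 0 \<le> 2 * dist (u t) 0"
      using borel_measurable_implies_sequence_metric[OF u, of 0] by auto
    have sm[measurable]: "s n \<in> borel_measurable borel" for n using s(1) by (rule borel_measurable_simple_function)
    note a = approx[OF s(1) f(1,3)]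
    have b: "cmod (complex_of_real (s n (\<phi> x)) * f x - complex_of_real (u (\<phi> x)) * f x) \<le> cmod (3 * (complex_of_real (u (\<phi> x)) * f x))" for n x
    proof -
      have "\<bar>s n (\<phi> x) - u (\<phi> x)\<bar> \<le> 3 * \<bar>u (\<phi> x)\<bar>" using s(3)[of n "\<phi> x"] by (simp add: dist_real_def)
      then have "\<bar>s n (\<phi> x) - u (\<phi> x)\<bar> * cmod (f x) \<le> (3 * \<bar>u (\<phi> x)\<bar>) * cmod (f x)" by (rule mult_right_mono) simp
      then show ?thesis by (simp add: norm_mult flip: left_diff_distrib of_real_diff)
    qed
    have l: "(\<lambda>n. l2_of (\<lambda>x. complex_of_real (s n (\<phi> x)) * f x)) \<longlonglongrightarrow> l2_of (\<lambda>x. complex_of_real (u (\<phi> x)) * f x)"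
      by (rule l2_of_tendsto[where g="\<lambda>x. 3 * (complex_of_real (u (\<phi> x)) * f x)"])
         (use a f b s(2) in \<open>auto intro!: square_integrable_cmult tendsto_intros\<close>)
    have "(\<lambda>n. \<Sum>c\<in>range (s n). c *\<^sub>R rotproj \<theta> \<phi> (s n -` {c}) F) \<longlonglongrightarrow> rot (cis \<theta>) (rot (cis (- \<theta>)) G)"
      unfolding f(4) conjunct1[OF a] by (rule tendsto_rot[OF l])
    moreover have "(\<lambda>n. \<integral>\<^sup>+ t. ennreal ((u t - s n t)\<^sup>2) \<partial>spectral_measure (rotproj \<theta> \<phi>) F) \<longlonglongrightarrow> 0"
    proof -
      have I: "(\<integral>\<^sup>+ t. ennreal ((u t - s n t)\<^sup>2) \<partial>spectral_measure (rotproj \<theta> \<phi>) F) =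
        ennreal ((norm (l2_of (\<lambda>x. complex_of_real (u (\<phi> x)) * f x) - l2_of (\<lambda>x. complex_of_real (s n (\<phi> x)) * f x)))\<^sup>2)" for n
      proof -
        have "(\<integral>\<^sup>+ t. ennreal ((u t - s n t)\<^sup>2) \<partial>spectral_measure (rotproj \<theta> \<phi>) F) =
          (\<integral>\<^sup>+ x. ennreal ((cmod (complex_of_real (u (\<phi> x)) * f x - complex_of_real (s n (\<phi> x)) * f x))\<^sup>2) \<partial>lborel)"
          by (subst nn_integral_spectral_measure_rotproj[OF f(1,3)])
             (auto simp: norm_mult power_mult_distrib ennreal_mult[symmetric] simp flip: left_diff_distrib of_real_diff)
        then show ?thesis using a f by (simp add: l2_of_diff norm_l2_of_nn square_integrable_diff)
      qed
      have "(\<lambda>n. ennreal ((norm (l2_of (\<lambda>x. complex_of_real (u (\<phi> x)) * f x) - l2_of (\<lambda>x. complex_of_real (s n (\<phi> x)) * f x)))\<^sup>2))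
         \<longlonglongrightarrow> ennreal ((norm (l2_of (\<lambda>x. complex_of_real (u (\<phi> x)) * f x) - l2_of (\<lambda>x. complex_of_real (u (\<phi> x)) * f x)))\<^sup>2)"
        by (intro tendsto_intros l)
      then show ?thesis by (simp add: I)
    qed
    ultimately show "(F, G) \<in> spectral_integral (rotproj \<theta> \<phi>) u"
      unfolding spectral_integral_def using s(1) by auto
  }
qed

end

text \<open>Where \<open>\<bar>\<psi> x\<bar>\<close> is at least some \<open>e > d\<close>, the
  k-th power amplifies the mass by at least \<open>e ^ (2 * k)\<close>, while the hypothesis allows
  only \<open>d ^ (2 * k)\<close>; so \<open>F\<close> carries no mass there.\<close>

lemma AE_zero_if_powers_bounded:
  assumes F: "square_integrable F" and [measurable]: "\<psi> \<in> borel_measurable borel" and d: "0 \<le> d"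
    and q: "\<And>k. square_integrable (\<lambda>x. complex_of_real (\<psi> x ^ k) * F x)"
    and b: "\<And>k. norm (l2_of (\<lambda>x. complex_of_real (\<psi> x ^ k) * F x)) \<le> d ^ k * norm (l2_of F)"
  shows "AE x in lborel. d < \<bar>\<psi> x\<bar> \<longrightarrow> F x = 0"
proof -
  have [measurable]: "F \<in> borel_measurable borel" using F by (rule square_integrable_measurable)
  have "AE x in lborel. d + 1 / Suc n \<le> \<bar>\<psi> x\<bar> \<longrightarrow> F x = 0" for n
  proof -
    define e where "e = d + 1 / Suc n"
    have e: "d < e" "0 < e" using d by (auto simp: e_def add_nonneg_pos)
    define G where "G x = indicator {x. e \<le> \<bar>\<psi> x\<bar>} x * (cmod (F x))\<^sup>2" for x
    have Gm[measurable]: "G \<in> borel_measurable borel" unfolding G_def by measurable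
    have Fi: "integrable lborel (\<lambda>x. (cmod (F x))\<^sup>2)" using F by (simp add: square_integrable_def)
    have Gi: "integrable lborel G"
      by (rule Bochner_Integration.integrable_bound[OF Fi]) (auto simp: G_def indicator_def)
    have bound: "(\<integral>x. G x \<partial>lborel) \<le> ((d / e)\<^sup>2) ^ k * (norm (l2_of F))\<^sup>2" for k
    proof -
      have ki: "integrable lborel (\<lambda>x. (cmod (complex_of_real (\<psi> x ^ k) * F x))\<^sup>2)" using q[of k] by (simp add: square_integrable_def)
      have "(e ^ k)\<^sup>2 * (\<integral>x. G x \<partial>lborel) = (\<integral>x. (e ^ k)\<^sup>2 * G x \<partial>lborel)" by simp
      also have "\<dots> \<le> (\<integral>x. (cmod (complex_of_real (\<psi> x ^ k) * F x))\<^sup>2 \<partial>lborel)"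
      proof (intro integral_mono ki integrable_mult_right Gi)
        fix x
        show "(e ^ k)\<^sup>2 * G x \<le> (cmod (complex_of_real (\<psi> x ^ k) * F x))\<^sup>2"
        proof (cases "e \<le> \<bar>\<psi> x\<bar>")
          case True
          then have "(e ^ k)\<^sup>2 \<le> (\<bar>\<psi> x\<bar> ^ k)\<^sup>2" using e by (intro power_mono) auto
          then have "(e ^ k)\<^sup>2 * (cmod (F x))\<^sup>2 \<le> (\<bar>\<psi> x\<bar> ^ k)\<^sup>2 * (cmod (F x))\<^sup>2" by (rule mult_right_mono) simp
          then show ?thesis using True by (simp add: G_def norm_mult norm_power power_mult_distrib)
        qed (simp add: G_def)
      qed
      also have "\<dots> = (norm (l2_of (\<lambda>x. complex_of_real (\<psi> x ^ k) * F x)))\<^sup>2" by (rule norm_l2_of[OF q, symmetric])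
      also have "\<dots> \<le> (d ^ k * norm (l2_of F))\<^sup>2" by (intro power_mono b) auto
      finally have "(\<integral>x. G x \<partial>lborel) \<le> (d ^ k * norm (l2_of F))\<^sup>2 / (e ^ k)\<^sup>2"
        using e by (simp add: pos_le_divide_eq mult.commute)
      also have "\<dots> = ((d / e)\<^sup>2) ^ k * (norm (l2_of F))\<^sup>2"
        by (simp add: power_mult_distrib power_divide flip: power_mult) (simp add: mult.commute)
      finally show ?thesis .
    qed
    have "(d / e)\<^sup>2 < 1" using e d by (simp add: power_less_one_iff)
    then have "(\<lambda>k. ((d / e)\<^sup>2) ^ k * (norm (l2_of F))\<^sup>2) \<longlonglongrightarrow> 0 * (norm (l2_of F))\<^sup>2"
      by (intro tendsto_intros LIMSEQ_realpow_zero) auto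
    then have "(\<integral>x. G x \<partial>lborel) \<le> 0"
      using bound by (intro LIMSEQ_le_const) auto
    moreover have "0 \<le> (\<integral>x. G x \<partial>lborel)" by (intro Bochner_Integration.integral_nonneg) (simp add: G_def)
    ultimately have "(\<integral>x. G x \<partial>lborel) = 0" by linarith
    then have "AE x in lborel. G x = 0"
      by (subst (asm) integral_nonneg_eq_0_iff_AE[OF Gi]) (simp_all add: G_def)
    then show ?thesis unfolding e_def[symmetric] by eventually_elim (auto simp: G_def indicator_def)
  qed
  then have "AE x in lborel. \<forall>n. d + 1 / Suc n \<le> \<bar>\<psi> x\<bar> \<longrightarrow> F x = 0"
    unfolding AE_all_countable by blast
  then show ?thesis
  proof eventually_elim
    case (elim x)
    show ?case
    proof
      assume "d < \<bar>\<psi> x\<bar>"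
      then obtain n where "inverse (real (Suc n)) < \<bar>\<psi> x\<bar> - d" using reals_Archimedean[of "\<bar>\<psi> x\<bar> - d"] by auto
      then have "d + 1 / Suc n \<le> \<bar>\<psi> x\<bar>" by (simp add: inverse_eq_divide)
      then show "F x = 0" using elim by blast
    qed
  qed
qed

text \<open>On the range of \<open>E {a..b}\<close> the operator differs from the midpoint by at
  most \<open>d\<close>, so its iterates on a projected core vector grow at most like
  \<open>d ^ k\<close>. In the multiplication picture this forces support in the strip
  \<open>a \<le> mm r x \<le> b\<close>, which is the inclusion of ranges asked for by
  \<open>pvm_eqI\<close>. Core vectors are chosen because every power applies to them.\<close>

lemma pvm_of_exponent_unique:
  assumes "pvm E" and E: "spectral_integral E (\<lambda>t. t) = rotop \<theta> (mm r)" and S: "S \<in> sets borel"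
  shows "E S f = rotproj \<theta> (mm r) S f"
proof (rule pvm_eqI[OF \<open>pvm E\<close> pvm_rotproj[OF measurable_mm] _ S])
  interpret E: pvm E by fact
  interpret P: pvm "rotproj \<theta> (mm r)" by (rule pvm_rotproj[OF measurable_mm])
  fix a b :: real and f
  have I: "{a..b} \<in> sets borel" by simp
  show "rotproj \<theta> (mm r) {a..b} (E {a..b} f) = E {a..b} f"
  proof (cases "a \<le> b")
    case False
    then have "{a..b} = {}" by simp
    then show ?thesis by (simp only: E.empty P.empty)
  next
    case True
    define z where "z = (a + b) / 2"
    define d where "d = (b - a) / 2"
    have d: "0 \<le> d" and zd: "\<And>t. t \<in> {a..b} \<Longrightarrow> \<bar>t - z\<bar> \<le> d" and zd': "\<And>t. \<not> d < \<bar>t - z\<bar> \<Longrightarrow> t \<in> {a..b}"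
      using True by (auto simp: d_def z_def abs_if field_simps split: if_splits)
    have GPcase: "rotproj \<theta> (mm r) {a..b} (E {a..b} (rot (cis \<theta>) (l2_of h))) = E {a..b} (rot (cis \<theta>) (l2_of h))" if h: "GP 0 0 h" for h
    proof -
      define hk where "hk k = (\<lambda>x. complex_of_real ((mm r x - z) ^ k) * h x)" for k
      have hk: "GP 0 0 (hk k)" for k
      proof (induction k)
        case 0 show ?case using h by (simp add: hk_def)
      next
        case (Suc k)
        have "hk (Suc k) = (\<lambda>x. complex_of_real (mm r x) * hk k x + (- complex_of_real z) * hk k x)"
          by (auto simp: hk_def algebra_simps)
        then show ?case
          using GP.add[OF GP_mm[OF Suc, of r] GP.scale[OF Suc, of "- complex_of_real z"]] by (simp only:)
      qed
      have hks: "square_integrable (hk k)" for k by (rule schwartz_square_integrable[OF GP_schwartz[OF hk]])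
      have mhks: "square_integrable (\<lambda>x. complex_of_real (mm r x) * hk k x)" for k
        by (rule schwartz_square_integrable[OF GP_schwartz[OF GP_mm[OF hk]]])
      define v where "v k = E {a..b} (rot (cis \<theta>) (l2_of (hk k)))" for k
      have next_v: "v (Suc k) = E {a..b} (rot (cis \<theta>) (l2_of (\<lambda>x. complex_of_real (mm r x) * hk k x))) - z *\<^sub>R v k" for k
      proof -
        have "l2_of (hk (Suc k)) = l2_of (\<lambda>x. complex_of_real (mm r x) * hk k x) - complex_of_real z *\<^sub>C l2_of (hk k)"
          by (simp add: l2_of_scale l2_of_diff square_integrable_cmult hks mhks) (simp add: hk_def algebra_simps)
        then show ?thesis unfolding v_def by (simp add: rot_cis_linear E.diff E.scale scaleR_l2_def)
      qed
      have ev: "E {a..b} (rot (cis \<theta>) (l2_of (\<lambda>x. complex_of_real (mm r x) * hk k x))) = v (Suc k) + z *\<^sub>R v k" for k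
        unfolding next_v by simp
      have pair: "(rot (cis \<theta>) (l2_of (hk k)), rot (cis \<theta>) (l2_of (\<lambda>x. complex_of_real (mm r x) * hk k x))) \<in> spectral_integral E (\<lambda>t. t)" for k
        unfolding E by (rule rotop_rot_GP[OF core_multiplier_mm hk])
      have in_op: "(v k, v (Suc k) + z *\<^sub>R v k) \<in> rotop \<theta> (mm r)" for k
        using E.spectral_integral_restrict(1)[OF pair, of a b k] unfolding E v_def[symmetric] ev .
      have nle: "norm (v (Suc k)) \<le> d * norm (v k)" for k
      proof -
        have "norm (E {a..b} (rot (cis \<theta>) (l2_of (\<lambda>x. complex_of_real (mm r x) * hk k x))) - z *\<^sub>R v k) \<le> d * norm (v k)"
          unfolding v_def by (rule E.spectral_integral_restrict(2)[OF pair]) (use zd d in auto)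
        then show ?thesis unfolding ev by simp
      qed
      obtain F where F: "square_integrable F" "rot (cis (- \<theta>)) (v 0) = l2_of F" by (rule l2_cases)
      have [measurable]: "F \<in> borel_measurable borel" using F(1) by (rule square_integrable_measurable)
      have step: "square_integrable (\<lambda>x. complex_of_real ((mm r x - z) ^ k) * F x) \<and>
          rot (cis (- \<theta>)) (v k) = l2_of (\<lambda>x. complex_of_real ((mm r x - z) ^ k) * F x)" for k
      proof (induction k)
        case 0 show ?case using F by simp
      next
        case (Suc k)
        define K where "K = (\<lambda>x. complex_of_real ((mm r x - z) ^ k) * F x)"
        have K: "square_integrable K" "rot (cis (- \<theta>)) (v k) = l2_of K" using Suc by (auto simp: K_def)
        have m: "square_integrable (\<lambda>x. complex_of_real (mm r x) * K x)"
          "rot (cis (- \<theta>)) (v (Suc k) + z *\<^sub>R v k) = l2_of (\<lambda>x. complex_of_real (mm r x) * K x)"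
          using in_op[of k] by (auto simp: rotop_def K mult_op_iff)
        have e: "(\<lambda>x. complex_of_real ((mm r x - z) ^ Suc k) * F x) = (\<lambda>x. complex_of_real (mm r x) * K x - complex_of_real z * K x)"
          by (auto simp: K_def algebra_simps)
        have "rot (cis (- \<theta>)) (v (Suc k)) = rot (cis (- \<theta>)) (v (Suc k) + z *\<^sub>R v k) - complex_of_real z *\<^sub>C rot (cis (- \<theta>)) (v k)"
          by (simp add: rot_cis_linear scaleR_l2_def)
        then show ?case unfolding e m(2) K(2)
          by (simp add: l2_of_scale l2_of_diff square_integrable_diff square_integrable_cmult m(1) K(1))
      qed
      have npow: "norm (v k) \<le> d ^ k * norm (v 0)" for k
      proof (induction k)
        case (Suc k)
        have "norm (v (Suc k)) \<le> d * (d ^ k * norm (v 0))" using nle[of k] mult_left_mono[OF Suc d] by linarith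
        then show ?case by (simp add: mult_ac)
      qed simp
      have "norm (l2_of (\<lambda>x. complex_of_real ((mm r x - z) ^ k) * F x)) \<le> d ^ k * norm (l2_of F)" for k
        using npow[of k] step[of k] F(2) rot_cis_linear(4)[of "- \<theta>" "v k"] rot_cis_linear(4)[of "- \<theta>" "v 0"] by simp
      then have "AE x in lborel. d < \<bar>mm r x - z\<bar> \<longrightarrow> F x = 0"
        using step by (intro AE_zero_if_powers_bounded[OF F(1) _ d]) auto
      then have "AE x in lborel. complex_of_real (indicator {a..b} (mm r x)) * F x = F x"
        by eventually_elim (use zd' in \<open>auto simp: indicator_def\<close>)
      then have "bproj (mm r) {a..b} (l2_of F) = l2_of F"
        using F(1) by (simp add: bproj_l2_of[OF measurable_mm I] l2_of_eq_iff square_integrable_indicator[OF measurable_mm I])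
      then have "rotproj \<theta> (mm r) {a..b} (v 0) = v 0"
        by (simp add: rotproj_def F(2)) (simp flip: F(2))
      then show ?thesis by (simp add: v_def hk_def)
    qed
    \<comment> \<open>Rotated core vectors suffice: they are dense and both sides are continuous in
      the vector.\<close>
    have "{f. rotproj \<theta> (mm r) {a..b} (E {a..b} f) = E {a..b} f} = UNIV"
    proof -
      have "closed {f. rotproj \<theta> (mm r) {a..b} (E {a..b} f) = E {a..b} f}"
        using bounded_linear.continuous_on[OF E.bounded_linear[OF I] continuous_on_id]
        by (intro closed_Collect_eq bounded_linear.continuous_on[OF P.bounded_linear[OF I]])
      moreover have "l2_of h \<in> {f. rotproj \<theta> (mm r) {a..b} (E {a..b} f) = E {a..b} f}" if "GP 0 0 h" for h
        using rot_GP_onto[OF that, of \<theta>] GPcase by fastforce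
      ultimately show ?thesis using closure_UNIV_if_GP closure_closed by blast
    qed
    then show ?thesis by blast
  qed
qed

text \<open>The choice is not vacuous because \<open>rotproj\<close> is a candidate, and by
  uniqueness any chosen candidate agrees with it on Borel sets.\<close>

theorem exp_pos_mom_eq_rotop:
  "exp_pos_mom (r * sin \<theta>) (r * cos \<theta>) = rotop \<theta> (\<lambda>x. exp (mm r x))"
proof -
  define E where "E = (SOME E. projection_valued_measure E \<and> spectral_integral E (\<lambda>t. t) = rotop \<theta> (mm r))"
  have "\<exists>E. projection_valued_measure E \<and> spectral_integral E (\<lambda>t. t) = rotop \<theta> (mm r)"
    using pvm.pvm[OF pvm_rotproj[OF measurable_mm]] spectral_integral_rotproj[OF measurable_mm, of "\<lambda>t. t"]
    by (intro exI[of _ "rotproj \<theta> (mm r)"]) simp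
  from someI_ex[OF this] have "projection_valued_measure E \<and> spectral_integral E (\<lambda>t. t) = rotop \<theta> (mm r)"
    unfolding E_def .
  then have "E S f = rotproj \<theta> (mm r) S f" if "S \<in> sets borel" for S f
    using that by (intro pvm_of_exponent_unique) (auto simp: pvm_def)
  then have "spectral_integral E exp = spectral_integral (rotproj \<theta> (mm r)) exp" by (rule spectral_integral_cong)
  also have "\<dots> = rotop \<theta> (\<lambda>x. exp (mm r x))" by (rule spectral_integral_rotproj[OF measurable_mm]) simp
  finally show ?thesis
    unfolding exp_pos_mom_def functional_calculus_def exponent_eq_sop closure_exponent E_def .
qed

section \<open>The exponential of the exponent\<close>

abbreviation tt :: "real \<Rightarrow> real \<Rightarrow> op" where
  "tt \<theta> r \<equiv> rotop \<theta> (\<lambda>x. exp (mm r x))"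

lemma measurable_exp_mm: "(\<lambda>x. exp (mm r x)) \<in> borel_measurable borel"
  by measurable

lemma exp_mm_minus: "complex_of_real (exp (mm (- r) x)) * (complex_of_real (exp (mm r x)) * z) = z"
  by (simp add: mm_def flip: of_real_mult exp_add mult.assoc)

lemma tt_converse: "(tt \<theta> r)\<inverse> = tt \<theta> (- r)"
proof -
  have *: "(G, F) \<in> mult_op (\<lambda>x. exp (mm (- r) x))" if FG: "(F, G) \<in> mult_op (\<lambda>x. exp (mm r x))" for F G r
  proof -
    obtain f where f: "square_integrable f" "square_integrable (\<lambda>x. complex_of_real (exp (mm r x)) * f x)"
      "F = l2_of f" "G = l2_of (\<lambda>x. complex_of_real (exp (mm r x)) * f x)" using FG by (rule mult_opE)
    then show ?thesis by (simp add: mult_op_iff measurable_exp_mm exp_mm_minus)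
  qed
  show ?thesis using *[of _ _ r] *[of _ _ "- r"] by (auto simp: rotop_def)
qed

lemma tt_iff_inverse: "(F, G) \<in> tt \<theta> r \<longleftrightarrow> (G, F) \<in> tt \<theta> (- r)"
  using tt_converse[of \<theta> r] by blast

text \<open>The delicate point is the domain: a vector in the domain of the exponential of twice the
  exponent lies in that of the single one, because
  \<open>e\<^sup>2 \<le> 1 + (e * e)\<^sup>2\<close>.\<close>

lemma tt_square: "tt \<theta> r *\<^sub>o tt \<theta> r = tt \<theta> (2 * r)"
proof -
  have e2: "exp (mm (2 * r) x) = exp (mm r x) * exp (mm r x)" for x
    by (simp add: mm_def algebra_simps flip: exp_add)
  have 1: "(F, H) \<in> mult_op (\<lambda>x. exp (mm (2 * r) x))"
    if FG: "(F, G) \<in> mult_op (\<lambda>x. exp (mm r x))" and GH: "(G, H) \<in> mult_op (\<lambda>x. exp (mm r x))" for F G H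
  proof -
    obtain f where f: "square_integrable f" "square_integrable (\<lambda>x. complex_of_real (exp (mm r x)) * f x)"
      "F = l2_of f" "G = l2_of (\<lambda>x. complex_of_real (exp (mm r x)) * f x)" using FG by (rule mult_opE)
    then show ?thesis using GH by (simp add: mult_op_iff measurable_exp_mm e2 mult.assoc)
  qed
  have 2: "\<exists>G. (F, G) \<in> mult_op (\<lambda>x. exp (mm r x)) \<and> (G, H) \<in> mult_op (\<lambda>x. exp (mm r x))"
    if FH: "(F, H) \<in> mult_op (\<lambda>x. exp (mm (2 * r) x))" for F H
  proof -
    obtain f where f: "square_integrable f" "square_integrable (\<lambda>x. complex_of_real (exp (mm (2 * r) x)) * f x)"
      "F = l2_of f" "H = l2_of (\<lambda>x. complex_of_real (exp (mm (2 * r) x)) * f x)" using FH by (rule mult_opE)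
    have [measurable]: "f \<in> borel_measurable borel" using f(1) by (rule square_integrable_measurable)
    have i: "integrable lborel (\<lambda>x. (cmod (f x))\<^sup>2 + (cmod (complex_of_real (exp (mm (2 * r) x)) * f x))\<^sup>2)"
      using f by (simp add: square_integrable_def)
    have "(cmod (complex_of_real (exp (mm r x)) * f x))\<^sup>2 \<le> (cmod (f x))\<^sup>2 + (cmod (complex_of_real (exp (mm (2 * r) x)) * f x))\<^sup>2" for x
    proof -
      define e where "e = exp (mm r x)"
      have "e\<^sup>2 \<le> 1 + (e * e)\<^sup>2" using sum_squares_bound[of 1 "e * e"] zero_le_square[of e]
        unfolding power2_eq_square by linarith
      then have "e\<^sup>2 * (cmod (f x))\<^sup>2 \<le> (1 + (e * e)\<^sup>2) * (cmod (f x))\<^sup>2" by (rule mult_right_mono) simp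
      then show ?thesis unfolding e2 by (simp add: e_def[symmetric] norm_mult power_mult_distrib distrib_right)
    qed
    then have "integrable lborel (\<lambda>x. (cmod (complex_of_real (exp (mm r x)) * f x))\<^sup>2)"
      by (intro Bochner_Integration.integrable_bound[OF i]) (auto intro: order_trans[OF _ abs_ge_self])
    then have g: "square_integrable (\<lambda>x. complex_of_real (exp (mm r x)) * f x)" by (simp add: square_integrable_def)
    show ?thesis
      using f g by (intro exI[of _ "l2_of (\<lambda>x. complex_of_real (exp (mm r x)) * f x)"])
        (simp add: mult_op_iff measurable_exp_mm e2 mult.assoc)
  qed
  show ?thesis
  proof (intro set_eqI iffI; clarify)
    fix F H assume "(F, H) \<in> tt \<theta> r *\<^sub>o tt \<theta> r"
    then show "(F, H) \<in> tt \<theta> (2 * r)" using 1 by (auto simp: op_mult_def rotop_def)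
  next
    fix F H assume "(F, H) \<in> tt \<theta> (2 * r)"
    then obtain G where "(rot (cis (- \<theta>)) F, G) \<in> mult_op (\<lambda>x. exp (mm r x))" "(G, rot (cis (- \<theta>)) H) \<in> mult_op (\<lambda>x. exp (mm r x))"
      using 2 by (auto simp: rotop_def)
    then have "(F, rot (cis \<theta>) G) \<in> tt \<theta> r" "(rot (cis \<theta>) G, H) \<in> tt \<theta> r" by (auto simp: rotop_def)
    then show "(F, H) \<in> tt \<theta> r *\<^sub>o tt \<theta> r" by (auto simp: op_mult_def)
  qed
qed

lemma self_adjoint_tt: "self_adjoint (tt \<theta> r)"
  by (rule self_adjoint_rotop[OF core_multiplier_exp_mm])

lemma linear_op_tt: "linear_op (tt \<theta> r)"
  using self_adjoint_tt by (simp add: self_adjoint_def)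

lemma single_valued_tt: "single_valued (tt \<theta> r)"
  using linear_op_tt by (simp add: linear_op_def)

lemma tt_add: "(F, G) \<in> tt \<theta> r \<Longrightarrow> (F', G') \<in> tt \<theta> r \<Longrightarrow> (F + F', G + G') \<in> tt \<theta> r"
  using linear_op_tt[of \<theta> r] unfolding linear_op_def by blast

lemma tt_scale: "(F, G) \<in> tt \<theta> r \<Longrightarrow> (c *\<^sub>C F, c *\<^sub>C G) \<in> tt \<theta> r"
  using linear_op_tt[of \<theta> r] unfolding linear_op_def by blast

lemma tt_zero: "(0, 0) \<in> tt \<theta> r"
  using linear_op_tt[of \<theta> r] unfolding linear_op_def by blast

lemma tt_symmetric: "(F, G) \<in> tt \<theta> r \<Longrightarrow> (F', G') \<in> tt \<theta> r \<Longrightarrow> cinner F G' = cinner G F'"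
  by (rule rotop_symmetric)

lemma tt_unique: "(F, G) \<in> tt \<theta> r \<Longrightarrow> (F, G') \<in> tt \<theta> r \<Longrightarrow> G = G'"
  using single_valued_tt by (auto simp: single_valued_def)

lemma invertible_tt: "invertible_op (tt \<theta> r)"
proof -
  have "Range (tt \<theta> r) = Domain (tt \<theta> (- r))" using tt_iff_inverse by (auto simp: Domain_iff Range_iff)
  then show ?thesis
    using self_adjoint_tt[of \<theta> "- r"] single_valued_tt[of \<theta> "- r"] by (simp add: invertible_op_def tt_converse self_adjoint_def)
qed

lemma unbounded_tt:
  assumes r: "r \<noteq> 0" shows "unbounded_op (tt \<theta> r)"
  unfolding unbounded_op_def
proof
  assume "\<exists>K. \<forall>(F, G)\<in>tt \<theta> r. norm G \<le> K * norm F"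
  then obtain K where K: "\<And>F G. (F, G) \<in> tt \<theta> r \<Longrightarrow> norm G \<le> K * norm F" by blast
  \<comment> \<open>The test function is a Gaussian cut off to the strip where the multiplier lies
    between \<open>exp c\<close> and \<open>exp (c + 1)\<close>. There it exceeds \<open>K\<close>,
    and the upper bound keeps the product square integrable.\<close>
  define c where "c = \<bar>K\<bar>"
  define f where "f x = complex_of_real (indicator {c..c + 1} (mm r x)) * gauss 0 0 x" for x
  have f: "square_integrable f"
    unfolding f_def[abs_def]
    by (rule square_integrable_indicator[OF measurable_mm]) (auto simp: schwartz_square_integrable schwartz_gauss)
  have [measurable]: "f \<in> borel_measurable borel" using f by (rule square_integrable_measurable)
  have ef: "(\<lambda>x. complex_of_real (exp (mm r x)) * f x) =
      (\<lambda>x. complex_of_real (exp (mm r x) * indicator {c..c + 1} (mm r x)) * f x)"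
    by (auto simp: f_def indicator_def)
  have sq: "square_integrable (\<lambda>x. complex_of_real (exp (mm r x)) * f x)"
    unfolding ef by (rule square_integrable_bounded_mult[where B="exp (c + 1)"]) (auto simp: f indicator_def)
  have "(rot (cis \<theta>) (l2_of f), rot (cis \<theta>) (l2_of (\<lambda>x. complex_of_real (exp (mm r x)) * f x))) \<in> tt \<theta> r"
    using f sq by (auto simp: rotop_def mult_op_def)
  from K[OF this] have le: "norm (l2_of (\<lambda>x. complex_of_real (exp (mm r x)) * f x)) \<le> K * norm (l2_of f)"
    by (simp add: rot_cis_linear)
  have "(exp c * norm (l2_of f))\<^sup>2 \<le> (norm (l2_of (\<lambda>x. complex_of_real (exp (mm r x)) * f x)))\<^sup>2"
  proof -
    have "(exp c * norm (l2_of f))\<^sup>2 = (\<integral>x. (exp c)\<^sup>2 * (cmod (f x))\<^sup>2 \<partial>lborel)"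
      by (simp add: power_mult_distrib norm_l2_of[OF f])
    also have "\<dots> \<le> (\<integral>x. (cmod (complex_of_real (exp (mm r x)) * f x))\<^sup>2 \<partial>lborel)"
    proof (rule integral_mono)
      show "integrable lborel (\<lambda>x. (exp c)\<^sup>2 * (cmod (f x))\<^sup>2)" using f by (simp add: square_integrable_def)
      show "integrable lborel (\<lambda>x. (cmod (complex_of_real (exp (mm r x)) * f x))\<^sup>2)" using sq by (simp add: square_integrable_def)
      show "(exp c)\<^sup>2 * (cmod (f x))\<^sup>2 \<le> (cmod (complex_of_real (exp (mm r x)) * f x))\<^sup>2" for x
        by (auto simp: f_def indicator_def norm_mult power_mult_distrib intro!: mult_right_mono power_mono)
    qed
    finally show ?thesis by (simp add: norm_l2_of[OF sq])
  qed
  then have "exp c * norm (l2_of f) \<le> norm (l2_of (\<lambda>x. complex_of_real (exp (mm r x)) * f x))"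
    by (rule power2_le_imp_le) simp
  then have "exp c * norm (l2_of f) \<le> K * norm (l2_of f)" using le by linarith
  moreover have "K < exp c" using exp_ge_add_one_self[of c] unfolding c_def by linarith
  ultimately have "norm (l2_of f) = 0"
    by (metis less_le_not_le mult_strict_right_mono norm_ge_zero order_le_less)
  then have "l2_of f = l2_of (\<lambda>x. 0)" by (simp flip: l2_of_zero)
  then have "AE x in lborel. f x = 0" using f by (simp add: l2_of_eq_iff square_integrable_zero)
  then have "AE x in lborel. x \<in> {x. mm r x \<le> c \<or> c + 1 \<le> mm r x}"
    by eventually_elim (auto simp: f_def indicator_def gauss_nonzero split: if_splits)
  then have "AE x in lebesgue. x \<in> {x. mm r x \<le> c \<or> c + 1 \<le> mm r x}" by (rule AE_completion)
  moreover have "continuous_on UNIV (mm r)" unfolding mm_def[abs_def] by (intro continuous_intros)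
  then have "closed {x. mm r x \<le> c \<or> c + 1 \<le> mm r x}"
    by (intro closed_Collect_disj closed_Collect_le continuous_intros)
  ultimately have "x \<in> {x. mm r x \<le> c \<or> c + 1 \<le> mm r x}" for x
    using mem_closed_if_AE_lebesgue by blast
  \<comment> \<open>This point has \<open>mm r x = c + 1/2\<close> and so lies inside the strip,
    where the cut-off Gaussian cannot vanish; it exists since \<open>r \<noteq> 0\<close>.\<close>
  from this[of "axis 1 ((c + 1/2) / r)"] show False using r by (simp add: mm_def axis_def)
qed

section \<open>Conjugation of first-order operators by the exponential\<close>

lemma rot_lin:
  assumes u: "schwartz u" and w: "schwartz w" "rot (cis \<theta>) (l2_of u) = l2_of w"
  shows "rot (cis \<theta>) (l2_of (lin a b c j u)) =
    l2_of (lin (a * cos \<theta> - b * sin \<theta>) (a * sin \<theta> + b * cos \<theta>) c j w)"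
proof -
  have s: "square_integrable (xf j u)" "square_integrable (pf j u)" "square_integrable u" "square_integrable w"
    "square_integrable (lin a' b' c' j w)" for a' b' c'
    by (intro schwartz_square_integrable schwartz_xf schwartz_pf schwartz_lin u w)+
  have "l2_of (lin a b c j u) = a *\<^sub>C l2_of (xf j u) + b *\<^sub>C l2_of (pf j u) + c *\<^sub>C l2_of u"
    unfolding lin_def[abs_def] by (simp add: l2_of_add l2_of_scale square_integrable_add square_integrable_cmult s)
  then have "rot (cis \<theta>) (l2_of (lin a b c j u)) = a *\<^sub>C l2_of (lin (cos \<theta>) (sin \<theta>) 0 j w) +
      b *\<^sub>C l2_of (lin (- sin \<theta>) (cos \<theta>) 0 j w) + c *\<^sub>C l2_of w"
    by (simp only: rot_cis_linear rot_xf[OF u w] w(2))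
  also have "\<dots> = l2_of (\<lambda>x. a * lin (cos \<theta>) (sin \<theta>) 0 j w x + b * lin (- sin \<theta>) (cos \<theta>) 0 j w x + c * w x)"
    by (simp add: l2_of_add l2_of_scale square_integrable_add square_integrable_cmult s)
  also have "(\<lambda>x. a * lin (cos \<theta>) (sin \<theta>) 0 j w x + b * lin (- sin \<theta>) (cos \<theta>) 0 j w x + c * w x) =
     lin (a * cos \<theta> - b * sin \<theta>) (a * sin \<theta> + b * cos \<theta>) c j w"
    by (auto simp: lin_def algebra_simps)
  finally show ?thesis .
qed

lemma partial_exp_mm: "partial j (\<lambda>x. complex_of_real (exp (mm r x))) x = complex_of_real r * complex_of_real (exp (mm r x))"
proof -
  have j: "j = 1 \<or> j = 2" by (rule exhaust_2)
  have D: "((\<lambda>x. complex_of_real r * (complex_of_real (x$1) + complex_of_real (x$2))) has_derivative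
      (\<lambda>h. complex_of_real r * (complex_of_real (h$1) + complex_of_real (h$2)))) (at x)"
    by (intro has_derivative_mult_right has_derivative_add has_derivative_coord)
  have "((\<lambda>x. exp (complex_of_real r * (complex_of_real (x$1) + complex_of_real (x$2)))) has_derivative
      (\<lambda>h. exp (complex_of_real r * (complex_of_real (x$1) + complex_of_real (x$2))) * (complex_of_real r * (complex_of_real (h$1) + complex_of_real (h$2))))) (at x)"
    by (rule has_derivative_compose[OF D DERIV_exp[unfolded has_field_derivative_def]])
  moreover have "exp (complex_of_real r * (complex_of_real (x$1) + complex_of_real (x$2))) = complex_of_real (exp (mm r x))" for x
    by (simp add: mm_def exp_of_real[symmetric])
  ultimately have "((\<lambda>x. complex_of_real (exp (mm r x))) has_derivative
      (\<lambda>h. complex_of_real (exp (mm r x)) * (complex_of_real r * (complex_of_real (h$1) + complex_of_real (h$2))))) (at x)"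
    by simp
  from partial_eqI[OF this, of j] show ?thesis using j by (auto simp: axis_def)
qed

lemma exp_mm_differentiable: "(\<lambda>x. complex_of_real (exp (mm r x))) differentiable (at x)"
proof -
  have "(\<lambda>x. complex_of_real r * (complex_of_real (x$1) + complex_of_real (x$2))) differentiable (at x)"
    by (intro differentiable_mult differentiable_add differentiable_coord differentiable_const)
  from differentiable_chain_at[OF this] have "(exp \<circ> (\<lambda>x. complex_of_real r * (complex_of_real (x$1) + complex_of_real (x$2)))) differentiable (at x)"
    using field_differentiable_imp_differentiable field_differentiable_within_exp by blast
  moreover have "(exp \<circ> (\<lambda>x. complex_of_real r * (complex_of_real (x$1) + complex_of_real (x$2)))) = (\<lambda>x. complex_of_real (exp (mm r x)))"
    by (auto simp: mm_def exp_of_real[symmetric])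
  ultimately show ?thesis by simp
qed

text \<open>Differentiating the exponential gives a factor \<open>r\<close> in either direction; the
  resulting \<open>- \<i> * r\<close> of the momentum is compensated in the constant.\<close>

lemma exp_mm_lin:
  assumes h: "schwartz h"
  shows "complex_of_real (exp (mm r x)) * lin a b c j h x =
    lin a b (c + \<i> * complex_of_real r * b) j (\<lambda>x. complex_of_real (exp (mm r x)) * h x) x"
proof -
  have "pf j (\<lambda>x. complex_of_real (exp (mm r x)) * h x) x =
      complex_of_real (exp (mm r x)) * pf j h x - \<i> * complex_of_real r * (complex_of_real (exp (mm r x)) * h x)"
    unfolding pf_def
    by (subst partial_mult[OF exp_mm_differentiable schwartz_differentiable[OF h]])
       (simp add: partial_exp_mm algebra_simps)
  then show ?thesis by (simp only: lin_def xf_def) (simp add: algebra_simps)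
qed

text \<open>Conjugation by the exponential shifts a first-order operator by a constant, first on
  Gaussians, then by duality on all Schwartz functions whose image is again a Schwartz function.\<close>

definition shift :: "real \<Rightarrow> real \<Rightarrow> complex \<Rightarrow> complex \<Rightarrow> complex" where
  "shift \<theta> r a b = \<i> * complex_of_real r * (b * cos \<theta> - a * sin \<theta>)"

lemma tt_GP:
  assumes h: "GP w1 w2 h"
  obtains w v1 v2 where "GP v1 v2 w" "(l2_of h, l2_of w) \<in> tt \<theta> r"
    "\<And>a b c j. (l2_of (lin a b c j h), l2_of (lin a b (c + shift \<theta> r a b) j w)) \<in> tt \<theta> r"
proof -
  have hs: "schwartz h" by (rule GP_schwartz[OF h])
  obtain h' where h': "GP (cis (- \<theta>) * w1) (cis (- \<theta>) * w2) h'" "rot (cis (- \<theta>)) (l2_of h) = l2_of h'"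
    using rot_GP[OF h, of "- \<theta>"] by blast
  have hs': "schwartz h'" by (rule GP_schwartz[OF h'(1)])
  have Wh': "rot (cis \<theta>) (l2_of h') = l2_of h" unfolding h'(2)[symmetric] by simp
  define k where "k = (\<lambda>x. complex_of_real (exp (mm r x)) * h' x)"
  obtain v1 v2 where k: "GP v1 v2 k" unfolding k_def using GP_exp_mm[OF h'(1)] by blast
  have ks: "schwartz k" by (rule GP_schwartz[OF k])
  obtain w where w: "GP (cis \<theta> * v1) (cis \<theta> * v2) w" "rot (cis \<theta>) (l2_of k) = l2_of w" using rot_GP[OF k] by blast
  have ws: "schwartz w" by (rule GP_schwartz[OF w(1)])
  have pair: "(rot (cis \<theta>) (l2_of u), rot (cis \<theta>) (l2_of (\<lambda>x. complex_of_real (exp (mm r x)) * u x))) \<in> tt \<theta> r"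
    if "GP u1 u2 u" for u1 u2 u
    using that by (auto simp: rotop_def mult_op_def schwartz_square_integrable GP_schwartz
        intro!: exI[of _ u] schwartz_square_integrable[OF GP_schwartz[OF GP_exp_mm[OF that]]])
  show ?thesis
  proof (rule that[OF w(1)])
    show "(l2_of h, l2_of w) \<in> tt \<theta> r" using pair[OF h'(1)] by (simp add: Wh' w(2) flip: k_def)
    fix a b c j
    define ct st where "ct = complex_of_real (cos \<theta>)" and "st = complex_of_real (sin \<theta>)"
    have cs: "ct * ct + st * st = 1" unfolding ct_def st_def
      by (simp add: sin_cos_squared_add3 flip: of_real_mult of_real_add)
    \<comment> \<open>The coefficients rotated backwards, so that rotating forwards restores
      \<open>a\<close> and \<open>b\<close>. In between, the exponential sees the momentum
      coefficient \<open>b'\<close>, which is the origin of \<open>shift\<close>.\<close>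
    define a' b' where "a' = a * ct + b * st" and "b' = b * ct - a * st"
    have ab: "a' * ct - b' * st = a" "a' * st + b' * ct = b"
    proof -
      have "a' * ct - b' * st = a * (ct * ct + st * st)" "a' * st + b' * ct = b * (ct * ct + st * st)"
        by (simp_all add: a'_def b'_def algebra_simps)
      then show "a' * ct - b' * st = a" "a' * st + b' * ct = b" by (simp_all add: cs)
    qed
    have 1: "rot (cis \<theta>) (l2_of (lin a' b' c j h')) = l2_of (lin a b c j h)"
      using rot_lin[OF hs' hs Wh', of a' b' c j] by (simp add: ab flip: ct_def st_def)
    have 2: "(\<lambda>x. complex_of_real (exp (mm r x)) * lin a' b' c j h' x) = lin a' b' (c + \<i> * complex_of_real r * b') j k"
      unfolding k_def by (rule ext) (rule exp_mm_lin[OF hs'])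
    have 3: "rot (cis \<theta>) (l2_of (lin a' b' (c + shift \<theta> r a b) j k)) = l2_of (lin a b (c + shift \<theta> r a b) j w)"
      using rot_lin[OF ks ws w(2), of a' b' _ j] by (simp add: ab flip: ct_def st_def)
    have 4: "\<i> * complex_of_real r * b' = shift \<theta> r a b" by (simp add: shift_def b'_def ct_def st_def)
    show "(l2_of (lin a b c j h), l2_of (lin a b (c + shift \<theta> r a b) j w)) \<in> tt \<theta> r"
      using pair[OF GP_lin[OF h'(1)], of a' b' c j] unfolding 1 2 3 4 .
  qed
qed

lemma tt_GP_ex:
  assumes "GP w1 w2 h" shows "\<exists>w v1 v2. GP v1 v2 w \<and> (l2_of h, l2_of w) \<in> tt \<theta> r"
  by (rule tt_GP[OF assms, where \<theta>=\<theta> and r=r]) (intro exI conjI)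

lemma shift_cnj: "cnj (shift \<theta> r (cnj a) (cnj b)) = - shift \<theta> r a b"
proof -
  have "cnj (cos (complex_of_real \<theta>)) = cos (complex_of_real \<theta>)" "cnj (sin (complex_of_real \<theta>)) = sin (complex_of_real \<theta>)"
    by (simp_all add: cos_of_real sin_of_real)
  then show ?thesis by (simp add: shift_def)
qed

lemma tt_lin:
  assumes f: "schwartz f" and g: "schwartz g" and fg: "(l2_of f, l2_of g) \<in> tt \<theta> r"
  shows "(l2_of (lin a b c j f), l2_of (lin a b (c + shift \<theta> r a b) j g)) \<in> tt \<theta> r"
  unfolding rotop_core_iff[OF core_multiplier_exp_mm]
proof (intro allI impI)
  fix h0 assume h0: "GP 0 0 h0"
  obtain h where h: "GP 0 0 h" "rot (cis \<theta>) (l2_of h0) = l2_of h" using rot_GP[OF h0, of \<theta>] by auto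
  obtain w v1 v2 where w: "GP v1 v2 w" "(l2_of h, l2_of w) \<in> tt \<theta> r"
    "\<And>a b c j. (l2_of (lin a b c j h), l2_of (lin a b (c + shift \<theta> r a b) j w)) \<in> tt \<theta> r"
    by (rule tt_GP[OF h(1), where \<theta>=\<theta> and r=r]) blast
  have hs: "schwartz h" and ws: "schwartz w" using h w GP_schwartz by blast+
  have ew: "rot (cis \<theta>) (l2_of (\<lambda>x. complex_of_real (exp (mm r x)) * h0 x)) = l2_of w"
    using rotop_rot_GP[OF core_multiplier_exp_mm h0, of \<theta> r] w(2) unfolding h(2) by (rule tt_unique)
  \<comment> \<open>Chosen so that the exponential shifts it to \<open>cnj c\<close>, the constant
    of the formal adjoint.\<close>
  define c' where "c' = cnj c - shift \<theta> r (cnj a) (cnj b)"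
  have "cinner (l2_of (lin a b c j f)) (l2_of w) = cinner (l2_of f) (l2_of (lin (cnj a) (cnj b) (cnj c) j w))"
    using cinner_lin[OF f ws, of "cnj a" "cnj b" "cnj c" j] by simp
  also have "\<dots> = cinner (l2_of g) (l2_of (lin (cnj a) (cnj b) c' j h))"
    using tt_symmetric[OF fg w(3)[of "cnj a" "cnj b" c' j]] by (simp add: c'_def)
  also have "\<dots> = cinner (l2_of (lin a b (cnj c') j g)) (l2_of h)"
    using cinner_lin[OF g hs, of "cnj a" "cnj b" c' j] by simp
  also have "cnj c' = c + shift \<theta> r a b" by (simp add: c'_def shift_cnj)
  finally show "cinner (l2_of (lin a b c j f)) (rot (cis \<theta>) (l2_of (\<lambda>x. complex_of_real (exp (mm r x)) * h0 x))) =
     cinner (l2_of (lin a b (c + shift \<theta> r a b) j g)) (rot (cis \<theta>) (l2_of h0))"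
    unfolding ew h(2) .
qed

text \<open>Intertwining wherever a function and its image are both Schwartz. The relation passes to
  sums and products, so quadratic operators follow from \<open>tcov_lin\<close>.\<close>

definition tcov :: "real \<Rightarrow> real \<Rightarrow> ((real^2 \<Rightarrow> complex) \<Rightarrow> real^2 \<Rightarrow> complex) \<Rightarrow> ((real^2 \<Rightarrow> complex) \<Rightarrow> real^2 \<Rightarrow> complex) \<Rightarrow> bool" where
  "tcov \<theta> r L M \<longleftrightarrow> schwartz_map L \<and> schwartz_map M \<and>
     (\<forall>f g. schwartz f \<longrightarrow> schwartz g \<longrightarrow> (l2_of f, l2_of g) \<in> tt \<theta> r \<longrightarrow> (l2_of (L f), l2_of (M g)) \<in> tt \<theta> r)"

lemma tcovD: "tcov \<theta> r L M \<Longrightarrow> schwartz f \<Longrightarrow> schwartz g \<Longrightarrow> (l2_of f, l2_of g) \<in> tt \<theta> r \<Longrightarrow> (l2_of (L f), l2_of (M g)) \<in> tt \<theta> r"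
  by (simp add: tcov_def)

lemma tcov_lin: "tcov \<theta> r (lin a b c j) (lin a b (c + shift \<theta> r a b) j)"
  by (simp add: tcov_def schwartz_map_lin tt_lin)

lemma tcov_comp: "tcov \<theta> r L M \<Longrightarrow> tcov \<theta> r L' M' \<Longrightarrow> tcov \<theta> r (\<lambda>f. L (L' f)) (\<lambda>f. M (M' f))"
  by (auto simp: tcov_def schwartz_map_def)

lemma tcov_ident: "tcov \<theta> r (\<lambda>f. f) (\<lambda>f. f)"
  by (simp add: tcov_def schwartz_map_def)

lemma tcov_add:
  assumes "tcov \<theta> r L M" "tcov \<theta> r L' M'"
  shows "tcov \<theta> r (\<lambda>f x. L f x + L' f x) (\<lambda>f x. M f x + M' f x)"
  using assms unfolding tcov_def
  by (auto simp: schwartz_map_add schwartz_mapD schwartz_square_integrable tt_add simp flip: l2_of_add)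

lemma tcov_scale:
  assumes "tcov \<theta> r L M"
  shows "tcov \<theta> r (\<lambda>f x. c * L f x) (\<lambda>f x. c * M f x)"
  using assms unfolding tcov_def
  by (auto simp: schwartz_map_scale schwartz_mapD schwartz_square_integrable tt_scale simp flip: l2_of_scale)

lemma tcov_pow: "tcov \<theta> r L M \<Longrightarrow> tcov \<theta> r (L ^^ n) (M ^^ n)"
proof (induction n)
  case 0 show ?case using tcov_ident by (simp add: id_def)
next
  case (Suc n) then show ?case using tcov_comp[of \<theta> r L M "L ^^ n" "M ^^ n"] by (simp add: o_def)
qed

section \<open>Operator identities on restricted domains\<close>

lemma stable_underE:
  assumes "stable_under M R" "F \<in> M" obtains G where "(F, G) \<in> R" "G \<in> M"
  using assms unfolding stable_under_def by blast

lemma op_restrict_eqI: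
  assumes "single_valued R" "single_valued R'"
    and "\<And>F. F \<in> M \<Longrightarrow> \<exists>G. (F, G) \<in> R \<and> (F, G) \<in> R'"
  shows "op_restrict R M = op_restrict R' M"
proof (intro set_eqI iffI; clarify)
  fix F G assume "(F, G) \<in> op_restrict R M"
  then have a: "(F, G) \<in> R" "F \<in> M" by (auto simp: op_restrict_def)
  then show "(F, G) \<in> op_restrict R' M" using assms by (auto simp: op_restrict_def single_valued_def) metis
next
  fix F G assume "(F, G) \<in> op_restrict R' M"
  then have a: "(F, G) \<in> R'" "F \<in> M" by (auto simp: op_restrict_def)
  then show "(F, G) \<in> op_restrict R M" using assms by (auto simp: op_restrict_def single_valued_def) metis
qed

lemma single_valued_sop: "single_valued (sop L)"
  by (rule single_valuedI) (metis sopE sop_iff)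

lemma single_valued_op_mult: "single_valued R \<Longrightarrow> single_valued S \<Longrightarrow> single_valued (R *\<^sub>o S)"
  unfolding op_mult_def by (rule single_valued_relcomp)

lemma maps_within_tt_E:
  assumes "F \<in> maps_within \<S> (tt \<theta> r)"
  obtains f g where "schwartz f" "schwartz g" "F = l2_of f" "(l2_of f, l2_of g) \<in> tt \<theta> r"
  using assms by (auto simp: maps_within_def \<S>_def)

text \<open>\<open>sop M\<close> needs a Schwartz class as argument, which is why the identity is
  confined to vectors whose image under \<open>tt \<theta> r\<close> lies in \<open>\<S>\<close> as
  well.\<close>

lemma conjugate_on_maps_within:
  assumes cov: "tcov \<theta> r L M"
  shows "op_restrict (sop L) (maps_within \<S> (tt \<theta> r)) =
    op_restrict ((tt \<theta> r)\<inverse> *\<^sub>o sop M *\<^sub>o tt \<theta> r) (maps_within \<S> (tt \<theta> r))"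
proof (rule op_restrict_eqI)
  show "single_valued ((tt \<theta> r)\<inverse> *\<^sub>o sop M *\<^sub>o tt \<theta> r)"
    unfolding tt_converse by (intro single_valued_op_mult single_valued_tt single_valued_sop)
  fix F assume "F \<in> maps_within \<S> (tt \<theta> r)"
  then obtain f g where f: "schwartz f" "schwartz g" "F = l2_of f" "(l2_of f, l2_of g) \<in> tt \<theta> r" by (rule maps_within_tt_E)
  have "(l2_of (L f), l2_of (M g)) \<in> tt \<theta> r" using cov f by (simp add: tcov_def)
  then have "(l2_of f, l2_of (L f)) \<in> (tt \<theta> r)\<inverse> *\<^sub>o sop M *\<^sub>o tt \<theta> r"
    using f by (auto simp: op_mult_def sop_iff intro!: relcompI)
  then show "\<exists>G. (F, G) \<in> sop L \<and> (F, G) \<in> (tt \<theta> r)\<inverse> *\<^sub>o sop M *\<^sub>o tt \<theta> r"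
    using f by (auto simp: sop_iff)
qed (rule single_valued_sop)

lemma csubspace_S: "csubspace \<S>"
  unfolding csubspace_def \<S>_def
proof (intro conjI ballI allI)
  have "0 = l2_of (\<lambda>x. 0 * gauss 0 0 x)" by (simp add: l2_of_zero)
  then show "0 \<in> l2_of ` {f. schwartz f}" using schwartz_cmult[OF schwartz_gauss] by blast
next
  fix F G assume "F \<in> l2_of ` {f. schwartz f}" "G \<in> l2_of ` {f. schwartz f}"
  then obtain f g where "schwartz f" "F = l2_of f" "schwartz g" "G = l2_of g" by blast
  then show "F + G \<in> l2_of ` {f. schwartz f}"
    by (intro image_eqI[of _ _ "\<lambda>x. f x + g x"]) (simp_all add: l2_of_add schwartz_square_integrable schwartz_add)
next
  fix c F assume "F \<in> l2_of ` {f. schwartz f}"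
  then obtain f where "schwartz f" "F = l2_of f" by blast
  then show "c *\<^sub>C F \<in> l2_of ` {f. schwartz f}"
    by (intro image_eqI[of _ _ "\<lambda>x. c * f x"]) (simp_all add: l2_of_scale schwartz_square_integrable schwartz_cmult)
qed

lemma S_zero: "0 \<in> \<S>" and S_add: "F \<in> \<S> \<Longrightarrow> G \<in> \<S> \<Longrightarrow> F + G \<in> \<S>" and S_scale: "F \<in> \<S> \<Longrightarrow> c *\<^sub>C F \<in> \<S>"
  using csubspace_S unfolding csubspace_def by blast+

lemma maps_withinI: "F \<in> M \<Longrightarrow> G \<in> M \<Longrightarrow> (F, G) \<in> R \<Longrightarrow> F \<in> maps_within M R"
  unfolding maps_within_def by blast

lemma maps_withinE:
  assumes "F \<in> maps_within M R" obtains G where "F \<in> M" "G \<in> M" "(F, G) \<in> R"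
  using assms unfolding maps_within_def by blast

lemma dense_maps_within_tt: "dense_subspace (maps_within \<S> (tt \<theta> r))"
  unfolding dense_subspace_def
proof
  show "csubspace (maps_within \<S> (tt \<theta> r))"
    unfolding csubspace_def
  proof (intro conjI ballI allI)
    show "0 \<in> maps_within \<S> (tt \<theta> r)"
      by (rule maps_withinI[OF S_zero S_zero tt_zero])
  next
    fix F G assume "F \<in> maps_within \<S> (tt \<theta> r)" "G \<in> maps_within \<S> (tt \<theta> r)"
    then obtain F' G' where F: "F \<in> \<S>" "F' \<in> \<S>" "(F, F') \<in> tt \<theta> r" and G: "G \<in> \<S>" "G' \<in> \<S>" "(G, G') \<in> tt \<theta> r"
      using maps_withinE by metis
    show "F + G \<in> maps_within \<S> (tt \<theta> r)"
      by (rule maps_withinI[OF S_add[OF F(1) G(1)] S_add[OF F(2) G(2)] tt_add[OF F(3) G(3)]])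
  next
    fix c F assume "F \<in> maps_within \<S> (tt \<theta> r)"
    then obtain F' where F: "F \<in> \<S>" "F' \<in> \<S>" "(F, F') \<in> tt \<theta> r" by (rule maps_withinE)
    show "c *\<^sub>C F \<in> maps_within \<S> (tt \<theta> r)"
      by (rule maps_withinI[OF S_scale[OF F(1)] S_scale[OF F(2)] tt_scale[OF F(3)]])
  qed
  show "closure (maps_within \<S> (tt \<theta> r)) = UNIV"
  proof (rule closure_UNIV_if_GP)
    fix h assume h: "GP 0 0 h"
    obtain w v1 v2 where "GP v1 v2 w" "(l2_of h, l2_of w) \<in> tt \<theta> r"
      using tt_GP_ex[OF h] by blast
    then show "l2_of h \<in> maps_within \<S> (tt \<theta> r)"
      using h l2_of_GP_in_S by (auto simp: maps_within_def)
  qed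
qed

section \<open>The invariant part of the Schwartz space\<close>

text \<open>The union of \<open>GP w1 w2\<close> over all parameters is invariant under both
  exponentials, since these map each class into one with other parameters; hence \<open>U\<close>
  quantifies over them.\<close>

lemma GP_in_invariant_part: "GP w1 w2 h \<Longrightarrow> l2_of h \<in> invariant_part \<S> (tt \<theta> r)"
proof -
  assume h: "GP w1 w2 h"
  define U where "U = {l2_of h | h w1 w2. GP w1 w2 h}"
  have st: "stable_under U (tt \<theta> s)" for s
    unfolding stable_under_def
  proof (intro conjI subsetI)
    fix F assume "F \<in> U"
    then obtain h w1 w2 where h: "F = l2_of h" "GP w1 w2 h" by (auto simp: U_def)
    obtain w v1 v2 where "GP v1 v2 w" "(l2_of h, l2_of w) \<in> tt \<theta> s"
      using tt_GP_ex[OF h(2)] by blast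
    then show "F \<in> Domain (tt \<theta> s)" using h by blast
  next
    fix G assume "G \<in> tt \<theta> s `` U"
    then obtain h w1 w2 where h: "(l2_of h, G) \<in> tt \<theta> s" "GP w1 w2 h" by (auto simp: U_def)
    obtain w v1 v2 where w: "GP v1 v2 w" "(l2_of h, l2_of w) \<in> tt \<theta> s"
      using tt_GP_ex[OF h(2)] by blast
    then have "G = l2_of w" using h tt_unique by blast
    then show "G \<in> U" using w by (auto simp: U_def)
  qed
  have "U \<subseteq> \<S>" by (auto simp: U_def l2_of_GP_in_S)
  then have "U \<subseteq> invariant_part \<S> (tt \<theta> r)"
    using st unfolding invariant_part_def tt_converse by blast
  then show ?thesis using h by (auto simp: U_def)
qed

lemma invariant_part_subset: "invariant_part \<S> (tt \<theta> r) \<subseteq> \<S>"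
  by (auto simp: invariant_part_def)

lemma stable_invariant_part:
  "stable_under (invariant_part \<S> (tt \<theta> r)) (tt \<theta> r)" "stable_under (invariant_part \<S> (tt \<theta> r)) (tt \<theta> (- r))"
  unfolding invariant_part_def stable_under_def tt_converse by blast+

lemma subset_invariant_part:
  "U \<subseteq> \<S> \<Longrightarrow> stable_under U (tt \<theta> r) \<Longrightarrow> stable_under U (tt \<theta> (- r)) \<Longrightarrow> U \<subseteq> invariant_part \<S> (tt \<theta> r)"
  unfolding invariant_part_def tt_converse by blast

text \<open>A union of invariant sets need not be closed under addition, but the combinations of two
  of its elements form another invariant set and so lie inside the largest one.\<close>

lemma csubspace_invariant_part: "csubspace (invariant_part \<S> (tt \<theta> r))"
proof -
  let ?I = "invariant_part \<S> (tt \<theta> r)"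
  define U where "U = {c *\<^sub>C F + d *\<^sub>C G | c d F G. F \<in> ?I \<and> G \<in> ?I}"
  have US: "U \<subseteq> \<S>"
  proof
    fix H assume "H \<in> U"
    then obtain c d F G where H: "H = c *\<^sub>C F + d *\<^sub>C G" "F \<in> ?I" "G \<in> ?I" by (auto simp: U_def)
    then have "F \<in> \<S>" "G \<in> \<S>" using invariant_part_subset by blast+
    then show "H \<in> \<S>" unfolding H(1) by (intro S_add S_scale)
  qed
  have st: "stable_under U (tt \<theta> s)" if s: "stable_under ?I (tt \<theta> s)" for s
    unfolding stable_under_def
  proof (intro conjI subsetI)
    fix H assume "H \<in> U"
    then obtain c d F G where H: "H = c *\<^sub>C F + d *\<^sub>C G" "F \<in> ?I" "G \<in> ?I" by (auto simp: U_def)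
    obtain F' G' where "(F, F') \<in> tt \<theta> s" "(G, G') \<in> tt \<theta> s"
      using stable_underE[OF s H(2)] stable_underE[OF s H(3)] by metis
    then show "H \<in> Domain (tt \<theta> s)" unfolding H using tt_add[OF tt_scale tt_scale] by blast
  next
    fix H' assume "H' \<in> tt \<theta> s `` U"
    then obtain c d F G where H: "(c *\<^sub>C F + d *\<^sub>C G, H') \<in> tt \<theta> s" "F \<in> ?I" "G \<in> ?I" by (auto simp: U_def)
    obtain F' G' where FG: "(F, F') \<in> tt \<theta> s" "(G, G') \<in> tt \<theta> s" "F' \<in> ?I" "G' \<in> ?I"
      using stable_underE[OF s H(2)] stable_underE[OF s H(3)] by metis
    have "(c *\<^sub>C F + d *\<^sub>C G, c *\<^sub>C F' + d *\<^sub>C G') \<in> tt \<theta> s" by (intro tt_add tt_scale FG)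
    then have "H' = c *\<^sub>C F' + d *\<^sub>C G'" using H tt_unique by blast
    then show "H' \<in> U" using FG by (auto simp: U_def)
  qed
  have UI: "U \<subseteq> ?I" by (intro subset_invariant_part US st stable_invariant_part)
  show ?thesis
    unfolding csubspace_def
  proof (intro conjI ballI allI)
    have "l2_of (\<lambda>x. 0 * gauss 0 0 x) \<in> ?I" by (rule GP_in_invariant_part[OF GP.scale[OF GP.gauss]])
    then show "0 \<in> ?I" by (simp add: l2_of_zero)
    fix F G assume "F \<in> ?I" "G \<in> ?I"
    then have "1 *\<^sub>C F + 1 *\<^sub>C G \<in> U" unfolding U_def by blast
    then show "F + G \<in> ?I" using UI by auto
  next
    fix c F assume F: "F \<in> ?I"
    then have "c *\<^sub>C F + 0 *\<^sub>C F \<in> U" unfolding U_def by blast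
    then show "c *\<^sub>C F \<in> ?I" using UI by auto
  qed
qed

lemma dense_invariant_part: "dense_subspace (invariant_part \<S> (tt \<theta> r))"
  using csubspace_invariant_part closure_UNIV_if_GP[OF GP_in_invariant_part] by (simp add: dense_subspace_def)

text \<open>Applying the exponential to \<open>lin a b c j f\<close> produces an extra scalar
  multiple of the image of \<open>f\<close>. The summand \<open>G\<close> in \<open>U\<close>
  absorbs it, which makes \<open>U\<close> invariant and hence part of the largest invariant
  set.\<close>

lemma stable_invariant_part_lin: "stable_under (invariant_part \<S> (tt \<theta> r)) (sop (lin a b c j))"
proof -
  let ?I = "invariant_part \<S> (tt \<theta> r)"
  define U where "U = {l2_of (lin a b c j f) + G | f G. schwartz f \<and> l2_of f \<in> ?I \<and> G \<in> ?I}"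
  have US: "U \<subseteq> \<S>"
  proof
    fix H assume "H \<in> U"
    then obtain f G where H: "H = l2_of (lin a b c j f) + G" "schwartz f" "G \<in> ?I" by (auto simp: U_def)
    have "l2_of (lin a b c j f) \<in> \<S>" using H by (auto simp: \<S>_def schwartz_lin)
    moreover have "G \<in> \<S>" using H invariant_part_subset by blast
    ultimately show "H \<in> \<S>" unfolding H(1) by (rule S_add)
  qed
  have key: "\<exists>H'\<in>U. (H, H') \<in> tt \<theta> s" if s: "stable_under ?I (tt \<theta> s)" and H: "H \<in> U" for s H
  proof -
    obtain f G where H: "H = l2_of (lin a b c j f) + G" "schwartz f" "l2_of f \<in> ?I" "G \<in> ?I" using H by (auto simp: U_def)
    obtain F' G' where FG: "(l2_of f, F') \<in> tt \<theta> s" "(G, G') \<in> tt \<theta> s" "F' \<in> ?I" "G' \<in> ?I"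
      using stable_underE[OF s H(3)] stable_underE[OF s H(4)] by metis
    have "F' \<in> \<S>" using FG(3) invariant_part_subset by blast
    then obtain f' where f': "schwartz f'" "F' = l2_of f'" by (auto simp: \<S>_def)
    have "(H, l2_of (lin a b (c + shift \<theta> s a b) j f') + G') \<in> tt \<theta> s"
      unfolding H(1) using FG f' H by (intro tt_add tt_lin) auto
    also have "lin a b (c + shift \<theta> s a b) j f' = (\<lambda>x. lin a b c j f' x + shift \<theta> s a b * f' x)"
      by (auto simp: lin_def algebra_simps)
    also have "l2_of (\<lambda>x. lin a b c j f' x + shift \<theta> s a b * f' x) = l2_of (lin a b c j f') + shift \<theta> s a b *\<^sub>C l2_of f'"
      using f' by (simp add: l2_of_add l2_of_scale schwartz_square_integrable schwartz_lin square_integrable_cmult)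
    finally have "(H, l2_of (lin a b c j f') + (shift \<theta> s a b *\<^sub>C l2_of f' + G')) \<in> tt \<theta> s" by (simp add: add.assoc)
    moreover have "shift \<theta> s a b *\<^sub>C l2_of f' + G' \<in> ?I"
      using csubspace_invariant_part FG f' by (simp add: csubspace_def)
    ultimately show ?thesis using FG f' unfolding U_def by blast
  qed
  have st: "stable_under U (tt \<theta> s)" if s: "stable_under ?I (tt \<theta> s)" for s
    unfolding stable_under_def
  proof (intro conjI subsetI)
    fix H assume "H \<in> U" then show "H \<in> Domain (tt \<theta> s)" using key[OF s] by blast
  next
    fix H' assume "H' \<in> tt \<theta> s `` U"
    then obtain H where H: "H \<in> U" "(H, H') \<in> tt \<theta> s" by blast
    obtain K where "K \<in> U" "(H, K) \<in> tt \<theta> s" using key[OF s H(1)] by blast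
    then show "H' \<in> U" using H tt_unique by blast
  qed
  have UI: "U \<subseteq> ?I" by (intro subset_invariant_part US st stable_invariant_part)
  show ?thesis
    unfolding stable_under_def
  proof (intro conjI)
    show "?I \<subseteq> Domain (sop (lin a b c j))" using invariant_part_subset by (simp add: sop_Domain)
    show "sop (lin a b c j) `` ?I \<subseteq> ?I"
    proof
      fix G assume "G \<in> sop (lin a b c j) `` ?I"
      then obtain F where "F \<in> ?I" "(F, G) \<in> sop (lin a b c j)" by blast
      then obtain f where f: "schwartz f" "l2_of f \<in> ?I" "G = l2_of (lin a b c j f)" by (auto elim!: sopE)
      have "0 \<in> ?I" using csubspace_invariant_part by (simp add: csubspace_def)
      then have "l2_of (lin a b c j f) + 0 \<in> U" using f unfolding U_def by blast
      then show "G \<in> ?I" using UI f by auto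
    qed
  qed
qed

lemma invariant_part_maps_within: "invariant_part \<S> (tt \<theta> r) \<subseteq> maps_within \<S> (tt \<theta> r)"
  using stable_invariant_part(1) invariant_part_subset unfolding stable_under_def maps_within_def by blast

lemma op_restrict_mono: "op_restrict R M = op_restrict R' M \<Longrightarrow> M' \<subseteq> M \<Longrightarrow> op_restrict R M' = op_restrict R' M'"
  unfolding op_restrict_def by blast

section \<open>Biorthogonal expansions\<close>

text \<open>Symmetry moves the exponentials from \<xi> and \<eta> onto \<open>f\<close> and
  \<open>g\<close>, leaving Parseval for the Hermite basis. Opposite exponents give the quasi bases,
  equal ones the expansions of \<Theta> and its inverse.\<close>

lemma has_sum_tt_expansion:
  assumes \<xi>: "\<And>n. (c *\<^sub>C hbasis n, \<xi> n) \<in> tt \<theta> r" and \<eta>: "\<And>n. (d *\<^sub>C hbasis n, \<eta> n) \<in> tt \<theta> s"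
    and cd: "c * cnj d = 1"
    and f: "(f, f') \<in> tt \<theta> r" and g: "(g, g') \<in> tt \<theta> s"
  shows "((\<lambda>n. cinner f (\<xi> n) * cinner (\<eta> n) g) has_sum cinner f' g') UNIV"
proof -
  have "cinner f (\<xi> n) * cinner (\<eta> n) g = cinner f' (hbasis n) * cinner (hbasis n) g'" for n
  proof -
    have "cinner f (\<xi> n) = c * cinner f' (hbasis n)" using tt_symmetric[OF f \<xi>, of n] by (simp add: cinner_scale_right)
    moreover have "cinner (\<eta> n) g = cnj d * cinner (hbasis n) g'" using tt_symmetric[OF \<eta> g, of n] by (simp add: cinner_scale_left)
    ultimately show ?thesis using cd by (simp add: mult_ac)
  qed
  then show ?thesis using Parseval_has_sum[OF orthonormal_basis_hbasis, of f' g'] by simp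
qed

text \<open>A uniform limit of finite-rank operators on the unit ball is bounded there. On the
  domain of \<open>tt \<theta> r\<close> its quadratic form dominates
  \<open>(cmod c)\<^sup>2 * (norm g')\<^sup>2\<close>, with \<open>g'\<close> the image of
  \<open>g\<close>, so \<open>tt \<theta> r\<close> would be bounded.\<close>

lemma not_uniform_limit_expansion:
  assumes r: "r \<noteq> 0" and c: "c \<noteq> 0" and \<xi>: "\<And>n. (c *\<^sub>C hbasis n, \<xi> n) \<in> tt \<theta> r"
    and F: "\<And>i. finite (F i)" "incseq F" "(\<Union>i. F i) = UNIV"
  shows "\<not> (\<exists>R. uniform_limit (cball 0 1) (\<lambda>i f. \<Sum>n\<in>F i. cinner (\<xi> n) f *\<^sub>C \<xi> n) R sequentially)"
proof
  assume "\<exists>R. uniform_limit (cball 0 1) (\<lambda>i f. \<Sum>n\<in>F i. cinner (\<xi> n) f *\<^sub>C \<xi> n) R sequentially"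
  then obtain R where R: "uniform_limit (cball 0 1) (\<lambda>i f. \<Sum>n\<in>F i. cinner (\<xi> n) f *\<^sub>C \<xi> n) R sequentially" ..
  define S where "S i f = (\<Sum>n\<in>F i. cinner (\<xi> n) f *\<^sub>C \<xi> n)" for i f
  have "\<forall>\<^sub>F i in sequentially. \<forall>f\<in>cball 0 1. dist (S i f) (R f) < 1"
    using uniform_limitD[OF R zero_less_one] unfolding S_def .
  then obtain i0 where i0: "\<And>f. f \<in> cball 0 1 \<Longrightarrow> dist (S i0 f) (R f) < 1"
    unfolding eventually_sequentially by blast
  \<comment> \<open>A bound of the finite sum on the unit ball, plus 1 for its distance from the
    limit.\<close>
  define B where "B = (\<Sum>n\<in>F i0. norm (\<xi> n) * norm (\<xi> n)) + 1"
  have RB: "norm (R f) \<le> B" if f: "f \<in> cball 0 1" for f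
  proof -
    have "norm (S i0 f) \<le> (\<Sum>n\<in>F i0. norm (\<xi> n) * norm (\<xi> n))"
      unfolding S_def
    proof (rule sum_norm_le)
      fix n
      have "cmod (cinner (\<xi> n) f) \<le> norm (\<xi> n) * norm f" by (rule cinner_Cauchy_Schwarz)
      also have "\<dots> \<le> norm (\<xi> n) * 1" using f by (intro mult_left_mono) auto
      finally show "norm (cinner (\<xi> n) f *\<^sub>C \<xi> n) \<le> norm (\<xi> n) * norm (\<xi> n)" by (simp add: mult_right_mono)
    qed
    then show ?thesis using i0[OF f] norm_triangle_ineq2[of "R f" "S i0 f"]
      by (simp add: B_def dist_norm norm_minus_commute)
  qed
  have bound: "(cmod c)\<^sup>2 * (norm g')\<^sup>2 \<le> B" if g: "(g, g') \<in> tt \<theta> r" "g \<in> cball 0 1" for g g'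
  proof -
    have trm: "cinner g (cinner (\<xi> n) g *\<^sub>C \<xi> n) = complex_of_real ((cmod c)\<^sup>2 * (cmod (cinner (hbasis n) g'))\<^sup>2)" for n
    proof -
      have "cinner (\<xi> n) g = cnj c * cinner (hbasis n) g'" using tt_symmetric[OF \<xi> g(1), of n] by (simp add: cinner_scale_left)
      moreover from this have "cinner g (\<xi> n) = c * cnj (cinner (hbasis n) g')" by (subst cinner_commute) simp
      ultimately show ?thesis
        by (simp add: cinner_scale_right complex_norm_square mult_ac del: of_real_power)
    qed
    have Sg: "cinner g (S i g) = complex_of_real (\<Sum>n\<in>F i. (cmod c)\<^sup>2 * (cmod (cinner (hbasis n) g'))\<^sup>2)" for i
      by (simp only: S_def cinner_sum_right trm of_real_sum)
    have "(\<lambda>i. S i g) \<longlonglongrightarrow> R g" unfolding S_def by (rule tendsto_uniform_limitI[OF R g(2)])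
    then have "(\<lambda>i. Re (cinner g (S i g))) \<longlonglongrightarrow> Re (cinner g (R g))" by (intro tendsto_intros)
    then have lim: "(\<lambda>i. \<Sum>n\<in>F i. (cmod c)\<^sup>2 * (cmod (cinner (hbasis n) g'))\<^sup>2) \<longlonglongrightarrow> Re (cinner g (R g))"
      by (simp add: Sg)
    have "Re (cinner g (R g)) \<le> norm g * norm (R g)"
      using cinner_Cauchy_Schwarz[of g "R g"] complex_Re_le_cmod[of "cinner g (R g)"] by linarith
    also have "\<dots> \<le> 1 * B" using g(2) RB[OF g(2)] by (intro mult_mono) auto
    finally have ReB: "Re (cinner g (R g)) \<le> B" by simp
    have fin: "(\<Sum>n\<in>P. (cmod c)\<^sup>2 * (cmod (cinner (hbasis n) g'))\<^sup>2) \<le> B" if P: "finite P" for P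
    proof -
      have "\<exists>i. P \<subseteq> F i" using P
      proof (induction rule: finite_induct)
        case (insert p P)
        then obtain i where "P \<subseteq> F i" by blast
        moreover obtain k where "p \<in> F k" using F(3) by blast
        ultimately have "insert p P \<subseteq> F (max i k)"
          using incseqD[OF F(2), of i "max i k"] incseqD[OF F(2), of k "max i k"] by auto
        then show ?case by blast
      qed simp
      then obtain i where i: "P \<subseteq> F i" by blast
      have "(\<Sum>n\<in>P. (cmod c)\<^sup>2 * (cmod (cinner (hbasis n) g'))\<^sup>2) \<le> Re (cinner g (R g))"
      proof (rule LIMSEQ_le_const[OF lim], intro exI allI impI)
        fix k assume "i \<le> k"
        then have "P \<subseteq> F k" using i incseqD[OF F(2)] by blast
        then show "(\<Sum>n\<in>P. (cmod c)\<^sup>2 * (cmod (cinner (hbasis n) g'))\<^sup>2) \<le> (\<Sum>n\<in>F k. (cmod c)\<^sup>2 * (cmod (cinner (hbasis n) g'))\<^sup>2)"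
          by (intro sum_mono2 F) auto
      qed
      then show ?thesis using ReB by linarith
    qed
    have "((\<lambda>n. cinner g' (hbasis n) * cinner (hbasis n) g') has_sum cinner g' g') UNIV"
      by (rule Parseval_has_sum[OF orthonormal_basis_hbasis])
    moreover have "cinner g' (hbasis n) * cinner (hbasis n) g' = complex_of_real ((cmod (cinner (hbasis n) g'))\<^sup>2)" for n
      by (subst cinner_commute) (simp add: complex_norm_square mult.commute del: of_real_power)
    ultimately have "((\<lambda>n. complex_of_real ((cmod (cinner (hbasis n) g'))\<^sup>2)) has_sum complex_of_real ((norm g')\<^sup>2)) UNIV"
      by (simp only: cinner_self_norm)
    from has_sum_Re[OF this] have "((\<lambda>n. (cmod (cinner (hbasis n) g'))\<^sup>2) has_sum (norm g')\<^sup>2) UNIV"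
      by (simp del: of_real_power)
    from has_sum_cmult_right[OF this, of "(cmod c)\<^sup>2"]
    have "((\<lambda>n. (cmod c)\<^sup>2 * (cmod (cinner (hbasis n) g'))\<^sup>2) has_sum (cmod c)\<^sup>2 * (norm g')\<^sup>2) UNIV" .
    then show ?thesis by (rule has_sum_le_finite_sums) (use fin in auto)
  qed
  define C where "C = sqrt (B / (cmod c)\<^sup>2)"
  have "norm g' \<le> C * norm g" if g: "(g, g') \<in> tt \<theta> r" for g g'
  proof (cases "g = 0")
    case True
    then have "g' = 0" using g tt_zero tt_unique by blast
    then show ?thesis using True by simp
  next
    case False
    define k where "k = complex_of_real (1 / norm g)"
    have "(k *\<^sub>C g, k *\<^sub>C g') \<in> tt \<theta> r" by (rule tt_scale[OF g])
    moreover have "k *\<^sub>C g \<in> cball 0 1" using False by (simp add: k_def norm_divide)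
    ultimately have "(cmod c)\<^sup>2 * (norm (k *\<^sub>C g'))\<^sup>2 \<le> B" by (rule bound)
    then have "(norm (k *\<^sub>C g'))\<^sup>2 \<le> B / (cmod c)\<^sup>2" using c by (simp add: field_simps)
    then have "norm (k *\<^sub>C g') \<le> C" unfolding C_def by (rule real_le_rsqrt)
    then show ?thesis using False by (simp add: k_def norm_divide field_simps)
  qed
  then show False using unbounded_tt[OF r, of \<theta>] unfolding unbounded_op_def by blast
qed

lemma dense_Domain_tt: "dense_subspace (Domain (tt \<theta> r) \<inter> Domain (tt \<theta> s))"
  unfolding dense_subspace_def
proof
  show "csubspace (Domain (tt \<theta> r) \<inter> Domain (tt \<theta> s))"
    unfolding csubspace_def by (auto intro: tt_zero tt_add tt_scale)
  show "closure (Domain (tt \<theta> r) \<inter> Domain (tt \<theta> s)) = UNIV"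
    by (rule closure_UNIV_if_GP) (simp add: rotop_Domain_GP core_multiplier_exp_mm)
qed

text \<open>The expansion sums to \<open>cinner f1 g2\<close> with \<open>f1\<close> the image of
  \<open>f\<close> under the exponential and \<open>g2\<close> that of \<open>g\<close> under its
  inverse; symmetry cancels the two.\<close>

lemma quasi_bases_tt:
  assumes \<xi>: "\<And>n. (c *\<^sub>C hbasis n, \<xi> n) \<in> tt \<theta> r" and \<eta>: "\<And>n. (d *\<^sub>C hbasis n, \<eta> n) \<in> tt \<theta> (- r)"
    and cd: "cnj c * d = 1"
    and dom: "range \<xi> \<subseteq> Domain (tt \<theta> r) \<inter> Domain (tt \<theta> (- r))" "range \<eta> \<subseteq> Domain (tt \<theta> r) \<inter> Domain (tt \<theta> (- r))"
  shows "quasi_bases (Domain (tt \<theta> r) \<inter> Domain (tt \<theta> (- r))) \<xi> \<eta>"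
  unfolding quasi_bases_def
proof (intro conjI ballI dom dense_Domain_tt)
  fix f g assume f: "f \<in> Domain (tt \<theta> r) \<inter> Domain (tt \<theta> (- r))" and g: "g \<in> Domain (tt \<theta> r) \<inter> Domain (tt \<theta> (- r))"
  then obtain f1 f2 g1 g2 where fg: "(f, f1) \<in> tt \<theta> r" "(f, f2) \<in> tt \<theta> (- r)" "(g, g1) \<in> tt \<theta> r" "(g, g2) \<in> tt \<theta> (- r)" by blast
  have cd1: "c * cnj d = 1" and cd2: "d * cnj c = 1"
    using arg_cong[OF cd, of cnj] cd by (simp_all add: mult.commute)
  have "(g2, g) \<in> tt \<theta> r" using fg(4) tt_iff_inverse[of g g2 \<theta> "- r"] by simp
  then have "cinner f1 g2 = cinner f g" using tt_symmetric[OF fg(1)] by simp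
  then show "((\<lambda>n. cinner f (\<xi> n) * cinner (\<eta> n) g) has_sum cinner f g) UNIV"
    using has_sum_tt_expansion[OF \<xi> \<eta> cd1 fg(1) fg(4)] by simp
  have "(g1, g) \<in> tt \<theta> (- r)" using fg(3) tt_iff_inverse[of g g1 \<theta> r] by simp
  then have "cinner f2 g1 = cinner f g" using tt_symmetric[OF fg(2)] by simp
  then show "((\<lambda>n. cinner f (\<eta> n) * cinner (\<xi> n) g) has_sum cinner f g) UNIV"
    using has_sum_tt_expansion[OF \<eta> \<xi> cd2 fg(2) fg(3)] by simp
qed

section \<open>Overlaps with the vacuum and the action of T on it\<close>

lemma distr_uminus_lborel: "distr lborel borel uminus = (lborel :: 'a::euclidean_space measure)"
  by (subst lborel_affine[of "-1" 0]) (auto simp: density_1 one_ennreal_def[symmetric])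

text \<open>The vacuum is even, so the substitution of \<open>- x\<close> for \<open>x\<close>
  changes only the sign of the parameters. This equates the vacuum factors of T and its
  inverse.\<close>

lemma goverlap_minus: "goverlap (- w1) (- w2) = goverlap w1 w2"
proof -
  have gi: "goverlap w1 w2 = (\<integral>x. cnj (g0 x) * gauss w1 w2 x \<partial>lborel)" for w1 w2
    by (simp add: goverlap_def cinner_schwartz schwartz_g0 schwartz_gauss)
  have [measurable]: "g0 \<in> borel_measurable borel" by (rule schwartz_measurable[OF schwartz_g0])
  have e: "cnj (g0 (- x)) * gauss w1 w2 (- x) = cnj (g0 x) * gauss (- w1) (- w2) x" for x
    by (simp add: g0_def gauss_def)
  have "goverlap w1 w2 = (\<integral>x. cnj (g0 x) * gauss w1 w2 x \<partial>distr lborel borel uminus)"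
    unfolding distr_uminus_lborel by (rule gi)
  also have "\<dots> = (\<integral>x. cnj (g0 (- x)) * gauss w1 w2 (- x) \<partial>lborel)"
    by (rule integral_distr) measurable
  also have "\<dots> = goverlap (- w1) (- w2)" unfolding e by (rule gi[symmetric])
  finally show ?thesis by simp
qed

text \<open>The scalar acquired by the vacuum Gaussian in \<open>tt_gauss\<close>: multiplication by
  the exponential gives \<open>gauss r r\<close>, and the rotation corrects its vacuum overlap by
  this ratio.\<close>

definition tfactor :: "real \<Rightarrow> real \<Rightarrow> complex" where
  "tfactor \<theta> r = goverlap r r / goverlap (cis \<theta> * r) (cis \<theta> * r)"

lemma tfactor_nonzero: "tfactor \<theta> r \<noteq> 0"
  by (simp add: tfactor_def goverlap_nonzero)

lemma tfactor_minus: "tfactor \<theta> (- r) = tfactor \<theta> r"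
  by (simp add: tfactor_def goverlap_minus)

lemma tt_gauss: "(l2_of (gauss 0 0), tfactor \<theta> r *\<^sub>C l2_of (gauss (cis \<theta> * r) (cis \<theta> * r))) \<in> tt \<theta> r"
proof -
  have 0: "rot (cis \<theta>) (l2_of (gauss 0 0)) = l2_of (gauss 0 0)"
    using rot_gauss[of "cis \<theta>" 0 0] by (simp add: goverlap_nonzero)
  have 1: "(\<lambda>x. complex_of_real (exp (mm r x)) * gauss 0 0 x) = gauss r r"
    by (auto simp: gauss_def mm_def exp_of_real[symmetric] exp_add[symmetric] algebra_simps)
  show ?thesis
    using rotop_rot_GP[OF core_multiplier_exp_mm GP.gauss, of \<theta> r] rot_gauss[of "cis \<theta>" r r]
    unfolding 0 1 by (simp add: tfactor_def)
qed

section \<open>The model\<close>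

lemma commutator_lin:
  "commutator (sop (lin a b c j)) (sop (lin a' b' c' k)) =
    (if j = k then \<i> * (a * b' - b * a') else 0) \<cdot>\<^sub>o Id_on \<S>"
  unfolding commutator_def Id_on_schwartz
  by (simp only: sop_simps schwartz_map_lin, rule sop_cong, rule ext, subst lin_commute) auto

lemma dagger_lin: "dagger (sop (lin a b c j)) = sop (lin (cnj a) (cnj b) (cnj c) j)"
  by (rule dagger_sop[OF adjoint_pair_lin])

text \<open>At the origin, position and momentum of \<open>gauss 0 0\<close> both vanish, so
  evaluating there isolates the constant.\<close>

lemma sop_lin_eqD:
  assumes "sop (lin a b c j) = sop (lin a' b' c' j)" shows "c = c'"
proof -
  have "(l2_of (gauss 0 0), l2_of (lin a b c j (gauss 0 0))) \<in> sop (lin a' b' c' j)"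
    using assms by (simp flip: assms add: sop_iff schwartz_gauss)
  then have "lin a b c j (gauss 0 0) 0 = lin a' b' c' j (gauss 0 0) 0"
    by (simp add: sop_iff schwartz_gauss l2_of_schwartz_inj schwartz_lin)
  then show ?thesis by (simp add: lin_gauss gauss_nonzero)
qed

text \<open>The constants carry the factor \<open>s2\<close>, so \<open>dn (CC A B)\<close> and
  \<open>up (DD A B)\<close> are the ladder operators of the model, \<open>dn 0\<close> and
  \<open>up 0\<close> those of the oscillator; the adjoint of \<open>dn c\<close> is
  \<open>up (cnj c)\<close>.\<close>

abbreviation dn :: "complex \<Rightarrow> 2 \<Rightarrow> (real^2 \<Rightarrow> complex) \<Rightarrow> real^2 \<Rightarrow> complex" where
  "dn c \<equiv> lin s2 (\<i> * s2) (s2 * c)"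

abbreviation up :: "complex \<Rightarrow> 2 \<Rightarrow> (real^2 \<Rightarrow> complex) \<Rightarrow> real^2 \<Rightarrow> complex" where
  "up d \<equiv> lin s2 (- (\<i> * s2)) (s2 * d)"

lemma XX_eq_sop: "XX A j = sop (lin 1 0 (\<i> * A) j)"
  unfolding XX_def lin_def[abs_def] by (simp add: sop_simps)

lemma PP_eq_sop: "PP B j = sop (lin 0 1 (\<i> * B) j)"
  unfolding PP_def lin_def[abs_def] by (simp add: sop_simps)

lemma aa_eq_sop: "aa A B j = sop (dn (CC A B) j)"
  unfolding aa_def XX_eq_sop PP_eq_sop
  by (simp only: sop_simps schwartz_map_lin, rule sop_cong)
     (auto simp: lin_def fun_eq_iff s2_def CC_def algebra_simps diff_divide_distrib add_divide_distrib)

lemma bb_eq_sop: "bb A B j = sop (up (DD A B) j)"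
  unfolding bb_def XX_eq_sop PP_eq_sop
  by (simp only: sop_simps schwartz_map_lin, rule sop_cong)
     (auto simp: lin_def fun_eq_iff s2_def DD_def algebra_simps diff_divide_distrib add_divide_distrib)

lemma cc_eq_sop: "cc j = sop (dn 0 j)"
  unfolding cc_def by (simp only: sop_simps, rule sop_cong) (auto simp: lin_def s2_def algebra_simps)

lemma aa_eq: "aa A B j = complex_of_real (1 / sqrt 2) \<cdot>\<^sub>o (pos j +\<^sub>o \<i> \<cdot>\<^sub>o mom j +\<^sub>o CC A B \<cdot>\<^sub>o Id)"
  unfolding aa_eq_sop
  by (simp only: sop_simps, rule sop_cong) (auto simp: lin_def s2_def algebra_simps)

lemma bb_eq: "bb A B j = complex_of_real (1 / sqrt 2) \<cdot>\<^sub>o (pos j +\<^sub>o (- \<i>) \<cdot>\<^sub>o mom j +\<^sub>o DD A B \<cdot>\<^sub>o Id)"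
  unfolding bb_eq_sop
  by (simp only: sop_simps, rule sop_cong) (auto simp: lin_def s2_def algebra_simps)

lemma dagger_aa: "dagger (aa A B j) = sop (up (cnj (CC A B)) j)"
  and dagger_bb: "dagger (bb A B j) = sop (dn (cnj (DD A B)) j)"
  and dagger_cc: "dagger (cc j) = sop (up 0 j)"
  by (simp_all add: aa_eq_sop bb_eq_sop cc_eq_sop dagger_lin)

lemma commutator_XX_PP: "commutator (XX A j) (PP B k) = (if j = k then \<i> else 0) \<cdot>\<^sub>o Id_on \<S>"
  unfolding XX_eq_sop PP_eq_sop commutator_lin by simp

lemma commutator_aa_bb: "commutator (aa A B j) (bb A B k) = (if j = k then 1 else 0) \<cdot>\<^sub>o Id_on \<S>"
  unfolding aa_eq_sop bb_eq_sop commutator_lin ccr_s2 ..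

lemma dagger_XX_neq: "A \<noteq> 0 \<Longrightarrow> dagger (XX A j) \<noteq> XX A j"
  unfolding XX_eq_sop dagger_lin by (auto dest: sop_lin_eqD)

lemma dagger_PP_neq: "B \<noteq> 0 \<Longrightarrow> dagger (PP B j) \<noteq> PP B j"
  unfolding PP_eq_sop dagger_lin by (auto dest: sop_lin_eqD)

lemma bb_neq_dagger_aa: "A \<noteq> 0 \<or> B \<noteq> 0 \<Longrightarrow> bb A B j \<noteq> dagger (aa A B j)"
proof
  assume AB: "A \<noteq> 0 \<or> B \<noteq> 0" and "bb A B j = dagger (aa A B j)"
  then have "s2 * DD A B = s2 * cnj (CC A B)"
    unfolding bb_eq_sop dagger_aa by (intro sop_lin_eqD)
  then have "DD A B = cnj (CC A B)" using s2_nonzero by simp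
  then show False using AB by (auto simp: CC_def DD_def complex_eq_iff)
qed

text \<open>The \<open>- 1\<close> in the last coefficient is the zero-point term from moving the
  momentum past the position. Over two modes the constants add up to \<open>c * d - 1\<close>, and
  \<open>CC A B * DD A B\<close> is the negative of \<open>A\<^sup>2 + B\<^sup>2\<close>, whence the
  constant \<open>A\<^sup>2 + B\<^sup>2 + 1\<close> in the Hamiltonian.\<close>

lemma up_dn:
  assumes "schwartz f"
  shows "up d j (dn c j f) x = (1/2) * (pf j (pf j f) x + xf j (xf j f) x)
    + (c + d) / 2 * xf j f x + \<i> * (d - c) / 2 * pf j f x + (c * d - 1) / 2 * f x"
proof -
  define t u v w z where "t = complex_of_real (x$j)" and "u = f x" and "v = pf j f x"
    and "w = pf j (pf j f) x" and "z = s2"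
  have "up d j (dn c j f) x = z * (t * (z * (t * u) + \<i> * z * v + z * c * u))
      - \<i> * z * (z * (t * v - \<i> * u) + \<i> * z * w + z * c * v) + z * d * (z * (t * u) + \<i> * z * v + z * c * u)"
    unfolding lin_def[of s2 "- (\<i> * s2)"] pf_lin[OF assms] pf_xf[OF assms]
    by (simp add: lin_def xf_def t_def u_def v_def w_def z_def)
  also have "\<dots> = (z * z) * (t * t * u + w - u + (c + d) * (t * u) + \<i> * (d - c) * v + c * d * u)"
    by (simp add: algebra_simps)
  also have "\<dots> = (1/2) * (w + t * (t * u)) + (c + d) / 2 * (t * u) + \<i> * (d - c) / 2 * v + (c * d - 1) / 2 * u"
    by (simp add: z_def s2_square algebra_simps add_divide_distrib diff_divide_distrib)
  finally show ?thesis by (simp only: xf_def t_def u_def v_def w_def)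
qed

text \<open>The pairs \<open>(CC, DD)\<close>, \<open>(cnj DD, cnj CC)\<close> and
  \<open>(0, 0)\<close> for \<open>c\<close> and \<open>d\<close> give the Hamiltonian, its adjoint
  and the oscillator, so eigenvectors and conjugation are treated once.\<close>

definition quad :: "complex \<Rightarrow> complex \<Rightarrow> complex \<Rightarrow> (real^2 \<Rightarrow> complex) \<Rightarrow> real^2 \<Rightarrow> complex" where
  "quad c d e f x = up d 1 (dn c 1 f) x + up d 2 (dn c 2 f) x + e * f x"

lemma schwartz_map_up_dn: "schwartz_map (\<lambda>f. up d j (dn c j f))"
  by (rule schwartz_map_comp[OF schwartz_map_lin schwartz_map_lin])

lemma adjoint_pair_up_dn: "adjoint_pair (\<lambda>f. up d j (dn c j f)) (\<lambda>f. up (cnj c) j (dn (cnj d) j f))"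
  using adjoint_pair_comp[OF adjoint_pair_lin[of s2 "- (\<i> * s2)" "s2 * d" j] adjoint_pair_lin[of s2 "\<i> * s2" "s2 * c" j]]
  by simp

lemma adjoint_pair_quad: "adjoint_pair (quad c d e) (quad (cnj d) (cnj c) (cnj e))"
  unfolding quad_def[abs_def]
  by (rule adjoint_pair_add_scalar, rule adjoint_pair_add) (rule adjoint_pair_up_dn)+

lemma NN_eq_sop: "NN A B j = sop (\<lambda>f. up (DD A B) j (dn (CC A B) j f))"
  unfolding NN_def aa_eq_sop bb_eq_sop by (rule sop_mult[OF schwartz_map_lin])

lemma dagger_NN: "dagger (NN A B j) = sop (\<lambda>f. up (cnj (CC A B)) j (dn (cnj (DD A B)) j f))"
  unfolding NN_eq_sop by (rule dagger_sop[OF adjoint_pair_up_dn])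

lemma sop_quad:
  "sop (\<lambda>f. up d 1 (dn c 1 f)) +\<^sub>o sop (\<lambda>f. up d 2 (dn c 2 f)) +\<^sub>o e \<cdot>\<^sub>o Id = sop (quad c d e)"
  unfolding quad_def[abs_def]
  by (simp only: sop_add sop_add_scalar schwartz_map_up_dn schwartz_map_add)

lemma Ham_eq_sop: "Ham A B = sop (quad (CC A B) (DD A B) (A\<^sup>2 + B\<^sup>2 + 1))"
proof -
  have sq: "CC A B * DD A B = - (of_real A)\<^sup>2 - (of_real B)\<^sup>2"
    "CC A B + DD A B = 2 * \<i> * of_real A" "DD A B - CC A B = 2 * of_real B"
    by (simp_all add: CC_def DD_def algebra_simps power2_eq_square)
  show ?thesis
    unfolding Ham_def
    by (simp only: sop_simps, rule sop_cong, rule ext)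
       (simp only: quad_def up_dn sq, simp add: field_simps)
qed

lemma Ham_eq: "Ham A B = NN A B 1 +\<^sub>o NN A B 2 +\<^sub>o complex_of_real (A\<^sup>2 + B\<^sup>2 + 1) \<cdot>\<^sub>o Id"
  unfolding NN_eq_sop sop_quad Ham_eq_sop ..

lemma dagger_Ham: "dagger (Ham A B) = sop (quad (cnj (DD A B)) (cnj (CC A B)) (A\<^sup>2 + B\<^sup>2 + 1))"
  unfolding Ham_eq_sop using dagger_sop[OF adjoint_pair_quad] by (simp only: complex_cnj_complex_of_real)

lemma htilde_eq_sop: "htilde A B = sop (quad 0 0 (A\<^sup>2 + B\<^sup>2 + 1))"
  unfolding htilde_def
  by (simp only: sop_simps, rule sop_cong, rule ext)
     (simp only: quad_def up_dn, simp add: field_simps)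

lemma htilde_eq:
  "htilde A B = dagger (cc 1) *\<^sub>o cc 1 +\<^sub>o dagger (cc 2) *\<^sub>o cc 2 +\<^sub>o complex_of_real (A\<^sup>2 + B\<^sup>2 + 1) \<cdot>\<^sub>o Id"
  unfolding dagger_cc unfolding cc_eq_sop htilde_eq_sop
  by (simp only: sop_mult schwartz_map_lin sop_quad)

section \<open>Ladder states\<close>

definition vac :: "complex \<Rightarrow> complex \<Rightarrow> real^2 \<Rightarrow> complex" where
  "vac c N x = N * gauss (- c) (- c) x"

abbreviation lad :: "complex \<Rightarrow> complex \<Rightarrow> complex \<Rightarrow> nat \<Rightarrow> nat \<Rightarrow> real^2 \<Rightarrow> complex" where
  "lad c d N \<equiv> rungs (up d) (vac c N)"

text \<open>With the same three parameter pairs as in \<open>quad\<close> this becomes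
  \<open>phi\<close>, \<open>Psi\<close> and \<open>Phi\<close>.\<close>

definition state :: "complex \<Rightarrow> complex \<Rightarrow> complex \<Rightarrow> nat \<Rightarrow> nat \<Rightarrow> l2" where
  "state c d N n1 n2 = complex_of_real (1 / sqrt (fact n1 * fact n2)) *\<^sub>C l2_of (lad c d N n1 n2)"

lemma GP_vac: "GP (- c) (- c) (vac c N)"
  unfolding vac_def[abs_def] by (intro GP.scale GP.gauss)

lemma schwartz_vac: "schwartz (vac c N)"
  by (rule GP_schwartz[OF GP_vac])

lemma dn_vac: "dn c j (vac c N) = (\<lambda>x. 0)"
  unfolding vac_def[abs_def] lin_scale[OF schwartz_gauss]
  by (rule ext) (simp add: lin_gauss algebra_simps flip: mult.assoc)

interpretation L: ladder s2 "\<i> * s2" "s2 * c" s2 "- (\<i> * s2)" "s2 * d" "vac c N" for c d N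
  by unfold_locales (rule schwartz_vac dn_vac ccr_s2)+

lemma GP_lad: "GP (- c) (- c) (lad c d N n1 n2)"
proof -
  have *: "GP w1 w2 ((up d j ^^ n) f)" if "GP w1 w2 f" for w1 w2 f j n
    using that by (induction n) (auto intro: GP_lin)
  show ?thesis unfolding rungs_def by (intro * GP_vac)
qed

lemma state_eq: "state c d N n1 n2 = l2_of (\<lambda>x. complex_of_real (1 / sqrt (fact n1 * fact n2)) * lad c d N n1 n2 x)"
  unfolding state_def by (rule l2_of_scale[OF schwartz_square_integrable[OF L.schwartz_rung]])

lemma state_in_invariant_part: "state c d N n1 n2 \<in> invariant_part \<S> (tt \<theta> r)"
  unfolding state_eq by (rule GP_in_invariant_part[OF GP.scale[OF GP_lad]])

lemma state_in_S: "state c d N n1 n2 \<in> \<S>"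
  using state_in_invariant_part invariant_part_subset by blast

lemma quad_lad: "quad c d e (lad c d N n1 n2) x = (of_nat n1 + of_nat n2 + e) * lad c d N n1 n2 x"
  unfolding quad_def L.raise_lower_rung_1 L.raise_lower_rung_2 by (simp add: algebra_simps)

lemma eigenvector_state:
  assumes "N \<noteq> 0"
  shows "eigenvector (sop (quad c d e)) (of_nat n1 + of_nat n2 + e) (state c d N n1 n2)"
proof -
  let ?k = "complex_of_real (1 / sqrt (fact n1 * fact n2))"
  have s: "schwartz (\<lambda>x. ?k * lad c d N n1 n2 x)" by (intro schwartz_cmult L.schwartz_rung)
  have "vac c N x \<noteq> 0" for x using assms by (simp add: vac_def gauss_nonzero)
  then have "lad c d N n1 n2 \<noteq> (\<lambda>x. 0)" by (intro L.rung_nonzero) (metis)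
  then have "state c d N n1 n2 \<noteq> 0"
    unfolding state_def by (simp add: l2_of_eq_0_iff L.schwartz_rung)
  moreover have "quad c d e (\<lambda>x. ?k * lad c d N n1 n2 x) = (\<lambda>x. (of_nat n1 + of_nat n2 + e) * (?k * lad c d N n1 n2 x))"
  proof
    fix x
    have "quad c d e (\<lambda>x. ?k * lad c d N n1 n2 x) x = ?k * quad c d e (lad c d N n1 n2) x"
      unfolding quad_def by (simp only: lin_scale L.schwartz_rung schwartz_lin) (simp only: algebra_simps)
    then show "quad c d e (\<lambda>x. ?k * lad c d N n1 n2 x) x = (of_nat n1 + of_nat n2 + e) * (?k * lad c d N n1 n2 x)"
      by (simp only: quad_lad mult_ac)
  qed
  ultimately show ?thesis
    unfolding eigenvector_def state_eq
    by (simp only: sop_iff[OF s] l2_of_scale[OF schwartz_square_integrable[OF s]]) simp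
qed

lemma relpow_sop:
  assumes "schwartz_map L" "schwartz f"
  shows "schwartz ((L ^^ n) f)" "(l2_of f, G) \<in> sop L ^^ n \<longleftrightarrow> G = l2_of ((L ^^ n) f)"
proof -
  show s: "schwartz ((L ^^ n) f)" for n using assms by (induction n) (auto intro: schwartz_mapD)
  show "(l2_of f, G) \<in> sop L ^^ n \<longleftrightarrow> G = l2_of ((L ^^ n) f)"
    by (induction n arbitrary: G) (auto simp: relcomp_unfold sop_iff s)
qed

lemma app_rungs:
  assumes L: "\<And>j. schwartz_map (R j)" and v: "schwartz v"
  shows "app (sop (R 1) ^^ n1 *\<^sub>o sop (R 2) ^^ n2) (l2_of v) = l2_of (rungs R v n1 n2)"
proof -
  have "(l2_of v, G) \<in> sop (R 1) ^^ n1 *\<^sub>o sop (R 2) ^^ n2 \<longleftrightarrow> G = l2_of (rungs R v n1 n2)" for G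
    unfolding op_mult_def rungs_def
    by (simp add: relcomp_unfold relpow_sop[OF L v] relpow_sop[OF L relpow_sop(1)[OF L v]])
  then show ?thesis unfolding app_def by simp
qed

lemma phi00_eq: "phi00 A B N = l2_of (vac (CC A B) N)"
  and Psi00_eq: "Psi00 A B N = l2_of (vac (cnj (DD A B)) N)"
proof -
  have "N * exp (complex_of_real (- (1/2) * ((x$1) ^ 2 + (x$2) ^ 2)) - c * (complex_of_real (x$1) + complex_of_real (x$2))) = vac c N x"
    for c and x :: "real^2"
    unfolding vac_def gauss_def by (rule arg_cong[where f="\<lambda>z. N * exp z"]) (simp add: algebra_simps)
  then show "phi00 A B N = l2_of (vac (CC A B) N)" "Psi00 A B N = l2_of (vac (cnj (DD A B)) N)"
    unfolding phi00_def Psi00_def by (simp_all only: of_real_add)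
qed

lemma phi_eq: "phi A B N n1 n2 = state (CC A B) (DD A B) N n1 n2"
  and Psi_eq: "Psi A B N n1 n2 = state (cnj (DD A B)) (cnj (CC A B)) N n1 n2"
  and Phi_eq: "Phi (l2_of (vac 0 N)) n1 n2 = state 0 0 N n1 n2"
  unfolding phi_def Psi_def Phi_def dagger_aa dagger_cc phi00_eq Psi00_eq state_def
  unfolding bb_eq_sop
  by (simp_all only: app_rungs[of "up _", OF schwartz_map_lin schwartz_vac])

section \<open>Factorization\<close>

text \<open>\<open>vector_derivative\<close> is meaningful only for differentiable functions; this
  class consists of such functions and is closed under each step of
  \<open>ladder_fun\<close>.\<close>

inductive gauss_poly :: "complex \<Rightarrow> (real \<Rightarrow> complex) \<Rightarrow> bool" for c where
  gauss: "gauss_poly c (\<lambda>t. exp (- (1/2) * t ^ 2 - c * t))"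
| add: "gauss_poly c f \<Longrightarrow> gauss_poly c g \<Longrightarrow> gauss_poly c (\<lambda>t. f t + g t)"
| scale: "gauss_poly c f \<Longrightarrow> gauss_poly c (\<lambda>t. k * f t)"
| coord: "gauss_poly c f \<Longrightarrow> gauss_poly c (\<lambda>t. complex_of_real t * f t)"

lemma gauss_poly_derivative:
  "gauss_poly c f \<Longrightarrow> \<exists>f'. gauss_poly c f' \<and> (\<forall>t. (f has_vector_derivative f' t) (at t))"
proof (induction rule: gauss_poly.induct)
  case gauss
  let ?e = "\<lambda>t::real. exp (- (1/2) * t ^ 2 - c * t)"
  have "gauss_poly c (\<lambda>t. (-1) * (complex_of_real t * ?e t) + (- c) * ?e t)" by (intro gauss_poly.intros)
  moreover have "(?e has_vector_derivative (-1) * (complex_of_real t * ?e t) + (- c) * ?e t) (at t)" for t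
  proof -
    have "((\<lambda>z. exp (- (1/2) * z ^ 2 - c * z)) has_field_derivative
        (-1) * (complex_of_real t * ?e t) + (- c) * ?e t) (at (complex_of_real t))"
      by (rule derivative_eq_intros refl | simp add: algebra_simps)+
    from has_vector_derivative_real_field[OF this] show ?thesis by (simp add: o_def)
  qed
  ultimately show ?case by blast
next
  case (add f g)
  then obtain f' g' where "gauss_poly c f'" "gauss_poly c g'"
    "\<And>t. (f has_vector_derivative f' t) (at t)" "\<And>t. (g has_vector_derivative g' t) (at t)" by blast
  then show ?case by (intro exI[of _ "\<lambda>t. f' t + g' t"]) (auto intro: gauss_poly.add has_vector_derivative_add)
next
  case (scale f k)
  then obtain f' where "gauss_poly c f'" "\<And>t. (f has_vector_derivative f' t) (at t)" by blast
  then show ?case by (intro exI[of _ "\<lambda>t. k * f' t"]) (auto intro: gauss_poly.scale has_vector_derivative_mult_right)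
next
  case (coord f)
  then obtain f' where f': "gauss_poly c f'" "\<And>t. (f has_vector_derivative f' t) (at t)" by blast
  have "((\<lambda>t. complex_of_real t * f t) has_vector_derivative (complex_of_real t * f' t + 1 * f t)) (at t)" for t
    by (intro has_vector_derivative_mult f' derivative_eq_intros) auto
  then show ?case using coord f' by (intro exI[of _ "\<lambda>t. complex_of_real t * f' t + 1 * f t"])
    (intro conjI allI gauss_poly.intros, auto)
qed

lemma ladder_fun_Suc:
  "ladder_fun c d (Suc n) t = complex_of_real t * ladder_fun c d n t
    - vector_derivative (ladder_fun c d n) (at t) + d * ladder_fun c d n t"
  by (simp add: ladder_fun_def)

lemma gauss_poly_ladder_fun: "gauss_poly c (ladder_fun c d n)"
proof (induction n)
  case 0
  show ?case unfolding ladder_fun_def using gauss_poly.gauss by simp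
next
  case (Suc n)
  obtain f' where f': "gauss_poly c f'" "\<And>t. (ladder_fun c d n has_vector_derivative f' t) (at t)"
    using gauss_poly_derivative[OF Suc] by blast
  have "ladder_fun c d (Suc n) = (\<lambda>t. (complex_of_real t * ladder_fun c d n t + (-1) * f' t) + d * ladder_fun c d n t)"
    by (rule ext) (simp add: ladder_fun_Suc vector_derivative_at[OF f'(2)])
  moreover have "gauss_poly c (\<lambda>t. (complex_of_real t * ladder_fun c d n t + (-1) * f' t) + d * ladder_fun c d n t)"
    by (intro gauss_poly.intros Suc f')
  ultimately show ?case by (simp only:)
qed

lemma ladder_fun_derivative:
  "(ladder_fun c d n has_vector_derivative vector_derivative (ladder_fun c d n) (at t)) (at t)"
  using gauss_poly_derivative[OF gauss_poly_ladder_fun] vector_derivative_at by metis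

lemma ladder_fun_coord_derivative:
  "((\<lambda>x::real^2. ladder_fun c d n (x$i)) has_derivative
     (\<lambda>h. (h$i) *\<^sub>R vector_derivative (ladder_fun c d n) (at (x$i)))) (at x)"
  by (rule has_derivative_compose[OF bounded_linear_imp_has_derivative[OF bounded_linear_vec_nth]
      ladder_fun_derivative[unfolded has_vector_derivative_def]])

text \<open>The momentum in direction \<open>j\<close> differentiates only the factor in
  \<open>x$j\<close>, so a raising operator is one step of \<open>ladder_fun\<close> there, times
  \<open>s2\<close>.\<close>

lemma up_ladder_fun:
  assumes ij: "i \<noteq> j"
  shows "up d j (\<lambda>x. k * (ladder_fun c d n (x$j) * ladder_fun c d m (x$i))) =
    (\<lambda>x. s2 * k * (ladder_fun c d (Suc n) (x$j) * ladder_fun c d m (x$i)))"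
proof
  fix x
  have "((\<lambda>x. k * (ladder_fun c d n (x$j) * ladder_fun c d m (x$i))) has_derivative
     (\<lambda>h. k * (ladder_fun c d n (x$j) * ((h$i) *\<^sub>R vector_derivative (ladder_fun c d m) (at (x$i))) +
        ((h$j) *\<^sub>R vector_derivative (ladder_fun c d n) (at (x$j))) * ladder_fun c d m (x$i)))) (at x)"
    by (intro has_derivative_mult_right has_derivative_mult ladder_fun_coord_derivative)
  from partial_eqI[OF this, of j]
  have "partial j (\<lambda>x. k * (ladder_fun c d n (x$j) * ladder_fun c d m (x$i))) x =
      k * (vector_derivative (ladder_fun c d n) (at (x$j)) * ladder_fun c d m (x$i))"
    using ij by (simp add: axis_def)
  then show "up d j (\<lambda>x. k * (ladder_fun c d n (x$j) * ladder_fun c d m (x$i))) x =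
      s2 * k * (ladder_fun c d (Suc n) (x$j) * ladder_fun c d m (x$i))"
    by (simp add: lin_def xf_def pf_def ladder_fun_Suc) (simp add: algebra_simps)
qed

lemma lad_factorizes:
  "lad c d N n1 n2 x = N * s2 ^ (n1 + n2) * (ladder_fun c d n1 (x$1) * ladder_fun c d n2 (x$2))"
proof -
  have v: "vac c N = (\<lambda>x. N * (ladder_fun c d 0 (x$2) * ladder_fun c d 0 (x$1)))"
    unfolding vac_def gauss_def ladder_fun_def funpow_0 exp_add[symmetric]
    by (rule ext, rule arg_cong[where f="\<lambda>z. N * exp z"]) (simp add: algebra_simps)
  have 2: "(up d 2 ^^ n2) (vac c N) = (\<lambda>x. N * s2 ^ n2 * (ladder_fun c d n2 (x$2) * ladder_fun c d 0 (x$1)))" for n2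
  proof (induction n2)
    case 0 show ?case by (simp add: v)
  next
    case (Suc n)
    have "(1::2) \<noteq> 2" by simp
    note u = up_ladder_fun[OF this]
    show ?case unfolding funpow.simps o_apply Suc u by (simp only: power_Suc mult_ac)
  qed
  have "(up d 1 ^^ n1) ((up d 2 ^^ n2) (vac c N)) =
      (\<lambda>x. N * s2 ^ (n1 + n2) * (ladder_fun c d n1 (x$1) * ladder_fun c d n2 (x$2)))"
  proof (induction n1)
    case 0 show ?case by (simp add: 2 mult_ac)
  next
    case (Suc n)
    have "(2::2) \<noteq> 1" by simp
    note u = up_ladder_fun[OF this]
    show ?case unfolding funpow.simps o_apply Suc u by (simp only: power_Suc add_Suc mult_ac)
  qed
  then show ?thesis by (simp add: rungs_def)
qed

lemma state_factorizes:
  "state c d N n1 n2 = l2_of (\<lambda>x. N / sqrt (fact n1 * fact n2 * 2 ^ (n1 + n2)) *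
     ladder_fun c d n1 (x$1) * ladder_fun c d n2 (x$2))"
proof -
  have "1 / sqrt (fact n1 * fact n2) * (1 / sqrt 2) ^ (n1 + n2) = 1 / sqrt (fact n1 * fact n2 * 2 ^ (n1 + n2))"
    by (simp add: real_sqrt_mult real_sqrt_power power_divide)
  then have "complex_of_real (1 / sqrt (fact n1 * fact n2)) * s2 ^ (n1 + n2) =
      complex_of_real (1 / sqrt (fact n1 * fact n2 * 2 ^ (n1 + n2)))"
    by (simp only: s2_def flip: of_real_power of_real_mult)
  then have "complex_of_real (1 / sqrt (fact n1 * fact n2)) * (N * s2 ^ (n1 + n2) * y) =
      N / sqrt (fact n1 * fact n2 * 2 ^ (n1 + n2)) * y" (is "?a * (N * ?b * y) = _") for y
  proof -
    assume "?a * ?b = complex_of_real (1 / sqrt (fact n1 * fact n2 * 2 ^ (n1 + n2)))"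
    moreover have "?a * (N * ?b * y) = N * (?a * ?b) * y" by (simp only: mult_ac)
    ultimately show ?thesis by simp
  qed
  then show ?thesis unfolding state_eq lad_factorizes by (simp only: mult.assoc)
qed

section \<open>The oscillator\<close>

lemma vac_0_eq: "vac 0 N = (\<lambda>x. N * complex_of_real gnorm * g0 x)"
  using gnorm_pos by (auto simp: vac_def g0_def)

lemma lad_0_eq: "lad 0 0 N n1 n2 = (\<lambda>x. N * complex_of_real gnorm * hf n1 n2 x)"
proof -
  have *: "(df j ^^ n) (\<lambda>x. k * f x) = (\<lambda>x. k * (df j ^^ n) f x)" if "schwartz f" for k f j n
    by (induction n) (auto simp: lin_scale H.schwartz_raise_pow that)
  show ?thesis unfolding rungs_def vac_0_eq by (simp add: * schwartz_g0 H.schwartz_raise_pow)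
qed

lemma state_0_eq: "state 0 0 N n1 n2 = (N * gnorm) *\<^sub>C hbasis (n1, n2)"
  unfolding state_def lad_0_eq hbasis_def
  by (simp add: mult.commute schwartz_square_integrable H.schwartz_rung flip: l2_of_scale)

text \<open>Every Hermite function but the lowest is a raised one, and the raising operator moves
  across the inner product to a lowering operator that kills \<open>f\<close>; only the lowest
  coefficient is left.\<close>

lemma vacuum_iff: "vacuum f \<longleftrightarrow> (\<exists>N::complex. cmod (N * gnorm) = 1 \<and> f = l2_of (vac 0 N))"
proof
  assume "vacuum f"
  then have f: "norm f = 1" "(f, 0) \<in> sop (dn 0 1)" "(f, 0) \<in> sop (dn 0 2)" by (auto simp: vacuum_def cc_eq_sop)
  then obtain h where h: "schwartz h" "f = l2_of h" by (auto elim: sopE)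
  have ann: "l2_of (cf j h) = 0" for j
    using exhaust_2[of j] f by (auto simp: h sop_iff)
  define k where "k = cinner (l2_of g0) f"
  have "f = k *\<^sub>C l2_of g0"
  proof (rule l2_eqI_hf)
    fix n1 n2
    have R: "cinner (l2_of (hf n1 n2)) (k *\<^sub>C l2_of g0) = k * (if n1 = 0 \<and> n2 = 0 then 1 else 0)"
      using cinner_hf[of n1 n2 0 0] by (simp add: cinner_scale_right rungs_def)
    show "cinner (l2_of (hf n1 n2)) f = cinner (l2_of (hf n1 n2)) (k *\<^sub>C l2_of g0)"
    proof (cases n1)
      case (Suc m)
      have "cinner (l2_of (df 1 (hf m n2))) f = 0"
        unfolding h(2) by (simp add: cinner_df H.schwartz_rung h ann)
      then show ?thesis unfolding R using Suc by (simp add: H.raise_rung_1)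
    next
      case n1: 0
      show ?thesis
      proof (cases n2)
        case (Suc m)
        have "cinner (l2_of (df 2 (hf n1 m))) f = 0"
          unfolding h(2) by (simp add: cinner_df H.schwartz_rung h ann)
        then show ?thesis unfolding R using Suc by (simp add: H.raise_rung_2)
      next
        case n2: 0
        show ?thesis unfolding R using n1 n2 by (simp add: k_def rungs_def)
      qed
    qed
  qed
  moreover from this have "cmod k = 1" using f(1) by (metis norm_scaleC norm_g0 mult.right_neutral)
  moreover have "l2_of (vac 0 (k / gnorm)) = k *\<^sub>C l2_of g0"
    using gnorm_pos by (simp add: vac_0_eq l2_of_scale schwartz_square_integrable schwartz_g0)
  ultimately show "\<exists>N::complex. cmod (N * gnorm) = 1 \<and> f = l2_of (vac 0 N)"
    using gnorm_pos by (intro exI[of _ "k / gnorm"]) simp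
next
  assume "\<exists>N::complex. cmod (N * gnorm) = 1 \<and> f = l2_of (vac 0 N)"
  then obtain N :: complex where N: "cmod (N * gnorm) = 1" "f = l2_of (vac 0 N)" by blast
  have "f = (N * gnorm) *\<^sub>C l2_of g0"
    by (simp add: N(2) vac_0_eq l2_of_scale schwartz_square_integrable schwartz_g0)
  then have "norm f = 1" using N(1) by (simp only: norm_scaleC norm_g0 mult_1_right)
  then show "vacuum f"
    unfolding vacuum_def cc_eq_sop N(2) sop_iff[OF schwartz_vac] dn_vac by (simp add: l2_of_zero)
qed

lemma vacuum_exists: "\<exists>f. vacuum f"
  unfolding vacuum_iff using gnorm_pos by (intro exI[of _ "l2_of (vac 0 (1 / gnorm))"] exI[of _ "complex_of_real (1 / gnorm)"]) simp

lemma orthonormal_basis_scale_hbasis: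
  assumes k: "cmod k = 1" shows "orthonormal_basis (\<lambda>n. k *\<^sub>C hbasis n)"
proof (rule orthonormal_basis_if_total)
  show "cinner (k *\<^sub>C hbasis m) (k *\<^sub>C hbasis n) = (if m = n then 1 else 0)" for m n
    using cmod_1_cnj[OF k] by (simp add: cinner_scale_left cinner_scale_right cinner_hbasis mult.commute)
next
  fix f assume 0: "\<And>n. cinner (k *\<^sub>C hbasis n) f = 0"
  have "k \<noteq> 0" using k by auto
  then have "cinner (hbasis n) f = cinner (hbasis n) 0" for n using 0[of n] by (simp add: cinner_scale_left)
  then show "f = 0" by (rule l2_eqI_hbasis)
qed

text \<open>The operator is symmetric and has the Hermite functions as eigenfunctions, so an
  eigenvector with any other eigenvalue would be orthogonal to a total family.\<close>

lemma eigenvalue_quad_0: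
  assumes "eigenvector (sop (quad 0 0 (complex_of_real e0))) e f"
  shows "\<exists>n1 n2. e = of_nat n1 + of_nat n2 + complex_of_real e0"
proof (rule ccontr)
  assume none: "\<not> ?thesis"
  obtain h where h: "schwartz h" "f = l2_of h" "e *\<^sub>C f = l2_of (quad 0 0 e0 h)"
    using assms by (auto simp: eigenvector_def elim: sopE)
  have "f = 0"
  proof (rule l2_eqI_hf)
    fix n1 n2
    let ?g = "lad 0 0 (1 / complex_of_real gnorm) n1 n2"
    have gs: "schwartz ?g" by (rule L.schwartz_rung)
    have g: "?g = hf n1 n2" unfolding lad_0_eq using gnorm_pos by simp
    have "e * cinner (l2_of ?g) f = cinner (l2_of ?g) (l2_of (quad 0 0 e0 h))"
      using h(3) by (metis cinner_scale_right)
    also have "\<dots> = cinner (l2_of (quad 0 0 e0 ?g)) f"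
      using adjoint_pair_quad[of 0 0 "complex_of_real e0"] h(1,2) gs
      unfolding adjoint_pair_def by simp
    also have "quad 0 0 e0 ?g = (\<lambda>x. (of_nat n1 + of_nat n2 + complex_of_real e0) * ?g x)" by (rule ext) (rule quad_lad)
    also have "l2_of \<dots> = (of_nat n1 + of_nat n2 + complex_of_real e0) *\<^sub>C l2_of ?g"
      by (rule l2_of_scale[OF schwartz_square_integrable[OF gs], symmetric])
    finally have "e * cinner (l2_of ?g) f = (of_nat n1 + of_nat n2 + complex_of_real e0) * cinner (l2_of ?g) f"
      by (simp add: cinner_scale_left)
    then show "cinner (l2_of (hf n1 n2)) f = cinner (l2_of (hf n1 n2)) 0"
      using none unfolding g by auto
  qed
  then show False using assms by (simp add: eigenvector_def)
qed

section \<open>Intertwining\<close>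

text \<open>With \<open>w = cis \<theta> * r\<close> the constant moves by \<open>cnj w\<close> for
  raising and, in \<open>tcov_dn\<close>, by \<open>- w\<close> for lowering operators. For
  \<open>w = ww A B\<close> these are \<open>DD A B\<close> and \<open>CC A B\<close>, so T carries
  the oscillator operators to those of the model.\<close>

lemma tcov_up: "tcov \<theta> r (up d j) (up (d + cnj (cis \<theta> * r)) j)"
proof -
  have "s2 * d + shift \<theta> r s2 (- (\<i> * s2)) = s2 * (d + cnj (cis \<theta> * r))"
    by (simp add: shift_def cis.ctr complex_eq_iff algebra_simps)
  then show ?thesis using tcov_lin[of \<theta> r s2 "- (\<i> * s2)" "s2 * d" j] by simp
qed

lemma tcov_dn: "tcov \<theta> r (dn c j) (dn (c - cis \<theta> * r) j)"
proof -
  have "s2 * c + shift \<theta> r s2 (\<i> * s2) = s2 * (c - cis \<theta> * r)"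
    by (simp add: shift_def cis.ctr complex_eq_iff algebra_simps)
  then show ?thesis using tcov_lin[of \<theta> r s2 "\<i> * s2" "s2 * c" j] by simp
qed

lemma tcov_up_dn:
  "tcov \<theta> r (\<lambda>f. up d j (dn c j f)) (\<lambda>f. up (d + cnj (cis \<theta> * r)) j (dn (c - cis \<theta> * r) j f))"
  by (rule tcov_comp[OF tcov_up tcov_dn])

lemma tcov_quad: "tcov \<theta> r (quad c d e) (quad (c - cis \<theta> * r) (d + cnj (cis \<theta> * r)) e)"
  unfolding quad_def[abs_def]
  by (rule tcov_add, rule tcov_add) (rule tcov_up_dn tcov_scale tcov_ident)+

lemma tt_lad:
  assumes "(l2_of (vac c N), l2_of (vac c' N')) \<in> tt \<theta> r"
  shows "(l2_of (lad c d N n1 n2), l2_of (lad c' (d + cnj (cis \<theta> * r)) N' n1 n2)) \<in> tt \<theta> r"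
  unfolding rungs_def
  by (intro tcovD[OF tcov_pow[OF tcov_up]] L.schwartz_raise_pow schwartz_vac assms)

lemma tt_state:
  assumes "(l2_of (vac c N), l2_of (vac c' N')) \<in> tt \<theta> r"
  shows "(state c d N n1 n2, state c' (d + cnj (cis \<theta> * r)) N' n1 n2) \<in> tt \<theta> r"
  unfolding state_def by (intro tt_scale tt_lad assms)

lemma l2_of_vac: "l2_of (vac c N) = N *\<^sub>C l2_of (gauss (- c) (- c))"
  unfolding vac_def[abs_def] by (simp add: l2_of_scale schwartz_square_integrable schwartz_gauss)

lemma tt_vac: "(l2_of (vac 0 (N / tfactor \<theta> r)), l2_of (vac (- (cis \<theta> * r)) N)) \<in> tt \<theta> r"
  using tt_scale[OF tt_gauss[of \<theta> r], of "N / tfactor \<theta> r"] tfactor_nonzero[of \<theta> r]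
  by (simp add: l2_of_vac)

text \<open>The two Gaussians are images of vacuum multiples under \<open>tt \<theta> r\<close> and
  its inverse; symmetry reduces their overlap to that of the vacuum with itself, without evaluating
  a Gaussian integral.\<close>

lemma cinner_vac:
  "cinner (l2_of (vac (- (cis \<theta> * r)) N)) (l2_of (vac (cis \<theta> * r) N')) =
    cnj (N / tfactor \<theta> r * gnorm) * (N' / tfactor \<theta> r * gnorm)"
proof -
  let ?G = "l2_of g0"
  have v0: "l2_of (vac 0 M) = (M * gnorm) *\<^sub>C ?G" for M
    by (simp add: vac_0_eq l2_of_scale schwartz_square_integrable schwartz_g0)
  have 1: "((N / tfactor \<theta> r * gnorm) *\<^sub>C ?G, l2_of (vac (- (cis \<theta> * r)) N)) \<in> tt \<theta> r"
    using tt_vac[of N \<theta> r] unfolding v0 .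
  have "((N' / tfactor \<theta> r * gnorm) *\<^sub>C ?G, l2_of (vac (cis \<theta> * r) N')) \<in> tt \<theta> (- r)"
    using tt_vac[of N' \<theta> "- r"] unfolding v0 tfactor_minus by simp
  then have 2: "(l2_of (vac (cis \<theta> * r) N'), (N' / tfactor \<theta> r * gnorm) *\<^sub>C ?G) \<in> tt \<theta> r"
    using tt_iff_inverse by simp
  have "cinner ?G ?G = 1" by (simp add: cinner_self_norm norm_g0)
  then show ?thesis
    using tt_symmetric[OF 1 2] by (simp add: cinner_scale_left cinner_scale_right mult_ac)
qed

section \<open>Polar form\<close>

text \<open>The number whose polar form is used for T; its negative is \<open>CC A B\<close> and its
  conjugate \<open>DD A B\<close>. For \<open>A = B = 0\<close> the radius is 0 and the exponential
  is the identity, so no case distinction arises.\<close>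

definition ww :: "real \<Rightarrow> real \<Rightarrow> complex" where
  "ww A B = complex_of_real B - \<i> * complex_of_real A"

definition rad :: "real \<Rightarrow> real \<Rightarrow> real" where
  "rad A B = cmod (ww A B)"

definition ang :: "real \<Rightarrow> real \<Rightarrow> real" where
  "ang A B = Arg (ww A B)"

lemma ww_polar: "cis (ang A B) * complex_of_real (rad A B) = ww A B"
  using rcis_cmod_Arg[of "ww A B"] by (simp add: rad_def ang_def rcis_def mult.commute)

lemma CC_ww: "CC A B = - ww A B" and DD_ww: "DD A B = cnj (ww A B)"
  by (simp_all add: CC_def DD_def ww_def)

lemma rad_nonzero: "rad A B \<noteq> 0 \<longleftrightarrow> A \<noteq> 0 \<or> B \<noteq> 0"
  by (auto simp: rad_def ww_def complex_eq_iff)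

lemma exp_pos_mom_eq_tt: "exp_pos_mom (- k * A) (k * B) = tt (ang A B) (k * rad A B)"
proof -
  have "rad A B * sin (ang A B) = - A" "rad A B * cos (ang A B) = B"
    using arg_cong[OF ww_polar, of Im A B] arg_cong[OF ww_polar, of Re A B]
    by (simp_all add: ww_def mult.commute)
  then have *: "k * rad A B * sin (ang A B) = - k * A" "k * rad A B * cos (ang A B) = k * B"
    by (simp_all add: mult.assoc)
  show ?thesis using exp_pos_mom_eq_rotop[of "k * rad A B" "ang A B"] unfolding * .
qed

lemma TT_eq_tt: "TT A B = tt (ang A B) (rad A B)"
  using exp_pos_mom_eq_tt[of 1 A B] by (simp add: TT_def)

lemma TT_inverse: "(TT A B)\<inverse> = tt (ang A B) (- rad A B)"
  by (simp add: TT_eq_tt tt_converse)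

lemma Theta_eq_tt: "Theta A B = tt (ang A B) (- (2 * rad A B))"
  by (simp add: Theta_def TT_inverse tt_square)

lemma Theta_inverse: "(Theta A B)\<inverse> = tt (ang A B) (2 * rad A B)"
  by (simp add: Theta_eq_tt tt_converse)

lemma Theta_eq_exp: "Theta A B = exp_pos_mom (2 * A) (- 2 * B)"
  using exp_pos_mom_eq_tt[of "- 2" A B] by (simp add: Theta_eq_tt)

lemma state_in_Domain_tt: "state c d N n1 n2 \<in> Domain (tt \<theta> r)"
  using state_in_invariant_part[of c d N n1 n2 \<theta> r] stable_invariant_part(1)[of \<theta> r]
  by (auto simp: stable_under_def)

abbreviation tf :: "real \<Rightarrow> real \<Rightarrow> complex" where
  "tf A B \<equiv> tfactor (ang A B) (rad A B)"

text \<open>\<open>tt_vac\<close> takes the vacuum to the Gaussian state with parameter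
  \<open>- ww A B\<close>, which is \<open>CC A B\<close>, and each raising operator acquires the
  constant \<open>cnj (ww A B)\<close>, which is \<open>DD A B\<close>.\<close>

lemma TT_phi: "(state 0 0 (N / tf A B) n1 n2, phi A B N n1 n2) \<in> TT A B"
  using tt_state[OF tt_vac[of N "ang A B" "rad A B"], of 0 n1 n2]
  unfolding ww_polar by (simp add: TT_eq_tt phi_eq CC_ww DD_ww)

lemma TT_inverse_Psi: "(state 0 0 (N / tf A B) n1 n2, Psi A B N n1 n2) \<in> (TT A B)\<inverse>"
proof -
  have "cis (ang A B) * complex_of_real (- rad A B) = - ww A B" by (simp flip: ww_polar)
  then show ?thesis
    using tt_state[OF tt_vac[of N "ang A B" "- rad A B"], of 0 n1 n2]
    by (simp only: tfactor_minus TT_inverse) (simp add: Psi_eq CC_ww DD_ww)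
qed

lemma tt_phi: "(((N / tf A B) * gnorm) *\<^sub>C hbasis n, case n of (n1, n2) \<Rightarrow> phi A B N n1 n2) \<in> tt (ang A B) (rad A B)"
  using TT_phi[of N A B "fst n" "snd n"] by (simp add: state_0_eq TT_eq_tt split_beta)

lemma tt_Psi: "(((N / tf A B) * gnorm) *\<^sub>C hbasis n, case n of (n1, n2) \<Rightarrow> Psi A B N n1 n2) \<in> tt (ang A B) (- rad A B)"
  using TT_inverse_Psi[of N A B "fst n" "snd n"] by (simp add: state_0_eq TT_inverse split_beta)

section \<open>Normalisation of the two vacua\<close>

lemma cinner_phi00_Psi00:
  "cinner (phi00 A B N) (Psi00 A B N') = cnj (N / tf A B * gnorm) * (N' / tf A B * gnorm)"
  using cinner_vac[of "ang A B" "rad A B" N N'] unfolding ww_polar by (simp add: phi00_eq Psi00_eq CC_ww DD_ww)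

lemma normalization_exists:
  "\<exists>M M'. cmod M = cmod M' \<and> cinner (phi00 A B M) (Psi00 A B M') = 1"
proof -
  define M where "M = tf A B / gnorm"
  have "M / tf A B * gnorm = 1" using gnorm_pos tfactor_nonzero by (simp add: M_def)
  then have "cinner (phi00 A B M) (Psi00 A B M) = 1" unfolding cinner_phi00_Psi00 by simp
  then show ?thesis by blast
qed

text \<open>The overlap condition fixes only \<open>cnj N * N'\<close>. With equal moduli the two
  vacuum coefficients have modulus 1, and since the conjugate of one is then the inverse of the
  other, they coincide.\<close>

lemma equal_normalization:
  assumes n: "cinner (phi00 A B N) (Psi00 A B N') = 1" and N: "cmod N = cmod N'"
  shows "N' = N" "cmod (N / tf A B * gnorm) = 1"
proof -
  define a b where "a = N / tf A B * gnorm" and "b = N' / tf A B * gnorm"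
  have ab: "cnj a * b = 1" using n unfolding cinner_phi00_Psi00 a_def b_def .
  have "cmod a = cmod b" by (simp add: a_def b_def norm_mult norm_divide N)
  moreover have "cmod a * cmod b = 1" using arg_cong[OF ab, of cmod] by (simp add: norm_mult)
  ultimately have "(cmod a)\<^sup>2 = 1" by (simp add: power2_eq_square)
  then have "cmod a = 1" using norm_ge_zero[of a] by (auto simp: power2_eq_1_iff simp del: norm_ge_zero)
  then show a: "cmod (N / tf A B * gnorm) = 1" by (simp only: a_def)
  have "cnj a * a = cnj a * b" using ab cmod_1_cnj[OF a] by (simp only: a_def)
  moreover have "cnj a \<noteq> 0" using ab by auto
  ultimately have "a = b" by simp
  then show "N' = N" using gnorm_pos tfactor_nonzero by (simp add: a_def b_def)
qed

lemma eigenvector_energy: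
  "N \<noteq> 0 \<Longrightarrow> eigenvector (sop (quad c d (complex_of_real (A\<^sup>2 + B\<^sup>2 + 1)))) (energy A B n1 n2) (state c d N n1 n2)"
  using eigenvector_state[of N c d "complex_of_real (A\<^sup>2 + B\<^sup>2 + 1)" n1 n2]
  by (simp add: energy_def add_ac)

section \<open>Spectrum, conjugation and expansions\<close>

lemma htilde_eigenvalues: "{e. \<exists>f. eigenvector (htilde A B) e f} = {energy A B n1 n2 | n1 n2. True}"
proof (intro set_eqI iffI; clarify)
  fix e f assume "eigenvector (htilde A B) e f"
  from eigenvalue_quad_0[OF this[unfolded htilde_eq_sop]]
  show "\<exists>n1 n2. e = energy A B n1 n2 \<and> True" by (simp add: energy_def add_ac)
next
  fix n1 n2
  show "\<exists>f. eigenvector (htilde A B) (energy A B n1 n2) f"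
    unfolding htilde_eq_sop using eigenvector_energy[of 1 0 0 A B n1 n2] by auto
qed

text \<open>Along the inverse of T the constants move by \<open>ww A B\<close> and
  \<open>- cnj (ww A B)\<close>, which cancels \<open>CC A B\<close> and
  \<open>DD A B\<close>.\<close>

lemma Ham_conjugate:
  "op_restrict (Ham A B) (maps_within \<S> ((TT A B)\<inverse>)) =
    op_restrict (TT A B *\<^sub>o htilde A B *\<^sub>o (TT A B)\<inverse>) (maps_within \<S> ((TT A B)\<inverse>))"
proof -
  have "cis (ang A B) * complex_of_real (- rad A B) = - ww A B" by (simp flip: ww_polar)
  then have "tcov (ang A B) (- rad A B) (quad (CC A B) (DD A B) e) (quad 0 0 e)" for e
    using tcov_quad[of "ang A B" "- rad A B" "CC A B" "DD A B" e] by (simp only:) (simp add: CC_ww DD_ww)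
  from conjugate_on_maps_within[OF this]
  show ?thesis by (simp add: TT_inverse TT_eq_tt tt_converse Ham_eq_sop htilde_eq_sop)
qed

text \<open>Twice the shift of the inverse of T overshoots zero: \<open>- ww A B\<close> becomes
  \<open>ww A B\<close> and \<open>cnj (ww A B)\<close> becomes its negative, which are the
  constants of the adjoint operators.\<close>

lemma Theta_tcov:
  "tcov (ang A B) (- (2 * rad A B)) (dn (CC A B) j) (dn (cnj (DD A B)) j)"
  "tcov (ang A B) (- (2 * rad A B)) (\<lambda>f. up (DD A B) j (dn (CC A B) j f))
     (\<lambda>f. up (cnj (CC A B)) j (dn (cnj (DD A B)) j f))"
proof -
  have w: "cis (ang A B) * complex_of_real (- (2 * rad A B)) = - 2 * ww A B" by (simp flip: ww_polar)
  have "CC A B - (- 2 * ww A B) = cnj (DD A B)" "DD A B + cnj (- 2 * ww A B) = cnj (CC A B)"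
    by (simp_all add: CC_ww DD_ww)
  then show "tcov (ang A B) (- (2 * rad A B)) (dn (CC A B) j) (dn (cnj (DD A B)) j)"
    "tcov (ang A B) (- (2 * rad A B)) (\<lambda>f. up (DD A B) j (dn (CC A B) j f))
     (\<lambda>f. up (cnj (CC A B)) j (dn (cnj (DD A B)) j f))"
    using tcov_dn[of "ang A B" "- (2 * rad A B)" "CC A B" j]
      tcov_up_dn[of "ang A B" "- (2 * rad A B)" "DD A B" j "CC A B"]
    by (simp_all only: w)
qed

lemma aa_conjugate:
  "op_restrict (aa A B j) (maps_within \<S> (Theta A B)) =
    op_restrict ((Theta A B)\<inverse> *\<^sub>o dagger (bb A B j) *\<^sub>o Theta A B) (maps_within \<S> (Theta A B))"
  unfolding aa_eq_sop dagger_bb Theta_eq_tt by (rule conjugate_on_maps_within[OF Theta_tcov(1)])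

lemma NN_conjugate:
  "op_restrict (NN A B j) (maps_within \<S> (Theta A B)) =
    op_restrict ((Theta A B)\<inverse> *\<^sub>o dagger (NN A B j) *\<^sub>o Theta A B) (maps_within \<S> (Theta A B))"
  unfolding dagger_NN unfolding NN_eq_sop Theta_eq_tt by (rule conjugate_on_maps_within[OF Theta_tcov(2)])

lemma Theta_conjugate_aa:
  "Theta_conjugate (invariant_part \<S> (Theta A B)) (Theta A B) (aa A B j) (dagger (bb A B j))"
proof -
  have "invariant_part \<S> (Theta A B) \<subseteq> Domain (aa A B j)"
    using invariant_part_subset by (simp add: Theta_eq_tt aa_eq_sop sop_Domain)
  then show ?thesis
    unfolding Theta_conjugate_def
    using op_restrict_mono[OF aa_conjugate, of "invariant_part \<S> (Theta A B)" A B j]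
      stable_invariant_part[of "ang A B" "- (2 * rad A B)"]
      invariant_part_maps_within self_adjoint_tt invertible_tt
    by (simp add: Theta_eq_tt tt_converse)
qed

text \<open>The operator is a square: one factor goes to \<open>f\<close>, the other to
  \<open>g\<close>, and both expansions run over the Hermite basis. Modulus 1 of \<open>k\<close>
  removes the constant.\<close>

lemma Theta_expansion:
  assumes n: "cmod k = 1" and \<xi>: "\<And>n. (k *\<^sub>C hbasis n, \<xi> n) \<in> tt \<theta> r"
    and f: "f \<in> Domain (tt \<theta> (2 * r))" and gh: "(g, h) \<in> tt \<theta> (2 * r)"
  shows "((\<lambda>n. cinner f (\<xi> n) * cinner (\<xi> n) g) has_sum cinner f h) UNIV"
proof -
  obtain f' where f': "(f, f') \<in> tt \<theta> r" using f by (auto simp: op_mult_def simp flip: tt_square)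
  obtain g' where g': "(g, g') \<in> tt \<theta> r" "(g', h) \<in> tt \<theta> r" using gh by (auto simp: op_mult_def simp flip: tt_square)
  have "cinner f h = cinner f' g'" by (rule tt_symmetric[OF f' g'(2)])
  moreover have "k * cnj k = 1" using cmod_1_cnj[OF n] by (simp add: mult.commute)
  ultimately show ?thesis using has_sum_tt_expansion[OF \<xi> \<xi> _ f' g'(1)] by simp
qed

theorem mainTheorem2:
  fixes A B :: real and N N' :: complex
  assumes "cinner (phi00 A B N) (Psi00 A B N') = 1"
  shows
  "((\<forall>j k. commutator (XX A j) (PP B k) = (if j = k then \<i> else 0) \<cdot>\<^sub>o Id_on \<S> \<and>
           commutator (aa A B j) (bb A B k) = (if j = k then 1 else 0) \<cdot>\<^sub>o Id_on \<S>) \<and>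
    (\<forall>j. aa A B j = complex_of_real (1 / sqrt 2) \<cdot>\<^sub>o (pos j +\<^sub>o \<i> \<cdot>\<^sub>o mom j +\<^sub>o CC A B \<cdot>\<^sub>o Id) \<and>
         bb A B j = complex_of_real (1 / sqrt 2) \<cdot>\<^sub>o (pos j +\<^sub>o (- \<i>) \<cdot>\<^sub>o mom j +\<^sub>o DD A B \<cdot>\<^sub>o Id) \<and>
         (A \<noteq> 0 \<longrightarrow> dagger (XX A j) \<noteq> XX A j) \<and>
         (B \<noteq> 0 \<longrightarrow> dagger (PP B j) \<noteq> PP B j) \<and>
         (A \<noteq> 0 \<or> B \<noteq> 0 \<longrightarrow> bb A B j \<noteq> dagger (aa A B j))) \<and>
    Ham A B = NN A B 1 +\<^sub>o NN A B 2 +\<^sub>o complex_of_real (A\<^sup>2 + B\<^sup>2 + 1) \<cdot>\<^sub>o Id)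
   \<and>
   ((\<exists>M M'. cmod M = cmod M' \<and> cinner (phi00 A B M) (Psi00 A B M') = 1) \<and>
    phi00 A B N \<in> \<S> \<and> Psi00 A B N' \<in> \<S> \<and>
    (\<forall>j. (phi00 A B N, 0) \<in> aa A B j \<and> (Psi00 A B N', 0) \<in> dagger (bb A B j) \<and>
         stable_under \<S> (aa A B j) \<and> stable_under \<S> (bb A B j) \<and>
         stable_under \<S> (dagger (aa A B j)) \<and> stable_under \<S> (dagger (bb A B j))))
   \<and>
   (\<forall>n1 n2.
      eigenvector (Ham A B) (energy A B n1 n2) (phi A B N n1 n2) \<and>
      eigenvector (dagger (Ham A B)) (energy A B n1 n2) (Psi A B N' n1 n2) \<and>
      phi A B N n1 n2 \<in> \<S> \<and> Psi A B N' n1 n2 \<in> \<S> \<and>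
      phi A B N n1 n2 =
        l2_of (\<lambda>x. N / sqrt (fact n1 * fact n2 * 2 ^ (n1 + n2)) *
          ladder_fun (CC A B) (DD A B) n1 (x$1) * ladder_fun (CC A B) (DD A B) n2 (x$2)) \<and>
      Psi A B N' n1 n2 =
        l2_of (\<lambda>x. N' / sqrt (fact n1 * fact n2 * 2 ^ (n1 + n2)) *
          ladder_fun (cnj (DD A B)) (cnj (CC A B)) n1 (x$1) *
          ladder_fun (cnj (DD A B)) (cnj (CC A B)) n2 (x$2)))
   \<and>
   (self_adjoint (TT A B) \<and> invertible_op (TT A B) \<and>
    (A \<noteq> 0 \<or> B \<noteq> 0 \<longrightarrow> unbounded_op (TT A B)) \<and>
    op_restrict (Ham A B) (maps_within \<S> ((TT A B)\<inverse>)) =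
      op_restrict (TT A B *\<^sub>o htilde A B *\<^sub>o (TT A B)\<inverse>) (maps_within \<S> ((TT A B)\<inverse>)) \<and>
    dense_subspace (maps_within \<S> ((TT A B)\<inverse>)) \<and>
    htilde A B = dagger (cc 1) *\<^sub>o cc 1 +\<^sub>o dagger (cc 2) *\<^sub>o cc 2 +\<^sub>o
      complex_of_real (A\<^sup>2 + B\<^sup>2 + 1) \<cdot>\<^sub>o Id \<and>
    {e. \<exists>f. eigenvector (htilde A B) e f} = {energy A B n1 n2 | n1 n2. True} \<and>
    (\<exists>\<Phi>00. vacuum \<Phi>00) \<and>
    (\<forall>\<Phi>00. vacuum \<Phi>00 \<longrightarrow>
       (\<forall>n1 n2. eigenvector (htilde A B) (energy A B n1 n2) (Phi \<Phi>00 n1 n2) \<and>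
          Phi \<Phi>00 n1 n2 \<in> Domain (TT A B) \<inter> Domain ((TT A B)\<inverse>)) \<and>
       orthonormal_basis (\<lambda>(n1, n2). Phi \<Phi>00 n1 n2)) \<and>
    (cmod N = cmod N' \<longrightarrow>
       (\<exists>\<Phi>00. vacuum \<Phi>00 \<and>
          (\<forall>n1 n2. (Phi \<Phi>00 n1 n2, phi A B N n1 n2) \<in> TT A B \<and>
             (Phi \<Phi>00 n1 n2, Psi A B N' n1 n2) \<in> (TT A B)\<inverse>))) \<and>
    quasi_bases (Domain (TT A B) \<inter> Domain ((TT A B)\<inverse>))
      (\<lambda>(n1, n2). phi A B N n1 n2) (\<lambda>(n1, n2). Psi A B N' n1 n2))
   \<and>
   (Theta A B = exp_pos_mom (2 * A) (- 2 * B) \<and>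
    dense_subspace (invariant_part \<S> (Theta A B)) \<and>
    (\<forall>n1 n2. phi A B N n1 n2 \<in> invariant_part \<S> (Theta A B) \<and>
       Psi A B N' n1 n2 \<in> invariant_part \<S> (Theta A B)) \<and>
    stable_under (invariant_part \<S> (Theta A B)) (Theta A B) \<and>
    stable_under (invariant_part \<S> (Theta A B)) ((Theta A B)\<inverse>) \<and>
    (\<forall>j. stable_under (invariant_part \<S> (Theta A B)) (aa A B j) \<and>
       stable_under (invariant_part \<S> (Theta A B)) (bb A B j) \<and>
       stable_under (invariant_part \<S> (Theta A B)) (dagger (aa A B j)) \<and>
       stable_under (invariant_part \<S> (Theta A B)) (dagger (bb A B j)) \<and>
       Theta_conjugate (invariant_part \<S> (Theta A B)) (Theta A B) (aa A B j) (dagger (bb A B j)) \<and>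
       op_restrict (aa A B j) (maps_within \<S> (Theta A B)) =
         op_restrict ((Theta A B)\<inverse> *\<^sub>o dagger (bb A B j) *\<^sub>o Theta A B)
           (maps_within \<S> (Theta A B)) \<and>
       op_restrict (NN A B j) (maps_within \<S> (Theta A B)) =
         op_restrict ((Theta A B)\<inverse> *\<^sub>o dagger (NN A B j) *\<^sub>o Theta A B)
           (maps_within \<S> (Theta A B))) \<and>
    (cmod N = cmod N' \<longrightarrow>
       (\<forall>n1 n2. (phi A B N n1 n2, Psi A B N' n1 n2) \<in> Theta A B) \<and>
       (\<forall>f\<in>Domain (Theta A B). \<forall>(g, h)\<in>Theta A B.
          ((\<lambda>(k1, k2). cinner f (Psi A B N' k1 k2) * cinner (Psi A B N' k1 k2) g)
             has_sum cinner f h) UNIV) \<and>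
       (\<forall>f\<in>Domain ((Theta A B)\<inverse>). \<forall>(g, h)\<in>(Theta A B)\<inverse>.
          ((\<lambda>(k1, k2). cinner f (phi A B N k1 k2) * cinner (phi A B N k1 k2) g)
             has_sum cinner f h) UNIV)) \<and>
    (A \<noteq> 0 \<or> B \<noteq> 0 \<longrightarrow>
       unbounded_op (Theta A B) \<and> unbounded_op ((Theta A B)\<inverse>) \<and>
       (\<forall>F :: nat \<Rightarrow> (nat \<times> nat) set.
          incseq F \<and> (\<forall>i. finite (F i)) \<and> (\<Union>i. F i) = UNIV \<longrightarrow>
          \<not> (\<exists>R. uniform_limit (cball 0 1)
                (\<lambda>i f. \<Sum>(k1, k2)\<in>F i. cinner (Psi A B N' k1 k2) f *\<^sub>C Psi A B N' k1 k2)
                R sequentially) \<and>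
          \<not> (\<exists>R. uniform_limit (cball 0 1)
                (\<lambda>i f. \<Sum>(k1, k2)\<in>F i. cinner (phi A B N k1 k2) f *\<^sub>C phi A B N k1 k2)
                R sequentially))))"
proof -
  have N0: "N \<noteq> 0" "N' \<noteq> 0" using assms unfolding cinner_phi00_Psi00 by auto
  have ab: "cnj (N / tf A B * gnorm) * (N' / tf A B * gnorm) = 1" using assms unfolding cinner_phi00_Psi00 .
  have dom: "phi A B M n1 n2 \<in> Domain (tt \<theta> r)" "Psi A B M n1 n2 \<in> Domain (tt \<theta> r)" for M n1 n2 \<theta> r
    by (simp_all add: phi_eq Psi_eq state_in_Domain_tt)
  have vac: "\<exists>M::complex. M \<noteq> 0 \<and> cmod (M * gnorm) = 1 \<and> \<Phi>00 = l2_of (vac 0 M)" if "vacuum \<Phi>00" for \<Phi>00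
  proof -
    obtain M :: complex where M: "cmod (M * gnorm) = 1" "\<Phi>00 = l2_of (vac 0 M)" using \<open>vacuum \<Phi>00\<close> vacuum_iff by blast
    then have "M \<noteq> 0" by auto
    then show ?thesis using M by blast
  qed
  show ?thesis
  proof (intro conjI allI impI)
    show "commutator (XX A j) (PP B k) = (if j = k then \<i> else 0) \<cdot>\<^sub>o Id_on \<S>" for j k by (rule commutator_XX_PP)
    show "commutator (aa A B j) (bb A B k) = (if j = k then 1 else 0) \<cdot>\<^sub>o Id_on \<S>" for j k by (rule commutator_aa_bb)
    show "aa A B j = complex_of_real (1 / sqrt 2) \<cdot>\<^sub>o (pos j +\<^sub>o \<i> \<cdot>\<^sub>o mom j +\<^sub>o CC A B \<cdot>\<^sub>o Id)" for j by (rule aa_eq)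
    show "bb A B j = complex_of_real (1 / sqrt 2) \<cdot>\<^sub>o (pos j +\<^sub>o (- \<i>) \<cdot>\<^sub>o mom j +\<^sub>o DD A B \<cdot>\<^sub>o Id)" for j by (rule bb_eq)
    show "dagger (XX A j) \<noteq> XX A j" if "A \<noteq> 0" for j using that by (rule dagger_XX_neq)
    show "dagger (PP B j) \<noteq> PP B j" if "B \<noteq> 0" for j using that by (rule dagger_PP_neq)
    show "bb A B j \<noteq> dagger (aa A B j)" if "A \<noteq> 0 \<or> B \<noteq> 0" for j using that by (rule bb_neq_dagger_aa)
    show "Ham A B = NN A B 1 +\<^sub>o NN A B 2 +\<^sub>o complex_of_real (A\<^sup>2 + B\<^sup>2 + 1) \<cdot>\<^sub>o Id" by (rule Ham_eq)
    show "\<exists>M M'. cmod M = cmod M' \<and> cinner (phi00 A B M) (Psi00 A B M') = 1" by (rule normalization_exists)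
    show "phi00 A B N \<in> \<S>" "Psi00 A B N' \<in> \<S>" by (simp_all add: phi00_eq Psi00_eq \<S>_def schwartz_vac)
    show "(phi00 A B N, 0) \<in> aa A B j" "(Psi00 A B N', 0) \<in> dagger (bb A B j)" for j
      unfolding aa_eq_sop dagger_bb phi00_eq Psi00_eq sop_iff[OF schwartz_vac] dn_vac by (rule l2_of_zero)+
    show "stable_under \<S> (aa A B j)" "stable_under \<S> (bb A B j)"
      "stable_under \<S> (dagger (aa A B j))" "stable_under \<S> (dagger (bb A B j))" for j
      unfolding dagger_aa dagger_bb unfolding aa_eq_sop bb_eq_sop
      by (rule stable_under_sop[OF schwartz_map_lin])+
    show "eigenvector (Ham A B) (energy A B n1 n2) (phi A B N n1 n2)"
      "eigenvector (dagger (Ham A B)) (energy A B n1 n2) (Psi A B N' n1 n2)" for n1 n2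
      unfolding dagger_Ham unfolding Ham_eq_sop phi_eq Psi_eq by (rule eigenvector_energy[OF N0(1)] eigenvector_energy[OF N0(2)])+
    show "phi A B N n1 n2 \<in> \<S>" "Psi A B N' n1 n2 \<in> \<S>" for n1 n2
      unfolding phi_eq Psi_eq by (rule state_in_S)+
    show "phi A B N n1 n2 =
        l2_of (\<lambda>x. N / sqrt (fact n1 * fact n2 * 2 ^ (n1 + n2)) *
          ladder_fun (CC A B) (DD A B) n1 (x$1) * ladder_fun (CC A B) (DD A B) n2 (x$2))" for n1 n2
      unfolding phi_eq by (rule state_factorizes)
    show "Psi A B N' n1 n2 =
        l2_of (\<lambda>x. N' / sqrt (fact n1 * fact n2 * 2 ^ (n1 + n2)) *
          ladder_fun (cnj (DD A B)) (cnj (CC A B)) n1 (x$1) *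
          ladder_fun (cnj (DD A B)) (cnj (CC A B)) n2 (x$2))" for n1 n2
      unfolding Psi_eq by (rule state_factorizes)
    show "self_adjoint (TT A B)" "invertible_op (TT A B)"
      unfolding TT_eq_tt by (rule self_adjoint_tt invertible_tt)+
    show "unbounded_op (TT A B)" if "A \<noteq> 0 \<or> B \<noteq> 0"
      using that unfolding TT_eq_tt rad_nonzero[symmetric] by (rule unbounded_tt)
    show "op_restrict (Ham A B) (maps_within \<S> ((TT A B)\<inverse>)) =
      op_restrict (TT A B *\<^sub>o htilde A B *\<^sub>o (TT A B)\<inverse>) (maps_within \<S> ((TT A B)\<inverse>))" by (rule Ham_conjugate)
    show "dense_subspace (maps_within \<S> ((TT A B)\<inverse>))"
      unfolding TT_inverse by (rule dense_maps_within_tt)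
    show "htilde A B = dagger (cc 1) *\<^sub>o cc 1 +\<^sub>o dagger (cc 2) *\<^sub>o cc 2 +\<^sub>o
      complex_of_real (A\<^sup>2 + B\<^sup>2 + 1) \<cdot>\<^sub>o Id" by (rule htilde_eq)
    show "{e. \<exists>f. eigenvector (htilde A B) e f} = {energy A B n1 n2 | n1 n2. True}" by (rule htilde_eigenvalues)
    show "\<exists>\<Phi>00. vacuum \<Phi>00" by (rule vacuum_exists)
    show "eigenvector (htilde A B) (energy A B n1 n2) (Phi \<Phi>00 n1 n2)" if "vacuum \<Phi>00" for \<Phi>00 n1 n2
    proof -
      obtain M :: complex where M: "M \<noteq> 0" "\<Phi>00 = l2_of (vac 0 M)" using vac[OF \<open>vacuum \<Phi>00\<close>] by blast
      show ?thesis unfolding M(2) Phi_eq htilde_eq_sop by (rule eigenvector_energy[OF M(1)])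
    qed
    show "Phi \<Phi>00 n1 n2 \<in> Domain (TT A B) \<inter> Domain ((TT A B)\<inverse>)" if "vacuum \<Phi>00" for \<Phi>00 n1 n2
    proof -
      obtain M :: complex where M: "\<Phi>00 = l2_of (vac 0 M)" using vac[OF \<open>vacuum \<Phi>00\<close>] by blast
      show ?thesis unfolding M Phi_eq TT_eq_tt tt_converse using state_in_Domain_tt by blast
    qed
    show "orthonormal_basis (\<lambda>(n1, n2). Phi \<Phi>00 n1 n2)" if "vacuum \<Phi>00" for \<Phi>00
    proof -
      obtain M :: complex where M: "cmod (M * gnorm) = 1" "\<Phi>00 = l2_of (vac 0 M)" using vac[OF \<open>vacuum \<Phi>00\<close>] by blast
      have "(\<lambda>(n1, n2). Phi \<Phi>00 n1 n2) = (\<lambda>n. (M * gnorm) *\<^sub>C hbasis n)"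
        unfolding M(2) Phi_eq state_0_eq by auto
      then show ?thesis using orthonormal_basis_scale_hbasis[OF M(1)] by simp
    qed
    show "\<exists>\<Phi>00. vacuum \<Phi>00 \<and>
          (\<forall>n1 n2. (Phi \<Phi>00 n1 n2, phi A B N n1 n2) \<in> TT A B \<and>
             (Phi \<Phi>00 n1 n2, Psi A B N' n1 n2) \<in> (TT A B)\<inverse>)" if "cmod N = cmod N'"
    proof -
      note eq = equal_normalization[OF assms that]
      \<comment> \<open>Dividing \<open>N\<close> by the factor of T on the vacuum gives the vector
        that T maps to \<open>phi00 A B N\<close>; the equal moduli make it a unit vector.\<close>
      have "vacuum (l2_of (vac 0 (N / tf A B)))" unfolding vacuum_iff using eq(2) by blast
      then show ?thesis
        using TT_phi TT_inverse_Psi unfolding eq(1) by (intro exI[of _ "l2_of (vac 0 (N / tf A B))"]) (simp only: Phi_eq simp_thms)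
    qed
    show "quasi_bases (Domain (TT A B) \<inter> Domain ((TT A B)\<inverse>))
      (\<lambda>(n1, n2). phi A B N n1 n2) (\<lambda>(n1, n2). Psi A B N' n1 n2)"
      unfolding TT_inverse unfolding TT_eq_tt
      by (rule quasi_bases_tt[OF tt_phi tt_Psi ab]) (auto simp only: split_paired_all prod.case dom image_iff)
    show "Theta A B = exp_pos_mom (2 * A) (- 2 * B)" by (rule Theta_eq_exp)
    show "dense_subspace (invariant_part \<S> (Theta A B))" unfolding Theta_eq_tt by (rule dense_invariant_part)
    show "phi A B N n1 n2 \<in> invariant_part \<S> (Theta A B)" "Psi A B N' n1 n2 \<in> invariant_part \<S> (Theta A B)" for n1 n2
      unfolding Theta_eq_tt phi_eq Psi_eq by (rule state_in_invariant_part)+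
    show "stable_under (invariant_part \<S> (Theta A B)) (Theta A B)"
      "stable_under (invariant_part \<S> (Theta A B)) ((Theta A B)\<inverse>)"
      unfolding Theta_eq_tt tt_converse by (rule stable_invariant_part)+
    show "stable_under (invariant_part \<S> (Theta A B)) (aa A B j)"
       "stable_under (invariant_part \<S> (Theta A B)) (bb A B j)"
       "stable_under (invariant_part \<S> (Theta A B)) (dagger (aa A B j))"
       "stable_under (invariant_part \<S> (Theta A B)) (dagger (bb A B j))" for j
      unfolding dagger_aa dagger_bb unfolding aa_eq_sop bb_eq_sop Theta_eq_tt
      by (rule stable_invariant_part_lin)+
    show "Theta_conjugate (invariant_part \<S> (Theta A B)) (Theta A B) (aa A B j) (dagger (bb A B j))" for j
      by (rule Theta_conjugate_aa)
    show "op_restrict (aa A B j) (maps_within \<S> (Theta A B)) =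
         op_restrict ((Theta A B)\<inverse> *\<^sub>o dagger (bb A B j) *\<^sub>o Theta A B)
           (maps_within \<S> (Theta A B))" for j by (rule aa_conjugate)
    show "op_restrict (NN A B j) (maps_within \<S> (Theta A B)) =
         op_restrict ((Theta A B)\<inverse> *\<^sub>o dagger (NN A B j) *\<^sub>o Theta A B)
           (maps_within \<S> (Theta A B))" for j by (rule NN_conjugate)
    \<comment> \<open>The oscillator state is the intermediate vector: the inverse of T takes
      \<open>phi\<close> to it, and a second application takes it to \<open>Psi\<close>.\<close>
    show "(phi A B N n1 n2, Psi A B N' n1 n2) \<in> Theta A B" if "cmod N = cmod N'" for n1 n2
      using TT_phi[of N A B n1 n2] TT_inverse_Psi[of N A B n1 n2]
      unfolding equal_normalization(1)[OF assms that] Theta_def op_mult_def by blast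
    show "\<forall>f\<in>Domain (Theta A B). \<forall>(g, h)\<in>Theta A B.
          ((\<lambda>(k1, k2). cinner f (Psi A B N' k1 k2) * cinner (Psi A B N' k1 k2) g)
             has_sum cinner f h) UNIV" if "cmod N = cmod N'"
    proof (intro ballI, clarify)
      fix f f' g h assume "(f, f') \<in> Theta A B" "(g, h) \<in> Theta A B"
      then have "f \<in> Domain (tt (ang A B) (2 * - rad A B))" "(g, h) \<in> tt (ang A B) (2 * - rad A B)"
        by (auto simp: Theta_eq_tt)
      from Theta_expansion[OF equal_normalization(2)[OF assms that] tt_Psi this]
      show "((\<lambda>(k1, k2). cinner f (Psi A B N' k1 k2) * cinner (Psi A B N' k1 k2) g) has_sum cinner f h) UNIV"
        unfolding equal_normalization(1)[OF assms that] by (simp add: case_prod_unfold)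
    qed
    show "\<forall>f\<in>Domain ((Theta A B)\<inverse>). \<forall>(g, h)\<in>(Theta A B)\<inverse>.
          ((\<lambda>(k1, k2). cinner f (phi A B N k1 k2) * cinner (phi A B N k1 k2) g)
             has_sum cinner f h) UNIV" if "cmod N = cmod N'"
      unfolding Theta_inverse
    proof (intro ballI, clarify)
      fix f f' g h assume "(f, f') \<in> tt (ang A B) (2 * rad A B)" "(g, h) \<in> tt (ang A B) (2 * rad A B)"
      then have "f \<in> Domain (tt (ang A B) (2 * rad A B))" "(g, h) \<in> tt (ang A B) (2 * rad A B)" by auto
      from Theta_expansion[OF equal_normalization(2)[OF assms that] tt_phi this]
      show "((\<lambda>(k1, k2). cinner f (phi A B N k1 k2) * cinner (phi A B N k1 k2) g) has_sum cinner f h) UNIV"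
        by (simp add: case_prod_unfold)
    qed
    show "unbounded_op (Theta A B)" "unbounded_op ((Theta A B)\<inverse>)" if "A \<noteq> 0 \<or> B \<noteq> 0"
      using that unfolding Theta_inverse unfolding Theta_eq_tt rad_nonzero[symmetric] by (intro unbounded_tt, simp)+
    show "\<not> (\<exists>R. uniform_limit (cball 0 1)
                (\<lambda>i f. \<Sum>(k1, k2)\<in>F i. cinner (Psi A B N' k1 k2) f *\<^sub>C Psi A B N' k1 k2) R sequentially)"
      if "A \<noteq> 0 \<or> B \<noteq> 0" and F: "incseq F \<and> (\<forall>i. finite (F i)) \<and> (\<Union>i. F i) = UNIV"
      for F :: "nat \<Rightarrow> (nat \<times> nat) set"
      using not_uniform_limit_expansion[OF _ _ tt_Psi, of A B N' F] that gnorm_pos tfactor_nonzero N0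
      by (simp add: case_prod_unfold rad_nonzero)
    show "\<not> (\<exists>R. uniform_limit (cball 0 1)
                (\<lambda>i f. \<Sum>(k1, k2)\<in>F i. cinner (phi A B N k1 k2) f *\<^sub>C phi A B N k1 k2) R sequentially)"
      if "A \<noteq> 0 \<or> B \<noteq> 0" and F: "incseq F \<and> (\<forall>i. finite (F i)) \<and> (\<Union>i. F i) = UNIV"
      for F :: "nat \<Rightarrow> (nat \<times> nat) set"
      using not_uniform_limit_expansion[OF _ _ tt_phi, of A B N F] that gnorm_pos tfactor_nonzero N0
      by (simp add: case_prod_unfold rad_nonzero)
  qed
qed

end
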